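(* For each $n\in\omega$ there are $x,y,z\subseteq\omega$ such that $y$ and $z$ are mutually $ITRM_n$-random, $x$ is not $ITRM$-computable, and $x$ is $ITRM$-computable from $y$ and from $z$. In fact, for every constructible real $x$ and every $n\in\omega$, there are reals $y,z$ and $m\in\omega$ such that $y$ and $z$ are mutually $ITRM_n$-random and $x$ is $ITRM_m$-computable both from $y$ and from $z$.
   Context: An infinite time register machine ($ITRM$) has finitely many registers, each holding a natural number, and runs a program of the same kind as a classical unlimited register machine (with an additional instruction querying membership of a number in an oracle), but in transfinite ordinal time: successor steps are as for register machines; at limit times the active program line is the limit inferior of earlier program lines and each register holds the limit inferior of its earlier contents, reset to $0$ if that limit inferior is infinite. $x$ is $ITRM$-computable from $y$ iff some program $P$, with oracle $y$, halts on every input $i\in\omega$ and outputs $1$ iff $i\in x$ and $0$ otherwise; $x$ is $ITRM_m$-computable from $y$ if this holds for some program using at most $m$ registers; $x$ is $ITRM$-computable iff it is computable from $\emptyset$. With $a\oplus b$ the join of reals, $X\subseteq\mathfrak{P}(\omega)$ is decidable in the oracle $w$ by a program $P$ iff for all $u$, $P$ with oracle $u\oplus w$ halts with output $1$ if $u\in X$ and $0$ otherwise. $y$ is $ITRM_n$-random relative to $z$ iff there is no meager set $X\ni y$ decidable in the oracle $z$ by a program using at most $n$ registers; $y,z$ are mutually $ITRM_n$-random iff each is $ITRM_n$-random relative to the other. *)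

theory Defs
  imports "HOL-Analysis.Analysis"
begin

section \<open>Successors and limits in a well-order\<close>

text \<open>Ordinals are represented by well-orders \<open>r\<close>, and the ordinals below by the elements
  of the field of \<open>r\<close>.\<close>

definition is_first :: "'o rel \<Rightarrow> 'o \<Rightarrow> bool" where
  "is_first r t \<longleftrightarrow> t \<in> Field r \<and> underS r t = {}"

definition is_succ :: "'o rel \<Rightarrow> 'o \<Rightarrow> 'o \<Rightarrow> bool" where
  "is_succ r s t \<longleftrightarrow> s \<in> Field r \<and> t \<in> Field r \<and> underS r t = under r s"

definition is_limit :: "'o rel \<Rightarrow> 'o \<Rightarrow> bool" where
  "is_limit r t \<longleftrightarrow> t \<in> Field r \<and> \<not> is_first r t \<and> (\<forall>s. \<not> is_succ r s t)"

definition liminf_below :: "'o rel \<Rightarrow> 'o \<Rightarrow> ('o \<Rightarrow> nat) \<Rightarrow> enat" where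
  "liminf_below r t f =
     (SUP s\<in>underS r t. INF s'\<in>{s' \<in> underS r t. (s, s') \<in> r}. enat (f s'))"


lemma zero_succ_limit:
  "t \<in> Field r \<Longrightarrow> is_first r t \<or> (\<exists>s. is_succ r s t) \<or> is_limit r t"
  by (auto simp: is_limit_def)

lemma is_succ_in_underS: "Well_order r \<Longrightarrow> is_succ r s t \<Longrightarrow> s \<in> underS r t"
  unfolding is_succ_def using Refl_under_in[of r s] wo_rel.REFL[of r] by (simp add: wo_rel_def)


section \<open>Infinite time register machines\<close>

datatype instr =
    Zero nat
  | Incr nat
  | Copy nat nat
  | Jump nat nat nat
  | Oracle nat

type_synonym prog = "instr list"

text \<open>A configuration consists of the active program line and the register contents.\<close>

type_synonym config = "nat \<times> (nat \<Rightarrow> nat)"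

fun step :: "nat set \<Rightarrow> instr \<Rightarrow> config \<Rightarrow> config" where
  "step A (Zero i) (l, R) = (Suc l, R(i := 0))"
| "step A (Incr i) (l, R) = (Suc l, R(i := Suc (R i)))"
| "step A (Copy i j) (l, R) = (Suc l, R(j := R i))"
| "step A (Jump i j q) (l, R) = (if R i = R j then q else Suc l, R)"
| "step A (Oracle i) (l, R) = (Suc l, R(i := (if R i \<in> A then 1 else 0)))"

fun instr_regs :: "instr \<Rightarrow> nat set" where
  "instr_regs (Zero i) = {i}"
| "instr_regs (Incr i) = {i}"
| "instr_regs (Copy i j) = {i, j}"
| "instr_regs (Jump i j q) = {i, j}"
| "instr_regs (Oracle i) = {i}"

definition num_regs :: "prog \<Rightarrow> nat" where
  "num_regs P = card (\<Union>I\<in>set P. instr_regs I)"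

fun reset_if_infinite :: "enat \<Rightarrow> nat" where
  "reset_if_infinite (enat k) = k"
| "reset_if_infinite \<infinity> = 0"

text \<open>The limit inferior of the program lines is always finite, as there are only finitely many
  active lines.\<close>

definition limit_config :: "'o rel \<Rightarrow> 'o \<Rightarrow> ('o \<Rightarrow> config) \<Rightarrow> config" where
  "limit_config r t C =
     (reset_if_infinite (liminf_below r t (\<lambda>s. fst (C s))),
      \<lambda>i. reset_if_infinite (liminf_below r t (\<lambda>s. snd (C s) i)))"

text \<open>The machine stops as soon as the active line lies outside the program, so a time whose line
  does so has no successor.\<close>

definition computation ::
    "prog \<Rightarrow> nat set \<Rightarrow> config \<Rightarrow> 'o rel \<Rightarrow> ('o \<Rightarrow> config) \<Rightarrow> bool" where
  "computation P A c0 r C \<longleftrightarrow> Well_order r \<and>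
     (\<forall>t. is_first r t \<longrightarrow> C t = c0) \<and>
     (\<forall>s t. is_succ r s t \<longrightarrow>
        fst (C s) < length P \<and> C t = step A (P ! fst (C s)) (C s)) \<and>
     (\<forall>t. is_limit r t \<longrightarrow> C t = limit_config r t C)"

definition initial :: "nat \<Rightarrow> config" where
  "initial i = (0, (\<lambda>_. 0)(0 := i))"

definition halting_computation ::
    "prog \<Rightarrow> nat set \<Rightarrow> nat \<Rightarrow> nat \<Rightarrow> 'o rel \<Rightarrow> ('o \<Rightarrow> config) \<Rightarrow> 'o \<Rightarrow> bool" where
  "halting_computation P A i k r C t \<longleftrightarrow> computation P A (initial i) r C \<and>
     t \<in> Field r \<and> length P \<le> fst (C t) \<and> snd (C t) 0 = k"

text \<open>Time is represented by well-orders of sets of natural numbers, that is, by countable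
  ordinals. This is no restriction: by lemma \<open>halts_with_if_halting_computation\<close> below, a
  program that halts along any well-order (of any type) also halts along a countable one,
  with the same output.\<close>

definition halts_with :: "prog \<Rightarrow> nat set \<Rightarrow> nat \<Rightarrow> nat \<Rightarrow> bool" where
  "halts_with P A i k \<longleftrightarrow>
     (\<exists>(r :: nat rel) C t. halting_computation P A i k r C t)"

subsection \<open>Halting times are countable\<close>

lemma ex_countable_closure:
  fixes G :: "'o \<Rightarrow> 'o \<Rightarrow> 'o set"
  assumes "\<And>a b. countable (G a b)"
  shows "\<exists>S. countable S \<and> t \<in> S \<and> (\<forall>a\<in>S. \<forall>b\<in>S. G a b \<subseteq> S)"
proof -
  define F where "F X = X \<union> (\<Union>a\<in>X. \<Union>b\<in>X. G a b)" for X
  define S where "S n = (F ^^ n) {t}" for n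
  have cS: "countable (S n)" for n
    by (induction n) (auto simp: S_def F_def assms)
  have S_Suc: "S (Suc n) = F (S n)" for n by (simp add: S_def)
  have mono: "S m \<subseteq> S n" if "m \<le> n" for m n
    using that by (rule lift_Suc_mono_le[rotated]) (auto simp: S_Suc F_def)
  have "G a b \<subseteq> (\<Union>n. S n)" if "a \<in> S m" "b \<in> S n" for a b m n
  proof -
    have "a \<in> S (max m n)" "b \<in> S (max m n)" using that mono[of m "max m n"] mono[of n "max m n"] by auto
    then have "G a b \<subseteq> S (Suc (max m n))" unfolding S_Suc F_def by blast
    then show ?thesis by blast
  qed
  moreover have "t \<in> S 0" by (simp add: S_def)
  ultimately show ?thesis using cS by (intro exI[of _ "\<Union>n. S n"]) auto
qed

lemma Inf_attained_enat:
  fixes f :: "'a \<Rightarrow> nat"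
  assumes "X \<noteq> {}" shows "\<exists>c\<in>X. enat (f c) = (INF c\<in>X. enat (f c))"
proof -
  obtain c where c: "c \<in> X" "\<And>d. d \<in> X \<Longrightarrow> f c \<le> f d"
    using assms ex_has_least_nat[of "\<lambda>c. c \<in> X" _ f] by blast
  then have "(INF c\<in>X. enat (f c)) = enat (f c)"
    by (intro antisym INF_lower INF_greatest) auto
  then show ?thesis using c(1) by metis
qed

lemma Sup_attained_enat:
  fixes g :: "'a \<Rightarrow> enat"
  assumes "X \<noteq> {}"
  shows "\<exists>b :: nat \<Rightarrow> 'a. (\<forall>k. b k \<in> X) \<and> (SUP k. g (b k)) = (SUP c\<in>X. g c)"
proof -
  have ne: "g ` X \<noteq> {}" using assms by simp
  have "\<exists>c\<in>X. g c = from_nat_into (g ` X) k" for k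
    using from_nat_into[OF ne, of k] by auto
  then obtain b where b: "\<And>k. b k \<in> X" "\<And>k. g (b k) = from_nat_into (g ` X) k"
    by metis
  have "range (\<lambda>k. g (b k)) = g ` X"
    using b(2) range_from_nat_into[OF ne] by simp
  then show ?thesis using b(1) by metis
qed

lemma is_succ_unique:
  assumes "Well_order r" "is_succ r s t" "is_succ r s' t" shows "s = s'"
proof -
  interpret wo_rel r using assms(1) by (simp add: wo_rel_def)
  have "under s = under s'" using assms(2,3) by (simp add: is_succ_def)
  moreover have "(s, s) \<in> r" "(s', s') \<in> r"
    using REFL assms(2,3) by (auto simp: is_succ_def refl_on_def)
  ultimately have "(s, s') \<in> r" "(s', s) \<in> r" by (auto simp: under_def)
  then show ?thesis using ANTISYM by (auto dest: antisymD)
qed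

lemma ex_succ:
  assumes "Well_order r" "a \<in> underS r t" shows "\<exists>b. is_succ r a b \<and> (b, t) \<in> r"
proof -
  interpret wo_rel r using assms(1) by (simp add: wo_rel_def)
  define B where "B = {b \<in> Field r. a \<in> underS b}"
  have t: "t \<in> B" using assms(2) by (auto simp: B_def underS_def Field_def)
  define b where "b = minim B"
  have b: "b \<in> B" "\<And>c. c \<in> B \<Longrightarrow> (b, c) \<in> r"
    using minim_in[of B] minim_least[of B] t unfolding b_def by (auto simp: B_def)
  have "underS b = under a"
  proof
    show "under a \<subseteq> underS b"
      using b(1) TRANS ANTISYM by (auto simp: B_def under_def underS_def dest: transD antisymD)
    show "underS b \<subseteq> under a"
    proof
      fix c assume c: "c \<in> underS b"
      show "c \<in> under a"
      proof (rule ccontr)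
        assume "c \<notin> under a"
        moreover have "a \<in> Field r" "c \<in> Field r" using assms(2) c by (auto simp: underS_def Field_def)
        ultimately have "a \<in> underS c" using TOTALS in_notinI[of c a]
          by (auto simp: under_def underS_def)
        then have "(b, c) \<in> r" using b(2) \<open>c \<in> Field r\<close> by (simp add: B_def)
        then show False using c ANTISYM by (auto simp: underS_def dest: antisymD)
      qed
    qed
  qed
  then have "is_succ r a b" using b(1) assms(2) by (auto simp: is_succ_def B_def underS_def Field_def)
  then show ?thesis using b(2)[OF t] by blast
qed

lemma computation_restrict:
  fixes r :: "'o rel"
  assumes comp: "computation P A c0 r C" and t: "t \<in> Field r"
  shows "\<exists>S. countable S \<and> S \<subseteq> Field r \<and> t \<in> S \<and> computation P A c0 (Restr r S) C"
proof -
  have r: "Well_order r" using comp by (simp add: computation_def)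
  interpret wo_rel r using r by (simp add: wo_rel_def)
  define f where "f i s = (case i of None \<Rightarrow> fst (C s) | Some j \<Rightarrow> snd (C s) j)" for i s
  define J where "J i s b = (INF c\<in>{c \<in> underS s. (b, c) \<in> r}. enat (f i c))" for i s b
  define w where "w s b i =
    (SOME c. c \<in> underS s \<and> (b, c) \<in> r \<and> enat (f i c) = J i s b)" for s b i
  have w: "w s b i \<in> underS s \<and> (b, w s b i) \<in> r \<and> enat (f i (w s b i)) = J i s b"
    if b: "b \<in> underS s" for s b i
  proof -
    have "(b, b) \<in> r" using b REFL by (auto simp: underS_def refl_on_def Field_def)
    then have "{c \<in> underS s. (b, c) \<in> r} \<noteq> {}" using b by blast
    from Inf_attained_enat[OF this, of "f i"]
    have "\<exists>c. c \<in> underS s \<and> (b, c) \<in> r \<and> enat (f i c) = J i s b" by (auto simp: J_def)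
    then show ?thesis unfolding w_def by (rule someI_ex)
  qed
  have "\<exists>\<beta> :: 'o \<Rightarrow> nat option \<Rightarrow> nat \<Rightarrow> 'o. \<forall>s i. is_limit r s \<longrightarrow>
      (\<forall>k. \<beta> s i k \<in> underS s) \<and> (SUP k. J i s (\<beta> s i k)) = (SUP b\<in>underS s. J i s b)"
  proof -
    have "\<exists>\<beta>. is_limit r s \<longrightarrow>
      (\<forall>k::nat. \<beta> k \<in> underS s) \<and> (SUP k. J i s (\<beta> k)) = (SUP b\<in>underS s. J i s b)" for s i
    proof (cases "is_limit r s")
      case True
      then have "underS s \<noteq> {}" by (auto simp: is_limit_def is_first_def)
      from Sup_attained_enat[OF this, of "J i s"] show ?thesis by blast
    qed simp
    then show ?thesis by (intro choice allI)
  qed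
  then obtain \<beta> :: "'o \<Rightarrow> nat option \<Rightarrow> nat \<Rightarrow> 'o" where \<beta>: "\<And>s i k. is_limit r s \<Longrightarrow> \<beta> s i k \<in> underS s"
      "\<And>s i. is_limit r s \<Longrightarrow> (SUP k. J i s (\<beta> s i k)) = (SUP b\<in>underS s. J i s b)"
    by blast
  define sc where "sc s b = (SOME c. is_succ r b c \<and> (c, s) \<in> r)" for s b
  have sc: "is_succ r b (sc s b) \<and> (sc s b, s) \<in> r" if "b \<in> underS s" for s b
    unfolding sc_def using ex_succ[OF r that] by (rule someI_ex)
  define pd where "pd s = (SOME u. is_succ r u s)" for s
  have pd: "pd s = u" if "is_succ r u s" for u s
    using is_succ_unique[OF r _ that] someI[of "\<lambda>u. is_succ r u s", OF that] by (simp add: pd_def)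
  define G where "G s b = {pd s, sc s b} \<union> range (w s b) \<union> (\<Union>i. range (\<beta> s i))" for s b
  have "countable (G s b)" for s b by (simp add: G_def)
  then have "\<exists>S. countable S \<and> t \<in> S \<and> (\<forall>a\<in>S. \<forall>b\<in>S. G a b \<subseteq> S)"
    by (rule ex_countable_closure)
  then obtain S0 where S0': "countable S0 \<and> t \<in> S0 \<and> (\<forall>a\<in>S0. \<forall>b\<in>S0. G a b \<subseteq> S0)" ..
  then have S0: "countable S0" "t \<in> S0" "\<And>a b. a \<in> S0 \<Longrightarrow> b \<in> S0 \<Longrightarrow> G a b \<subseteq> S0" by simp_all
  define S where "S = S0 \<inter> Field r"
  have SF: "S \<subseteq> Field r" by (simp add: S_def)
  have uF: "underS s \<subseteq> Field r" for s by (auto simp: underS_def Field_def)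
  have S_w: "w s b i \<in> S \<inter> underS s" "(b, w s b i) \<in> r" "enat (f i (w s b i)) = J i s b"
    if "s \<in> S" "b \<in> S" "b \<in> underS s" for s b i
    using S0(3)[of s b] w[OF that(3), of i] that(1,2) uF by (auto simp: S_def G_def)
  have S_\<beta>: "\<beta> s i k \<in> S \<inter> underS s" if "s \<in> S" "is_limit r s" for s i k
  proof -
    have "\<beta> s i k \<in> G s s" by (auto simp: G_def)
    then show ?thesis
      using S0(3)[of s s] \<beta>(1)[OF that(2), of i k] that(1) uF[of s] by (auto simp: S_def)
  qed
  have S_sc: "sc s b \<in> S" if "s \<in> S" "b \<in> S" "b \<in> underS s" for s b
    using S0(3)[of s b] sc[OF that(3)] that(1,2) by (auto simp: S_def G_def is_succ_def)
  have S_pd: "u \<in> S" if "s \<in> S" "is_succ r u s" for s u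
    using S0(3)[of s s] pd[OF that(2)] that by (auto simp: S_def G_def is_succ_def)
  define q where "q = Restr r S"
  have q_iff: "(a, b) \<in> q \<longleftrightarrow> (a, b) \<in> r \<and> a \<in> S \<and> b \<in> S" for a b by (auto simp: q_def)
  have Fq: "Field q = S"
    unfolding q_def using Refl_Field_Restr[OF REFL] SF by auto
  have uSq: "Order_Relation.underS q s = S \<inter> underS s" if "s \<in> S" for s
    using that by (auto simp: q_def underS_def)
  have uq: "Order_Relation.under q s = S \<inter> under s" if "s \<in> S" for s
    using that by (auto simp: q_def under_def)
  have succ_u: "u \<in> underS s" if "is_succ r u s" for u s
    using is_succ_in_underS[OF r that] .
  have first: "is_first r s" if "is_first q s" for s
  proof -
    have s: "s \<in> S" "S \<inter> underS s = {}" using that uSq by (auto simp: is_first_def Fq)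
    have "\<not> is_succ r u s" for u using S_pd[OF s(1), of u] succ_u[of u s] s(2) by blast
    moreover have "\<not> is_limit r s" using S_\<beta>[OF s(1), of None 0] s(2) by blast
    moreover have "s \<in> Field r" using s(1) SF by blast
    ultimately show ?thesis using zero_succ_limit[of s r] by blast
  qed
  have succ: "is_succ r u s" if us: "is_succ q u s" for u s
  proof -
    have s: "s \<in> S" "u \<in> S" "S \<inter> underS s = S \<inter> under u"
      using us uSq uq by (auto simp: is_succ_def Fq)
    have "(u, u) \<in> r" using s(2) SF REFL by (auto simp: refl_on_def)
    then have u: "u \<in> underS s" using s by (auto simp: under_def)
    have "\<not> is_limit r s"
    proof
      assume lim: "is_limit r s"
      have c: "is_succ r u (sc s u)" "(sc s u, s) \<in> r" using sc[OF u] by auto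
      have "sc s u \<noteq> s" using c(1) lim by (auto simp: is_limit_def)
      then have "sc s u \<in> S \<inter> underS s" using c(2) S_sc[OF s(1,2) u] by (simp add: underS_def)
      then have "(sc s u, u) \<in> r" using s(3) by (auto simp: under_def)
      moreover have "u \<in> underS (sc s u)" using succ_u[OF c(1)] .
      ultimately show False using ANTISYM by (auto simp: underS_def dest: antisymD)
    qed
    moreover have "\<not> is_first r s" using u by (auto simp: is_first_def)
    ultimately obtain u' where u': "is_succ r u' s" using zero_succ_limit[of s r] s(1) SF by blast
    have "u' \<in> S \<inter> underS s" using S_pd[OF s(1) u'] succ_u[OF u'] by blast
    then have "(u', u) \<in> r" using s(3) by (auto simp: under_def)
    moreover have "(u, u') \<in> r" using u u' by (auto simp: is_succ_def under_def)
    ultimately show ?thesis using u' ANTISYM by (auto dest: antisymD)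
  qed
  have limit: "is_limit r s" if lim: "is_limit q s" for s
  proof -
    have s: "s \<in> S" "S \<inter> underS s \<noteq> {}" using lim uSq by (auto simp: is_limit_def is_first_def Fq)
    have "\<not> is_succ r u s" for u
    proof
      assume u: "is_succ r u s"
      then have "is_succ q u s"
        using S_pd[OF s(1) u] s(1) by (auto simp: is_succ_def Fq uSq uq)
      then show False using lim by (auto simp: is_limit_def)
    qed
    moreover have "\<not> is_first r s" using s by (auto simp: is_first_def)
    ultimately show ?thesis using zero_succ_limit[of s r] s(1) SF by blast
  qed
  have liminf: "liminf_below q s (f i) = liminf_below r s (f i)" if s: "s \<in> S" "is_limit r s" for s i
  proof -
    have J: "(INF c\<in>{c \<in> Order_Relation.underS q s. (b, c) \<in> q}. enat (f i c)) = J i s b"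
      if b: "b \<in> S \<inter> underS s" for b
    proof (rule antisym)
      have "w s b i \<in> {c \<in> Order_Relation.underS q s. (b, c) \<in> q}"
        using S_w[of s b i] s b by (auto simp: uSq q_iff)
      then show "(INF c\<in>{c \<in> Order_Relation.underS q s. (b, c) \<in> q}. enat (f i c)) \<le> J i s b"
        using S_w(3)[of s b i] s b INF_lower[of "w s b i" _ "\<lambda>c. enat (f i c)"] by simp
      show "J i s b \<le> (INF c\<in>{c \<in> Order_Relation.underS q s. (b, c) \<in> q}. enat (f i c))"
        unfolding J_def by (rule INF_superset_mono) (auto simp: uSq s q_iff)
    qed
    have "liminf_below q s (f i) = (SUP b\<in>S \<inter> underS s. J i s b)"
      unfolding liminf_below_def uSq[OF s(1)]
      using J unfolding uSq[OF s(1)] by (intro SUP_cong) auto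
    also have "\<dots> = (SUP b\<in>underS s. J i s b)"
    proof (rule antisym)
      show "(SUP b\<in>S \<inter> underS s. J i s b) \<le> (SUP b\<in>underS s. J i s b)"
        by (rule SUP_subset_mono) auto
      have "(SUP k. J i s (\<beta> s i k)) \<le> (SUP b\<in>S \<inter> underS s. J i s b)"
        by (intro SUP_least SUP_upper S_\<beta> s)
      then show "(SUP b\<in>underS s. J i s b) \<le> (SUP b\<in>S \<inter> underS s. J i s b)"
        using \<beta>(2)[OF s(2)] by simp
    qed
    also have "\<dots> = liminf_below r s (f i)"
      by (simp add: liminf_below_def J_def)
    finally show ?thesis .
  qed
  have lc: "limit_config q s C = limit_config r s C" if "s \<in> S" "is_limit r s" for s
    unfolding limit_config_def
    using liminf[OF that, of None] liminf[OF that, of "Some _"] by (simp add: f_def[abs_def])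
  have "C s = c0" if "is_first q s" for s
    using comp first[OF that] by (simp add: computation_def)
  moreover have "fst (C u) < length P \<and> C s = step A (P ! fst (C u)) (C u)" if "is_succ q u s" for u s
    using comp succ[OF that] by (simp add: computation_def)
  moreover have "C s = limit_config q s C" if "is_limit q s" for s
    using comp limit[OF that] lc[of s] that by (simp add: computation_def is_limit_def Fq)
  moreover have "Well_order q" unfolding q_def by (rule Well_order_Restr[OF r])
  ultimately have "computation P A c0 q C"
    unfolding computation_def by simp
  moreover have "countable S" "t \<in> S" using S0 t by (auto simp: S_def)
  ultimately show ?thesis using SF unfolding q_def by blast
qed

lemma computation_iso:
  assumes comp: "computation P A c0 r C" and inj: "inj_on g (Field r)"
  shows "computation P A c0 (dir_image r g) (C \<circ> inv_into (Field r) g)"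
proof -
  define q where "q = dir_image r g"
  have r: "Well_order r" using comp by (simp add: computation_def)
  have Fq: "Field q = g ` Field r" unfolding q_def by (rule dir_image_Field)
  have q_iff: "(g a, g b) \<in> q \<longleftrightarrow> (a, b) \<in> r" if "a \<in> Field r" "b \<in> Field r" for a b
  proof
    assume "(g a, g b) \<in> q"
    then obtain a' b' where *: "g a = g a'" "g b = g b'" "(a', b') \<in> r"
      by (auto simp: q_def dir_image_def)
    then have "a' \<in> Field r" "b' \<in> Field r" by (auto simp: Field_def)
    then show "(a, b) \<in> r" using * that inj by (auto dest: inj_onD)
  qed (auto simp: q_def dir_image_def)
  have uS: "underS q (g s) = g ` underS r s" if "s \<in> Field r" for s
  proof -
    have "x \<in> underS q (g s) \<longleftrightarrow> x \<in> g ` underS r s" for x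
    proof
      assume x: "x \<in> underS q (g s)"
      then have "x \<in> Field q" by (auto simp: underS_def Field_def)
      then obtain a where a: "a \<in> Field r" "x = g a" using Fq by auto
      then show "x \<in> g ` underS r s" using x q_iff[OF a(1) that] by (auto simp: underS_def)
    next
      assume "x \<in> g ` underS r s"
      then obtain a where a: "a \<in> underS r s" "x = g a" by auto
      then have "a \<in> Field r" by (auto simp: underS_def Field_def)
      then show "x \<in> underS q (g s)" using a q_iff[of a s] that inj_onD[OF inj, of a s]
        by (auto simp: underS_def)
    qed
    then show ?thesis by blast
  qed
  have u: "under q (g s) = g ` under r s" if "s \<in> Field r" for s
  proof -
    have "x \<in> under q (g s) \<longleftrightarrow> x \<in> g ` under r s" for x
    proof
      assume x: "x \<in> under q (g s)"
      then have "x \<in> Field q" by (auto simp: under_def Field_def)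
      then obtain a where a: "a \<in> Field r" "x = g a" using Fq by auto
      then show "x \<in> g ` under r s" using x q_iff[OF a(1) that] by (auto simp: under_def)
    next
      assume "x \<in> g ` under r s"
      then obtain a where a: "a \<in> under r s" "x = g a" by auto
      then have "a \<in> Field r" by (auto simp: under_def Field_def)
      then show "x \<in> under q (g s)" using a q_iff[of a s] that by (auto simp: under_def)
    qed
    then show ?thesis by blast
  qed
  have sub: "underS r s \<subseteq> Field r" "under r s \<subseteq> Field r" for s
    by (auto simp: under_def underS_def Field_def)
  have zero: "is_first q (g s) \<longleftrightarrow> is_first r s" if "s \<in> Field r" for s
    using that by (auto simp: is_first_def uS Fq)
  have succ: "is_succ q (g a) (g b) \<longleftrightarrow> is_succ r a b" if "a \<in> Field r" "b \<in> Field r" for a b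
    using that inj_on_image_eq_iff[OF inj sub] by (simp add: is_succ_def uS u Fq)
  have limit: "is_limit q (g s) \<longleftrightarrow> is_limit r s" if s: "s \<in> Field r" for s
  proof -
    have "(\<exists>x. is_succ q x (g s)) \<longleftrightarrow> (\<exists>a. is_succ r a s)"
      using succ[OF _ s] by (metis Fq imageE is_succ_def)
    then show ?thesis using zero[OF s] s by (auto simp: is_limit_def Fq)
  qed
  let ?D = "C \<circ> inv_into (Field r) g"
  have D: "?D (g s) = C s" if "s \<in> Field r" for s using inj that by simp
  have liminf: "liminf_below q (g s) (\<lambda>x. h (?D x)) = liminf_below r s (\<lambda>x. h (C x))"
    if s: "s \<in> Field r" for s h
  proof -
    have 1: "{x \<in> underS q (g s). (g b, x) \<in> q} = g ` {x \<in> underS r s. (b, x) \<in> r}"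
      if "b \<in> underS r s" for b
    proof -
      have "(g b, g x) \<in> q \<longleftrightarrow> (b, x) \<in> r" if "x \<in> underS r s" for x
        using q_iff[of b x] sub(1)[of s] that \<open>b \<in> underS r s\<close> by blast
      then show ?thesis by (auto simp: uS s)
    qed
    have 2: "(INF x\<in>{x \<in> underS q (g s). (g b, x) \<in> q}. enat (h (?D x)))
      = (INF x\<in>{x \<in> underS r s. (b, x) \<in> r}. enat (h (C x)))" if "b \<in> underS r s" for b
      unfolding 1[OF that] image_image using D sub(1)[of s] by (intro INF_cong) (auto simp: subset_iff)
    show ?thesis
      unfolding liminf_below_def by (subst (1) uS[OF s], subst image_image, rule SUP_cong) (use 2 in auto)
  qed
  have lc: "limit_config q (g s) ?D = limit_config r s C" if "s \<in> Field r" for s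
    unfolding limit_config_def
    using liminf[OF that, of fst] liminf[OF that, of "\<lambda>c. snd c _"] by simp
  have "Well_order q" unfolding q_def using Well_order_dir_image[OF r inj] .
  moreover have "?D x = c0" if "is_first q x" for x
  proof -
    obtain s where "s \<in> Field r" "x = g s" using \<open>is_first q x\<close> by (auto simp: is_first_def Fq)
    then show ?thesis using that zero[of s] D[of s] comp by (simp add: computation_def)
  qed
  moreover have "fst (?D x) < length P \<and> ?D y = step A (P ! fst (?D x)) (?D x)" if "is_succ q x y" for x y
  proof -
    obtain a b where "a \<in> Field r" "x = g a" "b \<in> Field r" "y = g b"
      using \<open>is_succ q x y\<close> by (auto simp: is_succ_def Fq)
    then show ?thesis using that succ[of a b] D[of a] D[of b] comp by (simp add: computation_def)
  qed
  moreover have "?D x = limit_config q x ?D" if "is_limit q x" for x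
  proof -
    obtain s where s: "s \<in> Field r" "x = g s" using \<open>is_limit q x\<close> by (auto simp: is_limit_def Fq)
    then show ?thesis using that limit[of s] D[of s] lc[of s] comp by (simp add: computation_def)
  qed
  ultimately show ?thesis unfolding computation_def q_def by blast
qed

lemma halts_with_if_halting_computation:
  fixes r :: "'o rel"
  assumes "halting_computation P A i k r C t"
  shows "halts_with P A i k"
proof -
  have h: "computation P A (initial i) r C" "t \<in> Field r" "length P \<le> fst (C t)" "snd (C t) 0 = k"
    using assms by (auto simp: halting_computation_def)
  obtain S where S: "countable S" "S \<subseteq> Field r" "t \<in> S" "computation P A (initial i) (Restr r S) C"
    using computation_restrict[OF h(1,2)] by blast
  have "Refl r" using h(1) by (auto simp: computation_def order_on_defs)
  then have F: "Field (Restr r S) = S" using Refl_Field_Restr[of r S] S(2) by auto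
  obtain g :: "'o \<Rightarrow> nat" where g: "inj_on g S" using S(1) by (auto simp: countable_def)
  have "computation P A (initial i) (dir_image (Restr r S) g) (C \<circ> inv_into S g)"
    using computation_iso[OF S(4), of g] g by (simp add: F)
  moreover have "g t \<in> Field (dir_image (Restr r S) g)"
    using S(3) by (simp add: dir_image_Field F)
  moreover have "(C \<circ> inv_into S g) (g t) = C t" using g S(3) by simp
  ultimately have "halting_computation P A i k (dir_image (Restr r S) g) (C \<circ> inv_into S g) (g t)"
    using h by (simp add: halting_computation_def)
  then show ?thesis unfolding halts_with_def by blast
qed


subsection \<open>Computability\<close>

definition computes_from :: "prog \<Rightarrow> nat set \<Rightarrow> nat set \<Rightarrow> bool" where
  "computes_from P x y \<longleftrightarrow> (\<forall>i. halts_with P y i (if i \<in> x then 1 else 0))"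

definition ITRM_computable_from :: "nat set \<Rightarrow> nat set \<Rightarrow> bool" where
  "ITRM_computable_from x y \<longleftrightarrow> (\<exists>P. computes_from P x y)"

definition ITRMn_computable_from :: "nat \<Rightarrow> nat set \<Rightarrow> nat set \<Rightarrow> bool" where
  "ITRMn_computable_from m x y \<longleftrightarrow> (\<exists>P. num_regs P \<le> m \<and> computes_from P x y)"

definition ITRM_computable :: "nat set \<Rightarrow> bool" where
  "ITRM_computable x \<longleftrightarrow> ITRM_computable_from x {}"


section \<open>Mutual randomness\<close>

definition join :: "nat set \<Rightarrow> nat set \<Rightarrow> nat set" where
  "join a b = (\<lambda>k. 2 * k) ` a \<union> (\<lambda>k. 2 * k + 1) ` b"

text \<open>All registers, including the one otherwise holding the input, start with \<open>0\<close>.\<close>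

definition decides_in :: "prog \<Rightarrow> nat set \<Rightarrow> nat set set \<Rightarrow> bool" where
  "decides_in P w X \<longleftrightarrow> (\<forall>u. halts_with P (join u w) 0 (if u \<in> X then 1 else 0))"

definition nowhere_dense :: "'a :: topological_space set \<Rightarrow> bool" where
  "nowhere_dense S \<longleftrightarrow> interior (closure S) = {}"

definition meager :: "'a :: topological_space set \<Rightarrow> bool" where
  "meager S \<longleftrightarrow> (\<exists>N :: nat \<Rightarrow> 'a set. (\<forall>k. nowhere_dense (N k)) \<and> S \<subseteq> (\<Union>k. N k))"

text \<open>The power set of the natural numbers carries the topology of Cantor space, i.e. the product
  topology on \<open>nat \<Rightarrow> bool\<close> transported along characteristic functions.\<close>

definition meager_reals :: "nat set set \<Rightarrow> bool" where
  "meager_reals X \<longleftrightarrow> meager ((\<lambda>u i. i \<in> u) ` X :: (nat \<Rightarrow> bool) set)"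

definition ITRMn_random :: "nat \<Rightarrow> nat set \<Rightarrow> nat set \<Rightarrow> bool" where
  "ITRMn_random n y z \<longleftrightarrow>
     \<not> (\<exists>X P. meager_reals X \<and> y \<in> X \<and> num_regs P \<le> n \<and> decides_in P z X)"

definition mutually_ITRMn_random :: "nat \<Rightarrow> nat set \<Rightarrow> nat set \<Rightarrow> bool" where
  "mutually_ITRMn_random n y z \<longleftrightarrow> ITRMn_random n y z \<and> ITRMn_random n z y"


section \<open>Sets\<close>

text \<open>The type \<open>'i V\<close> consists of the well-founded sets that hereditarily have at most
  \<open>|'i + nat|\<close> elements: trees with this branching, up to extensional equality.\<close>

datatype 'i tree = Empty | Branch "'i + nat \<Rightarrow> 'i tree"

primrec children :: "'i tree \<Rightarrow> 'i tree set" where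
  "children Empty = {}"
| "children (Branch f) = range f"

primrec ext_eq :: "'i tree \<Rightarrow> 'i tree \<Rightarrow> bool" where
  "ext_eq Empty y \<longleftrightarrow> children y = {}"
| "ext_eq (Branch f) y \<longleftrightarrow>
     (\<forall>k. \<exists>b\<in>children y. ext_eq (f k) b) \<and> (\<forall>b\<in>children y. \<exists>k. ext_eq (f k) b)"

lemma ext_eq_iff:
  "ext_eq x y \<longleftrightarrow>
     (\<forall>a\<in>children x. \<exists>b\<in>children y. ext_eq a b) \<and>
     (\<forall>b\<in>children y. \<exists>a\<in>children x. ext_eq a b)"
  by (cases x) auto

lemma ext_eq_refl: "ext_eq x x"
  by (induction x) auto

lemma ext_eq_sym: "ext_eq x y \<Longrightarrow> ext_eq y x"
proof (induction x arbitrary: y)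
  case Empty
  then show ?case by (cases y) auto
next
  case (Branch f)
  then show ?case
    unfolding ext_eq_iff[of y] by (metis children.simps(2) ext_eq.simps(2) rangeE rangeI)
qed

lemma ext_eq_trans: "ext_eq x y \<Longrightarrow> ext_eq y z \<Longrightarrow> ext_eq x z"
proof (induction x arbitrary: y z)
  case Empty
  then show ?case unfolding ext_eq_iff[of y] by (cases z) auto
next
  case (Branch f)
  have 1: "\<exists>c\<in>children z. ext_eq (f k) c" for k
  proof -
    obtain b where b: "b \<in> children y" "ext_eq (f k) b"
      using Branch.prems(1) by auto
    obtain c where "c \<in> children z" "ext_eq b c"
      using Branch.prems(2) b(1) unfolding ext_eq_iff[of y] by auto
    then show ?thesis using Branch.IH[OF rangeI b(2)] by auto
  qed
  have 2: "\<exists>k. ext_eq (f k) c" if c: "c \<in> children z" for c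
  proof -
    obtain b where b: "b \<in> children y" "ext_eq b c"
      using Branch.prems(2) c unfolding ext_eq_iff[of y] by auto
    obtain k where "ext_eq (f k) b"
      using Branch.prems(1) b(1) by auto
    then show ?thesis using Branch.IH[OF rangeI _ b(2)] by auto
  qed
  show ?case using 1 2 by simp
qed

quotient_type 'i V = "'i tree" / ext_eq
  by (intro equivpI reflpI sympI transpI) (auto intro: ext_eq_refl ext_eq_sym ext_eq_trans)

definition elts :: "'i V \<Rightarrow> 'i V set" where
  "elts v = abs_V ` children (rep_V v)"

lemma abs_V_eq_iff: "abs_V x = abs_V y \<longleftrightarrow> ext_eq x y"
  by (rule V.abs_eq_iff)

lemma abs_rep_V: "abs_V (rep_V v) = v"
  by (rule Quotient3_abs_rep[OF Quotient3_V])

lemma elts_abs_V: "elts (abs_V x) = abs_V ` children x"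
proof -
  have "ext_eq (rep_V (abs_V x)) x"
    using abs_rep_V[of "abs_V x"] by (simp add: abs_V_eq_iff)
  then have *: "\<forall>a\<in>children (rep_V (abs_V x)). \<exists>b\<in>children x. abs_V a = abs_V b"
    "\<forall>b\<in>children x. \<exists>a\<in>children (rep_V (abs_V x)). abs_V b = abs_V a"
    unfolding ext_eq_iff[of "rep_V (abs_V x)"] abs_V_eq_iff using ext_eq_sym by blast+
  show ?thesis
    unfolding elts_def using * by blast
qed

lemma V_extensionality: "elts u = elts v \<Longrightarrow> u = v"
proof -
  assume *: "elts u = elts v"
  have "ext_eq (rep_V u) (rep_V v)"
    unfolding ext_eq_iff[of "rep_V u"]
  proof (intro conjI ballI)
    fix a assume "a \<in> children (rep_V u)"
    then have "abs_V a \<in> elts v" using * unfolding elts_def by blast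
    then show "\<exists>b\<in>children (rep_V v). ext_eq a b"
      unfolding elts_def by (auto simp: abs_V_eq_iff)
  next
    fix b assume "b \<in> children (rep_V v)"
    then have "abs_V b \<in> elts u" using * unfolding elts_def by blast
    then obtain a where "a \<in> children (rep_V u)" "ext_eq b a"
      unfolding elts_def by (auto simp: abs_V_eq_iff)
    then show "\<exists>a\<in>children (rep_V u). ext_eq a b"
      using ext_eq_sym by blast
  qed
  then have "abs_V (rep_V u) = abs_V (rep_V v)" by (simp add: abs_V_eq_iff)
  then show "u = v" by (simp add: abs_rep_V)
qed

lemma ex_V:
  fixes X :: "'i V set"
  assumes "X \<subseteq> range (f :: 'i + nat \<Rightarrow> 'i V)"
  shows "\<exists>v. elts v = X"
proof (cases "X = {}")
  case True
  then show ?thesis using elts_abs_V[of Empty] by auto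
next
  case False
  then obtain x0 where x0: "x0 \<in> X" by blast
  define g where "g k = (if f k \<in> X then f k else x0)" for k
  have "X = range g" using assms x0 by (auto simp: g_def image_iff)
  moreover have "elts (abs_V (Branch (\<lambda>k. rep_V (g k)))) = range g"
    by (simp add: elts_abs_V image_image abs_rep_V)
  ultimately show ?thesis by blast
qed

lemma ex_V_countable:
  fixes X :: "'i V set"
  assumes "countable X"
  shows "\<exists>v. elts v = X"
proof -
  define f :: "'i + nat \<Rightarrow> 'i V" where "f k = from_nat_into X (case k of Inl _ \<Rightarrow> 0 | Inr n \<Rightarrow> n)" for k
  have "X \<subseteq> range f"
  proof
    fix a assume "a \<in> X"
    then have "a = f (Inr (to_nat_on X a))" using assms by (simp add: f_def)
    then show "a \<in> range f" by blast
  qed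
  then show ?thesis by (rule ex_V)
qed

definition vset :: "'i V set \<Rightarrow> 'i V" where
  "vset X = (THE v. elts v = X)"

lemma elts_vset:
  assumes "\<exists>v. elts v = X" shows "elts (vset X) = X"
proof -
  obtain v where v: "elts v = X" using assms by blast
  show ?thesis
    unfolding vset_def by (rule theI[of _ v]) (simp_all add: v V_extensionality)
qed

lemma vset_elts: "vset (elts v) = v"
  by (rule V_extensionality, rule elts_vset) blast

text \<open>Natural numbers are von Neumann ordinals.\<close>

primrec numeral_V :: "nat \<Rightarrow> 'i V" where
  "numeral_V 0 = vset {}"
| "numeral_V (Suc n) = vset (insert (numeral_V n) (elts (numeral_V n)))"

definition real_V :: "nat set \<Rightarrow> 'i V" where
  "real_V x = vset (numeral_V ` x)"

lemma elts_numeral_V: "elts (numeral_V n) = numeral_V ` {..<n}"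
proof (induction n)
  case 0
  then show ?case by (simp add: elts_vset ex_V_countable)
next
  case (Suc n)
  then show ?case by (simp add: elts_vset ex_V_countable lessThan_Suc)
qed

lemma elts_real_V: "elts (real_V x) = numeral_V ` x"
  unfolding real_V_def by (intro elts_vset ex_V_countable) simp


section \<open>The constructible hierarchy\<close>

datatype fm =
    Member nat nat
  | Equal nat nat
  | Neg fm
  | Conj fm fm
  | Exists nat fm

primrec free_vars :: "fm \<Rightarrow> nat set" where
  "free_vars (Member i j) = {i, j}"
| "free_vars (Equal i j) = {i, j}"
| "free_vars (Neg p) = free_vars p"
| "free_vars (Conj p q) = free_vars p \<union> free_vars q"
| "free_vars (Exists i p) = free_vars p - {i}"

primrec sat :: "'i V set \<Rightarrow> (nat \<Rightarrow> 'i V) \<Rightarrow> fm \<Rightarrow> bool" where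
  "sat A e (Member i j) \<longleftrightarrow> e i \<in> elts (e j)"
| "sat A e (Equal i j) \<longleftrightarrow> e i = e j"
| "sat A e (Neg p) \<longleftrightarrow> \<not> sat A e p"
| "sat A e (Conj p q) \<longleftrightarrow> sat A e p \<and> sat A e q"
| "sat A e (Exists i p) \<longleftrightarrow> (\<exists>a\<in>A. sat A (e(i := a)) p)"

text \<open>The subsets of \<open>A\<close> that are first-order definable over \<open>(A, \<in>)\<close> with parameters from
  \<open>A\<close>; the variable \<open>0\<close> stands for the element, the others for the parameters.\<close>

definition Def :: "'i V set \<Rightarrow> 'i V set set" where
  "Def A = {{a \<in> A. sat A (e(0 := a)) p} | p e. \<forall>i \<in> free_vars p - {0}. e i \<in> A}"

definition constructible_hierarchy :: "'i rel \<Rightarrow> ('i \<Rightarrow> 'i V set) \<Rightarrow> bool" where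
  "constructible_hierarchy r L \<longleftrightarrow> Well_order r \<and>
     (\<forall>a. is_first r a \<longrightarrow> L a = {}) \<and>
     (\<forall>a b. is_succ r a b \<longrightarrow> L b = {v. elts v \<in> Def (L a)}) \<and>
     (\<forall>a. is_limit r a \<longrightarrow> L a = (\<Union>b\<in>underS r a. L b))"

text \<open>A real is constructible if it is an element of some level of the constructible hierarchy.
  As HOL has no type of all ordinals, the levels are indexed by well-orders of the type \<open>'i\<close>;
  a theorem in which \<open>'i\<close> is a type variable speaks about all ordinals.
  Lemma \<open>ex_V_Def\<close> below shows that \<open>'i V\<close> contains all the sets occurring in such a
  hierarchy.\<close>

definition constructible :: "'i itself \<Rightarrow> nat set \<Rightarrow> bool" where
  "constructible (_ :: 'i itself) x \<longleftrightarrow>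
     (\<exists>(r :: 'i rel) L. constructible_hierarchy r L \<and> (\<exists>a\<in>Field r. real_V x \<in> L a))"


subsection \<open>All definable sets exist\<close>

instance fm :: countable
  by countable_datatype

datatype 'i code = Code 'i fm "'i code list"

primrec interp :: "('i \<Rightarrow> 'i V set) \<Rightarrow> 'i code \<Rightarrow> 'i V" where
  "interp L (Code b p cs) =
     vset {x \<in> L b. sat (L b) ((\<lambda>i. map (interp L) cs ! i)(0 := x)) p}"

primrec enc :: "(('i + nat) \<times> ('i + nat) \<Rightarrow> 'i + nat) \<Rightarrow> 'i code \<Rightarrow> 'i + nat" where
  "enc pr (Code b p cs) =
     pr (Inl b, pr (Inr (to_nat p), pr (Inr (length cs),
       foldr (\<lambda>x y. pr (x, y)) (map (enc pr) cs) (Inr 0))))"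

lemma finite_free_vars: "finite (free_vars p)"
  by (induction p) auto

lemma sat_cong: "\<forall>i\<in>free_vars p. e i = e' i \<Longrightarrow> sat A e p \<longleftrightarrow> sat A e' p"
proof (induction p arbitrary: e e')
  case (Exists i p)
  have "sat A (e(i := a)) p \<longleftrightarrow> sat A (e'(i := a)) p" for a
    using Exists.prems by (intro Exists.IH) auto
  then show ?case by simp
next
  case (Neg p)
  have "sat A e p \<longleftrightarrow> sat A e' p" using Neg.prems by (intro Neg.IH) simp
  then show ?case by simp
next
  case (Conj p q)
  have "sat A e p \<longleftrightarrow> sat A e' p" using Conj.prems by (intro Conj.IH(1)) simp
  moreover have "sat A e q \<longleftrightarrow> sat A e' q" using Conj.prems by (intro Conj.IH(2)) simp
  ultimately show ?case by simp
qed simp_all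

lemma inj_foldr_pair:
  assumes "inj pr" "length xs = length ys"
    and "foldr (\<lambda>x y. pr (x, y)) xs z = foldr (\<lambda>x y. pr (x, y)) ys z"
  shows "xs = ys"
  using assms(2,3) by (induction xs ys rule: list_induct2) (simp_all add: inj_eq[OF assms(1)])

lemma inj_enc:
  assumes "inj pr" shows "inj (enc pr)"
proof (rule injI)
  fix c d assume "enc pr c = enc pr d"
  then show "c = d"
  proof (induction c arbitrary: d)
    case (Code b p cs)
    obtain b' p' ds where d: "d = Code b' p' ds" by (cases d)
    from Code.prems have eq: "b = b'" "p = p'" "length cs = length ds"
      and f: "foldr (\<lambda>x y. pr (x, y)) (map (enc pr) cs) (Inr 0)
        = foldr (\<lambda>x y. pr (x, y)) (map (enc pr) ds) (Inr 0)"
      unfolding d by (simp_all add: inj_eq[OF assms])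
    have "map (enc pr) cs = map (enc pr) ds"
      using inj_foldr_pair[OF assms _ f] eq by simp
    then have *: "enc pr (cs ! i) = enc pr (ds ! i)" if "i < length cs" for i
      using that eq(3) by (metis nth_map)
    have "cs = ds"
      by (rule nth_equalityI) (use eq(3) Code.IH[OF nth_mem *] in auto)
    then show ?case using eq d by simp
  qed
qed

lemma ex_inj_pair: "\<exists>pr :: ('i + nat) \<times> ('i + nat) \<Rightarrow> 'i + nat. inj pr"
proof -
  have "infinite (UNIV :: ('i + nat) set)"
    by simp
  from card_of_ordIso[THEN iffD2, OF card_of_Times_same_infinite[OF this]]
  have "\<exists>f. bij_betw f ((UNIV :: ('i + nat) set) \<times> (UNIV :: ('i + nat) set)) (UNIV :: ('i + nat) set)" .
  then show ?thesis
    unfolding UNIV_Times_UNIV bij_betw_def by auto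
qed

lemma levels_subset_range_interp:
  assumes L: "constructible_hierarchy r L" and "a \<in> Field r"
  shows "L a \<subseteq> range (interp L)"
proof -
  have r: "Well_order r" using L by (simp add: constructible_hierarchy_def)
  then have wf: "wf (r - Id)" by (simp add: well_order_on_def)
  show ?thesis using assms(2)
  proof (induction a rule: wf_induct_rule[OF wf])
    case (1 a)
    have IH: "L b \<subseteq> range (interp L)" if "b \<in> underS r a" for b
      using 1(1)[of b] that by (auto simp: underS_def Field_def)
    consider "is_first r a" | b where "is_succ r b a" | "is_limit r a"
      using zero_succ_limit[OF 1(2)] by blast
    then show ?case
    proof cases
      case 1
      then show ?thesis using L by (simp add: constructible_hierarchy_def)
    next
      case 3
      then have "L a = (\<Union>b\<in>underS r a. L b)" using L by (simp add: constructible_hierarchy_def)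
      then show ?thesis using IH by blast
    next
      case 2
      then have La: "L a = {v. elts v \<in> Def (L b)}"
        using L by (auto simp: constructible_hierarchy_def)
      have Lb: "L b \<subseteq> range (interp L)" using IH is_succ_in_underS[OF r 2] by blast
      show ?thesis
      proof
        fix v assume "v \<in> L a"
        then obtain p e where v: "elts v = {x \<in> L b. sat (L b) (e(0 := x)) p}"
          and e: "\<forall>i \<in> free_vars p - {0}. e i \<in> L b"
          by (auto simp: La Def_def)
        have "\<forall>i \<in> free_vars p - {0}. \<exists>c. e i = interp L c" using e Lb by blast
        then obtain c where c: "\<And>i. i \<in> free_vars p - {0} \<Longrightarrow> e i = interp L (c i)"
          by metis
        obtain N where N: "\<forall>i\<in>free_vars p. i < N"
          using finite_free_vars[of p] finite_nat_set_iff_bounded by blast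
        define cs where "cs = map c [0..<N]"
        have "sat (L b) (e(0 := x)) p \<longleftrightarrow>
            sat (L b) ((\<lambda>i. map (interp L) cs ! i)(0 := x)) p" for x
          using N c by (intro sat_cong) (auto simp: cs_def)
        then have "elts v = {x \<in> L b. sat (L b) ((\<lambda>i. map (interp L) cs ! i)(0 := x)) p}"
          using v by simp
        then have "v = interp L (Code b p cs)"
          using vset_elts[of v] by simp
        then show "v \<in> range (interp L)" by blast
      qed
    qed
  qed
qed

lemma ex_V_Def:
  fixes r :: "'i rel"
  assumes "constructible_hierarchy r L" "a \<in> Field r" "X \<in> Def (L a)"
  shows "\<exists>v. elts v = X"
proof -
  obtain pr :: "('i + nat) \<times> ('i + nat) \<Rightarrow> 'i + nat" where "inj pr"
    using ex_inj_pair by blast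
  then have "inj (enc pr)" by (rule inj_enc)
  then have "range (interp L) = range (interp L \<circ> inv (enc pr))"
    by (simp only: image_comp[symmetric] inj_imp_surj_inv)
  moreover have "X \<subseteq> L a" using assms(3) by (auto simp: Def_def)
  ultimately have "X \<subseteq> range (interp L \<circ> inv (enc pr))"
    using levels_subset_range_interp[OF assms(1,2)] by blast
  then show ?thesis by (rule ex_V)
qed

end

theory Submission
  imports Defs
begin

text \<open>
  Every real \<open>x\<close> can be coded into a mutually generic pair. Machines with at most \<open>n\<close> registers are
  simulated by one family of systems that always stop: a run loops iff a configuration recurs without
  any component having been smaller in between, and this is detected by keeping, for each number of
  zeros, the set of the past configurations below which the run has not dropped since.

  A finite condition forces a property of reals if the property holds on a comeager part of its
  cylinder. The halting times that are forced by some condition form a countable initial segment of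
  the ordinals, so countably many dense open requirements suffice for a truth lemma: along a real that
  meets them all, every state of a run is forced by a finite part of the real. If \<open>y \<oplus> z\<close> is such
  a real and a machine accepts it, then it accepts \<open>u \<oplus> z\<close> for a nonmeager set of \<open>u\<close>; hence \<open>y\<close> is
  random relative to \<open>z\<close>.

  To code \<open>x\<close>, the bits of \<open>x\<close> are put, in \<open>y\<close> as well as in \<open>z\<close>, at positions \<open>g 0 < g 1 < \<dots>\<close>. The
  block between \<open>g k\<close> and \<open>g (k + 1)\<close> meets the first requirements whatever was chosen before, and
  \<open>g (k + 1)\<close> is least such that a block of this kind exists. All finite modifications of \<open>y\<close> are then generic,
  and comparing the halting times and states of the systems run on them decides the forcing relation.
  Thus the requirements, the function \<open>g\<close> and the real \<open>x\<close> are computable from \<open>y\<close>, by a machine with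
  more registers, and likewise from \<open>z\<close>.
\<close>

section \<open>Countable ordinals\<close>

text \<open>The obstacle is that a machine with oracle \<open>y\<close> must recompute the coding
  positions, although these are chosen by means of forcing, a notion about all reals. Forcing is
  therefore defined by category instead of a forcing language, so that it applies directly to
  statements about runs. Ordinals enter it only through names, that is, as halting times of systems,
  so that two of them are compared by running two systems side by side. For this every system has to
  halt, and every time of a run has to be the halting time of some system; the first is why loop
  detection is built into the systems, the second why they are steered by lists of states. The
  search for a position never mentions \<open>x\<close>, so recomputing it involves no circle. The
  bound \<open>n\<close> on the registers gives all programs one dimension: states then form a
  countable set, and a single program of a larger machine can simulate the whole family.\<close>

typedef om1 = "Field (cardSuc natLeq)"
  using Field_cardSuc_not_empty[OF natLeq_Card_order] by blast

lemma om1_order: "Well_order (cardSuc natLeq)" "Card_order (cardSuc natLeq)"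
  using cardSuc_Card_order[OF natLeq_Card_order] by (auto simp: card_order_on_def)

instantiation om1 :: wellorder
begin

definition less_eq_om1 :: "om1 \<Rightarrow> om1 \<Rightarrow> bool" where
  "a \<le> b \<longleftrightarrow> (Rep_om1 a, Rep_om1 b) \<in> cardSuc natLeq"

definition less_om1 :: "om1 \<Rightarrow> om1 \<Rightarrow> bool" where
  "a < b \<longleftrightarrow> a \<le> b \<and> a \<noteq> b" for a b :: om1

instance
proof
  interpret wo_rel "cardSuc natLeq" using om1_order by (simp add: wo_rel_def)
  fix x y z :: om1
  show refl: "x \<le> x" using REFL Rep_om1[of x] by (auto simp: less_eq_om1_def refl_on_def)
  show anti: "x \<le> y \<Longrightarrow> y \<le> x \<Longrightarrow> x = y" for x y :: om1
    using ANTISYM unfolding less_eq_om1_def by (metis Rep_om1_inject antisymD)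
  show "(x < y) = (x \<le> y \<and> \<not> y \<le> x)" using anti refl by (auto simp: less_om1_def)
  show "x \<le> y \<Longrightarrow> y \<le> z \<Longrightarrow> x \<le> z" using TRANS unfolding less_eq_om1_def by (meson transD)
  show "x \<le> y \<or> y \<le> x" using TOTALS Rep_om1[of x] Rep_om1[of y] by (auto simp: less_eq_om1_def)
next
  interpret wo_rel "cardSuc natLeq" using om1_order by (simp add: wo_rel_def)
  fix P :: "om1 \<Rightarrow> bool" and a :: om1
  assume step: "\<And>x. (\<And>y. y < x \<Longrightarrow> P y) \<Longrightarrow> P x"
  have "wf {(a, b). a < (b :: om1)}"
    by (rule wf_subset[OF wf_inv_image[OF WF, of Rep_om1]])
      (auto simp: less_om1_def less_eq_om1_def Rep_om1_inject inv_image_def)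
  then show "P a" by (induction a rule: wf_induct_rule) (use step in auto)
qed

end

lemma countable_lessThan_om1:
  includes cardinal_syntax
  shows "countable {..<(a :: om1)}"
proof -
  have a: "Rep_om1 a \<in> Field (cardSuc natLeq)" by (rule Rep_om1)
  have "|underS (cardSuc natLeq) (Rep_om1 a)| <o cardSuc natLeq"
    using card_of_underS[OF om1_order(2) a] .
  then have "|underS (cardSuc natLeq) (Rep_om1 a)| \<le>o natLeq"
    using cardSuc_ordLeq_ordLess[OF natLeq_Card_order card_of_Card_order] by blast
  then have "|underS (cardSuc natLeq) (Rep_om1 a)| \<le>o |UNIV :: nat set|"
    using card_of_nat ordIso_symmetric ordLeq_ordIso_trans by blast
  then have c: "countable (underS (cardSuc natLeq) (Rep_om1 a))"
    unfolding card_of_ordLeq[symmetric] countable_def by blast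
  have "{..<a} \<subseteq> Abs_om1 ` underS (cardSuc natLeq) (Rep_om1 a)"
  proof
    fix b assume "b \<in> {..<a}"
    then have "Rep_om1 b \<in> underS (cardSuc natLeq) (Rep_om1 a)"
      by (auto simp: less_om1_def less_eq_om1_def underS_def Rep_om1_inject)
    then show "b \<in> Abs_om1 ` underS (cardSuc natLeq) (Rep_om1 a)"
      by (metis Rep_om1_inverse imageI)
  qed
  then show ?thesis using c countable_subset by blast
qed

lemma countable_atMost_om1: "countable {..(a :: om1)}"
  using countable_lessThan_om1[of a] by (simp add: ivl_disj_un_singleton(2)[symmetric])

lemma uncountable_om1:
  includes cardinal_syntax
  shows "uncountable (UNIV :: om1 set)"
proof
  assume "countable (UNIV :: om1 set)"
  then have "countable (Rep_om1 ` UNIV)" by simp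
  moreover have "Rep_om1 ` UNIV = Field (cardSuc natLeq)"
    using type_definition.Rep_range[OF type_definition_om1] .
  ultimately have "|Field (cardSuc natLeq)| \<le>o |UNIV :: nat set|"
    unfolding card_of_ordLeq[symmetric] countable_def by auto
  then have "cardSuc natLeq \<le>o natLeq"
    using card_of_nat card_of_Field_ordIso[OF om1_order(2)]
    by (meson ordIso_symmetric ordIso_ordLeq_trans ordLeq_ordIso_trans)
  then show False
    using cardSuc_greater[OF natLeq_Card_order] not_ordLess_ordLeq by blast
qed

text \<open>Regularity of the first uncountable ordinal: a cofinal countable set would make the type
  a countable union of countable initial segments. It provides suprema of countably many times, and
  later a bound on all nameable times.\<close>

lemma om1_bounded:
  fixes X :: "om1 set"
  assumes "countable X" shows "\<exists>b. \<forall>x\<in>X. x < b"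
proof (rule ccontr)
  assume "\<nexists>b. \<forall>x\<in>X. x < b"
  then have "UNIV = (\<Union>x\<in>X. {..x})" by (force simp: not_less)
  moreover have "countable (\<Union>x\<in>X. {..x})" using assms countable_atMost_om1 by blast
  ultimately show False using uncountable_om1 by simp
qed

definition ozero :: om1 where "ozero = (LEAST x. True)"
definition osuc :: "om1 \<Rightarrow> om1" where "osuc a = (LEAST b. a < b)"
definition olim :: "om1 \<Rightarrow> bool" where "olim t \<longleftrightarrow> t \<noteq> ozero \<and> (\<forall>s. t \<noteq> osuc s)"

lemma ozero_le [simp]: "ozero \<le> a" by (simp add: ozero_def Least_le)

lemma not_less_ozero [simp]: "\<not> a < ozero" by (simp add: not_less)

lemma less_osuc [simp]: "a < osuc a"
  unfolding osuc_def using om1_bounded[of "{a}"] LeastI_ex[of "\<lambda>b. a < b"] by auto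

lemma less_osuc_iff: "a < osuc b \<longleftrightarrow> a \<le> b"
proof
  assume "a < osuc b"
  then show "a \<le> b" unfolding osuc_def using not_less_Least by force
qed (use less_osuc[of b] in order)

lemma osuc_le_iff: "osuc a \<le> b \<longleftrightarrow> a < b"
  by (metis less_osuc_iff not_le)

lemma osuc_inject [simp]: "osuc a = osuc b \<longleftrightarrow> a = b"
  by (metis less_osuc less_osuc_iff antisym)

lemma osuc_neq_ozero [simp]: "osuc a \<noteq> ozero" "ozero \<noteq> osuc a"
  using less_osuc[of a] not_less_ozero by metis+

lemma om1_cases: obtains "t = ozero" | s where "t = osuc s" | "olim t"
  by (auto simp: olim_def)

lemma olim_osuc: "olim t \<Longrightarrow> s < t \<Longrightarrow> osuc s < t"
  by (metis olim_def order_le_less osuc_le_iff)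

lemma olim_pos: "olim t \<Longrightarrow> ozero < t"
  by (auto simp: olim_def order_less_le)

text \<open>The least strict upper bound is a limit because the sequence increases strictly.
  Constructions in countably many stages end at such limits.\<close>

lemma ex_limit_seq:
  fixes a :: "nat \<Rightarrow> om1"
  assumes "\<And>k. a k < a (Suc k)"
  shows "\<exists>t. olim t \<and> (\<forall>k. a k < t) \<and> (\<forall>s<t. \<exists>k. s < a k)"
proof -
  have "\<exists>b. \<forall>k. a k < b" using om1_bounded[of "range a"] by auto
  define t where "t = (LEAST b. \<forall>k. a k < b)"
  have t: "\<forall>k. a k < t" unfolding t_def by (rule LeastI_ex) fact
  have t': "\<exists>k. s < a k" if "s < t" for s
  proof -
    have "\<not> (\<forall>k. a k < s)" using that not_less_Least unfolding t_def by blast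
    then obtain k where "s \<le> a k" by (auto simp: not_less)
    then show ?thesis using assms[of k] by (metis order_le_less_trans)
  qed
  have "t \<noteq> osuc s" for s
  proof
    assume "t = osuc s"
    then obtain k where "s < a k" using t'[of s] by auto
    then show False using t \<open>t = osuc s\<close> by (metis less_osuc_iff not_le)
  qed
  moreover have "t \<noteq> ozero" using t by (metis not_less_ozero)
  ultimately show ?thesis using t t' by (auto simp: olim_def)
qed

subsection \<open>Limit inferior\<close>

definition linf :: "om1 \<Rightarrow> (om1 \<Rightarrow> nat) \<Rightarrow> enat" where
  "linf t f = (SUP s\<in>{..<t}. INF u\<in>{s..<t}. enat (f u))"

definition lm :: "om1 \<Rightarrow> (om1 \<Rightarrow> nat) \<Rightarrow> nat" where
  "lm t f = reset_if_infinite (linf t f)"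

text \<open>From here on thresholds replace nested suprema and infima; by \<open>enat_eqI\<close> an
  extended number is determined by the naturals below it.\<close>

lemma le_linf_iff:
  assumes "olim t"
  shows "enat v \<le> linf t f \<longleftrightarrow> (\<exists>s<t. \<forall>u. s \<le> u \<longrightarrow> u < t \<longrightarrow> v \<le> f u)"
proof
  assume *: "enat v \<le> linf t f"
  show "\<exists>s<t. \<forall>u. s \<le> u \<longrightarrow> u < t \<longrightarrow> v \<le> f u"
  proof (rule ccontr)
    assume no: "\<not> ?thesis"
    \<comment> \<open>For \<open>v = 0\<close> every tail is a witness; so \<open>v - 1\<close>
      below is a genuine predecessor.\<close>
    then have v: "v > 0" using olim_pos[OF assms] by (metis gr0I zero_le)
    have "(INF u\<in>{s..<t}. enat (f u)) \<le> enat (v - 1)" if "s < t" for s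
    proof -
      obtain u where "s \<le> u" "u < t" "f u < v" using no \<open>s < t\<close> by (auto simp: not_le)
      then show ?thesis by (intro INF_lower2[of u]) auto
    qed
    then have "linf t f \<le> enat (v - 1)" unfolding linf_def by (intro SUP_least) auto
    then have "enat v \<le> enat (v - 1)" using * order_trans by blast
    then show False using v by simp
  qed
next
  assume "\<exists>s<t. \<forall>u. s \<le> u \<longrightarrow> u < t \<longrightarrow> v \<le> f u"
  then obtain s where "s < t" "\<forall>u. s \<le> u \<longrightarrow> u < t \<longrightarrow> v \<le> f u" by blast
  then show "enat v \<le> linf t f"
    unfolding linf_def by (intro SUP_upper2[of s] INF_greatest) auto
qed

lemma linf_cong: "(\<And>u. u < t \<Longrightarrow> f u = g u) \<Longrightarrow> linf t f = linf t g"
  unfolding linf_def by (intro SUP_cong INF_cong) auto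

lemma lm_cong: "(\<And>u. u < t \<Longrightarrow> f u = g u) \<Longrightarrow> lm t f = lm t g"
  unfolding lm_def using linf_cong[of t f g] by simp

lemma lm_eqI:
  assumes "olim t" "s < t" "\<And>u. s \<le> u \<Longrightarrow> u < t \<Longrightarrow> c \<le> f u"
    and "\<And>s. s < t \<Longrightarrow> \<exists>u. s \<le> u \<and> u < t \<and> f u = c"
  shows "linf t f = enat c" "lm t f = c"
proof -
  have "enat c \<le> linf t f" using assms(2,3) by (auto simp: le_linf_iff[OF assms(1)])
  moreover have "\<not> enat (Suc c) \<le> linf t f"
    unfolding le_linf_iff[OF assms(1)] using assms(4) by fastforce
  ultimately show "linf t f = enat c" by (cases "linf t f") auto
  then show "lm t f = c" by (simp add: lm_def)
qed

lemma lm_const: "olim t \<Longrightarrow> s < t \<Longrightarrow> (\<And>u. s \<le> u \<Longrightarrow> u < t \<Longrightarrow> f u = c) \<Longrightarrow> lm t f = c"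
  by (rule lm_eqI(2)[of t s]) (auto, metis max.cobounded1 max.cobounded2 max_less_iff_conj)

lemma le_lm:
  assumes "olim t" "c \<le> lm t f" shows "\<exists>s<t. \<forall>u. s \<le> u \<longrightarrow> u < t \<longrightarrow> c \<le> f u"
proof -
  \<comment> \<open>Overflow resets the component to 0, and then only the trivial bound is
    possible.\<close>
  have "enat c \<le> linf t f \<or> c = 0"
    using assms(2) by (cases "linf t f") (auto simp: lm_def)
  then show ?thesis using le_linf_iff[OF assms(1)] olim_pos[OF assms(1)] by auto
qed

lemma linf_cofinal:
  assumes "olim t" "linf t f = enat w" "s < t" shows "\<exists>u. s \<le> u \<and> u < t \<and> f u = w"
proof -
  have "\<not> enat (Suc w) \<le> linf t f" "enat w \<le> linf t f" using assms(2) by auto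
  then obtain s0 where s0: "s0 < t" "\<forall>u. s0 \<le> u \<longrightarrow> u < t \<longrightarrow> w \<le> f u"
    and no: "\<not> (\<exists>s<t. \<forall>u. s \<le> u \<longrightarrow> u < t \<longrightarrow> Suc w \<le> f u)"
    unfolding le_linf_iff[OF assms(1)] by blast
  have "max s s0 < t" using s0 assms(3) by simp
  then obtain u where "max s s0 \<le> u" "u < t" "\<not> Suc w \<le> f u" using no by blast
  then show ?thesis using s0(2) by (intro exI[of _ u]) force
qed

lemma linf_infinite:
  assumes "olim t" "linf t f = \<infinity>" shows "\<exists>s<t. \<forall>u. s \<le> u \<longrightarrow> u < t \<longrightarrow> v \<le> f u"
  using le_linf_iff[OF assms(1), of v f] assms(2) by simp

lemma lm_cases:
  assumes "olim t"
  obtains (fin) w s where "linf t f = enat w" "lm t f = w" "s < t"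
      "\<And>u. s \<le> u \<Longrightarrow> u < t \<Longrightarrow> w \<le> f u" "\<And>s. s < t \<Longrightarrow> \<exists>u. s \<le> u \<and> u < t \<and> f u = w"
  | (inf) "linf t f = \<infinity>" "lm t f = 0" "\<And>v. \<exists>s<t. \<forall>u. s \<le> u \<longrightarrow> u < t \<longrightarrow> v \<le> f u"
proof (cases "linf t f")
  case (enat w)
  have "\<exists>s<t. \<forall>u. s \<le> u \<longrightarrow> u < t \<longrightarrow> w \<le> f u"
    using le_linf_iff[OF assms, of w f] enat by simp
  then obtain s where "s < t" "\<And>u. s \<le> u \<Longrightarrow> u < t \<Longrightarrow> w \<le> f u" by blast
  then show thesis using fin enat linf_cofinal[OF assms enat] by (auto simp: lm_def)
next
  case infinity
  then show thesis using inf linf_infinite[OF assms infinity] by (auto simp: lm_def)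
qed

section \<open>Transfinite runs\<close>

type_synonym vec = "nat \<Rightarrow> nat"

text \<open>All machines are treated as maps on vectors of naturals, iterated through the countable
  ordinals with the same limit rule for every component.\<close>

definition run :: "(vec \<Rightarrow> vec) \<Rightarrow> vec \<Rightarrow> om1 \<Rightarrow> vec" where
  "run F v = wfrec {(a, b). a < b} (\<lambda>f t. if t = ozero then v
     else if \<exists>s. t = osuc s then F (f (THE s. t = osuc s))
     else (\<lambda>i. lm t (\<lambda>u. f u i)))"

lemma run_unfold: "run F v t = (if t = ozero then v
     else if \<exists>s. t = osuc s then F (run F v (THE s. t = osuc s))
     else (\<lambda>i. lm t (\<lambda>u. run F v u i)))"
proof -
  have lmc: "lm t (\<lambda>u. cut (run F v) {(a, b). a < b} t u i) = lm t (\<lambda>u. run F v u i)" for i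
    by (rule lm_cong) (simp add: cut_def)
  show ?thesis
    unfolding def_wfrec[OF run_def[THEN eq_reflection] wf, of F v t] lmc
    by (auto simp: cut_def)
qed

lemma run_ozero [simp]: "run F v ozero = v" by (subst run_unfold) simp

lemma run_osuc [simp]: "run F v (osuc t) = F (run F v t)" by (subst run_unfold) simp

lemma run_olim: "olim t \<Longrightarrow> run F v t i = lm t (\<lambda>u. run F v u i)"
  by (subst run_unfold) (auto simp: olim_def)

lemma om1_induct [case_names zero suc lim]:
  assumes "P ozero" "\<And>t. P t \<Longrightarrow> P (osuc t)" "\<And>t. olim t \<Longrightarrow> (\<And>s. s < t \<Longrightarrow> P s) \<Longrightarrow> P t"
  shows "P t"
proof (induction t rule: less_induct)
  case (less t)
  then show ?case using assms by (cases t rule: om1_cases) auto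
qed

lemma run_fixed:
  assumes "F (run F v t) = run F v t" "t \<le> u" shows "run F v u = run F v t"
  using assms(2)
proof (induction u rule: om1_induct)
  case zero
  then show ?case by (metis antisym ozero_le)
next
  case (suc u)
  then show ?case using assms(1) by (metis less_osuc_iff order_le_less run_osuc)
next
  case (lim u)
  then consider "t = u" | "t < u" by force
  then show ?case
  proof cases
    case 2
    have "run F v u i = run F v t i" for i
      unfolding run_olim[OF lim(1)]
    proof (rule lm_const[OF lim(1) 2])
      fix w assume "t \<le> w" "w < u"
      then show "run F v w i = run F v t i" using lim(2)[of w] by metis
    qed
    then show ?thesis by blast
  qed simp
qed

subsection \<open>Big steps\<close>

text \<open>In \<open>seg F ok v m v'\<close> the vector \<open>m\<close> is the componentwise infimum of the states visited from
  \<open>v\<close> (inclusive) to \<open>v'\<close> (exclusive); it is what the limit rule needs to know about a segment.\<close>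

inductive seg :: "(vec \<Rightarrow> vec) \<Rightarrow> (vec \<Rightarrow> bool) \<Rightarrow> vec \<Rightarrow> vec \<Rightarrow> vec \<Rightarrow> bool" for F ok where
  seg_step: "ok v \<Longrightarrow> seg F ok v v (F v)"
| seg_trans: "seg F ok u m v \<Longrightarrow> seg F ok v m' w \<Longrightarrow> seg F ok u (\<lambda>i. min (m i) (m' i)) w"
| seg_lim: "(\<And>k::nat. seg F ok (c k) (m k) (c (Suc k))) \<Longrightarrow>
    seg F ok (c 0) (\<lambda>i. INF k. m k i) (\<lambda>i. reset_if_infinite (SUP k. INF j\<in>{k..}. enat (m j i)))"

lemma seq_SUP_INF_le_iff:
  fixes f :: "nat \<Rightarrow> nat"
  shows "enat v \<le> (SUP k. INF j\<in>{k..}. enat (f j)) \<longleftrightarrow> (\<exists>k. \<forall>j\<ge>k. v \<le> f j)"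
proof
  assume *: "enat v \<le> (SUP k. INF j\<in>{k..}. enat (f j))"
  show "\<exists>k. \<forall>j\<ge>k. v \<le> f j"
  proof (rule ccontr)
    assume no: "\<not> ?thesis"
    then have v: "v > 0" by (metis gr0I zero_le)
    have "(INF j\<in>{k..}. enat (f j)) \<le> enat (v - 1)" for k
    proof -
      obtain j where "k \<le> j" "f j < v" using no by (auto simp: not_le)
      then show ?thesis by (intro INF_lower2[of j]) auto
    qed
    then have "(SUP k. INF j\<in>{k..}. enat (f j)) \<le> enat (v - 1)" by (intro SUP_least) auto
    then have "enat v \<le> enat (v - 1)" using * order_trans by blast
    then show False using v by simp
  qed
next
  assume "\<exists>k. \<forall>j\<ge>k. v \<le> f j"
  then obtain k where "\<forall>j\<ge>k. v \<le> f j" by blast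
  then show "enat v \<le> (SUP k. INF j\<in>{k..}. enat (f j))"
    by (intro SUP_upper2[of k] INF_greatest) auto
qed

lemma enat_eqI: "(\<And>v. enat v \<le> a \<longleftrightarrow> enat v \<le> b) \<Longrightarrow> a = b"
proof (rule antisym)
  assume *: "\<And>v. enat v \<le> a \<longleftrightarrow> enat v \<le> b"
  have "x \<le> y" if "\<And>v. enat v \<le> x \<Longrightarrow> enat v \<le> y" for x y
    using that by (cases x; cases y) (auto, metis Suc_n_not_le_n)
  then show "a \<le> b" "b \<le> a" using * by blast+
qed

definition is_inf :: "(om1 \<Rightarrow> vec) \<Rightarrow> om1 \<Rightarrow> om1 \<Rightarrow> vec \<Rightarrow> bool" where
  "is_inf C s t m \<longleftrightarrow> (\<forall>i. (\<forall>u. s \<le> u \<longrightarrow> u < t \<longrightarrow> m i \<le> C u i) \<and> (\<exists>u. s \<le> u \<and> u < t \<and> C u i = m i))"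

lemma nat_INF_le: "(INF k. f k) \<le> (f k :: nat)" for k :: nat
  by (rule cINF_lower) auto

lemma nat_INF_attained: "\<exists>k::nat. (f k :: nat) = (INF k. f k)"
proof -
  have "Inf (range f) \<in> range f" by (rule Inf_nat_def1) simp
  then show ?thesis by (metis imageE)
qed

text \<open>A derivation of \<open>seg\<close> mentions no times, so it can be replayed from any
  time at which its start state occurs. At a limit the replayed pieces yield a cofinal sequence of
  times, and the limit inferior over all times is that of the infima of the pieces.\<close>

lemma seg_run:
  assumes "seg F ok v m v'" "run F v0 t = v"
  shows "\<exists>t'>t. run F v0 t' = v' \<and> (\<forall>u. t \<le> u \<longrightarrow> u < t' \<longrightarrow> ok (run F v0 u)) \<and>
    is_inf (run F v0) t t' m"
  using assms
proof (induction arbitrary: t)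
  case (seg_step v)
  then show ?case
    unfolding is_inf_def by (intro exI[of _ "osuc t"]) (metis less_osuc less_osuc_iff antisym order_refl run_osuc)
next
  case (seg_trans u m v m' w)
  obtain t1 where 1: "t < t1" "run F v0 t1 = v" "\<forall>u. t \<le> u \<longrightarrow> u < t1 \<longrightarrow> ok (run F v0 u)"
      "is_inf (run F v0) t t1 m"
    using seg_trans.IH(1) seg_trans.prems by blast
  obtain t2 where 2: "t1 < t2" "run F v0 t2 = w" "\<forall>u. t1 \<le> u \<longrightarrow> u < t2 \<longrightarrow> ok (run F v0 u)"
      "is_inf (run F v0) t1 t2 m'"
    using seg_trans.IH(2)[OF 1(2)] by blast
  have "is_inf (run F v0) t t2 (\<lambda>i. min (m i) (m' i))"
    unfolding is_inf_def
  proof (intro allI conjI impI)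
    fix i u assume "t \<le> u" "u < t2"
    then show "min (m i) (m' i) \<le> run F v0 u i"
      using 1(4) 2(4) unfolding is_inf_def by (meson min.coboundedI1 min.coboundedI2 not_le)
  next
    fix i
    obtain u1 u2 where u: "t \<le> u1" "u1 < t1" "run F v0 u1 i = m i"
      "t1 \<le> u2" "u2 < t2" "run F v0 u2 i = m' i"
      using 1(4) 2(4) unfolding is_inf_def by meson
    show "\<exists>u\<ge>t. u < t2 \<and> run F v0 u i = min (m i) (m' i)"
    proof (cases "m i \<le> m' i")
      case True
      have "u1 < t2" using u(2) 2(1) by order
      then show ?thesis using u(1,3) True by (intro exI[of _ u1]) (simp add: min_def)
    next
      case False
      have "t \<le> u2" using u(4) 1(1) by order
      then show ?thesis using u(5,6) False by (intro exI[of _ u2]) (simp add: min_def)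
    qed
  qed
  moreover have "\<forall>u. t \<le> u \<longrightarrow> u < t2 \<longrightarrow> ok (run F v0 u)" using 1(3) 2(3) by (meson not_le)
  moreover have "t < t2" using 1 2 by order
  ultimately show ?case using 2 by blast
next
  case (seg_lim c m)
  have "\<exists>a. a 0 = t \<and> (\<forall>k. run F v0 (a k) = c k \<and> a k < a (Suc k) \<and>
      (\<forall>u. a k \<le> u \<longrightarrow> u < a (Suc k) \<longrightarrow> ok (run F v0 u)) \<and> is_inf (run F v0) (a k) (a (Suc k)) (m k))"
  proof -
    have "\<exists>a. \<forall>k. (run F v0 (a k) = c k \<and> (k = 0 \<longrightarrow> a k = t)) \<and> (a k < a (Suc k) \<and>
      (\<forall>u. a k \<le> u \<longrightarrow> u < a (Suc k) \<longrightarrow> ok (run F v0 u)) \<and> is_inf (run F v0) (a k) (a (Suc k)) (m k))"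
    proof (rule dependent_nat_choice)
      show "\<exists>x. run F v0 x = c 0 \<and> ((0::nat) = 0 \<longrightarrow> x = t)" using seg_lim.prems by simp
    next
      fix x :: om1 and n :: nat assume "run F v0 x = c n \<and> (n = 0 \<longrightarrow> x = t)"
      then show "\<exists>y. (run F v0 y = c (Suc n) \<and> (Suc n = 0 \<longrightarrow> y = t)) \<and> x < y \<and>
        (\<forall>u. x \<le> u \<longrightarrow> u < y \<longrightarrow> ok (run F v0 u)) \<and> is_inf (run F v0) x y (m n)"
        using seg_lim.IH[of x n] by auto
    qed
    then show ?thesis by blast
  qed
  then obtain a where a: "a 0 = t" "\<And>k. run F v0 (a k) = c k" "\<And>k. a k < a (Suc k)"
      "\<And>k u. a k \<le> u \<Longrightarrow> u < a (Suc k) \<Longrightarrow> ok (run F v0 u)"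
      "\<And>k. is_inf (run F v0) (a k) (a (Suc k)) (m k)" by blast
  obtain t' where t': "olim t'" "\<And>k. a k < t'" "\<And>s. s < t' \<Longrightarrow> \<exists>k. s < a k"
    using ex_limit_seq[of a] a(3) by blast
  have mono: "a j \<le> a k" if "j \<le> k" for j k
    using lift_Suc_mono_le[of a, OF _ that] a(3) by (simp add: less_imp_le)
  have between: "\<exists>k\<ge>j. a k \<le> u \<and> u < a (Suc k)" if u: "a j \<le> u" "u < t'" for u j
  proof -
    obtain K where K: "u < a K" using t'(3)[OF u(2)] by blast
    define k where "k = (LEAST k. u < a k)"
    have k: "u < a k" unfolding k_def using K by (rule LeastI)
    then have "k \<noteq> 0" "j < k" using u(1) mono[of k j] mono[of 0 j] by (force simp: not_le)+
    then obtain k' where k': "k = Suc k'" by (cases k) auto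
    have "\<not> u < a k'" using not_less_Least[of k' "\<lambda>k. u < a k"] unfolding k_def[symmetric] k' by simp
    then show ?thesis using k k' \<open>j < k\<close> by (intro exI[of _ k']) auto
  qed
  have lim: "run F v0 t' i = reset_if_infinite (SUP k. INF j\<in>{k..}. enat (m j i))" for i
  proof -
    have "linf t' (\<lambda>u. run F v0 u i) = (SUP k. INF j\<in>{k..}. enat (m j i))"
    proof (rule enat_eqI)
      fix v
      have "(\<exists>s<t'. \<forall>u. s \<le> u \<longrightarrow> u < t' \<longrightarrow> v \<le> run F v0 u i) \<longleftrightarrow> (\<exists>k. \<forall>j\<ge>k. v \<le> m j i)"
      proof
        assume "\<exists>s<t'. \<forall>u. s \<le> u \<longrightarrow> u < t' \<longrightarrow> v \<le> run F v0 u i"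
        then obtain s where s: "s < t'" "\<forall>u. s \<le> u \<longrightarrow> u < t' \<longrightarrow> v \<le> run F v0 u i" by blast
        obtain k where k: "s < a k" using t'(3)[OF s(1)] by blast
        have "v \<le> m j i" if "j \<ge> k" for j
        proof -
          obtain u where u: "a j \<le> u" "u < a (Suc j)" "run F v0 u i = m j i"
            using a(5)[of j] unfolding is_inf_def by blast
          have "s \<le> u" "u < t'" using k mono[OF that] u t'(2)[of "Suc j"] by order+
          then show ?thesis using s(2) u(3) by auto
        qed
        then show "\<exists>k. \<forall>j\<ge>k. v \<le> m j i" by blast
      next
        assume "\<exists>k. \<forall>j\<ge>k. v \<le> m j i"
        then obtain k where k: "\<forall>j\<ge>k. v \<le> m j i" by blast
        have "v \<le> run F v0 u i" if "a k \<le> u" "u < t'" for u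
          using between[OF that] k a(5) unfolding is_inf_def by (meson le_trans)
        then show "\<exists>s<t'. \<forall>u. s \<le> u \<longrightarrow> u < t' \<longrightarrow> v \<le> run F v0 u i" using t'(2) by blast
      qed
      then show "enat v \<le> linf t' (\<lambda>u. run F v0 u i) \<longleftrightarrow> enat v \<le> (SUP k. INF j\<in>{k..}. enat (m j i))"
        unfolding le_linf_iff[OF t'(1)] seq_SUP_INF_le_iff .
    qed
    then show ?thesis by (simp add: run_olim[OF t'(1)] lm_def)
  qed
  have "is_inf (run F v0) t t' (\<lambda>i. INF k. m k i)"
    unfolding is_inf_def
  proof (intro allI conjI impI)
    fix i u assume "t \<le> u" "u < t'"
    then obtain k where "a k \<le> u" "u < a (Suc k)" using between[of 0 u] a(1) by auto
    then have "m k i \<le> run F v0 u i" using a(5)[of k] by (auto simp: is_inf_def)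
    then show "(INF k. m k i) \<le> run F v0 u i" using nat_INF_le[of "\<lambda>k. m k i" k] by simp
  next
    fix i
    obtain k where k: "m k i = (INF k. m k i)" using nat_INF_attained[of "\<lambda>k. m k i"] by blast
    obtain u where "a k \<le> u" "u < a (Suc k)" "run F v0 u i = m k i"
      using a(5)[of k] unfolding is_inf_def by meson
    moreover have "t \<le> a k" using mono[of 0 k] a(1) by simp
    ultimately show "\<exists>u\<ge>t. u < t' \<and> run F v0 u i = (INF k. m k i)"
      using k t'(2)[of "Suc k"] by (intro exI[of _ u]) force
  qed
  moreover have "t < t'" using a(1) t'(2) by metis
  moreover have "\<forall>u. t \<le> u \<longrightarrow> u < t' \<longrightarrow> ok (run F v0 u)" using between[of 0] a(1,4) by blast
  ultimately show ?case using lim by (intro exI[of _ t']) auto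
qed

subsection \<open>Runs along arbitrary well-orders\<close>

lemma le_liminf_below_iff:
  assumes "underS r t \<noteq> {}"
  shows "enat v \<le> liminf_below r t f \<longleftrightarrow> (\<exists>s\<in>underS r t. \<forall>u\<in>underS r t. (s, u) \<in> r \<longrightarrow> v \<le> f u)"
proof
  assume *: "enat v \<le> liminf_below r t f"
  show "\<exists>s\<in>underS r t. \<forall>u\<in>underS r t. (s, u) \<in> r \<longrightarrow> v \<le> f u"
  proof (rule ccontr)
    assume no: "\<not> ?thesis"
    then have v: "v > 0" using assms by (metis all_not_in_conv gr0I zero_le)
    have "(INF u\<in>{u \<in> underS r t. (s, u) \<in> r}. enat (f u)) \<le> enat (v - 1)" if s: "s \<in> underS r t" for s
    proof -
      obtain u where "u \<in> underS r t" "(s, u) \<in> r" "f u < v" using no s by (auto simp: not_le)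
      then show ?thesis by (intro INF_lower2[of u]) auto
    qed
    then have "liminf_below r t f \<le> enat (v - 1)" unfolding liminf_below_def by (intro SUP_least) auto
    then have "enat v \<le> enat (v - 1)" using * order_trans by blast
    then show False using v by simp
  qed
next
  assume "\<exists>s\<in>underS r t. \<forall>u\<in>underS r t. (s, u) \<in> r \<longrightarrow> v \<le> f u"
  then obtain s where "s \<in> underS r t" "\<forall>u\<in>underS r t. (s, u) \<in> r \<longrightarrow> v \<le> f u" by blast
  then show "enat v \<le> liminf_below r t f"
    unfolding liminf_below_def by (intro SUP_upper2[of s] INF_greatest) auto
qed

text \<open>The converse of \<open>seg_run\<close>, for all well-orders with countable initial
  segments: a limit then has cofinality \<omega>, so the part from \<open>s\<close> up to it splits
  into \<omega> many shorter parts covered by induction.\<close>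

lemma seg_complete:
  fixes r :: "'o rel" and D :: "'o \<Rightarrow> vec"
  assumes wo: "Well_order r" and cnt: "\<And>t. countable (underS r t)"
    and suc: "\<And>s t. is_succ r s t \<Longrightarrow> D t = F (D s)"
    and lim: "\<And>t. is_limit r t \<Longrightarrow> D t = (\<lambda>i. reset_if_infinite (liminf_below r t (\<lambda>u. D u i)))"
    and "s \<in> underS r t" "\<And>u. u \<in> underS r t \<Longrightarrow> (s, u) \<in> r \<Longrightarrow> ok (D u)"
  shows "\<exists>m. seg F ok (D s) m (D t) \<and>
    (\<forall>i. (\<forall>u\<in>underS r t. (s, u) \<in> r \<longrightarrow> m i \<le> D u i) \<and> (\<exists>u\<in>underS r t. (s, u) \<in> r \<and> D u i = m i))"
proof -
  interpret wo_rel r using wo by (simp add: wo_rel_def)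
  have tr: "(a, b) \<in> r \<Longrightarrow> (b, c) \<in> r \<Longrightarrow> (a, c) \<in> r" for a b c using TRANS by (meson transD)
  have as: "(a, b) \<in> r \<Longrightarrow> (b, a) \<in> r \<Longrightarrow> a = b" for a b using ANTISYM by (meson antisymD)
  have tot: "(a, b) \<in> r \<or> (b, a) \<in> r" if "a \<in> Field r" "b \<in> Field r" for a b
    using TOTALS that by blast
  have rf: "(a, a) \<in> r" if "a \<in> Field r" for a using REFL that by (auto simp: refl_on_def)
  have uF: "a \<in> Field r" "b \<in> Field r" if "a \<in> underS b" for a b
    using that by (auto simp: underS_def Field_def)
  have uu: "a \<in> underS b \<longleftrightarrow> (a, b) \<in> r \<and> a \<noteq> b" for a b by (auto simp: underS_def)
  have wf: "wf (r - Id)" using WF .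
  show ?thesis using assms(5,6)
  proof (induction t arbitrary: s rule: wf_induct_rule[OF wf])
    case (1 t)
    note IHt = 1(1) and st = 1(2) and okt = 1(3)
    have IH: "\<exists>m. seg F ok (D s) m (D t') \<and>
      (\<forall>i. (\<forall>u\<in>underS t'. (s, u) \<in> r \<longrightarrow> m i \<le> D u i) \<and> (\<exists>u\<in>underS t'. (s, u) \<in> r \<and> D u i = m i))"
      if "t' \<in> underS t" "s \<in> underS t'" "\<And>u. u \<in> underS t' \<Longrightarrow> (s, u) \<in> r \<Longrightarrow> ok (D u)" for s t'
      using IHt[of t' s] that by (auto simp: uu)
    have tF: "t \<in> Field r" using uF st by blast
    consider p where "is_succ r p t" | "is_limit r t"
      using zero_succ_limit[OF tF] st by (auto simp: is_first_def)
    then show ?case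
    proof cases
      case 1
      note p = this
      have pu: "underS t = under p" "p \<in> Field r" using p by (auto simp: is_succ_def)
      have pt: "p \<in> underS t" using is_succ_in_underS[OF wo p] .
      have okp: "ok (D p)" using okt[OF pt] st pu by (auto simp: under_def)
      have sg: "seg F ok (D p) (D p) (D t)" using seg_step[of ok "D p" F] okp suc[OF p] by simp
      show ?thesis
      proof (cases "s = p")
        case True
        have "u = p" if "u \<in> underS t" "(p, u) \<in> r" for u using that pu as by (auto simp: under_def)
        then show ?thesis using True sg pt rf[OF pu(2)] by (intro exI[of _ "D p"]) auto
      next
        case False
        then have sp: "s \<in> underS p" using st pu by (auto simp: under_def uu)
        have sub: "underS p \<subseteq> underS t" using pu by (auto simp: under_def uu)
        obtain m where m: "seg F ok (D s) m (D p)"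
          "\<forall>i. (\<forall>u\<in>underS p. (s, u) \<in> r \<longrightarrow> m i \<le> D u i) \<and> (\<exists>u\<in>underS p. (s, u) \<in> r \<and> D u i = m i)"
          using IH[OF pt sp] okt sub by blast
        have ut: "u \<in> underS p \<or> u = p" if "u \<in> underS t" for u
          using that pu by (auto simp: under_def uu)
        have "(\<forall>u\<in>underS t. (s, u) \<in> r \<longrightarrow> min (m i) (D p i) \<le> D u i) \<and>
          (\<exists>u\<in>underS t. (s, u) \<in> r \<and> D u i = min (m i) (D p i))" for i
        proof
          show "\<forall>u\<in>underS t. (s, u) \<in> r \<longrightarrow> min (m i) (D p i) \<le> D u i"
            using m(2) ut by (metis min.cobounded2 min.coboundedI1)
          show "\<exists>u\<in>underS t. (s, u) \<in> r \<and> D u i = min (m i) (D p i)"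
          proof (cases "m i \<le> D p i")
            case True
            then show ?thesis using m(2) sub by (metis min.absorb1 subsetD)
          next
            case False
            then show ?thesis using pt sp by (intro bexI[of _ p]) (auto simp: uu)
          qed
        qed
        then show ?thesis using seg_trans[OF m(1) sg] by blast
      qed
    next
      case 2
      have step: "\<exists>b\<in>underS t. a \<in> underS b \<and> (e, b) \<in> r" if ae: "a \<in> underS t" "e \<in> underS t" for a e
      proof -
        define x where "x = (if (a, e) \<in> r then e else a)"
        have "a \<in> Field r" "e \<in> Field r" using uF(1) ae by blast+
        then have x: "x \<in> underS t" "(a, x) \<in> r" "(e, x) \<in> r"
          using ae tot[of a e] rf[of e] rf[of a] by (auto simp: x_def)
        obtain b where b: "is_succ r x b" "(b, t) \<in> r" using ex_succ[OF wo x(1)] by blast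
        have "b \<noteq> t" using b(1) 2 by (auto simp: is_limit_def)
        then have "b \<in> underS t" using b(2) by (auto simp: uu)
        moreover have "x \<in> underS b" using is_succ_in_underS[OF wo b(1)] .
        moreover from this have "(x, b) \<in> r" "x \<noteq> b" by (auto simp: uu)
        moreover from this have "(a, b) \<in> r" "(e, b) \<in> r" "a \<noteq> b" using x tr as by blast+
        ultimately show ?thesis by (auto simp: uu)
      qed
      \<comment> \<open>Overtaking every term of this enumeration makes the sequence
        \<open>a\<close> below cofinal in \<open>t\<close>.\<close>
      define e where "e = from_nat_into (underS t)"
      have ne: "underS t \<noteq> {}" using st by auto
      have e: "range e = underS t" unfolding e_def using range_from_nat_into[OF ne cnt] .
      have "\<exists>a. \<forall>k. (a k \<in> underS t \<and> (k = 0 \<longrightarrow> a k = s)) \<and>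
        (a k \<in> underS (a (Suc k)) \<and> (e k, a (Suc k)) \<in> r)"
      proof (rule dependent_nat_choice)
        show "\<exists>x. x \<in> underS t \<and> ((0::nat) = 0 \<longrightarrow> x = s)" using st by simp
      next
        fix x and n :: nat assume x: "x \<in> underS t \<and> (n = 0 \<longrightarrow> x = s)"
        have "e n \<in> underS t" using e by auto
        then show "\<exists>y. (y \<in> underS t \<and> (Suc n = 0 \<longrightarrow> y = s)) \<and> x \<in> underS y \<and> (e n, y) \<in> r"
          using step[of x "e n"] x by auto
      qed
      then obtain a where a: "a 0 = s" "\<And>k. a k \<in> underS t" "\<And>k. a k \<in> underS (a (Suc k))"
        "\<And>k. (e k, a (Suc k)) \<in> r" by blast
      have mono: "(a j, a k) \<in> r" if "j \<le> k" for j k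
        using that
      proof (induction k)
        case (Suc k)
        then show ?case using a(3)[of k] tr rf uF(1)[OF a(2)] by (metis le_Suc_eq uu)
      qed (use rf uF(1)[OF a(2)] in auto)
      have cof: "\<exists>k. u \<in> underS (a k)" if u: "u \<in> underS t" for u
      proof -
        obtain k where "u = e k" using u e by blast
        then have "(u, a (Suc k)) \<in> r" using a(4) by simp
        then show ?thesis using a(3)[of "Suc k"] tr as uu by metis
      qed
      have ok: "ok (D u)" if "u \<in> underS (a (Suc k))" "(a k, u) \<in> r" for u k
      proof -
        have "u \<in> underS t" using that(1) a(2)[of "Suc k"] tr as by (metis uu)
        moreover have "(s, u) \<in> r" using mono[of 0 k] a(1) that(2) tr by auto
        ultimately show ?thesis using okt by blast
      qed
      have "\<forall>k. \<exists>m. seg F ok (D (a k)) m (D (a (Suc k))) \<and>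
        (\<forall>i. (\<forall>u\<in>underS (a (Suc k)). (a k, u) \<in> r \<longrightarrow> m i \<le> D u i) \<and>
          (\<exists>u\<in>underS (a (Suc k)). (a k, u) \<in> r \<and> D u i = m i))"
        using IH[OF a(2) a(3)] ok by blast
      then obtain m where m: "\<And>k. seg F ok (D (a k)) (m k) (D (a (Suc k)))"
        "\<And>k i u. u\<in>underS (a (Suc k)) \<Longrightarrow> (a k, u) \<in> r \<Longrightarrow> m k i \<le> D u i"
        "\<And>k i. \<exists>u\<in>underS (a (Suc k)). (a k, u) \<in> r \<and> D u i = m k i"
        by metis
      have between: "\<exists>k\<ge>j. (a k, u) \<in> r \<and> u \<in> underS (a (Suc k))" if u: "(a j, u) \<in> r" "u \<in> underS t" for u j
      proof -
        obtain K where K: "u \<in> underS (a K)" using cof[OF u(2)] by blast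
        define k where "k = (LEAST k. u \<in> underS (a k))"
        have k: "u \<in> underS (a k)" unfolding k_def using K by (rule LeastI)
        have jk: "j < k"
        proof (rule ccontr)
          assume "\<not> j < k"
          then have "(a k, a j) \<in> r" using mono by simp
          then have "(a k, u) \<in> r" using u(1) tr by blast
          then show False using k as by (auto simp: uu)
        qed
        then obtain k' where k': "k = Suc k'" by (cases k) auto
        have "u \<notin> underS (a k')" using not_less_Least[of k' "\<lambda>k. u \<in> underS (a k)"] unfolding k_def[symmetric] k' by simp
        then have "(a k', u) \<in> r"
          using tot[of "a k'" u] uF(1)[OF a(2)[of k']] uF(1)[OF u(2)] rf uu by metis
        then show ?thesis using k k' jk by (intro exI[of _ k']) auto
      qed
      have inU: "u \<in> underS t" if "u \<in> underS (a k)" for u k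
        using that a(2)[of k] tr as by (metis uu)
      have "D t = (\<lambda>i. reset_if_infinite (SUP k. INF j\<in>{k..}. enat (m j i)))"
      proof -
        have "liminf_below r t (\<lambda>u. D u i) = (SUP k. INF j\<in>{k..}. enat (m j i))" for i
        proof (rule enat_eqI)
          fix v
          have "(\<exists>s\<in>underS t. \<forall>u\<in>underS t. (s, u) \<in> r \<longrightarrow> v \<le> D u i) \<longleftrightarrow> (\<exists>k. \<forall>j\<ge>k. v \<le> m j i)"
          proof
            assume "\<exists>s\<in>underS t. \<forall>u\<in>underS t. (s, u) \<in> r \<longrightarrow> v \<le> D u i"
            then obtain s where s: "s \<in> underS t" "\<And>u. u\<in>underS t \<Longrightarrow> (s, u) \<in> r \<Longrightarrow> v \<le> D u i" by blast
            obtain k where k: "s \<in> underS (a k)" using cof[OF s(1)] by blast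
            have "v \<le> m j i" if "j \<ge> k" for j
            proof -
              obtain u where u: "u\<in>underS (a (Suc j))" "(a j, u) \<in> r" "D u i = m j i"
                using m(3)[of j i] by blast
              have "(s, u) \<in> r" using k mono[OF that] u(2) tr by (metis uu)
              then show ?thesis using s(2)[of u] inU[OF u(1)] u(3) by simp
            qed
            then show "\<exists>k. \<forall>j\<ge>k. v \<le> m j i" by blast
          next
            assume "\<exists>k. \<forall>j\<ge>k. v \<le> m j i"
            then obtain k where k: "\<forall>j\<ge>k. v \<le> m j i" by blast
            have "v \<le> D u i" if "u \<in> underS t" "(a k, u) \<in> r" for u
              using between[OF that(2,1)] k m(2) by (meson le_trans)
            then show "\<exists>s\<in>underS t. \<forall>u\<in>underS t. (s, u) \<in> r \<longrightarrow> v \<le> D u i" using a(2) by blast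
          qed
          then show "enat v \<le> liminf_below r t (\<lambda>u. D u i) \<longleftrightarrow> enat v \<le> (SUP k. INF j\<in>{k..}. enat (m j i))"
            unfolding le_liminf_below_iff[OF ne] seq_SUP_INF_le_iff .
        qed
        then show ?thesis unfolding lim[OF 2] by simp
      qed
      then have sg: "seg F ok (D s) (\<lambda>i. INF k. m k i) (D t)"
        using seg_lim[of F ok "\<lambda>k. D (a k)" m, OF m(1)] a(1) by simp
      have "(\<forall>u\<in>underS t. (s, u) \<in> r \<longrightarrow> (INF k. m k i) \<le> D u i) \<and>
        (\<exists>u\<in>underS t. (s, u) \<in> r \<and> D u i = (INF k. m k i))" for i
      proof
        show "\<forall>u\<in>underS t. (s, u) \<in> r \<longrightarrow> (INF k. m k i) \<le> D u i"
        proof (intro ballI impI)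
          fix u assume u: "u \<in> underS t" "(s, u) \<in> r"
          then obtain k where "(a k, u) \<in> r" "u \<in> underS (a (Suc k))" using between[of 0 u] a(1) by auto
          then have "m k i \<le> D u i" using m(2) by blast
          then show "(INF k. m k i) \<le> D u i" using nat_INF_le[of "\<lambda>k. m k i" k] by simp
        qed
        obtain k where k: "m k i = (INF k. m k i)" using nat_INF_attained[of "\<lambda>k. m k i"] by blast
        obtain u where u: "u\<in>underS (a (Suc k))" "(a k, u) \<in> r" "D u i = m k i"
          using m(3)[of k i] by blast
        have "(s, u) \<in> r" using mono[of 0 k] a(1) u(2) tr by auto
        then show "\<exists>u\<in>underS t. (s, u) \<in> r \<and> D u i = (INF k. m k i)" using inU[OF u(1)] u(3) k by auto
      qed
      then show ?thesis using sg by blast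
    qed
  qed
qed

text \<open>Initial segments in the form that \<open>computation\<close> expects, so that a run on
  \<open>om1\<close> cut off at \<open>t\<close> becomes a computation.\<close>

definition om1_rel :: "om1 \<Rightarrow> om1 rel" where "om1_rel t = {(a, b). a \<le> b \<and> b \<le> t}"

lemma Field_om1_rel: "Field (om1_rel t) = {..t}"
  by (auto simp: om1_rel_def Field_def)

lemma Well_order_om1_rel: "Well_order (om1_rel t)"
proof -
  have "wf (om1_rel t - Id)" by (rule wf_subset[OF wf]) (auto simp: om1_rel_def)
  moreover have "Linear_order (om1_rel t)"
    unfolding linear_order_on_def partial_order_on_def preorder_on_def Field_om1_rel
    by (auto simp: refl_on_def trans_def antisym_def total_on_def om1_rel_def)
  ultimately show ?thesis by (simp add: well_order_on_def)
qed

lemma underS_om1_rel: "underS (om1_rel t) a = (if a \<le> t then {..<a} else {})"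
  by (auto simp: underS_def om1_rel_def)

lemma under_om1_rel: "under (om1_rel t) a = (if a \<le> t then {..a} else {})"
  by (auto simp: under_def om1_rel_def)

lemma is_first_om1_rel: "is_first (om1_rel t) a \<longleftrightarrow> a = ozero"
proof -
  have "{..<a} = {} \<longleftrightarrow> a = ozero" by (metis lessThan_iff empty_iff not_less_ozero ozero_le order_le_less ex_in_conv)
  then show ?thesis by (auto simp: is_first_def Field_om1_rel underS_om1_rel)
qed

lemma is_succ_om1_rel: "is_succ (om1_rel t) a b \<longleftrightarrow> b = osuc a \<and> b \<le> t"
proof -
  have "{..<b} = {..a} \<longleftrightarrow> b = osuc a"
  proof
    assume "{..<b} = {..a}"
    then have "a < b" "\<not> osuc a < b" by (metis atMost_iff lessThan_iff order_refl less_osuc not_le)+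
    then show "b = osuc a" using osuc_le_iff[of a b] by auto
  qed (auto simp: less_osuc_iff)
  moreover have "b = osuc a \<Longrightarrow> b \<le> t \<Longrightarrow> a \<le> t"
    by (metis less_osuc less_imp_le order_trans)
  ultimately show ?thesis
    unfolding is_succ_def Field_om1_rel underS_om1_rel under_om1_rel atMost_iff by presburger
qed

lemma is_limit_om1_rel: "is_limit (om1_rel t) a \<longleftrightarrow> olim a \<and> a \<le> t"
  by (auto simp: is_limit_def Field_om1_rel is_first_om1_rel is_succ_om1_rel olim_def)

lemma liminf_below_om1_rel:
  assumes "a \<le> t" shows "liminf_below (om1_rel t) a f = linf a f"
proof -
  have "{u \<in> {..<a}. (s, u) \<in> om1_rel t} = {s..<a}" for s
    using assms by (auto simp: om1_rel_def)
  then show ?thesis using assms by (simp add: liminf_below_def linf_def underS_om1_rel)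
qed

lemma run_seg:
  assumes "s < t" "\<And>u. s \<le> u \<Longrightarrow> u < t \<Longrightarrow> ok (run F v u)"
  shows "\<exists>m. seg F ok (run F v s) m (run F v t) \<and> is_inf (run F v) s t m"
proof -
  have "\<exists>m. seg F ok (run F v s) m (run F v t) \<and>
    (\<forall>i. (\<forall>u\<in>underS (om1_rel t) t. (s, u) \<in> om1_rel t \<longrightarrow> m i \<le> run F v u i) \<and>
      (\<exists>u\<in>underS (om1_rel t) t. (s, u) \<in> om1_rel t \<and> run F v u i = m i))"
  proof (rule seg_complete[OF Well_order_om1_rel])
    show "countable (underS (om1_rel t) x)" for x
      by (simp add: underS_om1_rel countable_lessThan_om1)
    show "run F v b = F (run F v a)" if "is_succ (om1_rel t) a b" for a b
      using that by (auto simp: is_succ_om1_rel)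
    show "run F v a = (\<lambda>i. reset_if_infinite (liminf_below (om1_rel t) a (\<lambda>u. run F v u i)))"
      if "is_limit (om1_rel t) a" for a
      using that by (auto simp: is_limit_om1_rel liminf_below_om1_rel run_olim lm_def)
    show "s \<in> underS (om1_rel t) t" using assms by (simp add: underS_om1_rel)
    show "ok (run F v u)" if "u \<in> underS (om1_rel t) t" "(s, u) \<in> om1_rel t" for u
      using that assms by (simp add: underS_om1_rel) (simp add: om1_rel_def)
  qed
  moreover have "u \<in> underS (om1_rel t) t \<and> (s, u) \<in> om1_rel t \<longleftrightarrow> s \<le> u \<and> u < t" for u
    by (simp add: underS_om1_rel) (auto simp: om1_rel_def)
  ultimately show ?thesis unfolding is_inf_def by (smt (verit, ccfv_SIG))
qed

text \<open>The start state is itself among the visited ones.\<close>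

lemma seg_le_start: "seg F ok v m v' \<Longrightarrow> m i \<le> v i"
proof (induction rule: seg.induct)
  case (seg_lim c m)
  then show ?case using nat_INF_le[of "\<lambda>k. m k i" 0] by (meson le_trans)
qed auto

section \<open>Register machines as vector systems\<close>

text \<open>The active line becomes component 0, so that the limit rule does not have to distinguish
  lines from registers.\<close>

definition mk :: "nat \<Rightarrow> vec \<Rightarrow> vec" where "mk l R = case_nat l R"

lemma mk_simps [simp]: "mk l R 0 = l" "mk l R (Suc i) = R i" by (simp_all add: mk_def)

lemma mk_eta: "mk (v 0) (\<lambda>i. v (Suc i)) = v"
  by (rule ext) (simp add: mk_def split: nat.split)

definition mstep :: "prog \<Rightarrow> nat set \<Rightarrow> vec \<Rightarrow> vec" where
  "mstep P A v = case_prod mk (step A (P ! v 0) (v 0, \<lambda>i. v (Suc i)))"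

definition mok :: "prog \<Rightarrow> vec \<Rightarrow> bool" where "mok P v \<longleftrightarrow> v 0 < length P"

text \<open>Derivations of \<open>seg\<close> have positive length, hence the separate case of a
  machine that halts in its initial configuration.\<close>

lemma halts_with_seg:
  assumes "halts_with P A i k"
  shows "\<exists>c. (c = case_prod mk (initial i) \<or>
      (\<exists>m. seg (mstep P A) (mok P) (case_prod mk (initial i)) m c)) \<and> \<not> mok P c \<and> c (Suc 0) = k"
proof -
  obtain r :: "nat rel" and C t where h: "computation P A (initial i) r C" "t \<in> Field r"
    "length P \<le> fst (C t)" "snd (C t) 0 = k"
    using assms by (auto simp: halts_with_def halting_computation_def)
  have wo: "Well_order r" using h(1) by (simp add: computation_def)
  interpret wo_rel r using wo by (simp add: wo_rel_def)
  define D where "D = (\<lambda>t. case_prod mk (C t))"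
  have D0: "D u 0 = fst (C u)" "D u (Suc j) = snd (C u) j" for u j
    by (auto simp: D_def split: prod.split)
  have fin: "\<not> mok P (D t)" "D t (Suc 0) = k" using h by (simp_all add: mok_def D0)
  obtain z where z: "is_first r z"
  proof -
    have "minim (Field r) \<in> Field r" using minim_in[of "Field r"] h(2) by auto
    moreover have "underS (minim (Field r)) = {}"
    proof -
      have "(minim (Field r), u) \<in> r" if "u \<in> Field r" for u
        using minim_least[of "Field r" u] that by auto
      then show ?thesis using ANTISYM by (auto simp: underS_def Field_def dest: antisymD)
    qed
    ultimately show thesis using that by (auto simp: is_first_def)
  qed
  have Dz: "D z = case_prod mk (initial i)" using h(1) z by (simp add: computation_def D_def)
  show ?thesis
  proof (cases "t = z")
    case True
    then show ?thesis using fin Dz by metis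
  next
    case False
    have zt: "z \<in> underS t"
      using z False h(2) TOTALS by (auto simp: is_first_def underS_def)
    have "\<exists>m. seg (mstep P A) (mok P) (D z) m (D t) \<and>
     (\<forall>i. (\<forall>u\<in>underS t. (z, u) \<in> r \<longrightarrow> m i \<le> D u i) \<and> (\<exists>u\<in>underS t. (z, u) \<in> r \<and> D u i = m i))"
    proof (rule seg_complete[OF wo _ _ _ zt])
      fix s t assume st: "is_succ r s t"
      then have "C t = step A (P ! fst (C s)) (C s)" using h(1) by (simp add: computation_def)
      then show "D t = mstep P A (D s)"
        by (simp add: mstep_def D0) (simp add: D_def)
    next
      fix t assume "is_limit r t"
      then have "C t = limit_config r t C" using h(1) by (simp add: computation_def)
      then show "D t = (\<lambda>i. reset_if_infinite (liminf_below r t (\<lambda>u. D u i)))"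
        by (intro ext, simp add: D_def limit_config_def mk_def split: nat.split)
          (simp add: case_prod_unfold)
    next
      \<comment> \<open>A time that has a successor has its line inside the program, by the
        definition of computations.\<close>
      fix u assume "u \<in> underS t"
      then obtain b where "is_succ r u b" using ex_succ[OF wo] by blast
      then show "mok P (D u)" using h(1) by (simp add: computation_def mok_def D0)
    qed auto
    then show ?thesis using fin Dz by metis
  qed
qed

text \<open>The run on \<open>om1\<close> up to the halting time is a computation;
  \<open>halts_with_if_halting_computation\<close> then moves it to a well-order of
  naturals.\<close>

lemma seg_halts_with:
  assumes "seg (mstep P A) (mok P) (case_prod mk (initial i)) m c" "\<not> mok P c"
  shows "halts_with P A i (c (Suc 0))"
proof -
  let ?v = "case_prod mk (initial i)"
  define D where "D = run (mstep P A) ?v"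
  obtain t where t: "ozero < t" "D t = c" "\<And>u. u < t \<Longrightarrow> mok P (D u)"
    using seg_run[OF assms(1), of ?v ozero] by (auto simp: D_def)
  define C where "C u = (D u 0, \<lambda>j. D u (Suc j))" for u
  have "computation P A (initial i) (om1_rel t) C"
    unfolding computation_def
  proof (intro conjI allI impI)
    fix u assume "is_first (om1_rel t) u"
    then show "C u = initial i" by (auto simp: is_first_om1_rel C_def D_def initial_def)
  next
    fix s u assume su: "is_succ (om1_rel t) s u"
    then have "s < t" "u = osuc s" by (auto simp: is_succ_om1_rel osuc_le_iff)
    then show "fst (C s) < length P" using t(3) by (simp add: C_def mok_def)
    show "C u = step A (P ! fst (C s)) (C s)"
      using \<open>u = osuc s\<close> by (simp add: C_def D_def mstep_def case_prod_unfold)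
  next
    fix u assume "is_limit (om1_rel t) u"
    then show "C u = limit_config (om1_rel t) u C"
      by (auto simp: is_limit_om1_rel limit_config_def liminf_below_om1_rel C_def D_def run_olim lm_def)
  qed (rule Well_order_om1_rel)
  then have "halting_computation P A i (c (Suc 0)) (om1_rel t) C t"
    using t(2) assms(2) by (auto simp: halting_computation_def Field_om1_rel C_def mok_def)
  then show ?thesis by (rule halts_with_if_halting_computation)
qed

section \<open>Computable functions\<close>

definition code_at :: "prog \<Rightarrow> nat \<Rightarrow> prog \<Rightarrow> bool" where
  "code_at P off code \<longleftrightarrow> (\<forall>j<length code. off + j < length P \<and> P ! (off + j) = code ! j)"

lemma code_at_append: "code_at P off (c @ c') \<longleftrightarrow> code_at P off c \<and> code_at P (off + length c) c'"
proof
  assume *: "code_at P off (c @ c')"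
  have "off + length c + j < length P \<and> P ! (off + length c + j) = c' ! j" if "j < length c'" for j
    using *[unfolded code_at_def, rule_format, of "length c + j"] that by (auto simp: nth_append add.assoc)
  moreover have "off + j < length P \<and> P ! (off + j) = c ! j" if "j < length c" for j
    using *[unfolded code_at_def, rule_format, of j] that by (auto simp: nth_append)
  ultimately show "code_at P off c \<and> code_at P (off + length c) c'" by (auto simp: code_at_def)
next
  assume *: "code_at P off c \<and> code_at P (off + length c) c'"
  show "code_at P off (c @ c')" unfolding code_at_def
  proof (intro allI impI)
    fix j assume "j < length (c @ c')"
    then show "off + j < length P \<and> P ! (off + j) = (c @ c') ! j"
      using *[unfolded code_at_def] by (cases "j < length c") (auto simp: nth_append dest!: spec[of _ "j - length c"])
  qed
qed

lemma code_at_Cons: "code_at P off (I # c) \<longleftrightarrow> off < length P \<and> P ! off = I \<and> code_at P (Suc off) c"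
  using code_at_append[of P off "[I]" c] by (auto simp: code_at_def)

abbreviation bs :: "prog \<Rightarrow> nat set \<Rightarrow> nat \<Rightarrow> vec \<Rightarrow> vec \<Rightarrow> nat \<Rightarrow> vec \<Rightarrow> bool" where
  "bs P A l R m l' R' \<equiv> seg (mstep P A) (mok P) (mk l R) m (mk l' R')"

text \<open>The conditions on \<open>m\<close> matter when the fragment sits inside a loop: the line
  never falls below \<open>L\<close>, so that a limit cannot send control in front of the loop, and
  registers below \<open>B\<close> do not even dip meanwhile.\<close>

definition tr :: "prog \<Rightarrow> nat set \<Rightarrow> nat \<Rightarrow> nat \<Rightarrow> nat \<Rightarrow> vec \<Rightarrow> nat \<Rightarrow> vec \<Rightarrow> bool" where
  "tr P A L B l R l' R' \<longleftrightarrow> (\<exists>m. bs P A l R m l' R' \<and> L \<le> m 0 \<and> (\<forall>i<B. m (Suc i) = R i \<and> R' i = R i))"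

lemma tr_trans:
  assumes "tr P A L B l R l' R'" "tr P A L' B' l' R' l'' R''" "L \<le> L'" "B \<le> B'"
  shows "tr P A L B l R l'' R''"
proof -
  obtain m where m: "bs P A l R m l' R'" "L \<le> m 0" "\<forall>i<B. m (Suc i) = R i \<and> R' i = R i"
    using assms(1) by (auto simp: tr_def)
  obtain m' where m': "bs P A l' R' m' l'' R''" "L' \<le> m' 0" "\<forall>i<B'. m' (Suc i) = R' i \<and> R'' i = R' i"
    using assms(2) by (auto simp: tr_def)
  show ?thesis unfolding tr_def
    by (rule exI, rule conjI[OF seg_trans[OF m(1) m'(1)]]) (use m m' assms(3,4) in auto)
qed

lemma tr_mono: "tr P A L B l R l' R' \<Longrightarrow> L' \<le> L \<Longrightarrow> B' \<le> B \<Longrightarrow> tr P A L' B' l R l' R'"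
  unfolding tr_def by (metis le_trans order_less_le_trans)

lemma bs_instr:
  assumes "l < length P" "step A (P ! l) (l, R) = (l', R')"
  shows "bs P A l R (mk l R) l' R'"
proof -
  have "mstep P A (mk l R) = mk l' R'" using assms(2) by (simp add: mstep_def)
  then show ?thesis
    using seg_step[of "mok P" "mk l R" "mstep P A"] assms(1) by (simp add: mok_def)
qed

lemma tr_step:
  assumes "l < length P" "step A (P ! l) (l, R) = (l', R')" "L \<le> l" "\<forall>i<B. R' i = R i"
  shows "tr P A L B l R l' R'"
  unfolding tr_def using bs_instr[OF assms(1,2)] assms(3,4) by (intro exI[of _ "mk l R"]) auto

text \<open>The length is fixed before the offset is known, which allows jumps across a fragment to
  be laid out in advance. Registers from \<open>b\<close> on are free for results and scratch
  values.\<close>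

definition frag :: "nat set \<Rightarrow> nat \<Rightarrow> (vec \<Rightarrow> vec \<Rightarrow> bool) \<Rightarrow> bool" where
  "frag A b \<Phi> \<longleftrightarrow> (\<exists>n. \<forall>off. \<exists>code. length code = n \<and> (\<forall>P. code_at P off code \<longrightarrow>
     (\<forall>R. \<exists>R'. tr P A off b off R (off + n) R' \<and> \<Phi> R R')))"

lemma frag_mono:
  assumes fr: "frag A b \<Phi>" and imp: "\<And>R R'. (\<forall>i<b. R' i = R i) \<Longrightarrow> \<Phi> R R' \<Longrightarrow> \<Psi> R R'" and b: "b' \<le> b"
  shows "frag A b' \<Psi>"
proof -
  from fr obtain n where n: "\<forall>off. \<exists>code. length code = n \<and> (\<forall>P. code_at P off code \<longrightarrow>
     (\<forall>R. \<exists>R'. tr P A off b off R (off + n) R' \<and> \<Phi> R R'))" by (auto simp: frag_def)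
  show ?thesis unfolding frag_def
  proof (intro exI[of _ n] allI)
    fix off
    obtain code where c: "length code = n"
      "\<And>P R. code_at P off code \<Longrightarrow> \<exists>R'. tr P A off b off R (off + n) R' \<and> \<Phi> R R'" using n by meson
    show "\<exists>code. length code = n \<and> (\<forall>P. code_at P off code \<longrightarrow> (\<forall>R. \<exists>R'. tr P A off b' off R (off + n) R' \<and> \<Psi> R R'))"
    proof (intro exI[of _ code] conjI allI impI c(1))
      fix P R assume "code_at P off code"
      then obtain R' where R': "tr P A off b off R (off + n) R'" "\<Phi> R R'" using c(2) by blast
      moreover have "\<forall>i<b. R' i = R i" using R'(1) by (auto simp: tr_def)
      ultimately show "\<exists>R'. tr P A off b' off R (off + n) R' \<and> \<Psi> R R'"
        using imp b tr_mono by (metis order_refl)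
    qed
  qed
qed

text \<open>A larger bound \<open>b'\<close> lets the second part protect intermediate results that
  the first part has left in registers from \<open>b\<close> on.\<close>

lemma frag_seq:
  assumes "frag A b \<Phi>" "frag A b' \<Psi>" "b \<le> b'"
  shows "frag A b (\<lambda>R R''. \<exists>R'. \<Phi> R R' \<and> (\<forall>i<b. R' i = R i) \<and> \<Psi> R' R'' \<and> (\<forall>i<b'. R'' i = R' i))"
proof -
  from assms(1) obtain n where n: "\<forall>off. \<exists>code. length code = n \<and> (\<forall>P. code_at P off code \<longrightarrow>
     (\<forall>R. \<exists>R'. tr P A off b off R (off + n) R' \<and> \<Phi> R R'))" by (auto simp: frag_def)
  from assms(2) obtain n' where n': "\<forall>off. \<exists>code. length code = n' \<and> (\<forall>P. code_at P off code \<longrightarrow>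
     (\<forall>R. \<exists>R'. tr P A off b' off R (off + n') R' \<and> \<Psi> R R'))" by (auto simp: frag_def)
  show ?thesis unfolding frag_def
  proof (intro exI[of _ "n + n'"] allI)
    fix off
    obtain c where c: "length c = n" "\<And>P R. code_at P off c \<Longrightarrow> \<exists>R'. tr P A off b off R (off + n) R' \<and> \<Phi> R R'"
      using n by meson
    obtain c' where c': "length c' = n'"
      "\<And>P R. code_at P (off + n) c' \<Longrightarrow> \<exists>R'. tr P A (off + n) b' (off + n) R (off + n + n') R' \<and> \<Psi> R R'"
      using n' by meson
    show "\<exists>code. length code = n + n' \<and> (\<forall>P. code_at P off code \<longrightarrow> (\<forall>R. \<exists>R''. tr P A off b off R (off + (n + n')) R'' \<and>
      (\<exists>R'. \<Phi> R R' \<and> (\<forall>i<b. R' i = R i) \<and> \<Psi> R' R'' \<and> (\<forall>i<b'. R'' i = R' i))))"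
    proof (intro exI[of _ "c @ c'"] conjI allI impI)
      fix P R assume "code_at P off (c @ c')"
      then have a: "code_at P off c" "code_at P (off + n) c'" by (auto simp: code_at_append c(1))
      obtain R' where R': "tr P A off b off R (off + n) R'" "\<Phi> R R'" using c(2)[OF a(1)] by blast
      obtain R'' where R'': "tr P A (off + n) b' (off + n) R' (off + n + n') R''" "\<Psi> R' R''"
        using c'(2)[OF a(2)] by blast
      have "tr P A off b off R (off + (n + n')) R''"
        using tr_trans[OF R'(1) R''(1)] assms(3) by (simp add: add.assoc)
      moreover have "\<forall>i<b. R' i = R i" "\<forall>i<b'. R'' i = R' i" using R'(1) R''(1) by (auto simp: tr_def)
      ultimately show "\<exists>R''. tr P A off b off R (off + (n + n')) R'' \<and>
        (\<exists>R'. \<Phi> R R' \<and> (\<forall>i<b. R' i = R i) \<and> \<Psi> R' R'' \<and> (\<forall>i<b'. R'' i = R' i))"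
        using R'(2) R''(2) by blast
    qed (simp add: c c')
  qed
qed

lemma frag_instr:
  assumes "\<And>l R. \<exists>R'. step A I (l, R) = (Suc l, R') \<and> (\<forall>i<b. R' i = R i) \<and> \<Phi> R R'"
  shows "frag A b \<Phi>"
  unfolding frag_def
proof (intro exI[of _ 1] allI exI[of _ "[I]"] conjI impI)
  fix off P R assume "code_at P off [I]"
  then have P: "off < length P" "P ! off = I" by (auto simp: code_at_Cons)
  obtain R' where R': "step A I (off, R) = (Suc off, R')" "\<forall>i<b. R' i = R i" "\<Phi> R R'" using assms by blast
  then show "\<exists>R'. tr P A off b off R (off + 1) R' \<and> \<Phi> R R'"
    using tr_step[OF P(1), of A R "Suc off" R' off b] P(2) by auto
qed simp

lemma frag_copy: "b \<le> j \<Longrightarrow> frag A b (\<lambda>R R'. R' = R(j := R i))"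
  by (rule frag_instr[of _ "Copy i j"]) auto

lemma frag_zero: "b \<le> j \<Longrightarrow> frag A b (\<lambda>R R'. R' = R(j := 0))"
  by (rule frag_instr[of _ "Zero j"]) auto

section \<open>Functions computed by fragments\<close>

definition dep :: "nat \<Rightarrow> (vec \<Rightarrow> nat) \<Rightarrow> bool" where
  "dep k f \<longleftrightarrow> (\<forall>e e'. (\<forall>i<k. e i = e' i) \<longrightarrow> f e = f e')"

text \<open>Arguments are fetched from arbitrary registers \<open>\<rho> i\<close>, so composition
  requires no rearranging of arguments; the result goes to the first free register. Since
  \<open>f\<close> takes infinite vectors, \<open>dep\<close> limits the entries that
  matter.\<close>

definition cmp :: "nat set \<Rightarrow> nat \<Rightarrow> (vec \<Rightarrow> nat) \<Rightarrow> bool" where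
  "cmp A k f \<longleftrightarrow> dep k f \<and>
     (\<forall>b \<rho>. (\<forall>i<k. \<rho> i < b) \<longrightarrow> frag A b (\<lambda>R R'. R' b = f (\<lambda>i. R (\<rho> i))))"

lemma depD: "dep k f \<Longrightarrow> (\<And>i. i < k \<Longrightarrow> e i = e' i) \<Longrightarrow> f e = f e'"
  by (auto simp: dep_def)

lemma cmp_imp_dep: "cmp A k f \<Longrightarrow> dep k f" by (simp add: cmp_def)

definition rc :: "nat set \<Rightarrow> (vec \<Rightarrow> nat) \<Rightarrow> bool" where "rc A f \<longleftrightarrow> (\<exists>k. cmp A k f)"

lemma cmp_mono: "cmp A k f \<Longrightarrow> k \<le> k' \<Longrightarrow> cmp A k' f"
  unfolding cmp_def dep_def by (meson order_less_le_trans)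

lemma cmpI:
  assumes "dep k f" "\<And>b \<rho>. (\<forall>i<k. \<rho> i < b) \<Longrightarrow> frag A b (\<lambda>R R'. R' b = f (\<lambda>i. R (\<rho> i)))"
  shows "cmp A k f"
  using assms by (auto simp: cmp_def)

text \<open>The boundary of the free registers moves up by one after each value, which protects the
  values already computed.\<close>

lemma frag_list:
  assumes "\<forall>i<q. cmp A k (g i)" "\<forall>i<k. \<rho> i < b"
  shows "frag A b (\<lambda>R R'. \<forall>i<q. R' (b + i) = g i (\<lambda>i. R (\<rho> i)))"
  using assms(1)
proof (induction q)
  case 0
  then show ?case by (intro frag_mono[OF frag_zero[of b b]]) auto
next
  case (Suc q)
  have g: "cmp A k (g q)" using Suc.prems by simp
  have 1: "frag A b (\<lambda>R R'. \<forall>i<q. R' (b + i) = g i (\<lambda>i. R (\<rho> i)))" using Suc by auto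
  have 2: "frag A (b + q) (\<lambda>R R'. R' (b + q) = g q (\<lambda>i. R (\<rho> i)))"
    using g assms(2) unfolding cmp_def by (metis trans_less_add1)
  show ?case
  proof (rule frag_mono[OF frag_seq[OF 1 2]])
    fix R R''
    assume "\<exists>R'. (\<forall>i<q. R' (b + i) = g i (\<lambda>i. R (\<rho> i))) \<and> (\<forall>i<b. R' i = R i) \<and>
      R'' (b + q) = g q (\<lambda>i. R' (\<rho> i)) \<and> (\<forall>i<b + q. R'' i = R' i)"
    then obtain R' where R': "\<forall>i<q. R' (b + i) = g i (\<lambda>i. R (\<rho> i))" "\<forall>i<b. R' i = R i"
      "R'' (b + q) = g q (\<lambda>i. R' (\<rho> i))" "\<forall>i<b + q. R'' i = R' i" by blast
    have "g q (\<lambda>i. R' (\<rho> i)) = g q (\<lambda>i. R (\<rho> i))"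
      by (rule depD[OF cmp_imp_dep[OF g]]) (use R'(2) assms(2) in simp)
    then show "\<forall>i<Suc q. R'' (b + i) = g i (\<lambda>i. R (\<rho> i))"
      using R' by (auto simp: less_Suc_eq)
  qed auto
qed

lemma rc_list:
  fixes q :: nat
  assumes "\<And>i. i < q \<Longrightarrow> rc A (g i)" shows "\<exists>k. \<forall>i<q. cmp A k (g i)"
  using assms
proof (induction q)
  case (Suc q)
  then obtain k where k: "\<forall>i<q. cmp A k (g i)" by auto
  obtain k' where k': "cmp A k' (g q)" using Suc.prems[of q] by (auto simp: rc_def)
  have "\<forall>i<Suc q. cmp A (max k k') (g i)" using k k' by (auto simp: less_Suc_eq intro: cmp_mono)
  then show ?case by blast
qed auto

text \<open>The inner values are stacked from register \<open>b\<close> on, the outer value is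
  computed above them and then copied down to \<open>b\<close>.\<close>

lemma rc_comp:
  assumes "rc A f" "\<And>i. rc A (g i)" shows "rc A (\<lambda>e. f (\<lambda>i. g i e))"
proof -
  obtain q where q: "cmp A q f" using assms(1) by (auto simp: rc_def)
  obtain k where k: "\<forall>i<q. cmp A k (g i)" using rc_list[of q A g] assms(2) by blast
  have "cmp A k (\<lambda>e. f (\<lambda>i. g i e))"
  proof (rule cmpI)
    show "dep k (\<lambda>e. f (\<lambda>i. g i e))"
      unfolding dep_def
    proof (intro allI impI)
      fix e e' :: vec assume e: "\<forall>i<k. e i = e' i"
      have g: "g i e = g i e'" if "i < q" for i
        using k[rule_format, OF that, THEN cmp_imp_dep] e by (simp add: dep_def)
      show "f (\<lambda>i. g i e) = f (\<lambda>i. g i e')"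
        by (rule depD[OF cmp_imp_dep[OF q]]) (rule g)
    qed
    fix b and \<rho> :: "nat \<Rightarrow> nat" assume \<rho>: "\<forall>i<k. \<rho> i < b"
    have 1: "frag A b (\<lambda>R R'. \<forall>i<q. R' (b + i) = g i (\<lambda>i. R (\<rho> i)))"
      by (rule frag_list[OF k \<rho>])
    have 2: "frag A (b + q) (\<lambda>R R'. R' (b + q) = f (\<lambda>i. R (b + i)))"
      using q unfolding cmp_def by simp
    have 3: "frag A b (\<lambda>R R'. R' = R(b := R (b + q)))" by (rule frag_copy) simp
    have 12: "frag A b (\<lambda>R R'. R' (b + q) = f (\<lambda>i. g i (\<lambda>i. R (\<rho> i))))"
    proof (rule frag_mono[OF frag_seq[OF 1 2]])
      fix R R''
      assume "\<exists>R'. (\<forall>i<q. R' (b + i) = g i (\<lambda>i. R (\<rho> i))) \<and> (\<forall>i<b. R' i = R i) \<and>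
         R'' (b + q) = f (\<lambda>i. R' (b + i)) \<and> (\<forall>i<b + q. R'' i = R' i)"
      then obtain R' where R': "\<forall>i<q. R' (b + i) = g i (\<lambda>i. R (\<rho> i))" "R'' (b + q) = f (\<lambda>i. R' (b + i))"
        by blast
      have "f (\<lambda>i. R' (b + i)) = f (\<lambda>i. g i (\<lambda>i. R (\<rho> i)))"
        by (rule depD[OF cmp_imp_dep[OF q]]) (use R'(1) in simp)
      then show "R'' (b + q) = f (\<lambda>i. g i (\<lambda>i. R (\<rho> i)))" using R'(2) by simp
    qed auto
    show "frag A b (\<lambda>R R'. R' b = f (\<lambda>i. g i (\<lambda>i. R (\<rho> i))))"
      by (rule frag_mono[OF frag_seq[OF 12 3 order_refl] _ order_refl]) (metis fun_upd_same)
  qed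
  then show ?thesis unfolding rc_def by blast
qed

lemma rc_var: "rc A (\<lambda>e. e i)"
proof -
  have "cmp A (Suc i) (\<lambda>e. e i)"
  proof (rule cmpI)
    show "frag A b (\<lambda>R R'. R' b = R (\<rho> i))" for b \<rho>
      by (rule frag_mono[OF frag_copy[of b b A "\<rho> i"]]) auto
  qed (simp add: dep_def)
  then show ?thesis by (auto simp: rc_def)
qed

lemma rc_zero: "rc A (\<lambda>e. 0)"
proof -
  have "cmp A 0 (\<lambda>e. 0)"
  proof (rule cmpI)
    show "frag A b (\<lambda>R R'. R' b = 0)" for b
      by (rule frag_mono[OF frag_zero[of b b A]]) auto
  qed (simp add: dep_def)
  then show ?thesis by (auto simp: rc_def)
qed

lemma rc_Suc: assumes "rc A f" shows "rc A (\<lambda>e. Suc (f e))"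
proof -
  have "cmp A 1 (\<lambda>e. Suc (e 0))"
  proof (rule cmpI)
    fix b and \<rho> :: "nat \<Rightarrow> nat" assume "\<forall>i<1. \<rho> i < b"
    have "frag A b (\<lambda>R R'. R' = R(b := Suc (R b)))" by (rule frag_instr[of _ "Incr b"]) auto
    from frag_seq[OF frag_copy[of b b A "\<rho> 0"] this]
    show "frag A b (\<lambda>R R'. R' b = Suc (R (\<rho> 0)))" by (rule frag_mono) auto
  qed (simp add: dep_def)
  then have "rc A (\<lambda>e. Suc (e 0))" by (auto simp: rc_def)
  from rc_comp[OF this, of "\<lambda>_. f"] assms show ?thesis by simp
qed

lemma rc_oracle: assumes "rc A f" shows "rc A (\<lambda>e. if f e \<in> A then 1 else 0)"
proof -
  have "cmp A 1 (\<lambda>e. if e 0 \<in> A then 1 else 0)"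
  proof (rule cmpI)
    fix b and \<rho> :: "nat \<Rightarrow> nat" assume "\<forall>i<1. \<rho> i < b"
    have "frag A b (\<lambda>R R'. R' = R(b := if R b \<in> A then 1 else 0))"
      by (rule frag_instr[of _ "Oracle b"]) auto
    from frag_seq[OF frag_copy[of b b A "\<rho> 0"] this]
    show "frag A b (\<lambda>R R'. R' b = (if R (\<rho> 0) \<in> A then 1 else 0))" by (rule frag_mono) auto
  qed (simp add: dep_def)
  then have "rc A (\<lambda>e. if e 0 \<in> A then 1 else 0)" by (auto simp: rc_def)
  from rc_comp[OF this, of "\<lambda>_. f"] assms show ?thesis by simp
qed

lemma rc_if_eq:
  assumes "rc A f" "rc A g" "rc A h" "rc A h'"
  shows "rc A (\<lambda>e. if f e = g e then h e else h' e)"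
proof -
  have "cmp A 4 (\<lambda>e. if e 0 = e 1 then e 2 else e 3)"
  proof (rule cmpI)
    show "dep 4 (\<lambda>e. if e 0 = e 1 then e 2 else e 3)" by (simp add: dep_def)
    fix b and \<rho> :: "nat \<Rightarrow> nat" assume "\<forall>i<4. \<rho> i < b"
    show "frag A b (\<lambda>R R'. R' b = (if R (\<rho> 0) = R (\<rho> 1) then R (\<rho> 2) else R (\<rho> 3)))"
      unfolding frag_def
    proof (intro exI[of _ 4] allI)
      fix off
      show "\<exists>code. length code = 4 \<and> (\<forall>P. code_at P off code \<longrightarrow> (\<forall>R. \<exists>R'. tr P A off b off R (off + 4) R' \<and>
            R' b = (if R (\<rho> 0) = R (\<rho> 1) then R (\<rho> 2) else R (\<rho> 3))))"
      \<comment> \<open>The third instruction compares a register with itself, hence jumps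
        unconditionally over the other branch.\<close>
      proof (intro exI[of _ "[Jump (\<rho> 0) (\<rho> 1) (off + 3), Copy (\<rho> 3) b, Jump b b (off + 4), Copy (\<rho> 2) b]"]
          conjI allI impI)
        fix P R assume "code_at P off [Jump (\<rho> 0) (\<rho> 1) (off + 3), Copy (\<rho> 3) b, Jump b b (off + 4), Copy (\<rho> 2) b]"
        then have P: "off < length P" "P ! off = Jump (\<rho> 0) (\<rho> 1) (off + 3)"
          "Suc off < length P" "P ! Suc off = Copy (\<rho> 3) b"
          "Suc (Suc off) < length P" "P ! Suc (Suc off) = Jump b b (off + 4)"
          "off + 3 < length P" "P ! (off + 3) = Copy (\<rho> 2) b"
          by (auto simp: code_at_Cons numeral_3_eq_3)
        show "\<exists>R'. tr P A off b off R (off + 4) R' \<and> R' b = (if R (\<rho> 0) = R (\<rho> 1) then R (\<rho> 2) else R (\<rho> 3))"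
        proof (cases "R (\<rho> 0) = R (\<rho> 1)")
          case True
          have 1: "tr P A off b off R (off + 3) R"
            by (rule tr_step[OF P(1)]) (auto simp: P True)
          have 2: "tr P A off b (off + 3) R (off + 4) (R(b := R (\<rho> 2)))"
            by (rule tr_step[OF P(7)]) (auto simp: P)
          show ?thesis using tr_trans[OF 1 2] True by auto
        next
          case False
          have 1: "tr P A off b off R (Suc off) R"
            by (rule tr_step[OF P(1)]) (use False in \<open>auto simp: P\<close>)
          have 2: "tr P A off b (Suc off) R (Suc (Suc off)) (R(b := R (\<rho> 3)))"
            by (rule tr_step[OF P(3)]) (auto simp: P)
          have 3: "tr P A off b (Suc (Suc off)) (R(b := R (\<rho> 3))) (off + 4) (R(b := R (\<rho> 3)))"
            by (rule tr_step[OF P(5)]) (auto simp: P)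
          show ?thesis using tr_trans[OF tr_trans[OF 1 2] 3] False by auto
        qed
      qed simp
    qed
  qed
  then have "rc A (\<lambda>e. if e 0 = e 1 then e 2 else e 3)" by (auto simp: rc_def)
  from rc_comp[OF this, of "\<lambda>i. if i = 0 then f else if i = 1 then g else if i = 2 then h else h'"]
  show ?thesis using assms by (simp cong: if_cong)
qed

text \<open>Each target register is written exactly once, so during the block it shows only its old
  or its new value; this bound on the infimum is what the limit rule of the surrounding loop
  requires. All sources lie above all targets and are not overwritten.\<close>

lemma bs_copies:
  fixes R :: vec and s t :: nat
  defines "Q \<equiv> \<lambda>d j. if t \<le> j \<and> j < t + d then R (s + (j - t)) else R j"
  assumes "code_at P l (map (\<lambda>i. Copy (s + i) (t + i)) [0..<Suc d])" "t + Suc d \<le> s"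
  shows "\<exists>m. bs P A l R m (l + Suc d) (Q (Suc d)) \<and> l \<le> m 0 \<and> (\<forall>j. min (R j) (Q (Suc d) j) \<le> m (Suc j))"
  using assms(2,3)
proof (induction d)
  case 0
  then have "l < length P" "P ! l = Copy s t" by (auto simp: code_at_Cons)
  then have "bs P A l R (mk l R) (Suc l) (R(t := R s))" by (intro bs_instr) auto
  moreover have "Q (Suc 0) = R(t := R s)" by (auto simp: fun_eq_iff Q_def)
  ultimately have "bs P A l R (mk l R) (l + Suc 0) (Q (Suc 0))" by (metis add_Suc_right add_0_right)
  then show ?case by (intro exI conjI allI, assumption) simp_all
next
  case (Suc d)
  have a: "code_at P l (map (\<lambda>i. Copy (s + i) (t + i)) [0..<Suc d])"
    "l + Suc d < length P" "P ! (l + Suc d) = Copy (s + Suc d) (t + Suc d)"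
    using Suc.prems(1) code_at_append[of P l "map (\<lambda>i. Copy (s + i) (t + i)) [0..<Suc d]" "[Copy (s + Suc d) (t + Suc d)]"]
    by (simp_all add: code_at_Cons)
  obtain m where m: "bs P A l R m (l + Suc d) (Q (Suc d))" "l \<le> m 0" "\<And>j. min (R j) (Q (Suc d) j) \<le> m (Suc j)"
    using Suc.IH[OF a(1)] Suc.prems(2) by auto
  have "(Q (Suc d))(t + Suc d := Q (Suc d) (s + Suc d)) = Q (Suc (Suc d))"
    using Suc.prems(2) by (auto simp: fun_eq_iff Q_def)
  then have "bs P A (l + Suc d) (Q (Suc d)) (mk (l + Suc d) (Q (Suc d))) (Suc (l + Suc d)) (Q (Suc (Suc d)))"
    using a(3) by (intro bs_instr[OF a(2)]) simp
  note sg = seg_trans[OF m(1) this]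
  have "min (R j) (Q (Suc (Suc d)) j) \<le> min (m (Suc j)) (Q (Suc d) j)" for j
  proof -
    have "Q (Suc d) j = Q (Suc (Suc d)) j \<or> Q (Suc d) j = R j" by (auto simp: Q_def)
    then show ?thesis using m(3)[of j] by auto
  qed
  then show ?case
    by (intro exI conjI, use sg in \<open>simp only: add_Suc_right\<close>) (use m(2) in auto)
qed

text \<open>The main loop keeps the state in registers that are only written after
  the next state has been computed, so that their limits inferior are those of the iterated
  system.\<close>

lemma loop_sim:
  assumes seg: "seg G (\<lambda>v. v 0 = 0) v m v'"
    and G: "\<And>i. i < d \<Longrightarrow> dep d (\<lambda>v. G v i)"
    and iter: "\<And>R. R b = 0 \<Longrightarrow> R (Suc b) = 0 \<Longrightarrow> \<exists>\<mu> R'. bs P A h R \<mu> h R' \<and> h \<le> \<mu> 0 \<and>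
      (\<forall>j\<le>b. \<mu> (Suc j) = R j \<and> R' j = R j) \<and>
      (\<forall>i<d. R' (Suc (b + i)) = G (\<lambda>i. R (Suc (b + i))) i \<and>
         min (R (Suc (b + i))) (R' (Suc (b + i))) \<le> \<mu> (Suc (Suc (b + i))))"
    and d: "0 < d"
    and R: "R b = 0" "\<forall>i<d. R (Suc (b + i)) = v i"
  shows "\<exists>\<mu> R'. bs P A h R \<mu> h R' \<and> h \<le> \<mu> 0 \<and> (\<forall>j\<le>b. \<mu> (Suc j) = R j \<and> R' j = R j) \<and>
      (\<forall>i<d. R' (Suc (b + i)) = v' i \<and> \<mu> (Suc (Suc (b + i))) \<le> m i \<and>
         min (m i) (v' i) \<le> \<mu> (Suc (Suc (b + i))))"
  using seg R
proof (induction arbitrary: R)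
  case (seg_step v)
  have R1: "R (Suc b) = 0" using seg_step d by fastforce
  obtain \<mu> R' where \<mu>: "bs P A h R \<mu> h R'" "h \<le> \<mu> 0" "\<forall>j\<le>b. \<mu> (Suc j) = R j \<and> R' j = R j"
    "\<forall>i<d. R' (Suc (b + i)) = G (\<lambda>i. R (Suc (b + i))) i \<and>
         min (R (Suc (b + i))) (R' (Suc (b + i))) \<le> \<mu> (Suc (Suc (b + i)))"
    using iter[OF seg_step(2) R1] by (elim exE conjE) rule
  have "G (\<lambda>i. R (Suc (b + i))) i = G v i" if "i < d" for i
    by (rule depD[OF G[OF that]]) (use seg_step(3) in simp)
  moreover have "\<mu> (Suc (Suc (b + i))) \<le> v i" if "i < d" for i
    using seg_le_start[OF \<mu>(1), of "Suc (Suc (b + i))"] seg_step(3) that by simp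
  ultimately show ?case using \<mu> seg_step(3) by (intro exI[of _ \<mu>] exI[of _ R']) auto
next
  case (seg_trans u m v m' w)
  obtain \<mu> R' where 1: "bs P A h R \<mu> h R'" "h \<le> \<mu> 0" "\<forall>j\<le>b. \<mu> (Suc j) = R j \<and> R' j = R j"
    "\<forall>i<d. R' (Suc (b + i)) = v i \<and> \<mu> (Suc (Suc (b + i))) \<le> m i \<and> min (m i) (v i) \<le> \<mu> (Suc (Suc (b + i)))"
    using seg_trans.IH(1)[OF seg_trans.prems] by blast
  obtain \<mu>' R'' where 2: "bs P A h R' \<mu>' h R''" "h \<le> \<mu>' 0" "\<forall>j\<le>b. \<mu>' (Suc j) = R' j \<and> R'' j = R' j"
    "\<forall>i<d. R'' (Suc (b + i)) = w i \<and> \<mu>' (Suc (Suc (b + i))) \<le> m' i \<and> min (m' i) (w i) \<le> \<mu>' (Suc (Suc (b + i)))"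
    using seg_trans.IH(2)[of R'] 1 seg_trans.prems by auto
  \<comment> \<open>At the end of its first half the machine may already show components of
    \<open>v\<close>, which \<open>m\<close> does not take into account; the infimum
    \<open>m'\<close> of the second half is at most \<open>v\<close> and absorbs them.\<close>
  have mm: "min (\<mu> (Suc (Suc (b + i)))) (\<mu>' (Suc (Suc (b + i)))) \<le> min (m i) (m' i) \<and>
    min (min (m i) (m' i)) (w i) \<le> min (\<mu> (Suc (Suc (b + i)))) (\<mu>' (Suc (Suc (b + i))))" if "i < d" for i
  proof -
    have "m' i \<le> v i" using seg_le_start[OF seg_trans.hyps(2)] .
    then show ?thesis using 1(4) 2(4) that by fastforce
  qed
  show ?case
    by (rule exI, rule exI, rule conjI[OF seg.seg_trans[OF 1(1) 2(1)]]) (use 1(2,3) 2(2-4) mm in auto)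
next
  case (seg_lim c m)
  \<comment> \<open>\<open>fst (X k)\<close> are the registers where segment \<open>k\<close>
    starts, and \<open>snd (X (Suc k))\<close> is the infimum over segment \<open>k\<close>.\<close>
  have "\<exists>X. \<forall>k. (fst (X k) b = 0 \<and> (\<forall>i<d. fst (X k) (Suc (b + i)) = c k i) \<and> (\<forall>j\<le>b. fst (X k) j = R j) \<and> (k = 0 \<longrightarrow> fst (X k) = R)) \<and>
     (bs P A h (fst (X k)) (snd (X (Suc k))) h (fst (X (Suc k))) \<and> h \<le> snd (X (Suc k)) 0 \<and>
      (\<forall>j\<le>b. snd (X (Suc k)) (Suc j) = R j) \<and>
      (\<forall>i<d. snd (X (Suc k)) (Suc (Suc (b + i))) \<le> m k i \<and>
         min (m k i) (c (Suc k) i) \<le> snd (X (Suc k)) (Suc (Suc (b + i)))))"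
  proof (rule dependent_nat_choice)
    show "\<exists>x. fst x b = 0 \<and> (\<forall>i<d. fst x (Suc (b + i)) = c 0 i) \<and> (\<forall>j\<le>b. fst x j = R j) \<and> ((0::nat) = 0 \<longrightarrow> fst x = R)"
      using seg_lim.prems by (intro exI[of _ "(R, undefined)"]) simp
  next
    fix x :: "vec \<times> vec" and k :: nat
    assume x: "fst x b = 0 \<and> (\<forall>i<d. fst x (Suc (b + i)) = c k i) \<and> (\<forall>j\<le>b. fst x j = R j) \<and> (k = 0 \<longrightarrow> fst x = R)"
    then obtain \<mu> R' where "bs P A h (fst x) \<mu> h R'" "h \<le> \<mu> 0" "\<forall>j\<le>b. \<mu> (Suc j) = fst x j \<and> R' j = fst x j"
      "\<forall>i<d. R' (Suc (b + i)) = c (Suc k) i \<and> \<mu> (Suc (Suc (b + i))) \<le> m k i \<and>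
        min (m k i) (c (Suc k) i) \<le> \<mu> (Suc (Suc (b + i)))"
      using seg_lim.IH[of "fst x" k] by blast
    then show "\<exists>y. (fst y b = 0 \<and> (\<forall>i<d. fst y (Suc (b + i)) = c (Suc k) i) \<and> (\<forall>j\<le>b. fst y j = R j) \<and>
           (Suc k = 0 \<longrightarrow> fst y = R)) \<and>
       bs P A h (fst x) (snd y) h (fst y) \<and> h \<le> snd y 0 \<and> (\<forall>j\<le>b. snd y (Suc j) = R j) \<and>
       (\<forall>i<d. snd y (Suc (Suc (b + i))) \<le> m k i \<and> min (m k i) (c (Suc k) i) \<le> snd y (Suc (Suc (b + i))))"
      using x by (intro exI[of _ "(R', \<mu>)"]) auto
  qed
  then obtain X where X: "\<And>k. fst (X k) b = 0" "\<And>k i. i < d \<Longrightarrow> fst (X k) (Suc (b + i)) = c k i"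
    "\<And>k j. j \<le> b \<Longrightarrow> fst (X k) j = R j" "fst (X 0) = R"
    "\<And>k. bs P A h (fst (X k)) (snd (X (Suc k))) h (fst (X (Suc k)))" "\<And>k. h \<le> snd (X (Suc k)) 0"
    "\<And>k j. j \<le> b \<Longrightarrow> snd (X (Suc k)) (Suc j) = R j"
    "\<And>k i. i < d \<Longrightarrow> snd (X (Suc k)) (Suc (Suc (b + i))) \<le> m k i"
    "\<And>k i. i < d \<Longrightarrow> min (m k i) (c (Suc k) i) \<le> snd (X (Suc k)) (Suc (Suc (b + i)))"
    by (metis (no_types, lifting))
  define \<mu> where "\<mu> k = snd (X (Suc k))" for k
  define V where "V = (\<lambda>i. reset_if_infinite (SUP k. INF j\<in>{k..}. enat (\<mu> j i)))"
  have sV: "seg (mstep P A) (mok P) (mk h R) (\<lambda>i. INF k. \<mu> k i) V"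
    using seg.seg_lim[of "mstep P A" "mok P" "\<lambda>k. mk h (fst (X k))" \<mu>] X(4,5) unfolding V_def \<mu>_def by simp
  have const: "V i = x" "(INF k. \<mu> k i) = x" if "\<And>k. \<mu> k i = x" for i x
    using that by (simp_all add: V_def)
  have \<mu>0: "\<mu> k 0 = h" for k
    using X(6)[of k] seg_le_start[OF X(5)[of k], of 0] by (simp add: \<mu>_def)
  have \<mu>b: "\<mu> k (Suc j) = R j" if "j \<le> b" for k j using X(7)[OF that] by (simp add: \<mu>_def)
  have mc: "m (Suc k) i \<le> c (Suc k) i" for k i using seg_le_start[OF seg_lim.hyps] .
  \<comment> \<open>Each infimum of the machine lies between the minimum of two successive segment
    infima and the first of them, so both sequences have the same limit inferior.\<close>
  have le: "\<mu> k (Suc (Suc (b + i))) \<le> m k i" and ge: "min (m k i) (m (Suc k) i) \<le> \<mu> k (Suc (Suc (b + i)))"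
    if "i < d" for k i
    using X(8,9)[OF that, of k] mc[of k i] by (auto simp: \<mu>_def)
  have Vd: "V (Suc (Suc (b + i))) = reset_if_infinite (SUP k. INF j\<in>{k..}. enat (m j i))" if i: "i < d" for i
  proof -
    have "(SUP k. INF j\<in>{k..}. enat (\<mu> j (Suc (Suc (b + i))))) = (SUP k. INF j\<in>{k..}. enat (m j i))"
    proof (rule enat_eqI, unfold seq_SUP_INF_le_iff)
      fix v
      show "(\<exists>k. \<forall>j\<ge>k. v \<le> \<mu> j (Suc (Suc (b + i)))) \<longleftrightarrow> (\<exists>k. \<forall>j\<ge>k. v \<le> m j i)"
        using le[OF i] ge[OF i] by (meson le_SucI le_trans min.boundedI)
    qed
    then show ?thesis by (simp add: V_def)
  qed
  have Id: "(INF k. \<mu> k (Suc (Suc (b + i)))) \<le> (INF k. m k i)"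
    "min (INF k. m k i) x \<le> (INF k. \<mu> k (Suc (Suc (b + i))))" if i: "i < d" for i x
  proof -
    obtain k where "m k i = (INF k. m k i)" using nat_INF_attained[of "\<lambda>k. m k i"] by blast
    then show "(INF k. \<mu> k (Suc (Suc (b + i)))) \<le> (INF k. m k i)"
      using nat_INF_le[of "\<lambda>k. \<mu> k (Suc (Suc (b + i)))" k] le[OF i, of k] by linarith
    obtain k where "\<mu> k (Suc (Suc (b + i))) = (INF k. \<mu> k (Suc (Suc (b + i))))"
      using nat_INF_attained[of "\<lambda>k. \<mu> k (Suc (Suc (b + i)))"] by blast
    then show "min (INF k. m k i) x \<le> (INF k. \<mu> k (Suc (Suc (b + i))))"
      using ge[OF i, of k] nat_INF_le[of "\<lambda>k. m k i" k] nat_INF_le[of "\<lambda>k. m k i" "Suc k"] by linarith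
  qed
  have "V = mk h (\<lambda>j. V (Suc j))" using mk_eta[of V] const(1)[of 0, OF \<mu>0] by simp
  then have "bs P A h R (\<lambda>i. INF k. \<mu> k i) h (\<lambda>j. V (Suc j))" using sV by simp
  then show ?case
    using const(2)[of 0, OF \<mu>0] const[OF \<mu>b] Vd Id
    by (intro exI[of _ "\<lambda>i. INF k. \<mu> k i"] exI[of _ "\<lambda>j. V (Suc j)"]) auto
qed

text \<open>Component 0 of the state is the stop flag and component 1 the result. During the loop
  register \<open>b\<close> stays 0 for the test, the state occupies the next \<open>d\<close>
  registers, and its successor is computed above them before it is copied back.\<close>

lemma cmp_iterate:
  assumes G: "\<And>i. i < d \<Longrightarrow> cmp A d (\<lambda>v. G v i)" and init: "\<And>i. i < d \<Longrightarrow> cmp A k (\<lambda>e. init e i)"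
    and d: "2 \<le> d" and f: "dep k f"
    and halt: "\<And>e. \<exists>m v'. seg G (\<lambda>v. v 0 = 0) (init e) m v' \<and> v' 0 \<noteq> 0 \<and> f e = v' 1"
  shows "cmp A k f"
proof (rule cmpI[OF f])
  fix b and \<rho> :: "nat \<Rightarrow> nat" assume \<rho>: "\<forall>i<k. \<rho> i < b"
  have "frag A (Suc b) (\<lambda>R R'. \<forall>i<d. R' (Suc b + i) = init (\<lambda>i. R (\<rho> i)) i)"
    by (rule frag_list) (use init \<rho> less_SucI in auto)
  then have 0: "frag A b (\<lambda>R R'. \<forall>i<d. R' (Suc b + i) = init (\<lambda>i. R (\<rho> i)) i)"
    by (rule frag_mono) auto
  have "frag A b (\<lambda>R R'. R' b = 0 \<and> (\<forall>i<d. R' (Suc b + i) = init (\<lambda>i. R (\<rho> i)) i))"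
  proof (rule frag_mono[OF frag_seq[OF 0 frag_zero[OF order_refl] order_refl] _ order_refl], elim exE conjE)
    fix R R' R'' :: vec
    assume "\<forall>i<d. R' (Suc b + i) = init (\<lambda>i. R (\<rho> i)) i" "R'' = R'(b := 0)"
    then show "R'' b = 0 \<and> (\<forall>i<d. R'' (Suc b + i) = init (\<lambda>i. R (\<rho> i)) i)" by simp
  qed
  then obtain n1 where n1: "\<forall>off. \<exists>code. length code = n1 \<and> (\<forall>P. code_at P off code \<longrightarrow> (\<forall>R. \<exists>R'. tr P A off b off R (off + n1) R' \<and>
      R' b = 0 \<and> (\<forall>i<d. R' (Suc b + i) = init (\<lambda>i. R (\<rho> i)) i)))" by (auto simp: frag_def)
  have "frag A (Suc (b + d)) (\<lambda>R R'. \<forall>i<d. R' (Suc (b + d) + i) = G (\<lambda>i. R (Suc b + i)) i)"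
    by (rule frag_list[of d A d "\<lambda>i v. G v i" "\<lambda>i. Suc b + i"]) (use G in auto)
  then obtain n2 where n2: "\<forall>off. \<exists>code. length code = n2 \<and> (\<forall>P. code_at P off code \<longrightarrow>
      (\<forall>R. \<exists>R'. tr P A off (Suc (b + d)) off R (off + n2) R' \<and>
      (\<forall>i<d. R' (Suc (b + d) + i) = G (\<lambda>i. R (Suc b + i)) i)))" by (auto simp: frag_def)
  show "frag A b (\<lambda>R R'. R' b = f (\<lambda>i. R (\<rho> i)))"
    unfolding frag_def
  proof (intro exI[of _ "n1 + 2 + n2 + d + 2"] allI)
    fix off
    define h where "h = off + n1"
    \<comment> \<open>The exit line: behind the two jumps at the loop head \<open>h\<close>, the
      code for \<open>G\<close>, the \<open>d\<close> copies and the jump back.\<close>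
    define x where "x = h + 2 + n2 + d + 1"
    obtain c1 where c1: "length c1 = n1" "\<And>P R. code_at P off c1 \<Longrightarrow> \<exists>R'. tr P A off b off R h R' \<and>
      R' b = 0 \<and> (\<forall>i<d. R' (Suc b + i) = init (\<lambda>i. R (\<rho> i)) i)"
      using n1 unfolding h_def by meson
    obtain c2 where c2: "length c2 = n2" "\<And>P R. code_at P (h + 2) c2 \<Longrightarrow>
      \<exists>R'. tr P A (h + 2) (Suc (b + d)) (h + 2) R (h + 2 + n2) R' \<and>
      (\<forall>i<d. R' (Suc (b + d) + i) = G (\<lambda>i. R (Suc b + i)) i)"
      using n2 by meson
    define cp where "cp = map (\<lambda>i. Copy (Suc (b + d) + i) (Suc b + i)) [0..<d]"
    define code where "code = c1 @ [Jump (Suc b) b (h + 2), Jump b b x] @ c2 @ cp @ [Jump b b h, Copy (b + 2) b]"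
    have "\<exists>R'. tr P A off b off R (off + (n1 + 2 + n2 + d + 2)) R' \<and> R' b = f (\<lambda>i. R (\<rho> i))"
      if P: "code_at P off code" for P R
    proof -
      have a: "code_at P off c1" "h < length P" "P ! h = Jump (Suc b) b (h + 2)" "Suc h < length P" "P ! Suc h = Jump b b x"
        "code_at P (h + 2) c2" "code_at P (h + 2 + n2) cp" "h + 2 + n2 + d < length P"
        "P ! (h + 2 + n2 + d) = Jump b b h" "x < length P" "P ! x = Copy (b + 2) b"
        using P unfolding code_def code_at_append by (simp_all add: code_at_Cons c1 c2 cp_def h_def x_def)
      have iter: "\<exists>\<mu> R'. bs P A h R \<mu> h R' \<and> h \<le> \<mu> 0 \<and> (\<forall>j\<le>b. \<mu> (Suc j) = R j \<and> R' j = R j) \<and>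
        (\<forall>i<d. R' (Suc (b + i)) = G (\<lambda>i. R (Suc (b + i))) i \<and>
         min (R (Suc (b + i))) (R' (Suc (b + i))) \<le> \<mu> (Suc (Suc (b + i))))"
        if R: "R b = 0" "R (Suc b) = 0" for R
      proof -
        have 1: "tr P A h (Suc (b + d)) h R (h + 2) R" by (rule tr_step[OF a(2)]) (auto simp: a R)
        obtain R1 where R1: "tr P A (h + 2) (Suc (b + d)) (h + 2) R (h + 2 + n2) R1"
          "\<forall>i<d. R1 (Suc (b + d) + i) = G (\<lambda>i. R (Suc b + i)) i" using c2(2)[OF a(6)] by blast
        have "tr P A h (Suc (b + d)) h R (h + 2 + n2) R1" using tr_trans[OF 1 R1(1)] by simp
        then obtain m1 where m1: "bs P A h R m1 (h + 2 + n2) R1" "h \<le> m1 0"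
          "\<forall>i<Suc (b + d). m1 (Suc i) = R i \<and> R1 i = R i" by (auto simp: tr_def)
        define R2 where "R2 = (\<lambda>j. if Suc b \<le> j \<and> j < Suc b + d then R1 (Suc (b + d) + (j - Suc b)) else R1 j)"
        obtain d' where d': "d = Suc d'" using d by (cases d) auto
        have "\<exists>m. bs P A (h + 2 + n2) R1 m (h + 2 + n2 + d) R2 \<and> h + 2 + n2 \<le> m 0 \<and>
          (\<forall>j. min (R1 j) (R2 j) \<le> m (Suc j))"
          using bs_copies[of P "h + 2 + n2" "Suc (b + d)" "Suc b" d' A R1] a(7)
          unfolding R2_def cp_def d' by simp
        then obtain m2 where m2: "bs P A (h + 2 + n2) R1 m2 (h + 2 + n2 + d) R2" "h + 2 + n2 \<le> m2 0"
          "\<forall>j. min (R1 j) (R2 j) \<le> m2 (Suc j)" by blast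
        have m3: "bs P A (h + 2 + n2 + d) R2 (mk (h + 2 + n2 + d) R2) h R2"
          using seg_step[of "mok P" "mk (h + 2 + n2 + d) R2" "mstep P A"] a(8,9)
          by (simp add: mok_def mstep_def)
        note sg = seg_trans[OF seg_trans[OF m1(1) m2(1)] m3]
        have Rb: "R2 j = R j" "R1 j = R j" "m1 (Suc j) = R j" if "j \<le> b" for j
          using that m1(3) by (simp_all add: R2_def)
        have m2b: "m2 (Suc j) = R j" if "j \<le> b" for j
          using m2(3)[rule_format, of j] seg_le_start[OF m2(1), of "Suc j"] Rb[OF that] by simp
        have Rd: "R2 (Suc (b + i)) = G (\<lambda>i. R (Suc (b + i))) i" "R1 (Suc (b + i)) = R (Suc (b + i))"
          "m1 (Suc (Suc (b + i))) = R (Suc (b + i))" if "i < d" for i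
          using that R1(2) m1(3) by (simp_all add: R2_def)
        have Rm: "min (R (Suc (b + i))) (G (\<lambda>i. R (Suc (b + i))) i) \<le> m2 (Suc (Suc (b + i)))" if "i < d" for i
          using m2(3)[rule_format, of "Suc (b + i)"] Rd(1,2)[OF that] by simp
        show ?thesis
          by (rule exI, rule exI, rule conjI[OF sg]) (use m1(2) m2(2) Rb m2b Rd Rm in auto)
      qed
      obtain R0 where R0: "tr P A off b off R h R0" "R0 b = 0" "\<forall>i<d. R0 (Suc b + i) = init (\<lambda>i. R (\<rho> i)) i"
        using c1(2)[OF a(1)] by blast
      obtain m v' where v': "seg G (\<lambda>v. v 0 = 0) (init (\<lambda>i. R (\<rho> i))) m v'" "v' 0 \<noteq> 0"
        "f (\<lambda>i. R (\<rho> i)) = v' 1" using halt by blast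
      have "\<exists>\<mu> R'. bs P A h R0 \<mu> h R' \<and> h \<le> \<mu> 0 \<and> (\<forall>j\<le>b. \<mu> (Suc j) = R0 j \<and> R' j = R0 j) \<and>
        (\<forall>i<d. R' (Suc (b + i)) = v' i \<and> \<mu> (Suc (Suc (b + i))) \<le> m i \<and>
         min (m i) (v' i) \<le> \<mu> (Suc (Suc (b + i))))"
        by (rule loop_sim[OF v'(1) _ iter]) (use G d R0 in \<open>auto simp: cmp_def\<close>)
      then obtain \<mu> R1 where R1: "bs P A h R0 \<mu> h R1" "h \<le> \<mu> 0" "\<forall>j\<le>b. \<mu> (Suc j) = R0 j \<and> R1 j = R0 j"
        "\<forall>i<d. R1 (Suc (b + i)) = v' i" by blast
      have 1: "tr P A off b h R0 h R1" using R1 unfolding tr_def h_def by (intro exI[of _ \<mu>]) auto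
      have R1': "R1 b = 0" "R1 (Suc b) = v' 0" "R1 (b + 2) = v' 1"
        using R1(3,4) R0(2) d by (auto dest: spec[of _ 0] spec[of _ 1])
      have hoff: "off \<le> h" "off \<le> x" by (simp_all add: h_def x_def)
      have 2: "tr P A off b h R1 (Suc h) R1"
        by (rule tr_step[OF a(2)]) (use R1' v'(2) hoff in \<open>auto simp: a\<close>)
      have 3: "tr P A off b (Suc h) R1 x R1" by (rule tr_step[OF a(4)]) (use hoff in \<open>auto simp: a\<close>)
      have 4: "tr P A off b x R1 (Suc x) (R1(b := R1 (b + 2)))"
        by (rule tr_step[OF a(10)]) (use hoff in \<open>auto simp: a\<close>)
      have "tr P A off b off R (Suc x) (R1(b := R1 (b + 2)))"
        using tr_trans[OF tr_trans[OF tr_trans[OF tr_trans[OF R0(1) 1] 2] 3] 4] by simp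
      moreover have "Suc x = off + (n1 + 2 + n2 + d + 2)" by (simp add: x_def h_def)
      ultimately show ?thesis using R1' v'(3) by auto
    qed
    moreover have "length code = n1 + 2 + n2 + d + 2" by (simp add: code_def c1 c2 cp_def)
    ultimately show "\<exists>code. length code = n1 + 2 + n2 + d + 2 \<and> (\<forall>P. code_at P off code \<longrightarrow>
      (\<forall>R. \<exists>R'. tr P A off b off R (off + (n1 + 2 + n2 + d + 2)) R' \<and> R' b = f (\<lambda>i. R (\<rho> i))))"
      by blast
  qed
qed

lemma computable_if_rc:
  assumes "rc A (\<lambda>e. if e 0 \<in> x then 1 else 0)"
  shows "ITRM_computable_from x A"
proof -
  obtain k where k: "cmp A k (\<lambda>e. if e 0 \<in> x then 1 else 0)" using assms by (auto simp: rc_def)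
  have "frag A 1 (\<lambda>R R'. R' 1 = (if R 0 \<in> x then 1 else 0))"
    using k[unfolded cmp_def, THEN conjunct2, rule_format, of "\<lambda>_. 0" 1] by simp
  then have 0: "frag A 0 (\<lambda>R R'. R' 1 = (if R 0 \<in> x then 1 else 0))" by (rule frag_mono) simp_all
  have "frag A 0 (\<lambda>R R'. R' 0 = (if R 0 \<in> x then 1 else 0))"
    by (rule frag_mono[OF frag_seq[OF 0 frag_copy[of 0 0 A 1, OF order_refl] order_refl] _ order_refl]) (metis fun_upd_same)
  then obtain n where n: "\<forall>off. \<exists>code. length code = n \<and> (\<forall>P. code_at P off code \<longrightarrow> (\<forall>R. \<exists>R'. tr P A off 0 off R (off + n) R' \<and>
      R' 0 = (if R 0 \<in> x then 1 else 0)))" by (auto simp: frag_def)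
  from n[rule_format, of 0] obtain P where P: "length P = n" "\<And>Q R. code_at Q 0 P \<Longrightarrow> \<exists>R'. tr Q A 0 0 0 R n R' \<and>
      R' 0 = (if R 0 \<in> x then 1 else 0)" by auto
  have "code_at P 0 P" by (simp add: code_at_def)
  have "halts_with P A i (if i \<in> x then 1 else 0)" for i
  proof -
    obtain R' where R': "tr P A 0 0 0 ((\<lambda>_. 0)(0 := i)) n R'" "R' 0 = (if i \<in> x then 1 else 0)"
      using P(2)[OF \<open>code_at P 0 P\<close>, of "(\<lambda>_. 0)(0 := i)"] by auto
    then obtain m where "bs P A 0 ((\<lambda>_. 0)(0 := i)) m n R'" by (auto simp: tr_def)
    then show ?thesis using seg_halts_with[of P A i m "mk n R'"] R'(2) P(1) by (simp add: initial_def mok_def)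
  qed
  then show ?thesis unfolding ITRM_computable_from_def computes_from_def by blast
qed

lemma cmp_restrict:
  assumes "rc A f" "dep d f" "0 < d" shows "cmp A d f"
proof (rule cmpI[OF assms(2)])
  fix b and \<rho> :: "nat \<Rightarrow> nat" assume \<rho>: "\<forall>i<d. \<rho> i < b"
  obtain k where k: "cmp A k f" using assms(1) by (auto simp: rc_def)
  \<comment> \<open>Arguments beyond \<open>d\<close> are redirected to a register that is in use
    anyway; \<open>0 < d\<close> guarantees that there is one.\<close>
  define \<sigma> where "\<sigma> i = (if i < d then \<rho> i else \<rho> 0)" for i
  have "\<forall>i<k. \<sigma> i < b" using \<rho> assms(3) by (simp add: \<sigma>_def)
  then have "frag A b (\<lambda>R R'. R' b = f (\<lambda>i. R (\<sigma> i)))" using k by (simp add: cmp_def)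
  moreover have "f (\<lambda>i. R (\<sigma> i)) = f (\<lambda>i. R (\<rho> i))" for R
    by (rule depD[OF assms(2)]) (simp add: \<sigma>_def)
  ultimately show "frag A b (\<lambda>R R'. R' b = f (\<lambda>i. R (\<rho> i)))" by simp
qed

lemma run_dep:
  assumes G: "\<And>i. i < d \<Longrightarrow> dep d (\<lambda>v. G v i)" and vw: "\<forall>i<d. v i = w i"
  shows "\<forall>i<d. run G v t i = run G w t i"
proof (induction t rule: om1_induct)
  case zero
  then show ?case using vw by simp
next
  case (suc t)
  show ?case
  proof (intro allI impI)
    fix i assume i: "i < d"
    have "G (run G v t) i = G (run G w t) i" by (rule depD[OF G[OF i]]) (use suc in simp)
    then show "run G v (osuc t) i = run G w (osuc t) i" by simp
  qed
next
  case (lim t)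
  show ?case
  proof (intro allI impI)
    fix i assume i: "i < d"
    show "run G v t i = run G w t i"
      unfolding run_olim[OF lim(1)] by (rule lm_cong) (use lim(2) i in blast)
  qed
qed

text \<open>The source of the closure properties below: what a computable system that always stops
  shows at its stopping time is computable. The arity of \<open>f\<close> comes from that of
  \<open>init\<close>, since initial states that agree up to \<open>d\<close> stop together.\<close>

lemma rc_iterate:
  assumes G: "\<And>i. i < d \<Longrightarrow> rc A (\<lambda>v. G v i)" "\<And>i. i < d \<Longrightarrow> dep d (\<lambda>v. G v i)"
    and init: "\<And>i. i < d \<Longrightarrow> rc A (\<lambda>e. init e i)" and d: "2 \<le> d"
    and halt: "\<And>e. \<exists>t. init e 0 = 0 \<and> (\<forall>u<t. run G (init e) u 0 = 0) \<and> run G (init e) t 0 \<noteq> 0 \<and>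
      f e = run G (init e) t 1"
  shows "rc A f"
proof -
  obtain k where k: "\<forall>i<d. cmp A k (\<lambda>e. init e i)" using rc_list[of d A "\<lambda>i e. init e i"] init by blast
  have "dep k f" unfolding dep_def
  proof (intro allI impI)
    fix e e' :: vec assume e: "\<forall>i<k. e i = e' i"
    have ie: "init e i = init e' i" if "i < d" for i
      using k[rule_format, OF that, THEN cmp_imp_dep] e by (simp add: dep_def)
    have eq: "run G (init e) t i = run G (init e') t i" if "i < d" for t i
      using run_dep[of d G "init e" "init e'" t] G(2) ie that by blast
    obtain t where t: "\<forall>u<t. run G (init e) u 0 = 0" "run G (init e) t 0 \<noteq> 0" "f e = run G (init e) t 1"
      using halt by blast
    obtain t' where t': "\<forall>u<t'. run G (init e') u 0 = 0" "run G (init e') t' 0 \<noteq> 0" "f e' = run G (init e') t' 1"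
      using halt by blast
    have "t = t'" using t(1,2) t'(1,2) eq[of 0 t] eq[of 0 t'] d by (cases t t' rule: linorder_cases) auto
    then show "f e = f e'" using t(3) t'(3) eq[of 1] d by simp
  qed
  have "cmp A k f"
  proof (rule cmp_iterate[OF _ _ d \<open>dep k f\<close>])
    show "cmp A d (\<lambda>v. G v i)" if "i < d" for i using cmp_restrict[OF G[OF that]] d by simp
    show "cmp A k (\<lambda>e. init e i)" if "i < d" for i using k that by blast
    fix e
    obtain t where t: "init e 0 = 0" "\<forall>u<t. run G (init e) u 0 = 0" "run G (init e) t 0 \<noteq> 0"
      "f e = run G (init e) t 1" using halt by blast
    then have "ozero < t" by (metis ozero_le order_le_less run_ozero)
    then obtain m where "seg G (\<lambda>v. v 0 = 0) (run G (init e) ozero) m (run G (init e) t)"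
      using run_seg[of ozero t "\<lambda>v. v 0 = 0" G "init e"] t(2) by blast
    then show "\<exists>m v'. seg G (\<lambda>v. v 0 = 0) (init e) m v' \<and> v' 0 \<noteq> 0 \<and> f e = v' 1"
      using t(3,4) by auto
  qed
  then show ?thesis by (auto simp: rc_def)
qed

section \<open>Recursion, unbounded search and quantifiers\<close>

definition onat :: "nat \<Rightarrow> om1" where "onat n = (osuc ^^ n) ozero"

lemma onat_simps [simp]: "onat 0 = ozero" "onat (Suc n) = osuc (onat n)" by (simp_all add: onat_def)

lemma less_onat: "u < onat n \<Longrightarrow> \<exists>k<n. u = onat k"
proof (induction n)
  case (Suc n)
  then have "u < onat n \<or> u = onat n" by (auto simp: less_osuc_iff)
  then show ?case using Suc.IH less_SucI by blast
qed simp

lemma onat_strict: "onat n < onat (Suc n)" by simp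

lemma onat_mono: "m \<le> n \<Longrightarrow> onat m \<le> onat n"
  using lift_Suc_mono_le[of onat m n] onat_strict[THEN less_imp_le] by blast

definition rp :: "nat set \<Rightarrow> (vec \<Rightarrow> bool) \<Rightarrow> bool" where "rp A p \<longleftrightarrow> rc A (\<lambda>e. if p e then 1 else 0)"

lemma rc_const: "rc A (\<lambda>e. n)"
proof (induction n)
  case (Suc n) then show ?case by (rule rc_Suc)
qed (rule rc_zero)

lemma rp_const: "rp A (\<lambda>e. b)" using rc_const[of A "if b then 1 else 0"] by (simp add: rp_def)

lemma rc_if:
  assumes "rp A p" "rc A f" "rc A g" shows "rc A (\<lambda>e. if p e then f e else g e)"
proof -
  have "rc A (\<lambda>e. if (if p e then 1 else 0) = (1::nat) then f e else g e)"
    by (rule rc_if_eq) (use assms rc_const in \<open>auto simp: rp_def\<close>)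
  moreover have "(\<lambda>e. if (if p e then 1 else 0) = (1::nat) then f e else g e) = (\<lambda>e. if p e then f e else g e)"
    by auto
  ultimately show ?thesis by simp
qed

lemma rp_eq: "rc A f \<Longrightarrow> rc A g \<Longrightarrow> rp A (\<lambda>e. f e = g e)"
  unfolding rp_def by (rule rc_if_eq) (use rc_const in auto)

lemma rp_not: "rp A p \<Longrightarrow> rp A (\<lambda>e. \<not> p e)"
proof -
  assume *: "rp A p"
  have "(\<lambda>e. if p e then 0 else 1 :: nat) = (\<lambda>e. if \<not> p e then 1 else 0)" by auto
  then show ?thesis using rc_if[OF * rc_const rc_const, of 0 1] by (simp only: rp_def)
qed

lemma rp_conj: "rp A p \<Longrightarrow> rp A q \<Longrightarrow> rp A (\<lambda>e. p e \<and> q e)"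
proof -
  assume *: "rp A p" "rp A q"
  have "(\<lambda>e. if p e then if q e then 1 else 0 else 0 :: nat) = (\<lambda>e. if p e \<and> q e then 1 else 0)" by auto
  then show ?thesis using rc_if[OF *(1) *(2)[unfolded rp_def] rc_const, of 0] by (simp only: rp_def)
qed

lemma rp_disj: "rp A p \<Longrightarrow> rp A q \<Longrightarrow> rp A (\<lambda>e. p e \<or> q e)"
  using rp_not[OF rp_conj[OF rp_not rp_not, of A p q]] by simp

lemma rp_imp: "rp A p \<Longrightarrow> rp A q \<Longrightarrow> rp A (\<lambda>e. p e \<longrightarrow> q e)"
  unfolding imp_conv_disj by (intro rp_disj rp_not)

lemma rp_iff: "rp A p \<Longrightarrow> rp A q \<Longrightarrow> rp A (\<lambda>e. p e \<longleftrightarrow> q e)"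
  unfolding iff_conv_conj_imp by (intro rp_conj rp_imp)

lemma rp_oracle: "rc A f \<Longrightarrow> rp A (\<lambda>e. f e \<in> A)"
  unfolding rp_def by (rule rc_oracle)

lemma rc_rec:
  assumes "rc A z" "rc A (\<lambda>e. st (e 0) (e 1) (\<lambda>i. e (Suc (Suc i))))" "rc A n"
  shows "rc A (\<lambda>e. rec_nat (z e) (\<lambda>k s. st k s e) (n e))"
proof -
  obtain k where k: "cmp A k (\<lambda>e. st (e 0) (e 1) (\<lambda>i. e (Suc (Suc i))))" using assms(2) by (auto simp: rc_def)
  have st_cong: "st a b e = st a b e'" if "\<And>i. i < k \<Longrightarrow> e i = e' i" for a b e e'
  proof -
    define E where "E e = case_nat a (case_nat b e)" for e :: vec
    have "(\<lambda>e. st (e 0) (e 1) (\<lambda>i. e (Suc (Suc i)))) (E e) = (\<lambda>e. st (e 0) (e 1) (\<lambda>i. e (Suc (Suc i)))) (E e')"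
      by (rule depD[OF cmp_imp_dep[OF k]]) (use that in \<open>auto simp: E_def split: nat.splits\<close>)
    then show ?thesis by (simp add: E_def)
  qed
  define d where "d = 4 + k"
  \<comment> \<open>Components: 0 flag, 1 accumulator, 2 counter, 3 bound, parameters from 4
    on.\<close>
  define G :: "vec \<Rightarrow> vec" where "G v i = (if i = 0 then (if v 2 = v 3 then 1 else 0)
      else if i = 1 then (if v 2 = v 3 then v 1 else st (v 2) (v 1) (\<lambda>i. v (Suc (Suc (Suc (Suc i))))))
      else if i = 2 then Suc (v 2) else v i)" for v i
  define init :: "vec \<Rightarrow> vec" where "init e i = (if i = 0 then 0 else if i = 1 then z e else if i = 2 then 0
      else if i = 3 then n e else e (i - 4))" for e i
  show ?thesis
  proof (rule rc_iterate[where d = d and G = G and init = init])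
    fix i :: nat
    have stv: "rc A (\<lambda>v. st (v 2) (v 1) (\<lambda>i. v (Suc (Suc (Suc (Suc i))))))"
      using rc_comp[OF assms(2), of "\<lambda>i v. v (if i = 0 then 2 else if i = 1 then 1 else i + 2)"] rc_var
      by simp
    consider "i = 0" | "i = 1" | "i = 2" | "i \<noteq> 0" "i \<noteq> 1" "i \<noteq> 2" by blast
    then show "rc A (\<lambda>v. G v i)"
      by cases (auto simp: G_def intro!: rc_if_eq rc_var rc_const rc_Suc stv)
    consider "i = 0" | "i = 1" | "i = 2" | "i = 3" | "i \<noteq> 0" "i \<noteq> 1" "i \<noteq> 2" "i \<noteq> 3" by blast
    then show "rc A (\<lambda>e. init e i)"
      by cases (auto simp: init_def assms intro!: rc_var rc_const)
    assume i: "i < d"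
    show "dep d (\<lambda>v. G v i)" unfolding dep_def
    proof (intro allI impI)
      fix v w :: vec assume vw: "\<forall>i<d. v i = w i"
      have "st (v 2) (v 1) (\<lambda>i. v (Suc (Suc (Suc (Suc i))))) = st (v 2) (v 1) (\<lambda>i. w (Suc (Suc (Suc (Suc i)))))"
        by (rule st_cong) (use vw in \<open>simp add: d_def\<close>)
      moreover have "v 1 = w 1" "v 2 = w 2" "v 3 = w 3" "v i = w i" using vw i by (auto simp: d_def)
      ultimately show "G v i = G w i" by (simp add: G_def)
    qed
  next
    show "2 \<le> d" by (simp add: d_def)
  next
    fix e
    have run: "run G (init e) (onat j) = (\<lambda>i. if i = 0 then 0 else if i = 1 then rec_nat (z e) (\<lambda>k s. st k s e) j
      else if i = 2 then j else init e i)" if "j \<le> n e" for j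
      using that
    proof (induction j)
      case 0
      then show ?case by (auto simp: init_def fun_eq_iff)
    next
      case (Suc j)
      then have IH: "run G (init e) (onat j) = (\<lambda>i. if i = 0 then 0 else if i = 1 then rec_nat (z e) (\<lambda>k s. st k s e) j
        else if i = 2 then j else init e i)" by simp
      have "(\<lambda>i. init e (Suc (Suc (Suc (Suc i))))) = e" by (simp add: init_def)
      then show ?case using Suc.prems unfolding onat_simps run_osuc IH
        by (auto simp: G_def fun_eq_iff init_def)
    qed
    have "run G (init e) (osuc (onat (n e))) 0 = 1"
      "run G (init e) (osuc (onat (n e))) 1 = rec_nat (z e) (\<lambda>k s. st k s e) (n e)"
      unfolding run_osuc run[OF order_refl] by (simp_all add: G_def init_def)
    moreover have "\<forall>u<osuc (onat (n e)). run G (init e) u 0 = 0"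
    proof (intro allI impI)
      fix u assume "u < osuc (onat (n e))"
      then have "u < onat (Suc (n e))" by simp
      then obtain j where "u = onat j" "j \<le> n e" using less_onat less_Suc_eq_le by metis
      then show "run G (init e) u 0 = 0" using run by simp
    qed
    ultimately show "\<exists>t. init e 0 = 0 \<and> (\<forall>u<t. run G (init e) u 0 = 0) \<and> run G (init e) t 0 \<noteq> 0 \<and>
      rec_nat (z e) (\<lambda>k s. st k s e) (n e) = run G (init e) t 1"
      by (intro exI[of _ "osuc (onat (n e))"]) (simp add: init_def)
  qed
qed

text \<open>An unbounded search needs one limit step: there the counter overflows to 0 while the component
  3, which is 0 only initially, has become 1.\<close>

lemma rc_search:
  assumes "rc A (\<lambda>e. f (e 0) (\<lambda>i. e (Suc i)))"
  shows "rc A (\<lambda>e. if \<exists>j. f j e \<noteq> 0 then Suc (LEAST j. f j e \<noteq> 0) else 0)" (is "rc A ?F")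
proof -
  obtain k where k: "cmp A k (\<lambda>e. f (e 0) (\<lambda>i. e (Suc i)))" using assms by (auto simp: rc_def)
  have f_cong: "f a e = f a e'" if "\<And>i. i < k \<Longrightarrow> e i = e' i" for a e e'
  proof -
    define E where "E e = case_nat a e" for e :: vec
    have "(\<lambda>e. f (e 0) (\<lambda>i. e (Suc i))) (E e) = (\<lambda>e. f (e 0) (\<lambda>i. e (Suc i))) (E e')"
      by (rule depD[OF cmp_imp_dep[OF k]]) (use that in \<open>auto simp: E_def split: nat.splits\<close>)
    then show ?thesis by (simp add: E_def)
  qed
  define d where "d = 4 + k"
  define found where "found v \<longleftrightarrow> f (v 2) (\<lambda>i. v (Suc (Suc (Suc (Suc i))))) \<noteq> 0" for v :: vec
  \<comment> \<open>Component 2 is the counter and the parameters start at 4. The result in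
    component 1 is shifted by one, so that 0 can report failure.\<close>
  define G :: "vec \<Rightarrow> vec" where "G v i = (if i = 0 then (if v 2 = 0 \<and> v 3 = 1 then 1 else if found v then 1 else 0)
      else if i = 1 then (if v 2 = 0 \<and> v 3 = 1 then 0 else if found v then Suc (v 2) else 0)
      else if i = 2 then Suc (v 2) else if i = 3 then 1 else v i)" for v i
  define init :: "vec \<Rightarrow> vec" where "init e i = (if i < 4 then 0 else e (i - 4))" for e i
  show ?thesis
  proof (rule rc_iterate[where d = d and G = G and init = init])
    fix i :: nat
    have fv: "rp A found"
    proof -
      have "rc A (\<lambda>v. f (v 2) (\<lambda>i. v (Suc (Suc (Suc (Suc i))))))"
        using rc_comp[OF assms(1), of "\<lambda>i v. v (if i = 0 then 2 else Suc (Suc (Suc i)))"] rc_var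
        by simp
      then show ?thesis unfolding found_def by (intro rp_not rp_eq rc_const)
    qed
    consider "i = 0" | "i = 1" | "i = 2" | "i = 3" | "i \<noteq> 0" "i \<noteq> 1" "i \<noteq> 2" "i \<noteq> 3" by blast
    then show "rc A (\<lambda>v. G v i)"
      by cases (auto simp: G_def intro!: rc_if rp_conj rp_eq rc_var rc_const rc_Suc fv)
    show "rc A (\<lambda>e. init e i)" by (cases "i < 4") (auto simp: init_def intro!: rc_var rc_const)
    assume i: "i < d"
    show "dep d (\<lambda>v. G v i)" unfolding dep_def
    proof (intro allI impI)
      fix v w :: vec assume vw: "\<forall>i<d. v i = w i"
      have "f (v 2) (\<lambda>i. v (Suc (Suc (Suc (Suc i))))) = f (v 2) (\<lambda>i. w (Suc (Suc (Suc (Suc i)))))"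
        by (rule f_cong) (use vw in \<open>simp add: d_def\<close>)
      moreover have "v 1 = w 1" "v 2 = w 2" "v 3 = w 3" "v i = w i" using vw i by (auto simp: d_def)
      ultimately show "G v i = G w i" by (simp add: G_def found_def)
    qed
  next
    show "2 \<le> d" by (simp add: d_def)
  next
    fix e
    define S where "S j i = (if i < 2 then 0 else if i = 2 then j else if i = 3 then (if j = 0 then 0 else 1) else init e i)"
      for j i :: nat
    have fS: "found (S j) \<longleftrightarrow> f j e \<noteq> 0" for j
    proof -
      have "(\<lambda>i. S j (Suc (Suc (Suc (Suc i))))) = e" "S j 2 = j" by (simp_all add: S_def init_def)
      then show ?thesis by (simp add: found_def)
    qed
    have run: "run G (init e) (onat j) = S j" if "\<forall>l<j. f l e = 0" for j
      using that
    proof (induction j)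
      case 0
      then show ?case by (auto simp: init_def S_def fun_eq_iff)
    next
      case (Suc j)
      then have IH: "run G (init e) (onat j) = S j" by simp
      have "G (S j) i = S (Suc j) i" for i
        using Suc.prems fS[of j] by (auto simp: G_def S_def)
      then show ?case using IH by auto
    qed
    show "\<exists>t. init e 0 = 0 \<and> (\<forall>u<t. run G (init e) u 0 = 0) \<and> run G (init e) t 0 \<noteq> 0 \<and> ?F e = run G (init e) t 1"
    proof (cases "\<exists>j. f j e \<noteq> 0")
      case True
      define j where "j = (LEAST j. f j e \<noteq> 0)"
      have j: "f j e \<noteq> 0" "\<forall>l<j. f l e = 0"
        unfolding j_def using LeastI_ex[OF True] not_less_Least by blast+
      have r: "run G (init e) (onat l) = S l" if "l \<le> j" for l using run[of l] j(2) that by simp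
      have "run G (init e) (osuc (onat j)) 0 = 1" "run G (init e) (osuc (onat j)) 1 = Suc j"
        unfolding run_osuc r[OF order_refl] using fS[of j] j(1) by (simp_all add: G_def S_def)
      moreover have "\<forall>u<osuc (onat j). run G (init e) u 0 = 0"
      proof (intro allI impI)
        fix u assume "u < osuc (onat j)"
        then have "u < onat (Suc j)" by simp
        then obtain l where "u = onat l" "l \<le> j" using less_onat less_Suc_eq_le by metis
        then show "run G (init e) u 0 = 0" using r by (simp add: S_def)
      qed
      ultimately show ?thesis using True
        by (intro exI[of _ "osuc (onat j)"]) (simp add: init_def j_def)
    next
      case False
      then have r: "run G (init e) (onat j) = S j" for j using run by simp
      obtain t where t: "olim t" "\<forall>k. onat k < t" "\<forall>s<t. \<exists>k. s < onat k"
        using ex_limit_seq[of onat, OF onat_strict] by blast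
      have u: "\<exists>j. u = onat j" if "u < t" for u using t(3) that less_onat by blast
      have one: "\<exists>j\<ge>1. u = onat j" if u1: "onat 1 \<le> u" and u2: "u < t" for u
      proof -
        obtain j where j: "u = onat j" using u[OF u2] by blast
        then have "j \<noteq> 0" using u1 by (metis One_nat_def less_osuc not_le onat_simps)
        then show ?thesis using j by (intro exI[of _ j]) auto
      qed
      have r0: "run G (init e) w 0 = 0" if w: "w < t" for w
      proof -
        obtain j where "w = onat j" using u[OF w] by blast
        then show ?thesis using r[of j] by (simp add: S_def)
      qed
      have r3: "run G (init e) w 3 = 1" if w: "onat 1 \<le> w" "w < t" for w
      proof -
        obtain j where "j \<ge> 1" "w = onat j" using one[OF w] by blast
        then show ?thesis using r[of j] by (simp add: S_def)
      qed
      have "run G (init e) t 0 = 0"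
        unfolding run_olim[OF t(1)] by (rule lm_const[OF t(1) olim_pos[OF t(1)]]) (rule r0)
      moreover have "run G (init e) t 3 = 1"
        unfolding run_olim[OF t(1)] by (rule lm_const[OF t(1) t(2)[rule_format, of 1]]) (rule r3)
      moreover have "run G (init e) t 2 = 0"
      proof -
        have "enat v \<le> linf t (\<lambda>u. run G (init e) u 2)" for v
          unfolding le_linf_iff[OF t(1)]
        proof (intro exI[of _ "onat v"] conjI allI impI)
          show "onat v < t" using t(2) by blast
          fix w assume w: "onat v \<le> w" "w < t"
          then obtain j where j: "w = onat j" using u by blast
          have "v \<le> j"
          proof (rule ccontr)
            assume "\<not> v \<le> j"
            then have "onat (Suc j) \<le> onat v" by (intro onat_mono) simp
            then show False using w(1) j onat_strict[of j] by order
          qed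
          then show "v \<le> run G (init e) w 2" by (simp add: j r S_def)
        qed
        then have "linf t (\<lambda>u. run G (init e) u 2) = \<infinity>"
          by (metis enat_ord_simps(1) linorder_not_less not_infinity_eq Suc_n_not_le_n)
        then show ?thesis by (simp add: run_olim[OF t(1)] lm_def)
      qed
      ultimately have z: "run G (init e) t 0 = 0" "run G (init e) (osuc t) 0 = 1" "run G (init e) (osuc t) 1 = 0"
        by (simp_all add: G_def)
      moreover have "run G (init e) w 0 = 0" if "w < osuc t" for w
      proof (cases "w = t")
        case False
        then have "w < t" using that by (auto simp: less_osuc_iff)
        then show ?thesis by (rule r0)
      qed (use z in simp)
      ultimately show ?thesis using False by (intro exI[of _ "osuc t"]) (simp add: init_def)
    qed
  qed
qed

text \<open>One limit completes the search, so number quantifiers are decidable. In contrast to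
  ordinary computability, arithmetical definitions can be used as they are.\<close>

lemma rp_ex: assumes "rp A (\<lambda>e. p (e 0) (\<lambda>i. e (Suc i)))" shows "rp A (\<lambda>e. \<exists>j. p j e)"
proof -
  let ?f = "\<lambda>j e. if p j e then 1 else 0 :: nat"
  have "rc A (\<lambda>e. if \<exists>j. ?f j e \<noteq> 0 then Suc (LEAST j. ?f j e \<noteq> 0) else 0)"
    by (rule rc_search) (use assms in \<open>simp add: rp_def\<close>)
  then have "rp A (\<lambda>e. \<not> (if \<exists>j. ?f j e \<noteq> 0 then Suc (LEAST j. ?f j e \<noteq> 0) else 0) = 0)"
    by (intro rp_not rp_eq rc_const)
  moreover have "(\<not> (if \<exists>j. ?f j e \<noteq> 0 then Suc (LEAST j. ?f j e \<noteq> 0) else 0) = 0) \<longleftrightarrow> (\<exists>j. p j e)" for e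
    by auto
  ultimately show ?thesis by simp
qed

lemma rp_all: assumes "rp A (\<lambda>e. p (e 0) (\<lambda>i. e (Suc i)))" shows "rp A (\<lambda>e. \<forall>j. p j e)"
  using rp_not[OF rp_ex[of A "\<lambda>j e. \<not> p j e", OF rp_not[OF assms]]] by simp

lemma rc_Least:
  assumes "rp A (\<lambda>e. p (e 0) (\<lambda>i. e (Suc i)))" "\<And>e. \<exists>j. p j e"
  shows "rc A (\<lambda>e. LEAST j. p j e)"
proof -
  let ?f = "\<lambda>j e. if p j e then 1 else 0 :: nat"
  have 1: "rc A (\<lambda>e. if \<exists>j. ?f j e \<noteq> 0 then Suc (LEAST j. ?f j e \<noteq> 0) else 0)"
    by (rule rc_search) (use assms in \<open>simp add: rp_def\<close>)
  have 2: "(if \<exists>j. ?f j e \<noteq> 0 then Suc (LEAST j. ?f j e \<noteq> 0) else 0) = Suc (LEAST j. p j e)" for e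
    using assms(2)[of e] by simp
  have "rc A (\<lambda>e. rec_nat 0 (\<lambda>k s. k) (Suc (LEAST j. p j e)))"
    using rc_rec[OF rc_const[of A 0], where st = "\<lambda>k s e. k", OF rc_var 1] unfolding 2 .
  then show ?thesis by simp
qed

text \<open>For functions with a simple defining property, such as quotients, unpairings and
  operations on coded sets, this replaces an algorithm.\<close>

lemma rc_graph:
  assumes "rp A (\<lambda>e. p (e 0) (\<lambda>i. e (Suc i)))" "\<And>e j. p j e \<longleftrightarrow> j = f e"
  shows "rc A f"
proof -
  have "rc A (\<lambda>e. LEAST j. p j e)" by (rule rc_Least[OF assms(1)]) (use assms(2) in blast)
  moreover have "(LEAST j. p j e) = f e" for e unfolding assms(2) by (rule Least_equality) auto
  ultimately show ?thesis by simp
qed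

section \<open>Arithmetic, finite sets and pairing\<close>

lemma rc_add: assumes "rc A f" "rc A g" shows "rc A (\<lambda>e. f e + g e)"
proof -
  have "rec_nat a (\<lambda>k s. Suc s) b = a + b" for a b by (induction b) auto
  then show ?thesis using rc_rec[OF assms(1), where st = "\<lambda>k s e. Suc s", OF rc_Suc[OF rc_var] assms(2)] by simp
qed

lemma rc_comp1: "rc A (\<lambda>e. h (e 0)) \<Longrightarrow> rc A f \<Longrightarrow> rc A (\<lambda>e. h (f e))"
  using rc_comp[of A "\<lambda>e. h (e 0)" "\<lambda>i. f"] by simp

lemma rc_comp2:
  assumes "rc A (\<lambda>e. h (e 0) (e 1))" "rc A f" "rc A g" shows "rc A (\<lambda>e. h (f e) (g e))"
  using rc_comp[OF assms(1), of "\<lambda>i. if i = 0 then f else g"] assms(2,3) by simp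

lemma rp_comp2:
  assumes "rp A (\<lambda>e. h (e 0) (e 1))" "rc A f" "rc A g" shows "rp A (\<lambda>e. h (f e) (g e))"
  using rc_comp2[of A "\<lambda>a b. if h a b then 1 else 0"] assms by (simp add: rp_def)

lemma rc_mult: assumes "rc A f" "rc A g" shows "rc A (\<lambda>e. f e * g e)"
proof (rule rc_comp2[OF _ assms])
  have *: "rec_nat 0 (\<lambda>k s. s + a) b = a * b" for a b by (induction b) auto
  have "rc A (\<lambda>e. rec_nat 0 (\<lambda>k s. s + e 0) (e 1))"
    by (rule rc_rec) (intro rc_const rc_add rc_var)+
  then show "rc A (\<lambda>e. e 0 * e 1)" unfolding * .
qed

lemma rc_power: assumes "rc A f" "rc A g" shows "rc A (\<lambda>e. f e ^ g e)"
proof (rule rc_comp2[OF _ assms])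
  have *: "rec_nat 1 (\<lambda>k s. s * a) b = a ^ b" for a b :: nat by (induction b) auto
  have "rc A (\<lambda>e. rec_nat 1 (\<lambda>k s. s * e 0) (e 1))"
    by (rule rc_rec) (intro rc_const rc_mult rc_var)+
  then show "rc A (\<lambda>e. e 0 ^ e 1)" unfolding * .
qed

lemma rp_less: assumes "rc A f" "rc A g" shows "rp A (\<lambda>e. f e < g e)"
proof (rule rp_comp2[OF _ assms])
  have "rp A (\<lambda>e. \<exists>j. e 0 + Suc j = e 1)"
    by (rule rp_ex) (intro rp_eq rc_add rc_Suc rc_var)
  moreover have "(\<exists>j. a + Suc j = b) \<longleftrightarrow> a < b" for a b by (metis add_Suc_right less_iff_Suc_add)
  ultimately show "rp A (\<lambda>e. e 0 < e 1)" by simp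
qed

lemma rp_le: assumes "rc A f" "rc A g" shows "rp A (\<lambda>e. f e \<le> g e)"
  using rp_not[OF rp_less[OF assms(2,1)]] by (simp add: not_less)

lemma rc_div: assumes "rc A f" "rc A g" shows "rc A (\<lambda>e. f e div g e)"
proof (rule rc_comp2[OF _ assms], rule rc_graph)
  show "rp A (\<lambda>e. (\<lambda>j e. e 1 = 0 \<and> j = 0 \<or> e 1 \<noteq> 0 \<and> j * e 1 \<le> e 0 \<and> e 0 < Suc j * e 1) (e 0) (\<lambda>i. e (Suc i)))"
    by (intro rp_disj rp_conj rp_not rp_eq rp_le rp_less rc_const rc_mult rc_Suc rc_var)
  fix e :: vec and j
  show "(e 1 = 0 \<and> j = 0 \<or> e 1 \<noteq> 0 \<and> j * e 1 \<le> e 0 \<and> e 0 < Suc j * e 1) \<longleftrightarrow> j = e 0 div e 1"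
  proof (cases "e 1 = 0")
    case False
    then show ?thesis
      using div_nat_eqI[of "e 1" j "e 0"] div_times_less_eq_dividend[of "e 0" "e 1"]
        dividend_less_div_times[of "e 1" "e 0"] by (auto simp: mult.commute)
  qed simp
qed

lemma rc_mod: assumes "rc A f" "rc A g" shows "rc A (\<lambda>e. f e mod g e)"
proof (rule rc_comp2[OF _ assms], rule rc_graph)
  show "rp A (\<lambda>e. (\<lambda>j e. e 0 div e 1 * e 1 + j = e 0) (e 0) (\<lambda>i. e (Suc i)))"
    by (intro rp_eq rc_add rc_div rc_mult rc_var)
  fix e :: vec and j
  show "e 0 div e 1 * e 1 + j = e 0 \<longleftrightarrow> j = e 0 mod e 1" using div_mult_mod_eq[of "e 0" "e 1"] by linarith
qed

lemma rp_set_decode: assumes "rc A f" "rc A g" shows "rp A (\<lambda>e. f e \<in> set_decode (g e))"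
  unfolding set_decode_def mem_Collect_eq odd_iff_mod_2_eq_one
  by (intro rp_eq rc_mod rc_div rc_power rc_const assms)

lemma rc_prod_encode: assumes "rc A f" "rc A g" shows "rc A (\<lambda>e. prod_encode (f e, g e))"
  unfolding prod_encode_def triangle_def prod.case
  by (intro rc_add rc_div rc_mult rc_Suc rc_const assms)

lemma rc_fst_decode: assumes "rc A f" shows "rc A (\<lambda>e. fst (prod_decode (f e)))"
proof (rule rc_comp1[OF _ assms], rule rc_graph)
  show "rp A (\<lambda>e. (\<lambda>j e. \<exists>k. prod_encode (j, k) = e 0) (e 0) (\<lambda>i. e (Suc i)))"
    by (rule rp_ex) (intro rp_eq rc_prod_encode rc_var)
  fix e :: vec and j
  show "(\<exists>k. prod_encode (j, k) = e 0) \<longleftrightarrow> j = fst (prod_decode (e 0))"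
    by (metis fst_conv prod.collapse prod_decode_inverse prod_encode_inverse)
qed

lemma rc_snd_decode: assumes "rc A f" shows "rc A (\<lambda>e. snd (prod_decode (f e)))"
proof (rule rc_comp1[OF _ assms], rule rc_graph)
  show "rp A (\<lambda>e. (\<lambda>j e. \<exists>k. prod_encode (k, j) = e 0) (e 0) (\<lambda>i. e (Suc i)))"
    by (rule rp_ex) (intro rp_eq rc_prod_encode rc_var)
  fix e :: vec and j
  show "(\<exists>k. prod_encode (k, j) = e 0) \<longleftrightarrow> j = snd (prod_decode (e 0))"
    by (metis snd_conv prod.collapse prod_decode_inverse prod_encode_inverse)
qed

lemmas rc_intros = rc_const rc_var rc_Suc rc_add rc_mult rc_power rc_div rc_mod
  rc_prod_encode rc_fst_decode rc_snd_decode rp_set_decode rp_less rp_le rp_eq rp_not rp_conj rp_disj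
  rp_imp rp_iff rp_const rc_if rp_ex rp_all rp_oracle

section \<open>Loop detection\<close>

text \<open>The premises make the infimum over one round equal to the recurring state itself. Hence
  the round can be repeated, and a limit of rounds shows the same state again, so the run never
  leaves the loop.\<close>

lemma strong_loop:
  assumes "s < t" "run F v s = run F v t" "\<And>u i. s \<le> u \<Longrightarrow> u \<le> t \<Longrightarrow> run F v s i \<le> run F v u i"
  shows "\<exists>l'\<ge>l. run F v l' = run F v s"
proof -
  define c where "c = run F v s"
  obtain m where m: "seg F (\<lambda>_. True) (run F v s) m (run F v t)" "is_inf (run F v) s t m"
    using run_seg[OF assms(1), of "\<lambda>_. True"] by blast
  have "m = c"
  proof
    fix i
    obtain u where "s \<le> u" "u < t" "run F v u i = m i" using m(2) unfolding is_inf_def by blast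
    then have "c i \<le> m i" using assms(3)[of u i] by (simp add: c_def)
    moreover have "m i \<le> c i" using seg_le_start[OF m(1)] by (simp add: c_def)
    ultimately show "m i = c i" by simp
  qed
  then have sg: "seg F (\<lambda>_. True) c c c" using m(1) assms(2) by (simp add: c_def)
  \<comment> \<open>The recurrences up to which the run has not dropped below \<open>c\<close>. They
    have no last element and are closed under limits, hence unbounded.\<close>
  define X where "X = {l. s \<le> l \<and> run F v l = c \<and> (\<forall>u i. s \<le> u \<longrightarrow> u \<le> l \<longrightarrow> c i \<le> run F v u i)}"
  have nxt: "\<exists>l'\<in>X. l < l'" if l: "l \<in> X" for l
  proof -
    obtain l' where l': "l < l'" "run F v l' = c" "is_inf (run F v) l l' c"
      using seg_run[OF sg, of v l] l by (auto simp: X_def)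
    have "c i \<le> run F v u i" if "s \<le> u" "u \<le> l'" for u i
    proof -
      consider "u \<le> l" | "l \<le> u" "u < l'" | "u = l'" using \<open>u \<le> l'\<close> by force
      then show ?thesis
        using l l'(2,3) \<open>s \<le> u\<close> by cases (auto simp: X_def is_inf_def)
    qed
    then have "l' \<in> X" using l l'(1,2) by (auto simp: X_def)
    then show ?thesis using l'(1) by blast
  qed
  have "\<exists>x\<in>X. l \<le> x" for l
  proof (induction l rule: less_induct)
    case (less l)
    have sX: "s \<in> X"
    proof -
      have "u = s" if "s \<le> u" "u \<le> s" for u using that by simp
      then show ?thesis by (auto simp: X_def c_def)
    qed
    show ?case
    proof (rule ccontr)
      assume no: "\<not> ?thesis"
      then have sl: "s < l" using sX by force
      have cof: "\<exists>x\<in>X. y \<le> x \<and> x < l" if "y < l" for y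
        using less.IH[OF that] no by (force simp: not_le)
      have "olim l"
      proof (rule ccontr)
        assume "\<not> olim l"
        then obtain y where y: "l = osuc y" using sl by (cases l rule: om1_cases) auto
        then obtain x where "x \<in> X" "y \<le> x" using cof[of y] by auto
        then obtain x' where "x' \<in> X" "x < x'" using nxt by blast
        then have "l \<le> x'" using y \<open>y \<le> x\<close> by (simp add: osuc_le_iff order_le_less_trans)
        then show False using no \<open>x' \<in> X\<close> by blast
      qed
      have ge: "c i \<le> run F v u i" if "s \<le> u" "u < l" for u i
        using cof[OF that(2)] that(1) by (auto simp: X_def)
      have "run F v l i = c i" for i
        unfolding run_olim[OF \<open>olim l\<close>]
      proof (rule lm_eqI(2)[OF \<open>olim l\<close> sl])
        fix y assume "y < l"
        then obtain x where "x \<in> X" "y \<le> x" "x < l" using cof by blast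
        then show "\<exists>u. y \<le> u \<and> u < l \<and> run F v u i = c i" by (auto simp: X_def)
      qed (rule ge)
      then have "run F v l = c" by blast
      then have "l \<in> X" using ge sl by (auto simp: X_def order_le_less)
      then show False using no by blast
    qed
  qed
  then obtain x where "x \<in> X" "l \<le> x" by blast
  then show ?thesis by (auto simp: X_def c_def)
qed

text \<open>Some value is taken at arbitrarily late times, for otherwise countably many bounds would
  exhaust all times. The least such value is \<open>v\<close>, and the smaller ones are eventually
  avoided.\<close>

lemma unbounded_min:
  fixes f :: "om1 \<Rightarrow> nat"
  shows "\<exists>v \<gamma>. (\<forall>u\<ge>\<gamma>. v \<le> f u) \<and> (\<forall>s. \<exists>u\<ge>s. f u = v)"
proof -
  define Q where "Q v \<longleftrightarrow> (\<forall>s. \<exists>u\<ge>s. f u = v)" for v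
  have ev: "\<exists>s. \<forall>u\<ge>s. f u \<noteq> v" if "\<not> Q v" for v using that by (auto simp: Q_def)
  have "\<exists>v. Q v"
  proof (rule ccontr)
    assume "\<nexists>v. Q v"
    then have "\<forall>v. \<exists>s. \<forall>u\<ge>s. f u \<noteq> v" using ev by blast
    then obtain s where s: "\<And>v u. s v \<le> u \<Longrightarrow> f u \<noteq> v" by metis
    obtain b where "\<forall>x\<in>range s. x < b" using om1_bounded[of "range s"] by auto
    then have "f b \<noteq> v" for v using s[of v b] by (simp add: less_imp_le)
    then show False by blast
  qed
  define v where "v = (LEAST v. Q v)"
  have v: "Q v" "\<And>w. w < v \<Longrightarrow> \<not> Q w"
    unfolding v_def using LeastI_ex[OF \<open>\<exists>v. Q v\<close>] not_less_Least by blast+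
  have "\<forall>w. \<exists>s. w < v \<longrightarrow> (\<forall>u\<ge>s. f u \<noteq> w)" using ev v(2) by blast
  then obtain s where s: "\<And>w u. w < v \<Longrightarrow> s w \<le> u \<Longrightarrow> f u \<noteq> w" by metis
  obtain b where b: "\<forall>x\<in>range s. x < b" using om1_bounded[of "range s"] by auto
  have "v \<le> f u" if "b \<le> u" for u
  proof (rule ccontr)
    assume "\<not> v \<le> f u"
    moreover have "s (f u) \<le> u" using b that by (meson less_imp_le order_trans rangeI)
    ultimately show False using s[of "f u" u] by simp
  qed
  then show ?thesis using v(1) unfolding Q_def by blast
qed

text \<open>Between two successive members of the constructed sequence every component attains its
  minimal value, so the limit of the sequence shows all these values at once.\<close>

lemma recurrent_limit:
  fixes X :: "om1 \<Rightarrow> vec"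
  assumes I: "finite I" and v: "\<And>i u. i \<in> I \<Longrightarrow> \<gamma> \<le> u \<Longrightarrow> v i \<le> X u i" "\<And>i s. i \<in> I \<Longrightarrow> \<exists>u\<ge>s. X u i = v i"
  shows "\<exists>t>s. olim t \<and> (\<forall>i\<in>I. lm t (\<lambda>u. X u i) = v i)"
proof -
  have "\<forall>s. \<exists>t>s. \<forall>i\<in>I. \<exists>u. s \<le> u \<and> u < t \<and> X u i = v i"
  proof
    fix s
    have "\<forall>i. \<exists>u. i \<in> I \<longrightarrow> s \<le> u \<and> X u i = v i" using v(2) by blast
    then obtain u where u: "\<And>i. i \<in> I \<Longrightarrow> s \<le> u i \<and> X (u i) i = v i" by metis
    have "countable (insert s (u ` I))" using I by (simp add: countable_finite)
    from om1_bounded[OF this] obtain b where b: "\<forall>x\<in>insert s (u ` I). x < b" by blast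
    then show "\<exists>t>s. \<forall>i\<in>I. \<exists>u. s \<le> u \<and> u < t \<and> X u i = v i" using u by blast
  qed
  then obtain nx where nx: "\<And>s. s < nx s" "\<And>s i. i \<in> I \<Longrightarrow> \<exists>u. s \<le> u \<and> u < nx s \<and> X u i = v i" by metis
  define a where "a k = (nx ^^ k) (nx (max s \<gamma>))" for k
  have a: "a (Suc k) = nx (a k)" for k by (simp add: a_def)
  obtain t where t: "olim t" "\<forall>k. a k < t" "\<forall>y<t. \<exists>k. y < a k"
    using ex_limit_seq[of a] nx(1) a by metis
  have g: "max s \<gamma> < t"
    by (rule order_less_trans[OF nx(1)[of "max s \<gamma>"]]) (use t(2)[rule_format, of 0] in \<open>simp add: a_def\<close>)
  have "lm t (\<lambda>u. X u i) = v i" if i: "i \<in> I" for i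
  proof (rule lm_eqI(2)[OF t(1), of \<gamma>])
    show "\<gamma> < t" using g by simp
    show "v i \<le> X u i" if "\<gamma> \<le> u" for u using v(1)[OF i that] .
    fix y assume "y < t"
    then obtain k where k: "y < a k" using t(3) by blast
    obtain u where u: "a k \<le> u" "u < a (Suc k)" "X u i = v i" using nx(2)[OF i, of "a k"] a by metis
    then show "\<exists>u\<ge>y. u < t \<and> X u i = v i" using k t(2)[rule_format, of "Suc k"] by (intro exI[of _ u]) force
  qed
  then show ?thesis using t(1) g by auto
qed

subsection \<open>Coding finite sequences\<close>

definition prj :: "nat \<Rightarrow> nat \<Rightarrow> nat" where
  "prj k c = fst (prod_decode (((\<lambda>s. snd (prod_decode s)) ^^ k) c))"

text \<open>The final 0 unpairs into zeros forever, so entries beyond the length read as 0. The end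
  of a coded program will be recognised in this way.\<close>

primrec encv :: "nat \<Rightarrow> vec \<Rightarrow> nat" where
  "encv 0 v = 0"
| "encv (Suc n) v = prod_encode (v 0, encv n (\<lambda>i. v (Suc i)))"

lemma prj_Suc: "prj (Suc k) c = prj k (snd (prod_decode c))"
  by (simp add: prj_def funpow_Suc_right del: funpow.simps)

lemma prj_0: "prj 0 c = fst (prod_decode c)" by (simp add: prj_def)

lemma prod_decode_0: "prod_decode 0 = (0, 0)"
  using prod_encode_inverse[of "(0, 0)"] by (simp add: prod_encode_def)

lemma prj_of_0: "prj k 0 = 0"
  by (induction k) (simp_all add: prj_0 prj_Suc prod_decode_0)

lemma prj_encv: "prj k (encv n v) = (if k < n then v k else 0)"
proof (induction n arbitrary: k v)
  case 0
  then show ?case by (simp add: prj_of_0)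
next
  case (Suc n)
  then show ?case by (cases k) (simp_all add: prj_0 prj_Suc)
qed

lemma encv_cong: "(\<And>i. i < n \<Longrightarrow> v i = w i) \<Longrightarrow> encv n v = encv n w"
proof (induction n arbitrary: v w)
  case (Suc n)
  have "encv n (\<lambda>i. v (Suc i)) = encv n (\<lambda>i. w (Suc i))" by (rule Suc.IH) (use Suc.prems in simp)
  then show ?case using Suc.prems[of 0] by simp
qed simp

lemma finite_encv_le: "finite {encv n w |w. \<forall>i<n. w i \<le> b i}"
proof (induction n arbitrary: b)
  case (Suc n)
  have "{encv (Suc n) w |w. \<forall>i<Suc n. w i \<le> b i} \<subseteq>
      prod_encode ` ({..b 0} \<times> {encv n w |w. \<forall>i<n. w i \<le> b (Suc i)})"
  proof
    fix x assume "x \<in> {encv (Suc n) w |w. \<forall>i<Suc n. w i \<le> b i}"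
    then obtain w where w: "x = encv (Suc n) w" "\<forall>i<Suc n. w i \<le> b i" by blast
    then have "encv n (\<lambda>i. w (Suc i)) \<in> {encv n w |w. \<forall>i<n. w i \<le> b (Suc i)}" by force
    moreover have "w 0 \<in> {..b 0}" using w(2) by simp
    ultimately show "x \<in> prod_encode ` ({..b 0} \<times> {encv n w |w. \<forall>i<n. w i \<le> b (Suc i)})"
      using w(1) by simp
  qed
  then show ?case by (rule finite_subset) (use Suc.IH[of "\<lambda>i. b (Suc i)"] in simp)
qed simp

lemma rc_prj: assumes "rc A f" "rc A g" shows "rc A (\<lambda>e. prj (f e) (g e))"
proof (rule rc_comp2[OF _ assms])
  have *: "rec_nat c (\<lambda>k s. snd (prod_decode s)) k = ((\<lambda>s. snd (prod_decode s)) ^^ k) c" for c k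
    by (induction k) auto
  have "rc A (\<lambda>e. rec_nat (e 1) (\<lambda>k s. snd (prod_decode s)) (e 0))"
    by (rule rc_rec) (intro rc_intros)+
  then show "rc A (\<lambda>e. prj (e 0) (e 1))" unfolding * prj_def by (rule rc_fst_decode)
qed

lemma rc_encv: "(\<And>i. i < n \<Longrightarrow> rc A (g i)) \<Longrightarrow> rc A (\<lambda>e. encv n (\<lambda>i. g i e))"
proof (induction n arbitrary: g)
  case (Suc n)
  have "rc A (\<lambda>e. encv n (\<lambda>i. g (Suc i) e))" by (rule Suc.IH) (use Suc.prems in simp)
  then show ?case using Suc.prems[of 0] by (simp add: rc_prod_encode)
qed (simp add: rc_const)

lemma rp_ball: "(\<And>i. i < n \<Longrightarrow> rp A (p i)) \<Longrightarrow> rp A (\<lambda>e. \<forall>i<(n::nat). p i e)"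
proof (induction n)
  case (Suc n)
  have "(\<forall>i<Suc n. p i e) \<longleftrightarrow> p n e \<and> (\<forall>i<n. p i e)" for e by (auto simp: less_Suc_eq)
  then show ?case using rp_conj[of A "p n" "\<lambda>e. \<forall>i<n. p i e"] Suc by simp
qed (simp add: rp_const)

text \<open>Finite sets are coded by binary digits, where a subset never has a larger code. Hence a
  register with such codes overflows only if the sets are eventually not contained in any given
  finite set.\<close>

definition flt :: "nat \<Rightarrow> nat \<Rightarrow> vec \<Rightarrow> nat" where
  "flt D W v = set_encode {c \<in> set_decode W. \<forall>i<D. prj i c \<le> v i}"

definition ins :: "nat \<Rightarrow> nat \<Rightarrow> nat" where
  "ins W c = set_encode (insert c (set_decode W))"

lemma set_decode_flt: "set_decode (flt D W v) = {c \<in> set_decode W. \<forall>i<D. prj i c \<le> v i}"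
  by (simp add: flt_def)

lemma set_decode_ins: "set_decode (ins W c) = insert c (set_decode W)"
  by (simp add: ins_def)

lemma eq_set_decode_iff: "X = Y \<longleftrightarrow> (\<forall>c. c \<in> set_decode X \<longleftrightarrow> c \<in> set_decode Y)"
  by (metis set_decode_inverse set_eqI)

definition zc :: "nat \<Rightarrow> vec \<Rightarrow> nat" where "zc D v = card {i. i < D \<and> v i = 0}"

lemma zc_le: "zc D v \<le> D"
  unfolding zc_def using card_mono[of "{..<D}" "{i. i < D \<and> v i = 0}"] by auto

lemma zc_Suc: "zc (Suc D) v = zc D v + (if v D = 0 then 1 else 0)"
proof -
  have "{i. i < Suc D \<and> v i = 0} = (if v D = 0 then insert D {i. i < D \<and> v i = 0} else {i. i < D \<and> v i = 0})"
    by (auto simp: less_Suc_eq)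
  then show ?thesis by (simp add: zc_def)
qed

lemma rc_zc: "(\<And>i. i < D \<Longrightarrow> rc A (g i)) \<Longrightarrow> rc A (\<lambda>e. zc D (\<lambda>i. g i e))"
proof (induction D)
  case 0
  then show ?case by (simp add: zc_def rc_const)
next
  case (Suc D)
  have "rc A (\<lambda>e. zc D (\<lambda>i. g i e) + (if g D e = 0 then 1 else 0))"
    by (intro rc_add rc_if rp_eq rc_const Suc.IH Suc.prems) auto
  then show ?case by (simp add: zc_Suc)
qed

subsection \<open>The looping-aware system\<close>

definition cfg :: "nat \<Rightarrow> vec \<Rightarrow> vec" where "cfg D s = (\<lambda>i. if i < D then s (Suc (Suc i)) else 0)"

definition wreg :: "nat \<Rightarrow> nat \<Rightarrow> nat" where "wreg D j = Suc (Suc (D + j))"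

text \<open>Component 0 is the status (1 for halted, 2 for looping), component 1 the phase, and the
  components \<open>wreg D j\<close> code the sets of those past configurations with \<open>j\<close> zeros below which the
  run has not dropped since. Splitting by the number of zeros is what makes these sets survive the
  resetting of overflowing components.\<close>

definition bstep :: "nat \<Rightarrow> (vec \<Rightarrow> vec) \<Rightarrow> (vec \<Rightarrow> bool) \<Rightarrow> vec \<Rightarrow> vec" where
  "bstep D F hal s = (if s 0 \<noteq> 0 then s
     else if s 1 = 0 then s(0 := (if hal (cfg D s) then 1 else 0), 1 := 1)
     else (\<lambda>i. if i = 1 then 0 else if 2 \<le> i \<and> i < Suc (Suc D) then F (cfg D s) (i - 2) else s i))"

text \<open>Phase 0 compares the configuration with the stored ones and filters the sets; phase 1
  makes the step and stores the old configuration. As filtering and storing are different steps, a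
  register holds the bare filtered set in between, and its limit inferior notices this.\<close>

definition lstep :: "nat \<Rightarrow> (vec \<Rightarrow> vec) \<Rightarrow> (vec \<Rightarrow> bool) \<Rightarrow> vec \<Rightarrow> vec" where
  "lstep D F hal s = (if s 0 \<noteq> 0 then s
     else if s 1 = 0 then (\<lambda>i. if i = 0 then
         (if encv D (cfg D s) \<in> set_decode (s (wreg D (zc D (cfg D s)))) then 2
          else if hal (cfg D s) then 1 else 0)
       else if i = 1 then 1 else if i < Suc (Suc D) then s i
       else if i \<le> wreg D D then flt D (s i) (cfg D s) else s i)
     else (\<lambda>i. if i = 1 then 0 else if 2 \<le> i \<and> i < Suc (Suc D) then F (cfg D s) (i - 2)
       else if i = wreg D (zc D (cfg D s)) then ins (s i) (encv D (cfg D s)) else s i))"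

locale loop_system =
  fixes D :: nat and F :: "vec \<Rightarrow> vec" and hal :: "vec \<Rightarrow> bool"
begin

definition C :: "om1 \<Rightarrow> vec" where "C = run (lstep D F hal) (\<lambda>_. 0)"
definition B :: "om1 \<Rightarrow> vec" where "B = run (bstep D F hal) (\<lambda>_. 0)"

abbreviation cf :: "om1 \<Rightarrow> vec" where "cf t \<equiv> cfg D (C t)"
abbreviation WW :: "nat \<Rightarrow> om1 \<Rightarrow> nat set" where "WW j t \<equiv> set_decode (C t (wreg D j))"
abbreviation lec :: "nat \<Rightarrow> vec \<Rightarrow> bool" where "lec c v \<equiv> \<forall>i<D. prj i c \<le> v i"

lemma C_osuc: "C (osuc t) = lstep D F hal (C t)" by (simp add: C_def)
lemma C_olim: "olim t \<Longrightarrow> C t i = lm t (\<lambda>u. C u i)" by (simp add: C_def run_olim)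
lemma C_zero: "C ozero = (\<lambda>_. 0)" by (simp add: C_def)

lemma C_frozen: "C t 0 \<noteq> 0 \<Longrightarrow> t \<le> u \<Longrightarrow> C u = C t"
  unfolding C_def by (rule run_fixed) (simp_all add: lstep_def)

lemma B_frozen: "B t 0 \<noteq> 0 \<Longrightarrow> t \<le> u \<Longrightarrow> B u = B t"
  unfolding B_def by (rule run_fixed) (simp_all add: bstep_def)

lemma C_running: "C t 0 = 0 \<Longrightarrow> u \<le> t \<Longrightarrow> C u 0 = 0"
  using C_frozen[of u t] by metis

text \<open>While the run is on, the phases alternate, so phase 0 occurs cofinally often.
  Consequently every limit configuration is tested for recurrence.\<close>

lemma phase_olim:
  assumes t: "olim t" "C t 0 = 0" shows "C t 1 = 0"
proof (rule ccontr)
  assume "C t 1 \<noteq> 0"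
  then have "1 \<le> lm t (\<lambda>u. C u 1)" using t by (simp add: C_olim)
  then obtain s where s: "s < t" "\<forall>u. s \<le> u \<longrightarrow> u < t \<longrightarrow> 1 \<le> C u 1" using le_lm[OF t(1)] by blast
  have "C s 0 = 0" using C_running[OF t(2)] s(1) by simp
  moreover have "C s 1 \<noteq> 0" using s by auto
  ultimately have "C (osuc s) 1 = 0" by (simp add: C_osuc lstep_def)
  moreover have "1 \<le> C (osuc s) 1" using s olim_osuc[OF t(1) s(1)] by (simp add: less_imp_le)
  ultimately show False by simp
qed

lemma phase1:
  assumes "C t 0 = 0" "C t 1 \<noteq> 0"
  shows "\<exists>s. t = osuc s \<and> C s 0 = 0 \<and> C s 1 = 0 \<and> cf t = cf s \<and> (\<forall>j\<le>D. WW j t = {c \<in> WW j s. lec c (cf s)})"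
proof -
  obtain s where s: "t = osuc s"
    using assms phase_olim by (cases t rule: om1_cases) (auto simp: C_zero)
  have s0: "C s 0 = 0" using C_running[OF assms(1), of s] s by (simp add: less_imp_le)
  have s1: "C s 1 = 0" using assms(2) s0 by (auto simp: s C_osuc lstep_def split: if_splits)
  have "cf t = cf s" using s0 s1 by (auto simp: s C_osuc lstep_def cfg_def fun_eq_iff)
  moreover have "WW j t = {c \<in> WW j s. lec c (cf s)}" if "j \<le> D" for j
    using s0 s1 that by (simp add: s C_osuc lstep_def wreg_def set_decode_flt)
  ultimately show ?thesis using s s0 s1 by blast
qed

text \<open>A register that is not 0 at a limit has not overflowed there, so its value was attained
  cofinally often before.\<close>

lemma W_olim:
  assumes t: "olim t" "s < t" and c: "c \<in> WW j t"
  shows "\<exists>u. s \<le> u \<and> u < t \<and> C u (wreg D j) = C t (wreg D j)"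
proof (cases rule: lm_cases[OF t(1), of "\<lambda>u. C u (wreg D j)", case_names fin inf])
  case (fin w s')
  then show ?thesis using t by (simp add: C_olim)
next
  case inf
  then show ?thesis using c t by (simp add: C_olim set_decode_0)
qed

lemma W_succ0:
  assumes "C t 0 = 0" "C t 1 = 0" "j \<le> D"
  shows "WW j (osuc t) = {c \<in> WW j t. lec c (cf t)}"
  using assms by (simp add: C_osuc lstep_def wreg_def set_decode_flt)

lemma W_succ1:
  assumes "C t 0 = 0" "C t 1 \<noteq> 0" "j \<le> D"
  shows "WW j (osuc t) = (if j = zc D (cf t) then insert (encv D (cf t)) (WW j t) else WW j t)"
  using assms zc_le[of D "cf t"] by (auto simp: C_osuc lstep_def wreg_def set_decode_ins)

text \<open>Configurations from a testing phase below which the run has not dropped since; if one of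
  them recurs, the premises of \<open>strong_loop\<close> hold.\<close>

definition alive :: "om1 \<Rightarrow> nat \<Rightarrow> bool" where
  "alive t c \<longleftrightarrow> (\<exists>s<t. encv D (cf s) = c \<and> C s 1 = 0 \<and> C s 0 = 0 \<and> (\<forall>u. s \<le> u \<longrightarrow> u < t \<longrightarrow> lec c (cf u)))"

definition cmpb :: "nat \<Rightarrow> nat \<Rightarrow> bool" where
  "cmpb c c' \<longleftrightarrow> lec c (\<lambda>i. prj i c') \<or> lec c' (\<lambda>i. prj i c)"

lemma alive_osuc: "alive t c \<Longrightarrow> lec c (cf t) \<Longrightarrow> alive (osuc t) c"
proof -
  assume a: "alive t c" and le: "lec c (cf t)"
  obtain s where s: "s < t" "encv D (cf s) = c" "C s 1 = 0" "C s 0 = 0"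
    "\<forall>u. s \<le> u \<longrightarrow> u < t \<longrightarrow> lec c (cf u)" using a unfolding alive_def by blast
  have "lec c (cf u)" if "s \<le> u" "u < osuc t" for u
  proof (cases "u = t")
    case False
    then have "u < t" using that(2) by (simp add: less_osuc_iff)
    then show ?thesis using s(5) that(1) by blast
  qed (use le in simp)
  moreover have "s < osuc t" using s(1) by (simp add: less_osuc_iff)
  ultimately show "alive (osuc t) c" unfolding alive_def using s(2-4) by blast
qed

text \<open>A new member lies above all old ones, because the sets have just been filtered by the
  same configuration; so the members form a chain. Liveness is claimed only for members below the
  present configuration, since the next filtering may still be to come.\<close>

lemma W_invariant:
  assumes "C t 0 = 0" "j \<le> D" "c \<in> WW j t"
  shows "c = encv D (\<lambda>i. prj i c)" "zc D (\<lambda>i. prj i c) = j" "c' \<in> WW j t \<Longrightarrow> cmpb c c'"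
    "lec c (cf t) \<Longrightarrow> alive t c"
proof -
  define code where "code c \<longleftrightarrow> c = encv D (\<lambda>i. prj i c) \<and> zc D (\<lambda>i. prj i c) = j" for c
  have "\<forall>c\<in>WW j t. code c \<and> (\<forall>c'\<in>WW j t. cmpb c c') \<and> (lec c (cf t) \<longrightarrow> alive t c)"
    using assms(1)
  proof (induction t rule: om1_induct)
    case zero
    then show ?case by (simp add: C_zero set_decode_0)
  next
    case (suc t)
    have t0: "C t 0 = 0" using C_running[OF suc.prems, of t] by (simp add: less_imp_le)
    have IH: "\<And>c. c \<in> WW j t \<Longrightarrow> code c" "\<And>c c'. c \<in> WW j t \<Longrightarrow> c' \<in> WW j t \<Longrightarrow> cmpb c c'"
      "\<And>c. c \<in> WW j t \<Longrightarrow> lec c (cf t) \<Longrightarrow> alive t c" using suc.IH[OF t0] by metis+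
    show ?case
    proof (cases "C t 1 = 0")
      case True
      have W: "WW j (osuc t) = {c \<in> WW j t. lec c (cf t)}" using W_succ0[OF t0 True assms(2)] .
      then show ?thesis using IH alive_osuc by simp
    next
      case False
      obtain s where s: "t = osuc s" "C s 0 = 0" "C s 1 = 0" "cf t = cf s" "WW j t = {c \<in> WW j s. lec c (cf s)}"
        using phase1[OF t0 False] assms(2) by blast
      have le: "lec c (cf t)" if "c \<in> WW j t" for c using that s(4,5) by simp
      have old: "alive (osuc t) c" if "c \<in> WW j t" for c
        using alive_osuc[OF IH(3)[OF that le[OF that]] le[OF that]] .
      define n where "n = encv D (cf t)"
      have new: "prj i n = cf t i" if "i < D" for i using that by (simp add: prj_encv n_def)
      have W: "WW j (osuc t) = (if j = zc D (cf t) then insert n (WW j t) else WW j t)"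
        using W_succ1[OF t0 False assms(2)] by (simp add: n_def)
      have newp: "code n" if "j = zc D (cf t)"
      proof -
        have "encv D (cf t) = encv D (\<lambda>i. prj i n)" by (rule encv_cong) (simp add: new)
        moreover have "zc D (\<lambda>i. prj i n) = zc D (cf t)"
          unfolding zc_def by (rule arg_cong[where f = card]) (use new in auto)
        ultimately show ?thesis using that by (simp add: code_def n_def)
      qed
      have newex: "alive (osuc t) n"
        unfolding alive_def
      proof (intro exI[of _ s] conjI allI impI)
        show "s < osuc t" by (simp add: s(1) less_osuc_iff less_imp_le)
        fix u i assume u: "s \<le> u" "u < osuc t" and i: "i < D"
        have "u = s \<or> u = t" using u s(1) by (metis less_osuc_iff antisym order_le_less osuc_le_iff)
        then show "prj i n \<le> cf u i" using new[OF i] s(4) by auto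
      qed (use s n_def in auto)
      have newc: "cmpb c n" "cmpb n c" if "c \<in> WW j t" for c using le[OF that] new by (auto simp: cmpb_def)
      have newn: "cmpb n n" by (simp add: cmpb_def)
      show ?thesis
      proof (cases "j = zc D (cf t)")
        case True
        then have W': "WW j (osuc t) = insert n (WW j t)" using W by simp
        show ?thesis unfolding W' using IH(1,2) old newp[OF True] newex newc newn by simp
      next
        case False
        then have "WW j (osuc t) = WW j t" using W by simp
        then show ?thesis using IH(1,2) old by simp
      qed
    qed
  next
    case (lim t)
    have IH: "code c" "c' \<in> WW j u \<Longrightarrow> cmpb c c'" "lec c (cf u) \<Longrightarrow> alive u c"
      if "u < t" "c \<in> WW j u" for u c c'
      using lim.IH[OF that(1) C_running[OF lim.prems]] that by (simp_all add: less_imp_le)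
    have "code c \<and> (\<forall>c'\<in>WW j t. cmpb c c') \<and> (lec c (cf t) \<longrightarrow> alive t c)" if c: "c \<in> WW j t" for c
    proof -
      obtain u0 where u0: "u0 < t" "C u0 (wreg D j) = C t (wreg D j)"
        using W_olim[OF lim(1) olim_pos[OF lim(1)] c] by blast
      have 1: "code c" "\<forall>c'\<in>WW j t. cmpb c c'"
        using IH(1,2)[OF u0(1), of c] c by (simp_all add: u0(2))
      have 2: "alive t c" if lec: "lec c (cf t)"
      proof -
        have "\<exists>s<t. \<forall>u. s \<le> u \<longrightarrow> u < t \<longrightarrow> prj i c \<le> cf u i" if i: "i < D" for i
        proof -
          have "prj i c \<le> lm t (\<lambda>u. C u (Suc (Suc i)))" using lec i by (simp add: cfg_def C_olim[OF lim(1)])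
          from le_lm[OF lim(1) this] show ?thesis using i by (simp add: cfg_def)
        qed
        then obtain s where s: "\<And>i. i < D \<Longrightarrow> s i < t \<and> (\<forall>u. s i \<le> u \<longrightarrow> u < t \<longrightarrow> prj i c \<le> cf u i)" by metis
        \<comment> \<open>From \<open>S\<close> on no component is below \<open>c\<close>; for the
          times before that, some later moment at which the register had its limit value vouches for
          \<open>c\<close>.\<close>
        define S where "S = Max (insert ozero (s ` {..<D}))"
        have St: "S < t" using s olim_pos[OF lim(1)] by (auto simp: S_def)
        have sS: "s i \<le> S" if "i < D" for i using that by (simp add: S_def)
        have S: "lec c (cf u)" if u: "S \<le> u" "u < t" for u
        proof (intro allI impI)
          fix i assume i: "i < D"
          then have "s i \<le> u" using sS[OF i] u(1) by simp
          then show "prj i c \<le> cf u i" using s[OF i] u(2) by blast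
        qed
        obtain u where u: "S \<le> u" "u < t" "C u (wreg D j) = C t (wreg D j)"
          using W_olim[OF lim(1) St c] by blast
        have "c \<in> WW j u" using c u(3) by simp
        then have "alive u c" using IH(3)[OF u(2)] S[OF u(1,2)] by blast
        then obtain s' where s': "s' < u" "encv D (cf s') = c" "C s' 1 = 0" "C s' 0 = 0"
          "\<forall>w. s' \<le> w \<longrightarrow> w < u \<longrightarrow> lec c (cf w)" unfolding alive_def by blast
        have "lec c (cf w)" if w: "s' \<le> w" "w < t" for w
        proof (cases "w < u")
          case False
          then have "S \<le> w" using u(1) by simp
          then show ?thesis using S w(2) by blast
        qed (use s'(5) w in blast)
        moreover have "s' < t" using s'(1) u(2) by simp
        ultimately show ?thesis unfolding alive_def using s'(2-4) by blast
      qed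
      show ?thesis using 1 2 by blast
    qed
    then show ?case by blast
  qed
  then show "c = encv D (\<lambda>i. prj i c)" "zc D (\<lambda>i. prj i c) = j" "c' \<in> WW j t \<Longrightarrow> cmpb c c'"
    "lec c (cf t) \<Longrightarrow> alive t c"
    using assms(3) by (simp_all add: code_def)
qed

text \<open>The stored sets influence status, phase and configuration only through the loop
  verdict.\<close>

lemma agree:
  assumes "\<And>u. u \<le> t \<Longrightarrow> C u 0 \<noteq> 2" "i < Suc (Suc D)"
  shows "C t i = B t i"
  using assms
proof (induction t arbitrary: i rule: om1_induct)
  case zero
  then show ?case by (simp add: C_def B_def)
next
  case (suc t)
  have IH: "C t i = B t i" if "i < Suc (Suc D)" for i
    using suc.IH[OF _ that] suc.prems(1) by (meson less_imp_le less_osuc order_trans)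
  have cf: "cfg D (C t) = cfg D (B t)" using IH by (auto simp: cfg_def)
  have "C (osuc t) 0 \<noteq> 2" using suc.prems(1) by blast
  then have no: "C t 0 = 0 \<Longrightarrow> C t 1 = 0 \<Longrightarrow> encv D (cf t) \<notin> WW (zc D (cf t)) t"
    by (auto simp: C_osuc lstep_def)
  have "C (osuc t) i = lstep D F hal (C t) i" "B (osuc t) i = bstep D F hal (B t) i"
    by (simp_all add: C_osuc B_def)
  then show ?case
    using IH[OF suc.prems(2)] IH[of 0] IH[of 1] no suc.prems(2) zc_le[of D "cf t"]
    by (auto simp: lstep_def bstep_def cf wreg_def)
next
  case (lim t)
  show ?case
    unfolding C_olim[OF lim(1)] unfolding B_def run_olim[OF lim(1)] unfolding B_def[symmetric]
  proof (rule lm_cong)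
    fix u assume "u < t"
    then have "\<And>w. w \<le> u \<Longrightarrow> C w 0 \<noteq> 2" using lim.prems(1) by (meson less_imp_le order_trans)
    then show "C u i = B u i" using lim.IH[OF \<open>u < t\<close> _ lim.prems(2)] by blast
  qed
qed

lemma B_beyond: "i \<ge> Suc (Suc D) \<Longrightarrow> B t i = 0"
proof (induction t rule: om1_induct)
  case (suc t)
  then show ?case by (auto simp: B_def bstep_def)
next
  case (lim t)
  then show ?case unfolding B_def run_olim[OF lim(1)] unfolding B_def[symmetric]
    by (intro lm_const[OF lim(1) olim_pos[OF lim(1)]]) auto
qed (simp add: B_def)

text \<open>The first verdict 2 exhibits a strong loop of the plain system \<open>B\<close>. It then
  returns to a running state at arbitrarily late times, whereas a stopped system no longer
  changes.\<close>

lemma no_false_loop: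
  assumes "C t 0 = 2" shows "B u 0 = 0"
proof -
  define t0 where "t0 = (LEAST t. C t 0 = 2)"
  have t0: "C t0 0 = 2" "\<And>u. u < t0 \<Longrightarrow> C u 0 \<noteq> 2"
    unfolding t0_def using LeastI[of "\<lambda>t. C t 0 = 2", OF assms] not_less_Least by blast+
  have run: "C u 0 = 0" if "u < t0" for u
    using t0 C_frozen[of u t0] that by (metis less_imp_le)
  have "\<not> olim t0"
  proof
    assume l: "olim t0"
    have "C t0 0 = 0" unfolding C_olim[OF l] by (rule lm_const[OF l olim_pos[OF l]]) (use run in auto)
    then show False using t0 by simp
  qed
  then obtain s where s: "t0 = osuc s" using t0 by (cases t0 rule: om1_cases) (auto simp: C_zero)
  have s0: "C s 0 = 0" using run s by simp
  define j where "j = zc D (cf s)"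
  have s1: "C s 1 = 0" and c: "encv D (cf s) \<in> WW j s"
    using t0(1) s0 by (auto simp: s C_osuc lstep_def j_def wreg_def split: if_splits)
  have "lec (encv D (cf s)) (cf s)" by (simp add: prj_encv)
  then obtain s' where s': "s' < s" "encv D (cf s') = encv D (cf s)" "C s' 1 = 0" "C s' 0 = 0"
    "\<forall>u. s' \<le> u \<longrightarrow> u < s \<longrightarrow> lec (encv D (cf s)) (cf u)"
    using W_invariant(4)[OF s0 _ c] zc_le[of D "cf s"] unfolding j_def alive_def by blast
  have no2: "C u 0 \<noteq> 2" if "u \<le> s" for u using that t0(2) s by (simp add: less_osuc_iff)
  have ag: "C u i = B u i" if "u \<le> s" "i < Suc (Suc D)" for u i
    using agree[of u i] no2 that by (meson order_trans)
  have cfi: "cf s' i = cf s i" if "i < D" for i using s'(2) prj_encv[of i D] that by metis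
  have eqs: "B s' i = B s i" for i
  proof (cases "i < Suc (Suc D)")
    case True
    consider "i = 0" | "i = 1" | k where "i = Suc (Suc k)" "k < D" using True by (metis One_nat_def Suc_less_eq not0_implies_Suc)
    then have "C s' i = C s i"
      using s0 s1 s'(3,4) cfi by cases (auto simp: cfg_def)
    then show ?thesis using ag[of s' i] ag[of s i] s'(1) True by simp
  qed (use B_beyond in simp)
  have ge: "B s' i \<le> B u i" if u: "s' \<le> u" "u \<le> s" for u i
  proof (cases "i < Suc (Suc D)")
    case True
    consider "i = 0" | "i = 1" | k where "i = Suc (Suc k)" "k < D" using True by (metis One_nat_def Suc_less_eq not0_implies_Suc)
    then show ?thesis
    proof cases
      case 3
      have "cf s k \<le> cf u k"
      proof (cases "u = s")
        case False
        then have "prj k (encv D (cf s)) \<le> cf u k" using s'(5) u 3 by auto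
        then show ?thesis using 3 by (simp add: prj_encv)
      qed simp
      then show ?thesis using ag[of s' i] ag[of u i] s'(1) True u 3 cfi[of k] by (simp add: cfg_def)
    qed (use ag[of s' i] s'(1,3,4) True in auto)
  qed (use B_beyond in simp)
  have "\<exists>l\<ge>u. B l = B s'"
    using strong_loop[of s' s "bstep D F hal" "\<lambda>_. 0" u] s'(1) eqs ge unfolding B_def by blast
  then obtain l where "l \<ge> u" "B l = B s'" by blast
  moreover have "B s' 0 = 0" using ag[of s' 0] s'(1,4) by simp
  ultimately show ?thesis using B_frozen[of u l] by metis
qed

text \<open>If \<open>c\<close> is componentwise at most \<open>c'\<close>, then all zeros of
  \<open>c'\<close> are zeros of \<open>c\<close>, and equally many zeros means the same
  zeros.\<close>

lemma zeros_eq: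
  assumes "lec c (\<lambda>i. prj i c')" "zc D (\<lambda>i. prj i c) = zc D (\<lambda>i. prj i c')" "i < D" "prj i c = 0"
  shows "prj i c' = 0"
proof -
  have "{i. i < D \<and> prj i c' = 0} = {i. i < D \<and> prj i c = 0}"
    by (rule card_subset_eq) (use assms in \<open>auto simp: zc_def\<close>)
  then show ?thesis using assms(3,4) by blast
qed

text \<open>If the run went on, its components would have eventual minimal values \<open>v\<close>,
  and the configuration \<open>vs\<close> formed from them would recur at limits. Once stored, its
  code is never filtered out, as nothing drops below it any more, and the next recurrence is
  detected. What has to be excluded is that the set with this code is lost by overflow at a
  limit.\<close>

lemma total: "\<exists>t. C t 0 \<noteq> 0"
proof (rule ccontr)
  assume "\<not> ?thesis"
  then have run: "C t 0 = 0" for t by simp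
  have "\<exists>v. \<forall>i. \<exists>\<gamma>. (\<forall>u\<ge>\<gamma>. v i \<le> C u i) \<and> (\<forall>s. \<exists>u\<ge>s. C u i = v i)"
    by (intro choice allI unbounded_min)
  then obtain v where v: "\<forall>i. \<exists>\<gamma>. (\<forall>u\<ge>\<gamma>. v i \<le> C u i) \<and> (\<forall>s. \<exists>u\<ge>s. C u i = v i)" ..
  from choice[OF v] obtain \<gamma> where vg': "\<forall>i. (\<forall>u\<ge>\<gamma> i. v i \<le> C u i) \<and> (\<forall>s. \<exists>u\<ge>s. C u i = v i)" ..
  have vg: "\<And>i u. \<gamma> i \<le> u \<Longrightarrow> v i \<le> C u i" "\<And>i s. \<exists>u\<ge>s. C u i = v i" using vg' by simp_all
  have "countable (range \<gamma>)" by simp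
  from om1_bounded[OF this] obtain g where g: "\<forall>x\<in>range \<gamma>. x < g" ..
  have vge: "v i \<le> C u i" if "g \<le> u" for i u
  proof -
    have "\<gamma> i < g" by (rule g[rule_format]) (rule rangeI)
    then have "\<gamma> i \<le> u" using that by simp
    then show ?thesis by (rule vg(1))
  qed
  \<comment> \<open>Status, phase and configuration show their minimal values together at
    arbitrarily late limits.\<close>
  have rec: "\<exists>t>s. olim t \<and> (\<forall>i<Suc (Suc D). C t i = v i)" for s
  proof -
    obtain t where "t > s" "olim t" "\<forall>i\<in>{..<Suc (Suc D)}. lm t (\<lambda>u. C u i) = v i"
      using recurrent_limit[of "{..<Suc (Suc D)}" g v C s] vge vg(2) by auto
    then show ?thesis using C_olim by (intro exI[of _ t]) auto
  qed
  define vs where "vs i = (if i < D then v (Suc (Suc i)) else 0)" for i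
  define c where "c = encv D vs"
  define j where "j = zc D vs"
  have jD: "j \<le> D" by (simp add: j_def zc_le)
  obtain l where l: "g < l" "olim l" "\<forall>i<Suc (Suc D). C l i = v i" using rec by blast
  have cfl: "cf l = vs" using l(3) by (auto simp: cfg_def vs_def)
  have ph: "C l 1 = 0" using phase_olim[OF l(2) run] .
  have "cf (osuc l) = cf l" using ph run[of l] by (auto simp: C_osuc lstep_def cfg_def fun_eq_iff)
  then have C1: "C (osuc l) 1 \<noteq> 0" "cf (osuc l) = vs"
    using ph run[of l] cfl by (simp_all add: C_osuc lstep_def)
  define l2 where "l2 = osuc (osuc l)"
  have ccl: "lec c (cf u)" if "g \<le> u" for u
    using vge[OF that] by (simp add: c_def prj_encv cfg_def vs_def)
  have gl2: "g \<le> l2" using l(1) less_osuc unfolding l2_def by (meson less_imp_le order_trans)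
  have base: "c \<in> WW j l2"
    unfolding l2_def using W_succ1[OF run C1(1) jD] C1(2) by (simp add: c_def j_def)
  have persist: "l2 \<le> u \<longrightarrow> c \<in> WW j u" for u
  proof (induction u rule: om1_induct)
    case zero
    then show ?case using base by (metis antisym ozero_le)
  next
    case (suc u)
    show ?case
    proof
      assume "l2 \<le> osuc u"
      then consider "l2 = osuc u" | "l2 \<le> u" by (metis less_osuc_iff order_le_less)
      then show "c \<in> WW j (osuc u)"
      proof cases
        case 2
        then have c: "c \<in> WW j u" using suc by blast
        have "g \<le> u" using gl2 2 by simp
        then show ?thesis
          using W_succ0[OF run _ jD, of u] W_succ1[OF run _ jD, of u] c ccl[of u] by (cases "C u 1 = 0") auto
      qed (use base in simp)
    qed
  next
    case (lim u)
    show ?case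
    proof
      assume "l2 \<le> u"
      then consider "l2 = u" | "l2 < u" by force
      then show "c \<in> WW j u"
      proof cases
        case 2
        have cW: "c \<in> WW j t" if "l2 \<le> t" "t < u" for t using lim.IH[OF that(2)] that(1) by blast
        show ?thesis
        proof (cases rule: lm_cases[OF lim(1), of "\<lambda>t. C t (wreg D j)", case_names fin inf])
          case (fin w s)
          obtain t where "l2 \<le> t" "t < u" "C t (wreg D j) = w" using fin(5)[OF 2] by blast
          then show ?thesis using cW fin(2) by (auto simp: C_olim[OF lim(1)])
        next
          case inf
          \<comment> \<open>\<open>BB\<close> consists of the codes of configurations bounded by the
            limits inferior, infinite ones counting as 0. Overflow means that from some time on the
            set is never contained in \<open>BB\<close>.\<close>
          define b where "b i = (case linf u (\<lambda>t. C t (Suc (Suc i))) of enat w \<Rightarrow> w | \<infinity> \<Rightarrow> 0)" for i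
          define BB where "BB = {encv D w |w. \<forall>i<D. w i \<le> b i}"
          have finB: "finite BB" unfolding BB_def by (rule finite_encv_le)
          have over: "prj i c = 0" if "linf u (\<lambda>t. C t (Suc (Suc i))) = \<infinity>" "i < D" for i
          proof -
            have "C u (Suc (Suc i)) = 0" using that by (simp add: C_olim[OF lim(1)] lm_def)
            then show ?thesis using ccl[of u] gl2 2 that(2) by (force simp: cfg_def)
          qed
          obtain s where s: "s < u" "\<forall>t. s \<le> t \<longrightarrow> t < u \<longrightarrow> Suc (set_encode BB) \<le> C t (wreg D j)"
            using inf(3) by blast
          define t0 where "t0 = max s l2"
          have t0: "t0 < u" "l2 \<le> t0" "s \<le> t0" using s(1) 2 by (auto simp: t0_def)
          have nB: "\<not> WW j t \<subseteq> BB" if "t0 \<le> t" "t < u" for t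
          proof
            assume "WW j t \<subseteq> BB"
            then have "set_decode (C t (wreg D j)) \<subseteq> set_decode (set_encode BB)" using finB by simp
            then have "C t (wreg D j) \<le> set_encode BB" by (rule subset_decode_imp_le)
            moreover have "Suc (set_encode BB) \<le> C t (wreg D j)" using s(2) that t0(3) by (meson order_trans)
            ultimately show False by simp
          qed
          \<comment> \<open>Here the splitting by the number of zeros is used: all members share the
            zeros of \<open>c\<close>, in particular those in the components that overflow at
            \<open>u\<close>.\<close>
          have zer: "prj i e = 0" if e: "e \<in> WW j t" and tt: "t0 \<le> t" "t < u" and i: "i < D" "prj i c = 0" for e t i
          proof -
            have cw: "c \<in> WW j t" using cW[of t] tt t0(2) by simp
            have z: "zc D (\<lambda>i. prj i c) = j" "zc D (\<lambda>i. prj i e) = j"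
              using W_invariant(2)[OF run jD cw] W_invariant(2)[OF run jD e] .
            consider "lec c (\<lambda>i. prj i e)" | "lec e (\<lambda>i. prj i c)"
              using W_invariant(3)[OF run jD cw e] unfolding cmpb_def by blast
            then show ?thesis
            proof cases
              case 1
              show ?thesis by (rule zeros_eq[OF 1]) (use z i in auto)
            next
              case 2
              then show ?thesis using i by force
            qed
          qed
          obtain e1 where "e1 \<in> WW j t0 - BB" using nB[OF order_refl t0(1)] by blast
          \<comment> \<open>In a chain, a member outside \<open>BB\<close> with least sum is below
            all other members outside \<open>BB\<close>.\<close>
          then obtain e0 where e0: "e0 \<in> WW j t0 - BB"
            "\<And>e. e \<in> WW j t0 - BB \<Longrightarrow> (\<Sum>i<D. prj i e0) \<le> (\<Sum>i<D. prj i e)"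
            using ex_has_least_nat[of "\<lambda>e. e \<in> WW j t0 - BB" e1 "\<lambda>e. \<Sum>i<D. prj i e"] by blast
          have least: "lec e0 (\<lambda>i. prj i e)" if e: "e \<in> WW j t0 - BB" for e
          proof (rule ccontr)
            assume no: "\<not> lec e0 (\<lambda>i. prj i e)"
            then have le: "lec e (\<lambda>i. prj i e0)" using W_invariant(3)[OF run jD, of e0 t0 e] e e0(1) unfolding cmpb_def by blast
            obtain i where "i < D" "prj i e < prj i e0" using no by (auto simp: not_le)
            then have "(\<Sum>i<D. prj i e) < (\<Sum>i<D. prj i e0)"
              using le by (intro sum_strict_mono_ex1) auto
            then show False using e0(2)[OF e] by simp
          qed
          define K where "K t \<longleftrightarrow> e0 \<in> WW j t \<and> (\<forall>e\<in>WW j t - BB. lec e0 (\<lambda>i. prj i e))" for t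
          have Kt0: "K t0" using e0(1) least by (auto simp: K_def)
          have "\<exists>t. t0 \<le> t \<and> t < u \<and> \<not> K t"
          proof -
            have "\<exists>i<D. \<not> prj i e0 \<le> b i"
            proof (rule ccontr)
              assume "\<not> ?thesis"
              moreover have "e0 = encv D (\<lambda>i. prj i e0)" using W_invariant(1)[OF run jD] e0(1) by blast
              ultimately have "e0 \<in> BB" unfolding BB_def by blast
              then show False using e0(1) by blast
            qed
            then obtain i where i: "i < D" "b i < prj i e0" by (auto simp: not_le)
            have fin': "linf u (\<lambda>t. C t (Suc (Suc i))) \<noteq> \<infinity>"
            proof
              assume "linf u (\<lambda>t. C t (Suc (Suc i))) = \<infinity>"
              then have "prj i c = 0" using over i(1) by blast
              then have "prj i e0 = 0" using zer[of e0 t0 i] e0(1) t0(1) i(1) by blast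
              then show False using i(2) by simp
            qed
            then have "linf u (\<lambda>t. C t (Suc (Suc i))) = enat (b i)" by (auto simp: b_def)
            \<comment> \<open>The run returns to the value \<open>b i\<close>, which is less than
              component \<open>i\<close> of \<open>e0\<close>; hence \<open>e0\<close> cannot
              survive.\<close>
            from linf_cofinal[OF lim(1) this t0(1)] obtain t1 where t1: "t0 \<le> t1" "t1 < u" "C t1 (Suc (Suc i)) = b i"
              by blast
            have nle: "\<not> lec e0 (cf t1)" using i t1(3) by (auto simp: cfg_def not_le)
            show ?thesis
            proof (cases "K t1")
              case True
              have "C t1 1 = 0"
              proof (rule ccontr)
                assume "C t1 1 \<noteq> 0"
                then obtain s where "cf t1 = cf s" "WW j t1 = {c \<in> WW j s. lec c (cf s)}"
                  using phase1[OF run, of t1] jD by blast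
                then show False using True nle by (auto simp: K_def)
              qed
              then have "e0 \<notin> WW j (osuc t1)" using W_succ0[OF run _ jD, of t1] nle by blast
              then have "\<not> K (osuc t1)" by (simp add: K_def)
              moreover have "t0 \<le> osuc t1" using t1(1) by (meson less_imp_le less_osuc order_trans)
              ultimately show ?thesis using olim_osuc[OF lim(1) t1(2)] by blast
            qed (use t1 in blast)
          qed
          \<comment> \<open>\<open>K\<close> can fail only when \<open>e0\<close> is filtered out.
            Everything above \<open>e0\<close> goes with it, which leaves a subset of
            \<open>BB\<close> and contradicts \<open>nB\<close>.\<close>
          define t2 where "t2 = (LEAST t. t0 \<le> t \<and> \<not> K t)"
          have t2: "t0 \<le> t2" "\<not> K t2" "t2 < u"
          proof -
            obtain t where t: "t0 \<le> t" "t < u" "\<not> K t" using \<open>\<exists>t. t0 \<le> t \<and> t < u \<and> \<not> K t\<close> by blast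
            show "t0 \<le> t2" "\<not> K t2" unfolding t2_def using LeastI[of "\<lambda>t. t0 \<le> t \<and> \<not> K t" t] t by blast+
            have "t2 \<le> t" unfolding t2_def by (rule Least_le) (use t in blast)
            then show "t2 < u" using t(2) by simp
          qed
          have Kb: "K t" if "t0 \<le> t" "t < t2" for t
            using not_less_Least[of t "\<lambda>t. t0 \<le> t \<and> \<not> K t"] that unfolding t2_def by blast
          have t02: "t0 < t2" using t2 Kt0 by (metis order_le_less)
          have "WW j t2 \<subseteq> BB"
          proof (cases t2 rule: om1_cases)
            case 1
            then show ?thesis using t02 by simp
          next
            case (2 t')
            have t': "t0 \<le> t'" "t' < t2" using t02 2 by (auto simp: less_osuc_iff)
            have Kt': "K t'" using Kb t' by blast
            show ?thesis
            proof (cases "C t' 1 = 0")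
              case True
              have W: "WW j t2 = {c \<in> WW j t'. lec c (cf t')}" using W_succ0[OF run True jD] 2 by simp
              have "\<not> lec e0 (cf t')"
              proof
                assume "lec e0 (cf t')"
                then have "K t2" using Kt' W by (auto simp: K_def)
                then show False using t2(2) by blast
              qed
              then obtain i where i: "i < D" "cf t' i < prj i e0" by (auto simp: not_le)
              show ?thesis
              proof
                fix x assume x: "x \<in> WW j t2"
                show "x \<in> BB"
                proof (rule ccontr)
                  assume "x \<notin> BB"
                  then have "prj i e0 \<le> prj i x" using x W Kt' i(1) unfolding K_def by blast
                  moreover have "prj i x \<le> cf t' i" using x W i(1) by blast
                  ultimately show False using i(2) by simp
                qed
              qed
            next
              case False
              obtain s' where s': "cf t' = cf s'" "WW j t' = {c \<in> WW j s'. lec c (cf s')}"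
                using phase1[OF run False] jD by blast
              have "lec e0 (cf t')" using Kt' s' by (auto simp: K_def)
              then have "lec e0 (\<lambda>i. prj i (encv D (cf t')))" by (simp add: prj_encv)
              then have "K t2" using Kt' W_succ1[OF run False jD] unfolding 2 K_def by auto
              then show ?thesis using t2(2) by blast
            qed
          next
            case 3
            have "c \<in> WW j t2" using cW t2 t0 by (meson order_trans)
            then obtain t where t: "t0 \<le> t" "t < t2" "C t (wreg D j) = C t2 (wreg D j)"
              using W_olim[OF 3 t02] by blast
            then have "K t2" using Kb[OF t(1,2)] unfolding K_def by simp
            then show ?thesis using t2(2) by blast
          qed
          then show ?thesis using nB[OF t2(1,3)] by blast
        qed
      qed (use base in simp)
    qed
  qed
  obtain l' where l': "l2 < l'" "olim l'" "\<forall>i<Suc (Suc D). C l' i = v i" using rec by blast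
  have "cf l' = vs" using l'(3) by (auto simp: cfg_def vs_def)
  moreover have "c \<in> WW j l'" using persist l'(1) by simp
  moreover have "C l' 1 = 0" using phase_olim[OF l'(2) run] .
  ultimately have "C (osuc l') 0 = 2" using run[of l'] by (simp add: C_osuc lstep_def c_def j_def)
  then show False using run by simp
qed

text \<open>If \<open>B\<close> stops, a loop is never reported, so \<open>agree\<close> applies at
  all times.\<close>

lemma halting_agree:
  assumes "B u 0 \<noteq> 0" "C t 0 \<noteq> 0" "i < Suc (Suc D)" shows "C t i = B u i"
proof -
  have no2: "C x 0 \<noteq> 2" for x using no_false_loop[of x u] assms(1) by blast
  have ag: "C x i = B x i" if "i < Suc (Suc D)" for x i using agree[of x i] no2 that by blast
  have "B t 0 \<noteq> 0" using ag[of 0 t] assms(2) by simp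
  then have "B t = B u" using B_frozen[of t u] B_frozen[of u t] assms(1) by (metis linear)
  then show ?thesis using ag[OF assms(3), of t] by simp
qed

end

section \<open>Category in Cantor space\<close>

declare split_paired_All [simp del] split_paired_Ex [simp del]

text \<open>A condition \<open>(s, l)\<close> fixes the membership of all numbers below \<open>l\<close> as in \<open>set_decode s\<close>.\<close>

type_synonym cond = "nat \<times> nat"

definition cyl :: "cond \<Rightarrow> nat set set" where
  "cyl c = {A. \<forall>i<snd c. i \<in> A \<longleftrightarrow> i \<in> set_decode (fst c)}"

definition ext :: "cond \<Rightarrow> cond \<Rightarrow> bool" where
  "ext c' c \<longleftrightarrow> snd c \<le> snd c' \<and> (\<forall>i<snd c. i \<in> set_decode (fst c') \<longleftrightarrow> i \<in> set_decode (fst c))"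

definition restr :: "nat set \<Rightarrow> nat \<Rightarrow> cond" where
  "restr A l = (set_encode (A \<inter> {..<l}), l)"

lemma ext_refl: "ext c c" by (simp add: ext_def)

lemma ext_trans: "ext a b \<Longrightarrow> ext b c \<Longrightarrow> ext a c" by (auto simp: ext_def)

lemma cyl_ext: "ext c' c \<Longrightarrow> cyl c' \<subseteq> cyl c" by (auto simp: ext_def cyl_def)

lemma restr_cyl: "A \<in> cyl (restr A l)"
  by (auto simp: restr_def cyl_def)

lemma mem_restr: "i < l \<Longrightarrow> i \<in> set_decode (fst (restr A l)) \<longleftrightarrow> i \<in> A"
  by (simp add: restr_def)

lemma snd_restr [simp]: "snd (restr A l) = l" by (simp add: restr_def)

lemma ext_restr: "A \<in> cyl c \<Longrightarrow> snd c \<le> l \<Longrightarrow> ext (restr A l) c"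
  by (auto simp: ext_def cyl_def mem_restr)

lemma cyl_restr: "B \<in> cyl (restr A l) \<longleftrightarrow> (\<forall>i<l. i \<in> B \<longleftrightarrow> i \<in> A)"
  by (simp add: cyl_def mem_restr)

lemma cyl_nonempty: "set_decode (fst c) \<in> cyl c" by (simp add: cyl_def)

definition dense :: "cond set \<Rightarrow> bool" where "dense E \<longleftrightarrow> (\<forall>c. \<exists>c'\<in>E. ext c' c)"

text \<open>Meagerness in terms of conditions: each point of \<open>S\<close> misses one of
  countably many dense open sets, an open set being given as the union of the cylinders of its
  conditions.\<close>

definition mgr :: "nat set set \<Rightarrow> bool" where
  "mgr S \<longleftrightarrow> (\<exists>E::nat \<Rightarrow> cond set. (\<forall>k. dense (E k)) \<and> (\<forall>A\<in>S. \<exists>k. \<forall>c\<in>E k. A \<notin> cyl c))"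

lemma mgr_mono: "mgr S \<Longrightarrow> T \<subseteq> S \<Longrightarrow> mgr T" unfolding mgr_def by blast

lemma mgr_UN:
  assumes "\<And>k::nat. mgr (S k)" shows "mgr (\<Union>k. S k)"
proof -
  define Q where "Q k E \<longleftrightarrow> (\<forall>j. dense (E j)) \<and> (\<forall>A\<in>S k. \<exists>j. \<forall>c\<in>E j. A \<notin> cyl c)"
    for k and E :: "nat \<Rightarrow> cond set"
  define E where "E k = (SOME E. Q k E)" for k
  have "\<exists>E. Q k E" for k using assms[of k] unfolding mgr_def Q_def .
  then have "Q k (E k)" for k unfolding E_def by (rule someI_ex)
  then have E: "(\<forall>j. dense (E k j)) \<and> (\<forall>A\<in>S k. \<exists>j. \<forall>c\<in>E k j. A \<notin> cyl c)" for k
    by (simp add: Q_def)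
  define E' where "E' m = E (fst (prod_decode m)) (snd (prod_decode m))" for m
  have "\<exists>m. \<forall>c\<in>E' m. A \<notin> cyl c" if "A \<in> S k" for A k
  proof -
    obtain j where "\<forall>c\<in>E k j. A \<notin> cyl c" using E[of k] \<open>A \<in> S k\<close> by blast
    then have "\<forall>c\<in>E' (prod_encode (k, j)). A \<notin> cyl c" by (simp add: E'_def)
    then show ?thesis by blast
  qed
  then show ?thesis unfolding mgr_def using E by (intro exI[of _ E']) (auto simp: E'_def)
qed

lemma mgr_empty: "mgr {}"
  unfolding mgr_def dense_def by (rule exI[of _ "\<lambda>_. UNIV"]) (auto intro: ext_refl)

lemma mgr_UN_countable:
  assumes "countable I" "\<And>k. k \<in> I \<Longrightarrow> mgr (S k)" shows "mgr (\<Union>k\<in>I. S k)"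
proof (cases "I = {}")
  case True
  then show ?thesis using mgr_empty by simp
next
  case False
  have "mgr (\<Union>n. S (from_nat_into I n))"
    by (rule mgr_UN) (use assms(2) from_nat_into[OF False] in blast)
  moreover have "(\<Union>n. S (from_nat_into I n)) = (\<Union>k\<in>range (from_nat_into I). S k)" by blast
  ultimately show ?thesis using range_from_nat_into[OF False assms(1)] by simp
qed

lemma mgr_Un: "mgr S \<Longrightarrow> mgr T \<Longrightarrow> mgr (S \<union> T)"
proof -
  assume "mgr S" "mgr T"
  then have "mgr (\<Union>b\<in>(UNIV :: bool set). if b then S else T)" by (intro mgr_UN_countable) auto
  then show ?thesis by (rule mgr_mono) (auto split: if_splits)
qed

lemma baire:
  assumes "\<And>k::nat. dense (E k)" shows "\<exists>A\<in>cyl c. \<forall>k. \<exists>c'\<in>E k. A \<in> cyl c'"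
proof -
  have "\<exists>C. \<forall>k. (k = 0 \<longrightarrow> C k = c) \<and> (ext (C (Suc k)) (C k) \<and> k < snd (C (Suc k)) \<and> (\<exists>c'\<in>E k. ext (C (Suc k)) c'))"
  proof (rule dependent_nat_choice)
    fix x :: cond and n :: nat
    obtain c' where c': "c' \<in> E n" "ext c' x" using assms[of n] unfolding dense_def by blast
    \<comment> \<open>Lengthening beyond \<open>n\<close> ensures that the sequence of conditions
      determines a real.\<close>
    define y where "y = restr (set_decode (fst c')) (max (snd c') (Suc n))"
    have "ext y c'" unfolding y_def by (rule ext_restr) (simp_all add: cyl_nonempty)
    then have "ext y x \<and> n < snd y \<and> (\<exists>c'\<in>E n. ext y c')"
      using c' ext_trans unfolding y_def by (auto simp: less_max_iff_disj)
    then show "\<exists>y. (Suc n = 0 \<longrightarrow> y = c) \<and> ext y x \<and> n < snd y \<and> (\<exists>c'\<in>E n. ext y c')" by blast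
  qed simp
  then obtain C where C: "C 0 = c" "\<And>k. ext (C (Suc k)) (C k)" "\<And>k. k < snd (C (Suc k))"
    "\<And>k. \<exists>c'\<in>E k. ext (C (Suc k)) c'" by blast
  have mono: "ext (C n) (C m)" if "m \<le> n" for m n
    using that
  proof (induction n)
    case (Suc n)
    then show ?case using C(2)[of n] ext_trans ext_refl by (metis le_Suc_eq)
  qed (simp add: ext_refl)
  \<comment> \<open>At stage \<open>Suc i\<close> the condition is long enough to fix bit
    \<open>i\<close>.\<close>
  define A where "A = {i. i \<in> set_decode (fst (C (Suc i)))}"
  have A: "A \<in> cyl (C k)" for k
    unfolding cyl_def
  proof (intro CollectI allI impI)
    fix i assume i: "i < snd (C k)"
    show "i \<in> A \<longleftrightarrow> i \<in> set_decode (fst (C k))"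
    proof (cases "k \<le> Suc i")
      case True
      then show ?thesis using mono[OF True] i by (auto simp: A_def ext_def)
    next
      case False
      then have "ext (C k) (C (Suc i))" by (intro mono) simp
      then show ?thesis using C(3)[of i] by (auto simp: A_def ext_def)
    qed
  qed
  have "\<exists>c'\<in>E k. A \<in> cyl c'" for k using C(4)[of k] A[of "Suc k"] cyl_ext by blast
  then show ?thesis using A[of 0] C(1) by blast
qed

lemma not_mgr_cyl: "\<not> mgr (cyl c)"
proof
  assume "mgr (cyl c)"
  then obtain E :: "nat \<Rightarrow> cond set" where E: "\<And>k. dense (E k)" "\<And>A. A \<in> cyl c \<Longrightarrow> \<exists>k. \<forall>c\<in>E k. A \<notin> cyl c"
    unfolding mgr_def by blast
  obtain A where "A \<in> cyl c" "\<forall>k. \<exists>c'\<in>E k. A \<in> cyl c'" using baire[of E c] E(1) by blast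
  then show False using E(2) by blast
qed

lemma compatible:
  assumes "A \<in> cyl c" "A \<in> cyl d"
  shows "\<exists>l. ext (restr A l) c \<and> ext (restr A l) d"
  using assms by (intro exI[of _ "max (snd c) (snd d)"] conjI ext_restr) auto

text \<open>An easy case of the Banach category theorem: there are only countably many conditions,
  so the locally meager pieces can be united.\<close>

lemma mgr_local:
  assumes "\<And>c'. ext c' c \<Longrightarrow> \<exists>c''. ext c'' c' \<and> mgr (cyl c'' \<inter> S)"
  shows "mgr (cyl c \<inter> S)"
proof -
  define E where "E = {c''. mgr (cyl c'' \<inter> S) \<or> cyl c'' \<inter> cyl c = {}}"
  have "dense E" unfolding dense_def
  proof
    fix d
    show "\<exists>c'\<in>E. ext c' d"
    proof (cases "cyl d \<inter> cyl c = {}")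
      case True
      then show ?thesis by (intro bexI[of _ d]) (auto simp: E_def ext_refl)
    next
      case False
      then obtain A where A: "A \<in> cyl d" "A \<in> cyl c" by blast
      obtain l where l: "ext (restr A l) d" "ext (restr A l) c" using compatible[OF A] by blast
      obtain c'' where "ext c'' (restr A l)" "mgr (cyl c'' \<inter> S)" using assms[OF l(2)] by blast
      then show ?thesis using l(1) ext_trans by (intro bexI[of _ c'']) (auto simp: E_def)
    qed
  qed
  then have "mgr {A. \<forall>c\<in>E. A \<notin> cyl c}" unfolding mgr_def by (intro exI[of _ "\<lambda>_. E"]) auto
  moreover have "mgr (\<Union>c''\<in>{c''. mgr (cyl c'' \<inter> S)}. cyl c'' \<inter> S)"
    by (rule mgr_UN_countable) auto
  ultimately have "mgr ({A. \<forall>c\<in>E. A \<notin> cyl c} \<union> (\<Union>c''\<in>{c''. mgr (cyl c'' \<inter> S)}. cyl c'' \<inter> S))"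
    by (rule mgr_Un)
  then show ?thesis by (rule mgr_mono) (auto simp: E_def)
qed

section \<open>Forcing by category\<close>

definition fo :: "cond \<Rightarrow> nat set set \<Rightarrow> bool" where "fo c S \<longleftrightarrow> mgr (cyl c - S)"

text \<open>Sets that are decided by a dense set of conditions; this is a form of the Baire
  property.\<close>

definition bp :: "nat set set \<Rightarrow> bool" where "bp S \<longleftrightarrow> (\<forall>c. \<exists>c'. ext c' c \<and> (fo c' S \<or> fo c' (- S)))"

lemma fo_ext: "fo c S \<Longrightarrow> ext c' c \<Longrightarrow> fo c' S"
  unfolding fo_def using cyl_ext by (meson Diff_mono mgr_mono order_refl)

lemma fo_mono: "fo c S \<Longrightarrow> S \<subseteq> T \<Longrightarrow> fo c T"
  unfolding fo_def by (erule mgr_mono) blast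

lemma fo_Int: "fo c S \<Longrightarrow> fo c T \<Longrightarrow> fo c (S \<inter> T)"
  unfolding fo_def using mgr_Un[of "cyl c - S" "cyl c - T"] by (simp add: Diff_Int)

lemma fo_INT: "countable I \<Longrightarrow> (\<And>k. k \<in> I \<Longrightarrow> fo c (S k)) \<Longrightarrow> fo c (\<Inter>k\<in>I. S k)"
  unfolding fo_def using mgr_UN_countable[of I "\<lambda>k. cyl c - S k"]
  by (rule mgr_mono) blast+

lemma fo_UNIV: "fo c UNIV" by (simp add: fo_def mgr_empty)

lemma fo_nonempty: "fo c S \<Longrightarrow> \<exists>A\<in>cyl c. A \<in> S"
  unfolding fo_def using not_mgr_cyl[of c] mgr_mono by blast

lemma fo_consistent: "fo c S \<Longrightarrow> fo d T \<Longrightarrow> A \<in> cyl c \<Longrightarrow> A \<in> cyl d \<Longrightarrow> \<exists>B. B \<in> S \<inter> T"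
  using compatible[of A c d] fo_ext fo_Int fo_nonempty by meson

text \<open>Otherwise every extension of \<open>c\<close> could be extended further so as to force
  \<open>S\<close>, and the complement of \<open>S\<close> would be locally meager in the
  cylinder.\<close>

lemma fo_or_refine: "bp S \<Longrightarrow> \<not> fo c S \<Longrightarrow> \<exists>c'. ext c' c \<and> fo c' (- S)"
proof (rule ccontr)
  assume S: "bp S" "\<not> fo c S" "\<nexists>c'. ext c' c \<and> fo c' (- S)"
  have "mgr (cyl c \<inter> (- S))"
  proof (rule mgr_local)
    fix c' assume c': "ext c' c"
    obtain c'' where "ext c'' c'" "fo c'' S \<or> fo c'' (- S)" using S(1) unfolding bp_def by blast
    moreover from this have "ext c'' c" using c' ext_trans by blast
    ultimately have "ext c'' c' \<and> fo c'' S" using S(3) by blast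
    then show "\<exists>c''. ext c'' c' \<and> mgr (cyl c'' \<inter> - S)" by (auto simp: fo_def Diff_eq)
  qed
  then show False using S(2) by (simp add: fo_def Diff_eq)
qed

lemma bp_Compl: "bp S \<Longrightarrow> bp (- S)" unfolding bp_def by auto

text \<open>Either an extension forces one of the sets, or \<open>c\<close> forces the complement of
  each of them and hence of the countable union.\<close>

lemma bp_UN:
  assumes "countable I" "\<And>k. k \<in> I \<Longrightarrow> bp (S k)" shows "bp (\<Union>k\<in>I. S k)"
  unfolding bp_def
proof
  fix c
  show "\<exists>c'. ext c' c \<and> (fo c' (\<Union>k\<in>I. S k) \<or> fo c' (- (\<Union>k\<in>I. S k)))"
  proof (cases "\<exists>c' k. ext c' c \<and> k \<in> I \<and> fo c' (S k)")
    case True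
    then obtain c' k where "ext c' c" "k \<in> I" "fo c' (S k)" by blast
    then show ?thesis using fo_mono[of c' "S k"] by blast
  next
    case False
    have "fo c (- S k)" if k: "k \<in> I" for k
      unfolding fo_def Diff_eq double_compl
    proof (rule mgr_local)
      fix c' assume "ext c' c"
      then have "\<not> fo c' (S k)" using False k by blast
      from fo_or_refine[OF assms(2)[OF k] this]
      show "\<exists>c''. ext c'' c' \<and> mgr (cyl c'' \<inter> S k)" by (auto simp: fo_def Diff_eq)
    qed
    then have "fo c (\<Inter>k\<in>I. - S k)" by (rule fo_INT[OF assms(1)])
    then have "fo c (- (\<Union>k\<in>I. S k))" by (simp only: Compl_UN)
    then show ?thesis using ext_refl by blast
  qed
qed

lemma bp_INT: "countable I \<Longrightarrow> (\<And>k. k \<in> I \<Longrightarrow> bp (S k)) \<Longrightarrow> bp (\<Inter>k\<in>I. S k)"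
  using bp_Compl[OF bp_UN[of I "\<lambda>k. - S k"]] bp_Compl by auto

lemma bp_const: "bp {A. P}"
proof (cases P)
  case True
  then show ?thesis unfolding bp_def using ext_refl fo_UNIV by auto
next
  case False
  then show ?thesis unfolding bp_def using ext_refl fo_UNIV by auto
qed

lemma bp_Int: assumes "bp S" "bp T" shows "bp (S \<inter> T)"
proof -
  have "bp (\<Inter>b\<in>(UNIV :: bool set). if b then S else T)" by (intro bp_INT) (use assms in auto)
  moreover have "(\<Inter>b\<in>(UNIV :: bool set). if b then S else T) = S \<inter> T" by (auto split: if_splits)
  ultimately show ?thesis by simp
qed

lemma bp_Un: assumes "bp S" "bp T" shows "bp (S \<union> T)"
proof -
  have "bp (\<Union>b\<in>(UNIV :: bool set). if b then S else T)" by (intro bp_UN) (use assms in auto)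
  moreover have "(\<Union>b\<in>(UNIV :: bool set). if b then S else T) = S \<union> T" by (auto split: if_splits)
  ultimately show ?thesis by simp
qed

lemma bp_bit: "bp {A. (n \<in> A) = b}"
  unfolding bp_def
proof
  fix c
  define c' where "c' = restr (set_decode (fst c)) (max (snd c) (Suc n))"
  have e: "ext c' c" unfolding c'_def by (rule ext_restr) (simp_all add: cyl_nonempty)
  have "(\<forall>A\<in>cyl c'. (n \<in> A) = b) \<or> (\<forall>A\<in>cyl c'. (n \<in> A) \<noteq> b)"
    by (auto simp: c'_def cyl_restr)
  then have "cyl c' - {A. (n \<in> A) = b} = {} \<or> cyl c' - (- {A. (n \<in> A) = b}) = {}" by blast
  then show "\<exists>c'. ext c' c \<and> (fo c' {A. (n \<in> A) = b} \<or> fo c' (- {A. (n \<in> A) = b}))"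
    using e mgr_empty unfolding fo_def by metis
qed

section \<open>Families of total systems\<close>

definition decD :: "(cond \<Rightarrow> bool) \<Rightarrow> cond \<Rightarrow> bool" where
  "decD Q c \<longleftrightarrow> Q c \<or> (\<forall>c'. ext c' c \<longrightarrow> \<not> Q c')"

lemma decD_dense: "\<exists>c'. ext c' c \<and> decD Q c'"
  unfolding decD_def using ext_refl by blast

lemma decD_ext:
  assumes "\<And>c c'. Q c \<Longrightarrow> ext c' c \<Longrightarrow> Q c'" "decD Q c" "ext c' c" shows "decD Q c'"
  using assms ext_trans unfolding decD_def by blast

definition md :: "nat set \<Rightarrow> cond \<Rightarrow> nat set" where
  "md y c = {i. if i < snd c then i \<in> set_decode (fst c) else i \<in> y}"

lemma md_cyl: "md y c \<in> cyl c" by (simp add: md_def cyl_def)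

type_synonym name = "cond \<times> nat"

text \<open>A name \<open>(c, q)\<close> stands for the halting time of the system \<open>q\<close> if \<open>c\<close> forces its value. The
  requirement \<open>j\<close> asks that \<open>c\<close> decides the halting time of a system, a component of its state at a
  named time, and whether the limit inferior of this component before a named limit is at least \<open>v\<close>.
  The validity, order and forcing relations are parameters because they will be evaluated in two
  ways, by forcing and by inspecting a generic real.\<close>

definition req ::
    "(name \<Rightarrow> bool) \<Rightarrow> (name \<Rightarrow> name \<Rightarrow> bool) \<Rightarrow> (cond \<Rightarrow> nat \<Rightarrow> name \<Rightarrow> nat \<Rightarrow> nat set \<Rightarrow> bool) \<Rightarrow> nat \<Rightarrow> cond \<Rightarrow> bool" where
  "req V LE FF j c = (let q = prj 0 j; \<nu> = ((prj 1 j, prj 2 j), prj 3 j); \<nu>' = ((prj 4 j, prj 5 j), prj 6 j);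
      i = prj 7 j; v = prj 8 j in
    V (c, q) \<and>
    (V \<nu> \<longrightarrow> (\<exists>w. FF c q \<nu> i {w}) \<and>
      decD (\<lambda>c. \<exists>\<mu>. V \<mu> \<and> \<not> LE \<nu> \<mu> \<and> (\<forall>\<kappa>. V \<kappa> \<longrightarrow> LE \<mu> \<kappa> \<longrightarrow> \<not> LE \<nu> \<kappa> \<longrightarrow> FF c q \<kappa> i {v..})) c) \<and>
    (V \<nu> \<longrightarrow> V \<nu>' \<longrightarrow> decD (\<lambda>c. \<exists>\<kappa>. V \<kappa> \<and> LE \<nu>' \<kappa> \<and> \<not> LE \<nu> \<kappa> \<and> FF c q \<kappa> i {..<v}) c))"

text \<open>The names in a requirement are guarded by validity, so agreement on valid names
  suffices. This is what permits the passage from forcing to its evaluation along a real.\<close>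

lemma req_cong:
  assumes "\<And>\<mu> \<kappa>. V \<mu> \<Longrightarrow> V \<kappa> \<Longrightarrow> LE \<mu> \<kappa> = LE' \<mu> \<kappa>" "\<And>c q \<mu> i S. V \<mu> \<Longrightarrow> FF c q \<mu> i S = FF' c q \<mu> i S"
  shows "req V LE FF = req V LE' FF'"
proof (intro ext)
  fix j c
  have 1: "(\<exists>\<mu>. V \<mu> \<and> \<not> LE \<nu> \<mu> \<and> (\<forall>\<kappa>. V \<kappa> \<longrightarrow> LE \<mu> \<kappa> \<longrightarrow> \<not> LE \<nu> \<kappa> \<longrightarrow> FF c q \<kappa> i S)) =
    (\<exists>\<mu>. V \<mu> \<and> \<not> LE' \<nu> \<mu> \<and> (\<forall>\<kappa>. V \<kappa> \<longrightarrow> LE' \<mu> \<kappa> \<longrightarrow> \<not> LE' \<nu> \<kappa> \<longrightarrow> FF' c q \<kappa> i S))" if "V \<nu>" for \<nu> c q i S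
    using assms that by (metis (no_types, lifting))
  have 2: "(\<exists>\<kappa>. V \<kappa> \<and> LE \<nu>' \<kappa> \<and> \<not> LE \<nu> \<kappa> \<and> FF c q \<kappa> i S) = (\<exists>\<kappa>. V \<kappa> \<and> LE' \<nu>' \<kappa> \<and> \<not> LE' \<nu> \<kappa> \<and> FF' c q \<kappa> i S)"
    if "V \<nu>" "V \<nu>'" for \<nu> \<nu>' c q i S
    using assms that by (metis (no_types, lifting))
  show "req V LE FF j c = req V LE' FF' j c"
    unfolding req_def Let_def decD_def
    using 1 2 assms(2) by (intro conj_cong imp_cong refl) (simp_all)
qed

text \<open>A step consults the oracle at the single number \<open>qr q v\<close>. By
  \<open>naming\<close>, every time up to the end of a run is itself a halting time; names of
  halting times thus reach all times of runs.\<close>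

locale family =
  fixes H :: "nat \<Rightarrow> nat set \<Rightarrow> vec \<Rightarrow> vec" and hl :: "nat \<Rightarrow> vec \<Rightarrow> bool" and qr :: "nat \<Rightarrow> vec \<Rightarrow> nat" and D :: nat
  assumes use: "(qr q v \<in> A \<longleftrightarrow> qr q v \<in> A') \<Longrightarrow> H q A v = H q A' v"
    and frozen: "hl q v \<Longrightarrow> H q A v = v"
    and total: "\<exists>t. hl q (run (H q A) (\<lambda>_. 0) t)"
    and naming: "(\<And>u. u < t \<Longrightarrow> \<not> hl q (run (H q A) (\<lambda>_. 0) u)) \<Longrightarrow>
      \<exists>q'. hl q' (run (H q' A) (\<lambda>_. 0) t) \<and> (\<forall>u<t. \<not> hl q' (run (H q' A) (\<lambda>_. 0) u))"
    and bounded: "D \<le> i \<Longrightarrow> run (H q A) (\<lambda>_. 0) t i = 0"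
begin

definition C :: "nat \<Rightarrow> nat set \<Rightarrow> om1 \<Rightarrow> vec" where "C q A t = run (H q A) (\<lambda>_. 0) t"

definition eta :: "nat \<Rightarrow> nat set \<Rightarrow> om1" where "eta q A = (LEAST t. hl q (C q A t))"

lemma hl_eta: "hl q (C q A (eta q A))"
  unfolding eta_def using LeastI_ex[of "\<lambda>t. hl q (C q A t)"] total[of q A] by (simp add: C_def)

lemma not_hl: "t < eta q A \<Longrightarrow> \<not> hl q (C q A t)"
  unfolding eta_def by (rule not_less_Least)

lemma hl_iff: "hl q (C q A t) \<longleftrightarrow> eta q A \<le> t"
proof
  show "hl q (C q A t) \<Longrightarrow> eta q A \<le> t" using not_hl not_le by blast
  assume "eta q A \<le> t"
  then have "C q A t = C q A (eta q A)"
    unfolding C_def using run_fixed[of "H q A" "\<lambda>_. 0" "eta q A" t] frozen[OF hl_eta, of q A A]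
    by (simp add: C_def)
  then show "hl q (C q A t)" using hl_eta by simp
qed

lemma eta_eqI: "hl q (C q A t) \<Longrightarrow> (\<And>u. u < t \<Longrightarrow> \<not> hl q (C q A u)) \<Longrightarrow> eta q A = t"
  using hl_iff[of q A] by (meson antisym not_le order_refl)

lemma eta_eq_iff: "eta q A = t \<longleftrightarrow> hl q (C q A t) \<and> (\<forall>u<t. \<not> hl q (C q A u))"
  using eta_eqI hl_eta not_hl by metis

lemma named: "t \<le> eta q A \<Longrightarrow> \<exists>q'. eta q' A = t"
proof -
  assume t: "t \<le> eta q A"
  have "\<not> hl q (run (H q A) (\<lambda>_. 0) u)" if "u < t" for u
    using not_hl[of u q A] that t by (simp add: C_def)
  from naming[OF this] show ?thesis unfolding eta_eq_iff C_def by blast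
qed

section \<open>Baire property of runs\<close>

definition Z :: "vec set" where "Z = {v. \<forall>i\<ge>D. v i = 0}"

lemma countable_Z: "countable Z"
proof (rule countableI'[of "encv D"], rule inj_onI)
  fix v w assume v: "v \<in> Z" "w \<in> Z" "encv D v = encv D w"
  show "v = w"
  proof
    fix i
    show "v i = w i" using v prj_encv[of i D v] prj_encv[of i D w] by (cases "i < D") (auto simp: Z_def)
  qed
qed

lemma C_Z: "C q A t \<in> Z" by (simp add: C_def Z_def bounded)

text \<open>At countable times one stays within countable Boolean combinations: a successor state
  depends on one of countably many states and on one bit, a limit state on thresholds at countably
  many earlier times.\<close>

lemma bp_state: "bp {A. C q A t \<in> X}"
proof (induction t arbitrary: X rule: om1_induct)
  case zero
  show ?case unfolding C_def run_ozero by (rule bp_const)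
next
  case (suc t)
  have "bp {A. H q A c \<in> X}" for c
  proof -
    have e: "H q A c = H q (if qr q c \<in> A then UNIV else {}) c" for A by (rule use) simp
    have "{A. H q A c \<in> X} = ({A. (qr q c \<in> A) = True} \<inter> {A. H q UNIV c \<in> X}) \<union>
        ({A. (qr q c \<in> A) = False} \<inter> {A. H q {} c \<in> X})"
    proof (rule set_eqI)
      fix A
      show "A \<in> {A. H q A c \<in> X} \<longleftrightarrow> A \<in> ({A. (qr q c \<in> A) = True} \<inter> {A. H q UNIV c \<in> X}) \<union>
        ({A. (qr q c \<in> A) = False} \<inter> {A. H q {} c \<in> X})"
        using e[of A] by (cases "qr q c \<in> A") simp_all
    qed
    then show ?thesis by (simp only: bp_Un bp_Int bp_bit bp_const)
  qed
  then have "bp (\<Union>c\<in>Z. {A. C q A t \<in> {c}} \<inter> {A. H q A c \<in> X})"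
    by (intro bp_UN countable_Z bp_Int suc.IH)
  moreover have "{A. C q A (osuc t) \<in> X} = (\<Union>c\<in>Z. {A. C q A t \<in> {c}} \<inter> {A. H q A c \<in> X})"
    using C_Z[of q _ t] by (auto simp: C_def)
  ultimately show ?case by simp
next
  case (lim t)
  have ct: "countable {u. s \<le> u \<and> u < t}" for s
    by (rule countable_subset[OF _ countable_lessThan_om1[of t]]) auto
  have L: "bp {A. enat v \<le> linf t (\<lambda>u. C q A u i)}" for v i
  proof -
    have b: "bp {A. v \<le> C q A u i}" if "u < t" for u
      using lim.IH[OF that, of "{x. v \<le> x i}"] by simp
    have "bp (\<Union>s\<in>{..<t}. \<Inter>u\<in>{u. s \<le> u \<and> u < t}. {A. v \<le> C q A u i})"
      by (rule bp_UN[OF countable_lessThan_om1], rule bp_INT[OF ct], rule b) simp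
    moreover have "(\<Union>s\<in>{..<t}. \<Inter>u\<in>{u. s \<le> u \<and> u < t}. {A. v \<le> C q A u i}) = {A. enat v \<le> linf t (\<lambda>u. C q A u i)}"
      unfolding le_linf_iff[OF lim(1)] by auto
    ultimately show ?thesis by simp
  qed
  have 1: "bp {A. C q A t i = k}" for i k
  proof -
    \<comment> \<open>The second disjunct is the overflow to 0.\<close>
    have "C q A t i = k \<longleftrightarrow> (enat k \<le> linf t (\<lambda>u. C q A u i) \<and> \<not> enat (Suc k) \<le> linf t (\<lambda>u. C q A u i)) \<or>
       (k = 0 \<and> (\<forall>v. enat v \<le> linf t (\<lambda>u. C q A u i)))" for A
    proof -
      have "C q A t i = reset_if_infinite (linf t (\<lambda>u. C q A u i))"
        unfolding C_def run_olim[OF lim(1)] by (simp add: lm_def)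
      moreover have inf: "(\<forall>v. enat v \<le> x) \<longleftrightarrow> x = \<infinity>" for x :: enat
        by (cases x) (auto, metis Suc_n_not_le_n)
      ultimately show ?thesis unfolding inf by (cases "linf t (\<lambda>u. C q A u i)") auto
    qed
    then have "{A. C q A t i = k} = ({A. enat k \<le> linf t (\<lambda>u. C q A u i)} \<inter> - {A. enat (Suc k) \<le> linf t (\<lambda>u. C q A u i)}) \<union>
       ({A. k = 0} \<inter> (\<Inter>v\<in>(UNIV::nat set). {A. enat v \<le> linf t (\<lambda>u. C q A u i)}))" by auto
    moreover have "bp (\<Inter>v\<in>(UNIV::nat set). {A. enat v \<le> linf t (\<lambda>u. C q A u i)})" by (rule bp_INT) (use L in auto)
    ultimately show ?thesis using L bp_Un bp_Int bp_Compl bp_const by metis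
  qed
  have "bp (\<Union>c\<in>X \<inter> Z. \<Inter>i\<in>(UNIV::nat set). {A. C q A t i = c i})"
    by (rule bp_UN, rule countable_subset[OF _ countable_Z], simp, rule bp_INT) (use 1 in auto)
  moreover have "(\<Union>c\<in>X \<inter> Z. \<Inter>i\<in>(UNIV::nat set). {A. C q A t i = c i}) = {A. C q A t \<in> X}"
    using C_Z[of q _ t] by (auto simp: fun_eq_iff[symmetric])
  ultimately show ?case by simp
qed

lemma bp_comp: "bp {A. C q A t i \<in> S}"
  using bp_state[of q t "{x. x i \<in> S}"] by simp

lemma bp_eta: "bp {A. eta q A = t}"
proof -
  have "bp ({A. C q A t \<in> {x. hl q x}} \<inter> (\<Inter>u\<in>{..<t}. {A. C q A u \<in> {x. \<not> hl q x}}))"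
    by (intro bp_Int bp_INT bp_state countable_lessThan_om1)
  moreover have "({A. C q A t \<in> {x. hl q x}} \<inter> (\<Inter>u\<in>{..<t}. {A. C q A u \<in> {x. \<not> hl q x}})) = {A. eta q A = t}"
    by (auto simp: eta_eq_iff)
  ultimately show ?thesis by simp
qed

section \<open>Named times\<close>

definition valid :: "name \<Rightarrow> bool" where "valid \<nu> \<longleftrightarrow> (\<exists>t. fo (fst \<nu>) {A. eta (snd \<nu>) A = t})"

definition lam :: "name \<Rightarrow> om1" where "lam \<nu> = (THE t. fo (fst \<nu>) {A. eta (snd \<nu>) A = t})"

lemma lam_eq: "fo (fst \<nu>) {A. eta (snd \<nu>) A = t} \<Longrightarrow> lam \<nu> = t"
  unfolding lam_def
proof (rule the_equality)
  fix t' assume "fo (fst \<nu>) {A. eta (snd \<nu>) A = t}" "fo (fst \<nu>) {A. eta (snd \<nu>) A = t'}"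
  from fo_nonempty[OF fo_Int[OF this]] show "t' = t" by auto
qed

lemma valid_fo: "valid \<nu> \<Longrightarrow> fo (fst \<nu>) {A. eta (snd \<nu>) A = lam \<nu>}"
proof -
  assume "valid \<nu>"
  then obtain t where t: "fo (fst \<nu>) {A. eta (snd \<nu>) A = t}" unfolding valid_def by blast
  then show ?thesis using lam_eq[OF t] by simp
qed

definition L :: "om1 set" where "L = {t. \<exists>\<nu>. valid \<nu> \<and> lam \<nu> = t}"

lemma countable_L: "countable L"
proof -
  have "L \<subseteq> range lam" by (auto simp: L_def)
  moreover have "countable (range lam)" by simp
  ultimately show ?thesis by (rule countable_subset)
qed

lemma non_mgr_force: "bp S \<Longrightarrow> \<not> mgr (cyl c \<inter> S) \<Longrightarrow> \<exists>c'. ext c' c \<and> fo c' S"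
  using fo_or_refine[of "- S" c] bp_Compl[of S] by (auto simp: fo_def Diff_eq)

text \<open>By \<open>naming\<close>, a real whose run reaches \<open>t\<close> has a system halting
  exactly at \<open>t\<close>. One of these countably many cases is not meager and therefore forced
  by some condition.\<close>

lemma L_if_non_mgr:
  assumes "\<not> mgr {A. t \<le> eta q A}" shows "t \<in> L"
proof -
  have "\<exists>q'. \<not> mgr {A. eta q' A = t}"
  proof (rule ccontr)
    assume "\<not> ?thesis"
    then have "mgr (\<Union>q'. {A. eta q' A = t})" by (intro mgr_UN) auto
    then have "mgr {A. t \<le> eta q A}" by (rule mgr_mono) (use named in auto)
    then show False using assms by blast
  qed
  then obtain q' where "\<not> mgr {A. eta q' A = t}" by blast
  then have "\<not> mgr (cyl (0, 0) \<inter> {A. eta q' A = t})" by (simp add: cyl_def)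
  from non_mgr_force[OF bp_eta this] obtain c where c: "fo c {A. eta q' A = t}" by blast
  then have "valid (c, q')" "lam (c, q') = t" using lam_eq[of "(c, q')" t] by (auto simp: valid_def)
  then show ?thesis unfolding L_def by blast
qed

text \<open>A priori the halting times of one system may take uncountably many values, so that
  splitting by values proves nothing. But \<open>L\<close> is countable, and at or beyond a bound
  \<open>d\<close> of \<open>L\<close> the system halts only for a meager set of reals.\<close>

lemma valid_dense: "\<exists>c'. ext c' c \<and> valid (c', q)"
proof -
  obtain d where d: "\<forall>x\<in>L. x < d" using om1_bounded[OF countable_L] by blast
  then have "d \<notin> L" by blast
  then have m: "mgr {A. d \<le> eta q A}" using L_if_non_mgr by blast
  show ?thesis
  proof (rule ccontr)
    assume no: "\<not> ?thesis"
    have "mgr (cyl c \<inter> {A. eta q A = t})" for t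
    proof (rule ccontr)
      assume "\<not> mgr (cyl c \<inter> {A. eta q A = t})"
      from non_mgr_force[OF bp_eta this] show False using no by (auto simp: valid_def)
    qed
    then have "mgr (\<Union>t\<in>{..<d}. cyl c \<inter> {A. eta q A = t})" by (intro mgr_UN_countable countable_lessThan_om1)
    from mgr_Un[OF this m] have "mgr (cyl c)" by (rule mgr_mono) (auto simp: not_le)
    then show False using not_mgr_cyl by blast
  qed
qed

text \<open>A system forced to halt at \<open>t\<close> passes \<open>u\<close> on a set that is not
  meager.\<close>

lemma L_down: assumes "t \<in> L" "u < t" shows "u \<in> L"
proof -
  obtain \<nu> where \<nu>: "valid \<nu>" "lam \<nu> = t" using assms(1) by (auto simp: L_def)
  have "\<not> mgr {A. u \<le> eta (snd \<nu>) A}"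
  proof
    assume "mgr {A. u \<le> eta (snd \<nu>) A}"
    moreover have "mgr (cyl (fst \<nu>) - {A. eta (snd \<nu>) A = t})" using valid_fo[OF \<nu>(1)] \<nu>(2) by (simp add: fo_def)
    ultimately have "mgr ({A. u \<le> eta (snd \<nu>) A} \<union> (cyl (fst \<nu>) - {A. eta (snd \<nu>) A = t}))" by (rule mgr_Un)
    then have "mgr (cyl (fst \<nu>))" by (rule mgr_mono) (use assms(2) in auto)
    then show False using not_mgr_cyl by blast
  qed
  then show ?thesis by (rule L_if_non_mgr)
qed

section \<open>Requirements and generic reals\<close>

definition Fo :: "cond \<Rightarrow> nat \<Rightarrow> name \<Rightarrow> nat \<Rightarrow> nat set \<Rightarrow> bool" where
  "Fo c q \<nu> i S \<longleftrightarrow> fo c {A. C q A (lam \<nu>) i \<in> S}"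

definition Req :: "nat \<Rightarrow> cond \<Rightarrow> bool" where "Req = req valid (\<lambda>\<mu> \<kappa>. lam \<mu> \<le> lam \<kappa>) Fo"

lemma valid_ext: "valid (c, q) \<Longrightarrow> ext c' c \<Longrightarrow> valid (c', q)"
  unfolding valid_def using fo_ext by fastforce

lemma Fo_ext: "Fo c q \<nu> i S \<Longrightarrow> ext c' c \<Longrightarrow> Fo c' q \<nu> i S"
  unfolding Fo_def using fo_ext by blast

text \<open>The countably many possible values cannot all be excluded on comeager sets.\<close>

lemma Fo_dense: "\<exists>c' w. ext c' c \<and> Fo c' q \<nu> i {w}"
proof (rule ccontr)
  assume no: "\<not> ?thesis"
  have "fo c (- {A. C q A (lam \<nu>) i \<in> {w}})" for w
  proof (rule ccontr)
    assume "\<not> fo c (- {A. C q A (lam \<nu>) i \<in> {w}})"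
    from fo_or_refine[OF bp_Compl[OF bp_comp] this] no show False by (auto simp: Fo_def)
  qed
  then have "fo c (\<Inter>w\<in>UNIV. - {A. C q A (lam \<nu>) i \<in> {w}})" by (intro fo_INT) auto
  then show False using fo_nonempty by fastforce
qed

lemma D2_ext: "\<exists>\<mu>. valid \<mu> \<and> P \<mu> \<and> (\<forall>\<kappa>. valid \<kappa> \<longrightarrow> Q \<mu> \<kappa> \<longrightarrow> R \<kappa> \<longrightarrow> Fo c q \<kappa> i S) \<Longrightarrow> ext c' c \<Longrightarrow>
    \<exists>\<mu>. valid \<mu> \<and> P \<mu> \<and> (\<forall>\<kappa>. valid \<kappa> \<longrightarrow> Q \<mu> \<kappa> \<longrightarrow> R \<kappa> \<longrightarrow> Fo c' q \<kappa> i S)"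
  using Fo_ext by blast

lemma D3_ext: "\<exists>\<kappa>. valid \<kappa> \<and> P \<kappa> \<and> R \<kappa> \<and> Fo c q \<kappa> i S \<Longrightarrow> ext c' c \<Longrightarrow> \<exists>\<kappa>. valid \<kappa> \<and> P \<kappa> \<and> R \<kappa> \<and> Fo c' q \<kappa> i S"
  using Fo_ext by blast

lemma Req_ext: assumes "Req j c" "ext c' c" shows "Req j c'"
proof -
  define q where "q = prj 0 j"
  define \<nu> where "\<nu> = ((prj 1 j, prj 2 j), prj 3 j)"
  define \<nu>' where "\<nu>' = ((prj 4 j, prj 5 j), prj 6 j)"
  define i where "i = prj 7 j"
  define v where "v = prj 8 j"
  define D2 where "D2 = (\<lambda>c. \<exists>\<mu>. valid \<mu> \<and> \<not> lam \<nu> \<le> lam \<mu> \<and> (\<forall>\<kappa>. valid \<kappa> \<longrightarrow> lam \<mu> \<le> lam \<kappa> \<longrightarrow> \<not> lam \<nu> \<le> lam \<kappa> \<longrightarrow> Fo c q \<kappa> i {v..}))"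
  define D3 where "D3 = (\<lambda>c. \<exists>\<kappa>. valid \<kappa> \<and> lam \<nu>' \<le> lam \<kappa> \<and> \<not> lam \<nu> \<le> lam \<kappa> \<and> Fo c q \<kappa> i {..<v})"
  have D2e: "D2 c \<Longrightarrow> ext c' c \<Longrightarrow> D2 c'" for c c' unfolding D2_def by (rule D2_ext)
  have D3e: "D3 c \<Longrightarrow> ext c' c \<Longrightarrow> D3 c'" for c c' unfolding D3_def by (rule D3_ext)
  have iff: "Req j c \<longleftrightarrow> valid (c, q) \<and> (valid \<nu> \<longrightarrow> (\<exists>w. Fo c q \<nu> i {w}) \<and> decD D2 c) \<and> (valid \<nu> \<longrightarrow> valid \<nu>' \<longrightarrow> decD D3 c)" for c
    unfolding Req_def req_def Let_def q_def \<nu>_def \<nu>'_def i_def v_def D2_def D3_def ..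
  have "decD D2 c \<Longrightarrow> decD D2 c'" by (rule decD_ext[OF D2e _ assms(2)])
  moreover have "decD D3 c \<Longrightarrow> decD D3 c'" by (rule decD_ext[OF D3e _ assms(2)])
  moreover have "(\<exists>w. Fo c q \<nu> i {w}) \<Longrightarrow> \<exists>w. Fo c' q \<nu> i {w}" using Fo_ext[OF _ assms(2)] by metis
  ultimately show ?thesis using assms(1) valid_ext[OF _ assms(2), of q] unfolding iff by metis
qed

lemma Req_dense: "dense {c. Req j c}"
  unfolding dense_def
proof
  fix c
  define q where "q = prj 0 j"
  define \<nu> where "\<nu> = ((prj 1 j, prj 2 j), prj 3 j)"
  define \<nu>' where "\<nu>' = ((prj 4 j, prj 5 j), prj 6 j)"
  define i where "i = prj 7 j"
  define v where "v = prj 8 j"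
  define D2 where "D2 = (\<lambda>c. \<exists>\<mu>. valid \<mu> \<and> \<not> lam \<nu> \<le> lam \<mu> \<and> (\<forall>\<kappa>. valid \<kappa> \<longrightarrow> lam \<mu> \<le> lam \<kappa> \<longrightarrow> \<not> lam \<nu> \<le> lam \<kappa> \<longrightarrow> Fo c q \<kappa> i {v..}))"
  define D3 where "D3 = (\<lambda>c. \<exists>\<kappa>. valid \<kappa> \<and> lam \<nu>' \<le> lam \<kappa> \<and> \<not> lam \<nu> \<le> lam \<kappa> \<and> Fo c q \<kappa> i {..<v})"
  have D2e: "D2 c \<Longrightarrow> ext c' c \<Longrightarrow> D2 c'" for c c' unfolding D2_def by (rule D2_ext)
  obtain c1 where c1: "ext c1 c" "valid (c1, q)" using valid_dense by blast
  obtain c2 w where c2: "ext c2 c1" "Fo c2 q \<nu> i {w}" using Fo_dense by blast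
  obtain c3 where c3: "ext c3 c2" "decD D2 c3" using decD_dense by blast
  obtain c4 where c4: "ext c4 c3" "decD D3 c4" using decD_dense by blast
  have e42: "ext c4 c2" using c4 c3 ext_trans by blast
  have e41: "ext c4 c1" using e42 c2 ext_trans by blast
  have "valid (c4, q)" using valid_ext[OF c1(2) e41] .
  moreover have "Fo c4 q \<nu> i {w}" using Fo_ext[OF c2(2) e42] .
  moreover have "decD D2 c4" by (rule decD_ext[OF D2e c3(2) c4(1)])
  ultimately have "Req j c4"
    using c4(2) unfolding Req_def req_def Let_def q_def[symmetric] \<nu>_def[symmetric] \<nu>'_def[symmetric]
      i_def[symmetric] v_def[symmetric] D2_def[symmetric] D3_def[symmetric] by blast
  then show "\<exists>c'\<in>{c. Req j c}. ext c' c" using e41 c1(1) ext_trans by blast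
qed

definition Gen :: "nat set \<Rightarrow> bool" where "Gen A \<longleftrightarrow> (\<forall>j. \<exists>c. Req j c \<and> A \<in> cyl c)"

lemma mgr_not_Gen: "mgr {A. \<not> Gen A}"
  unfolding mgr_def by (rule exI[of _ "\<lambda>j. {c. Req j c}"]) (auto simp: Req_dense Gen_def)

lemma fo_Gen: "fo c S \<Longrightarrow> \<exists>A\<in>cyl c. A \<in> S \<and> Gen A"
proof -
  assume "fo c S"
  moreover have "fo c {A. Gen A}" unfolding fo_def by (rule mgr_mono[OF mgr_not_Gen]) auto
  ultimately show ?thesis using fo_nonempty[OF fo_Int[of c S "{A. Gen A}"]] by blast
qed

lemma Gen_req:
  assumes "Gen A" "valid \<nu>" "valid \<nu>'"
  shows "\<exists>c. A \<in> cyl c \<and> valid (c, q) \<and> (\<exists>w. Fo c q \<nu> i {w}) \<and>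
    decD (\<lambda>c. \<exists>\<mu>. valid \<mu> \<and> \<not> lam \<nu> \<le> lam \<mu> \<and> (\<forall>\<kappa>. valid \<kappa> \<longrightarrow> lam \<mu> \<le> lam \<kappa> \<longrightarrow> \<not> lam \<nu> \<le> lam \<kappa> \<longrightarrow> Fo c q \<kappa> i {v..})) c \<and>
    decD (\<lambda>c. \<exists>\<kappa>. valid \<kappa> \<and> lam \<nu>' \<le> lam \<kappa> \<and> \<not> lam \<nu> \<le> lam \<kappa> \<and> Fo c q \<kappa> i {..<v}) c"
proof -
  define f where "f = (\<lambda>k::nat. if k = 0 then q else if k = 1 then fst (fst \<nu>) else if k = 2 then snd (fst \<nu>)
    else if k = 3 then snd \<nu> else if k = 4 then fst (fst \<nu>') else if k = 5 then snd (fst \<nu>')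
    else if k = 6 then snd \<nu>' else if k = 7 then i else (v::nat))" 
  \<comment> \<open>Nine parameters: the system, two names of three numbers each, a component and a
    threshold.\<close>
  define j where "j = encv 9 f"
  have p: "prj k j = f k" if "k < 9" for k using that by (simp add: j_def prj_encv)
  have pj: "prj 0 j = q" "((prj 1 j, prj 2 j), prj 3 j) = \<nu>" "((prj 4 j, prj 5 j), prj 6 j) = \<nu>'" "prj 7 j = i" "prj 8 j = v"
    using p[of 0] p[of 1] p[of 2] p[of 3] p[of 4] p[of 5] p[of 6] p[of 7] p[of 8] by (simp_all add: f_def)
  obtain c where c: "Req j c" "A \<in> cyl c" using assms(1) unfolding Gen_def by blast
  note r = c(1)[unfolded Req_def req_def Let_def pj]
  show ?thesis
    by (intro exI[of _ c] conjI c(2)) (use r assms(2,3) in \<open>simp_all only: simp_thms\<close>)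
qed

text \<open>Only the limit case uses the requirements: they let \<open>A\<close> meet conditions
  that decide each threshold of the limit inferior. The value forced at \<open>t\<close> is compared
  with the true one by means of a second generic real in the same cylinder.\<close>

lemma truth:
  assumes "t \<in> L" "Gen A" shows "\<exists>c. A \<in> cyl c \<and> fo c {A'. C q A' t i = C q A t i}"
  using assms
proof (induction t arbitrary: A i rule: less_induct)
  case (less t)
  have IH: "\<exists>c. A \<in> cyl c \<and> fo c {A'. C q A' u i = C q A u i}" if "u < t" "Gen A" for u A i
    using less.IH[OF that(1) L_down[OF less.prems(1) that(1)] that(2)] .
  show ?case
  proof (cases t rule: om1_cases)
    case 1
    then show ?thesis using restr_cyl[of A 0] fo_UNIV by (intro exI[of _ "restr A 0"]) (simp add: C_def)
  next
    case (2 s)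
    have "\<forall>i. \<exists>c. A \<in> cyl c \<and> fo c {A'. C q A' s i = C q A s i}" using IH[of s A] 2 less.prems(2) by simp
    then obtain c where c: "\<And>i. A \<in> cyl (c i)" "\<And>i. fo (c i) {A'. C q A' s i = C q A s i}" by metis
    \<comment> \<open>Besides the state at \<open>s\<close>, the condition must fix the bit that the
      step from \<open>s\<close> queries.\<close>
    define n where "n = qr q (C q A s)"
    define l where "l = Max (insert (Suc n) ((\<lambda>i. snd (c i)) ` {..<D}))"
    have "snd (c i) \<le> l" if "i < D" for i using that by (simp add: l_def)
    then have "fo (restr A l) {A'. C q A' s i = C q A s i}" if "i < D" for i
      using fo_ext[OF c(2) ext_restr[OF c(1)]] that by blast
    then have "fo (restr A l) (\<Inter>i\<in>{..<D}. {A'. C q A' s i = C q A s i})" by (intro fo_INT) auto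
    moreover have "fo (restr A l) (cyl (restr A l))" by (simp add: fo_def mgr_empty)
    ultimately have "fo (restr A l) ((\<Inter>i\<in>{..<D}. {A'. C q A' s i = C q A s i}) \<inter> cyl (restr A l))" by (rule fo_Int)
    moreover have "C q A' t i = C q A t i"
      if A': "\<forall>i<D. C q A' s i = C q A s i" "A' \<in> cyl (restr A l)" for A'
    proof -
      have "C q A' s = C q A s"
      proof
        fix i show "C q A' s i = C q A s i"
          using A'(1) C_Z[of q A s] C_Z[of q A' s] by (cases "i < D") (auto simp: Z_def)
      qed
      moreover have "Suc n \<le> l" by (simp add: l_def)
      then have "n \<in> A' \<longleftrightarrow> n \<in> A" using A'(2) by (simp add: cyl_restr)
      then have "H q A' (C q A s) = H q A (C q A s)" by (intro use) (simp add: n_def)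
      ultimately show ?thesis by (simp add: 2 C_def)
    qed
    ultimately have "fo (restr A l) {A'. C q A' t i = C q A t i}" by (elim fo_mono) auto
    then show ?thesis using restr_cyl by blast
  next
    case 3
    obtain \<nu> where \<nu>: "valid \<nu>" "lam \<nu> = t" using less.prems(1) by (auto simp: L_def)
    define D2 where "D2 v = (\<lambda>c. \<exists>\<mu>. valid \<mu> \<and> \<not> lam \<nu> \<le> lam \<mu> \<and> (\<forall>\<kappa>. valid \<kappa> \<longrightarrow> lam \<mu> \<le> lam \<kappa> \<longrightarrow> \<not> lam \<nu> \<le> lam \<kappa> \<longrightarrow> Fo c q \<kappa> i {v..}))" for v
    define LI where "LI A v \<longleftrightarrow> (\<exists>s<t. \<forall>u. s \<le> u \<longrightarrow> u < t \<longrightarrow> v \<le> C q A u i)" for A v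
    have agree: "C q A u i \<in> S" if u: "u < t" and A: "Gen A" "A \<in> cyl c" and f: "fo c {A'. C q A' u i \<in> S}" for A c u S
    proof -
      obtain d where d: "A \<in> cyl d" "fo d {A'. C q A' u i = C q A u i}" using IH[OF u A(1)] by blast
      from fo_consistent[OF f d(2) A(2) d(1)] show ?thesis by auto
    qed
    \<comment> \<open>\<open>D2\<close> bounds the component at named times only, but all times
      below \<open>t\<close> are named, as \<open>L\<close> is closed downwards.\<close>
    have c1: "LI A v" if A: "Gen A" "A \<in> cyl c" "D2 v c" for A c v
    proof -
      obtain \<mu> where \<mu>: "valid \<mu>" "lam \<mu> < t" "\<And>\<kappa>. valid \<kappa> \<Longrightarrow> lam \<mu> \<le> lam \<kappa> \<Longrightarrow> lam \<kappa> < t \<Longrightarrow> Fo c q \<kappa> i {v..}"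
        using A(3) unfolding D2_def \<nu>(2) not_le by blast
      have "v \<le> C q A u i" if u: "lam \<mu> \<le> u" "u < t" for u
      proof -
        obtain \<kappa> where \<kappa>: "valid \<kappa>" "lam \<kappa> = u" using L_down[OF less.prems(1) u(2)] by (auto simp: L_def)
        then have "fo c {A'. C q A' u i \<in> {v..}}" using \<mu>(3)[of \<kappa>] u by (simp add: Fo_def)
        from agree[OF u(2) A(1,2) this] show ?thesis by simp
      qed
      then show ?thesis unfolding LI_def using \<mu>(2) by blast
    qed
    have c2: "\<not> LI A v" if A: "Gen A" "A \<in> cyl c" "\<forall>c'. ext c' c \<longrightarrow> \<not> D2 v c'" for A c v
    proof
      assume "LI A v"
      then obtain s where s: "s < t" "\<forall>u. s \<le> u \<longrightarrow> u < t \<longrightarrow> v \<le> C q A u i" unfolding LI_def by blast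
      obtain \<nu>' where \<nu>': "valid \<nu>'" "lam \<nu>' = s" using L_down[OF less.prems(1) s(1)] by (auto simp: L_def)
      \<comment> \<open>By this requirement, a drop below \<open>v\<close> after \<open>s\<close>
        that remains forceable near \<open>A\<close> would have to occur along \<open>A\<close>.
        Since it does not, a finite part of \<open>A\<close> forces the threshold from
        \<open>s\<close> on.\<close>
      define D3 where "D3 = (\<lambda>c. \<exists>\<kappa>. valid \<kappa> \<and> lam \<nu>' \<le> lam \<kappa> \<and> \<not> lam \<nu> \<le> lam \<kappa> \<and> Fo c q \<kappa> i {..<v})"
      obtain d where d: "A \<in> cyl d" "decD D3 d"
        using Gen_req[OF A(1) \<nu>(1) \<nu>'(1), of q i v] unfolding D3_def by blast
      have "\<not> D3 d"
      proof
        assume "D3 d"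
        then obtain \<kappa> where \<kappa>: "valid \<kappa>" "s \<le> lam \<kappa>" "lam \<kappa> < t" "Fo d q \<kappa> i {..<v}"
          unfolding D3_def \<nu>(2) \<nu>'(2) not_le by blast
        then have "C q A (lam \<kappa>) i \<in> {..<v}" using agree[OF \<kappa>(3) A(1) d(1) \<kappa>(4)[unfolded Fo_def]] by blast
        then show False using s(2) \<kappa>(2,3) by force
      qed
      then have no3: "\<forall>d'. ext d' d \<longrightarrow> \<not> D3 d'" using d(2) by (auto simp: decD_def)
      obtain l where l: "ext (restr A l) c" "ext (restr A l) d" using compatible[OF A(2) d(1)] by blast
      have "Fo (restr A l) q \<kappa> i {v..}" if \<kappa>: "valid \<kappa>" "s \<le> lam \<kappa>" "lam \<kappa> < t" for \<kappa>
      proof (rule ccontr)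
        assume "\<not> Fo (restr A l) q \<kappa> i {v..}"
        from fo_or_refine[OF bp_comp this[unfolded Fo_def]]
        obtain d' where d': "ext d' (restr A l)" "fo d' (- {A. C q A (lam \<kappa>) i \<in> {v..}})" by blast
        have "- {A. C q A (lam \<kappa>) i \<in> {v..}} = {A. C q A (lam \<kappa>) i \<in> {..<v}}" by auto
        then have "Fo d' q \<kappa> i {..<v}" using d'(2) by (simp only: Fo_def)
        then have "D3 d'" unfolding D3_def \<nu>(2) \<nu>'(2) not_le using \<kappa> by blast
        then show False using no3 d'(1) l(2) ext_trans by blast
      qed
      then have "D2 v (restr A l)" unfolding D2_def \<nu>(2) not_le using \<nu>' s(1) by blast
      then show False using A(3) l(1) by blast
    qed
    have dec: "\<exists>c. A \<in> cyl c \<and> decD (D2 v) c" if "Gen A" for A v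
      using Gen_req[OF that \<nu>(1) \<nu>(1), of q i v] unfolding D2_def by blast
    have D2e: "D2 v c \<Longrightarrow> ext c' c \<Longrightarrow> D2 v c'" for v c c' unfolding D2_def by (rule D2_ext)
    have Cr: "C q A t i = reset_if_infinite (linf t (\<lambda>u. C q A u i))" for A
      unfolding C_def run_olim[OF 3] by (simp add: lm_def)
    have LIl: "enat v \<le> linf t (\<lambda>u. C q A u i) \<longleftrightarrow> LI A v" for A v
      unfolding LI_def le_linf_iff[OF 3] ..
    obtain c w where c: "A \<in> cyl c" "Fo c q \<nu> i {w}"
      using Gen_req[OF less.prems(2) \<nu>(1) \<nu>(1), of q i 0] by blast
    have cw: "fo c {A'. C q A' t i = w}" using c(2) by (simp add: Fo_def \<nu>(2))
    \<comment> \<open>Some generic \<open>A'\<close> close to \<open>A\<close> has the forced value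
      \<open>w\<close> and shares the decided thresholds with \<open>A\<close>; so the limit rule
      gives the same value for both.\<close>
    have "C q A t i = w"
    proof (cases "linf t (\<lambda>u. C q A u i)")
      case (enat k)
      have LI: "LI A k" "\<not> LI A (Suc k)" using LIl[where A=A] enat by (metis enat_ord_simps(1) order_refl, metis Suc_n_not_le_n enat_ord_simps(1))
      obtain d where d: "A \<in> cyl d" "decD (D2 k) d" using dec[OF less.prems(2)] by blast
      obtain e where e: "A \<in> cyl e" "decD (D2 (Suc k)) e" using dec[OF less.prems(2)] by blast
      have dk: "D2 k d" using d c2[OF less.prems(2) d(1)] LI(1) unfolding decD_def by blast
      have ek: "\<forall>c'. ext c' e \<longrightarrow> \<not> D2 (Suc k) c'" using e c1[OF less.prems(2) e(1)] LI(2) unfolding decD_def by blast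
      obtain l where l: "ext (restr A l) c" "ext (restr A l) d" "ext (restr A l) e"
        using c(1) d(1) e(1) by (meson ext_restr max.cobounded1 max.cobounded2 order_trans)
      obtain A' where A': "A' \<in> cyl (restr A l)" "C q A' t i = w" "Gen A'"
        using fo_Gen[OF fo_ext[OF cw l(1)]] by blast
      have "LI A' k" by (rule c1[OF A'(3,1) D2e[OF dk l(2)]])
      moreover have "\<not> LI A' (Suc k)" by (rule c2[OF A'(3,1)]) (use ek l(3) ext_trans in blast)
      ultimately have "enat k \<le> linf t (\<lambda>u. C q A' u i)" "\<not> enat (Suc k) \<le> linf t (\<lambda>u. C q A' u i)" by (simp_all add: LIl)
      then have "linf t (\<lambda>u. C q A' u i) = enat k" by (cases "linf t (\<lambda>u. C q A' u i)") auto
      then show ?thesis using A'(2) Cr[of A'] Cr[of A] enat by simp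
    next
      case infinity
      have LI: "LI A (Suc w)" using LIl[of "Suc w" A] infinity by simp
      obtain d where d: "A \<in> cyl d" "decD (D2 (Suc w)) d" using dec[OF less.prems(2)] by blast
      have dk: "D2 (Suc w) d" using d c2[OF less.prems(2) d(1)] LI unfolding decD_def by blast
      obtain l where l: "ext (restr A l) c" "ext (restr A l) d" using compatible[OF c(1) d(1)] by blast
      obtain A' where A': "A' \<in> cyl (restr A l)" "C q A' t i = w" "Gen A'"
        using fo_Gen[OF fo_ext[OF cw l(1)]] by blast
      have "LI A' (Suc w)" by (rule c1[OF A'(3,1) D2e[OF dk l(2)]])
      then have "enat (Suc w) \<le> linf t (\<lambda>u. C q A' u i)" by (simp add: LIl)
      then have "w = 0" using A'(2) Cr[of A'] by (cases "linf t (\<lambda>u. C q A' u i)") auto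
      then show ?thesis using Cr[of A] infinity by simp
    qed
    then show ?thesis using c(1) cw by auto
  qed
qed

lemma truth_state:
  assumes "t \<in> L" "Gen A" shows "\<exists>c. A \<in> cyl c \<and> fo c {A'. C q A' t = C q A t}"
proof -
  have "\<forall>i. \<exists>c. A \<in> cyl c \<and> fo c {A'. C q A' t i = C q A t i}" using truth[OF assms] by blast
  then obtain c where c: "\<And>i. A \<in> cyl (c i)" "\<And>i. fo (c i) {A'. C q A' t i = C q A t i}" by metis
  define l where "l = Max (insert 0 ((\<lambda>i. snd (c i)) ` {..<D}))"
  have "snd (c i) \<le> l" if "i < D" for i using that by (simp add: l_def)
  then have "fo (restr A l) {A'. C q A' t i = C q A t i}" if "i < D" for i
    using fo_ext[OF c(2) ext_restr[OF c(1)]] that by blast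
  then have "fo (restr A l) (\<Inter>i\<in>{..<D}. {A'. C q A' t i = C q A t i})" by (intro fo_INT) auto
  moreover have "C q A' t = C q A t" if "\<forall>i<D. C q A' t i = C q A t i" for A'
  proof
    fix i show "C q A' t i = C q A t i"
      using that C_Z[of q A t] C_Z[of q A' t] by (cases "i < D") (auto simp: Z_def)
  qed
  ultimately have "fo (restr A l) {A'. C q A' t = C q A t}" by (elim fo_mono) auto
  then show ?thesis using restr_cyl by blast
qed

lemma truth_agree:
  assumes "t \<in> L" "Gen A" "A \<in> cyl c" "fo c {A'. C q A' t \<in> S}" shows "C q A t \<in> S"
proof -
  obtain d where d: "A \<in> cyl d" "fo d {A'. C q A' t = C q A t}" using truth_state[OF assms(1,2), of q] by blast
  from fo_consistent[OF assms(4) d(2) assms(3) d(1)] show ?thesis by auto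
qed

text \<open>Having halted at the named time, and not having halted earlier, are statements about
  states at times in \<open>L\<close>, to which the truth lemma applies.\<close>

lemma truth_eta:
  assumes "valid (c, q)" "Gen A" "A \<in> cyl c" shows "eta q A = lam (c, q)"
proof -
  let ?t = "lam (c, q)"
  have f: "fo c {A. eta q A = ?t}" using valid_fo[OF assms(1)] by simp
  have t: "?t \<in> L" using assms(1) by (auto simp: L_def)
  have "C q A ?t \<in> {x. hl q x}"
    by (rule truth_agree[OF t assms(2,3)], rule fo_mono[OF f]) (auto simp: hl_iff)
  moreover have "C q A u \<in> {x. \<not> hl q x}" if "u < ?t" for u
    by (rule truth_agree[OF L_down[OF t that] assms(2,3)], rule fo_mono[OF f]) (use that in \<open>auto simp: hl_iff\<close>)
  ultimately show ?thesis by (intro eta_eqI) auto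
qed

lemma Gen_valid:
  assumes "Gen A" shows "\<exists>c. A \<in> cyl c \<and> valid (c, q)"
proof -
  have "prj 0 (encv 1 (\<lambda>_. q)) = q" by (simp add: prj_0)
  then show ?thesis using assms unfolding Gen_def Req_def req_def Let_def by metis
qed

lemma eta_L: "Gen A \<Longrightarrow> eta q A \<in> L"
proof -
  assume A: "Gen A"
  then obtain c where c: "A \<in> cyl c" "valid (c, q)" using Gen_valid by blast
  then have "eta q A = lam (c, q)" using truth_eta[OF c(2) A c(1)] by simp
  then show ?thesis using c(2) unfolding L_def by auto
qed

subsection \<open>Reading off the forcing relation from a generic real\<close>

text \<open>Every extension of \<open>c\<close> is realised by a generic real, namely a finite
  modification of \<open>y\<close>. If forcing fails, an extension forces the opposite, and this
  shows on the corresponding modification.\<close>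

lemma Fo_read:
  assumes "\<And>c. Gen (md y c)" "valid \<nu>"
  shows "Fo c q \<nu> i S \<longleftrightarrow> (\<forall>c'. ext c' c \<longrightarrow> C q (md y c') (lam \<nu>) i \<in> S)"
proof
  have t: "lam \<nu> \<in> L" using assms(2) by (auto simp: L_def)
  have agree: "C q (md y c') (lam \<nu>) i \<in> S" if "fo c' {A. C q A (lam \<nu>) i \<in> S}" for c' S
    using truth_agree[OF t assms(1) md_cyl, of c' q "{x. x i \<in> S}"] that by simp
  show "Fo c q \<nu> i S \<Longrightarrow> \<forall>c'. ext c' c \<longrightarrow> C q (md y c') (lam \<nu>) i \<in> S"
    using agree Fo_ext unfolding Fo_def by blast
  assume *: "\<forall>c'. ext c' c \<longrightarrow> C q (md y c') (lam \<nu>) i \<in> S"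
  show "Fo c q \<nu> i S"
  proof (rule ccontr)
    assume "\<not> Fo c q \<nu> i S"
    from fo_or_refine[OF bp_comp this[unfolded Fo_def]]
    obtain c' where c': "ext c' c" "fo c' (- {A. C q A (lam \<nu>) i \<in> S})" by blast
    have "- {A. C q A (lam \<nu>) i \<in> S} = {A. C q A (lam \<nu>) i \<in> - S}" by auto
    then have "C q (md y c') (lam \<nu>) i \<in> - S" using agree[of c' "- S"] c'(2) by simp
    then show False using * c'(1) by blast
  qed
qed

text \<open>If the common halting time were not forced, an extension would force a different
  outcome; the modification of \<open>y\<close> along this extension is generic and refutes
  that.\<close>

lemma valid_read:
  assumes "\<And>c. Gen (md y c)"
  shows "valid (c, q) \<longleftrightarrow> (\<forall>c'. ext c' c \<longrightarrow> eta q (md y c') = eta q (md y c))"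
    "valid (c, q) \<Longrightarrow> lam (c, q) = eta q (md y c)"
proof -
  show lam: "lam (c, q) = eta q (md y c)" if "valid (c, q)"
    using truth_eta[OF that assms md_cyl] by simp
  show "valid (c, q) \<longleftrightarrow> (\<forall>c'. ext c' c \<longrightarrow> eta q (md y c') = eta q (md y c))"
  proof (intro iffI allI impI)
    fix c' assume v: "valid (c, q)" and e: "ext c' c"
    have "md y c' \<in> cyl c" using md_cyl cyl_ext[OF e] by blast
    then show "eta q (md y c') = eta q (md y c)" using truth_eta[OF v assms] lam[OF v] by simp
  next
    assume *: "\<forall>c'. ext c' c \<longrightarrow> eta q (md y c') = eta q (md y c)"
    let ?t = "eta q (md y c)"
    have "fo c {A. eta q A = ?t}"
    proof (rule ccontr)
      assume "\<not> fo c {A. eta q A = ?t}"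
      from fo_or_refine[OF bp_eta this] obtain c' where c': "ext c' c" "fo c' (- {A. eta q A = ?t})" by blast
      obtain d where d: "md y c' \<in> cyl d" "valid (d, q)" using Gen_valid[OF assms] by blast
      have "lam (d, q) = ?t" using truth_eta[OF d(2) assms d(1)] * c'(1) by simp
      then have "fo d {A. eta q A = ?t}" using valid_fo[OF d(2)] by simp
      from fo_consistent[OF this c'(2) d(1) md_cyl] show False by auto
    qed
    then show "valid (c, q)" by (auto simp: valid_def)
  qed
qed

end

section \<open>A universal system for machines with few registers\<close>

definition rg :: "nat \<Rightarrow> vec \<Rightarrow> nat \<Rightarrow> nat" where "rg N v a = (if a < N then v (Suc a) else 0)"

text \<open>Line \<open>l\<close> of the program \<open>p\<close> occupies the entries
  \<open>4 * l\<close> to \<open>4 * l + 3\<close>: operation, two registers and jump target. As the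
  program is data, one computable map of fixed dimension serves all programs with \<open>N\<close>
  registers.\<close>

definition ustep :: "nat \<Rightarrow> nat \<Rightarrow> nat set \<Rightarrow> vec \<Rightarrow> vec" where
  "ustep N p A v = (let l = v 0; op = prj (4 * l) p; a = prj (4 * l + 1) p; b = prj (4 * l + 2) p;
      q = prj (4 * l + 3) p in
    (\<lambda>i. if i = 0 then (if op = 4 \<and> rg N v a = rg N v b then q else Suc l)
      else if op = 1 \<and> i = Suc a then 0
      else if op = 2 \<and> i = Suc a then Suc (v i)
      else if op = 3 \<and> i = Suc b then rg N v a
      else if op = 5 \<and> i = Suc a then (if rg N v a \<in> A then 1 else 0)
      else v i))"

text \<open>Operation 0 is what \<open>prj\<close> returns beyond the end of a coded
  program.\<close>

definition uhal :: "nat \<Rightarrow> vec \<Rightarrow> bool" where "uhal p v \<longleftrightarrow> prj (4 * v 0) p = 0"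

definition uqry :: "nat \<Rightarrow> nat \<Rightarrow> vec \<Rightarrow> nat" where "uqry N p v = rg N v (prj (4 * v 0 + 1) p)"

lemma ustep_use: "(uqry N p v \<in> A \<longleftrightarrow> uqry N p v \<in> A') \<Longrightarrow> ustep N p A v = ustep N p A' v"
  by (simp add: ustep_def uqry_def Let_def)

abbreviation lsys :: "nat \<Rightarrow> nat \<Rightarrow> nat set \<Rightarrow> vec \<Rightarrow> vec" where
  "lsys N p A \<equiv> lstep (Suc N) (ustep N p A) (uhal p)"

text \<open>Status, phase, \<open>N + 1\<close> components of the configuration, and
  \<open>N + 2\<close> sets, one for each possible number of zeros.\<close>

definition sdim :: "nat \<Rightarrow> nat" where "sdim N = Suc (wreg (Suc N) (Suc N))"

lemma lsys_use: "(uqry N p (cfg (Suc N) s) \<in> A \<longleftrightarrow> uqry N p (cfg (Suc N) s) \<in> A') \<Longrightarrow> lsys N p A s = lsys N p A' s"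
  using ustep_use[of N p "cfg (Suc N) s" A A'] by (simp add: lstep_def cong: if_cong)

lemma lsys_beyond: "sdim N \<le> i \<Longrightarrow> lsys N p A s i = s i"
  using zc_le[of "Suc N" "cfg (Suc N) s"] by (auto simp: lstep_def sdim_def wreg_def)

text \<open>The systems below are indexed by a program together with a list of states; they run the program
  until the states of the list have been met in this order. In this way every time up to the end of
  a run is the halting time of some system.\<close>

definition tail :: "vec \<Rightarrow> vec" where "tail s = (\<lambda>i. s (Suc i))"

definition tmatch :: "nat \<Rightarrow> nat \<Rightarrow> vec \<Rightarrow> bool" where
  "tmatch N q s \<longleftrightarrow> s 0 < prj 1 q \<and> encv (sdim N) (tail s) = prj (s 0 + 2) q"

definition hhal :: "nat \<Rightarrow> nat \<Rightarrow> vec \<Rightarrow> bool" where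
  "hhal N q s \<longleftrightarrow> s 1 \<noteq> 0 \<or> (tmatch N q s \<and> Suc (s 0) = prj 1 q)"

definition hstep :: "nat \<Rightarrow> nat \<Rightarrow> nat set \<Rightarrow> vec \<Rightarrow> vec" where
  "hstep N q A s = (if hhal N q s then s else (\<lambda>i. if i = 0 then (if tmatch N q s then Suc (s 0) else s 0)
     else lsys N (prj 0 q) A (tail s) (i - 1)))"

definition hqry :: "nat \<Rightarrow> nat \<Rightarrow> vec \<Rightarrow> nat" where
  "hqry N q s = uqry N (prj 0 q) (cfg (Suc N) (tail s))"

definition mkq :: "nat \<Rightarrow> nat list \<Rightarrow> nat" where
  "mkq p ts = encv (length ts + 2) (\<lambda>i. if i = 0 then p else if i = 1 then length ts else ts ! (i - 2))"

lemma prj_mkq: "prj 0 (mkq p ts) = p" "prj 1 (mkq p ts) = length ts"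
  "k < length ts \<Longrightarrow> prj (k + 2) (mkq p ts) = ts ! k"
  by (simp_all add: mkq_def prj_encv del: encv.simps add_2_eq_Suc')

section \<open>Every time of a run is a halting time\<close>

context
  fixes N :: nat and A :: "nat set"
begin

definition Cp :: "nat \<Rightarrow> om1 \<Rightarrow> vec" where "Cp p = loop_system.C (Suc N) (ustep N p A) (uhal p)"

definition Hc :: "nat \<Rightarrow> om1 \<Rightarrow> vec" where "Hc q = run (hstep N q A) (\<lambda>_. 0)"

lemma Cp_simps: "Cp p ozero = (\<lambda>_. 0)" "Cp p (osuc t) = lsys N p A (Cp p t)" "olim t \<Longrightarrow> Cp p t i = lm t (\<lambda>u. Cp p u i)"
  unfolding Cp_def by (rule loop_system.C_zero loop_system.C_osuc loop_system.C_olim; assumption?)+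

lemma Cp_total: "\<exists>t. Cp p t 0 \<noteq> 0" unfolding Cp_def by (rule loop_system.total)

lemma Cp_frozen: "Cp p t 0 \<noteq> 0 \<Longrightarrow> t \<le> u \<Longrightarrow> Cp p u = Cp p t" unfolding Cp_def by (rule loop_system.C_frozen)

lemma Cp_beyond: "sdim N \<le> i \<Longrightarrow> Cp p t i = 0"
proof (induction t rule: om1_induct)
  case zero
  then show ?case by (simp add: Cp_simps)
next
  case (suc t)
  then show ?case by (simp add: Cp_simps lsys_beyond)
next
  case (lim t)
  show ?case unfolding Cp_simps(3)[OF lim(1)]
    by (rule lm_const[OF lim(1) olim_pos[OF lim(1)]]) (use lim in simp)
qed

lemma Hc_beyond: "Suc (sdim N) \<le> i \<Longrightarrow> Hc q t i = 0"
proof (induction t rule: om1_induct)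
  case zero
  then show ?case by (simp add: Hc_def)
next
  case (suc t)
  have "Hc q (osuc t) i = hstep N q A (Hc q t) i" by (simp add: Hc_def)
  also have "\<dots> = 0" using suc lsys_beyond[of N "i - 1" "prj 0 q" A "tail (Hc q t)"]
    by (auto simp: hstep_def tail_def)
  finally show ?case .
next
  case (lim t)
  show ?case unfolding Hc_def run_olim[OF lim(1)] unfolding Hc_def[symmetric]
    by (rule lm_const[OF lim(1) olim_pos[OF lim(1)]]) (use lim in simp)
qed

text \<open>Until the system halts, the counter of matched states does not influence the rest of the
  state.\<close>

lemma tail_Hc:
  assumes "\<And>u. u < t \<Longrightarrow> \<not> hhal N q (Hc q u)" shows "tail (Hc q t) = Cp (prj 0 q) t"
  using assms
proof (induction t rule: om1_induct)
  case zero
  then show ?case by (simp add: Hc_def Cp_simps tail_def)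
next
  case (suc t)
  have "tail (Hc q t) = Cp (prj 0 q) t"
    by (rule suc.IH) (use suc.prems in \<open>simp add: less_osuc_iff less_imp_le\<close>)
  moreover have "\<not> hhal N q (Hc q t)" using suc.prems by simp
  ultimately show ?case by (simp add: Hc_def Cp_simps hstep_def tail_def[of "\<lambda>i. if i = 0 then _ i else _ i"] tail_def)
next
  case (lim t)
  have IH: "Hc q u (Suc i) = Cp (prj 0 q) u i" if "u < t" for u i
  proof -
    have "tail (Hc q u) = Cp (prj 0 q) u" by (rule lim.IH[OF that]) (use lim.prems that in force)
    then show ?thesis by (metis tail_def)
  qed
  show ?case
  proof
    fix i
    have "Hc q t (Suc i) = lm t (\<lambda>u. Hc q u (Suc i))" by (simp add: Hc_def run_olim[OF lim(1)])
    also have "\<dots> = lm t (\<lambda>u. Cp (prj 0 q) u i)" by (rule lm_cong) (rule IH)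
    finally show "tail (Hc q t) i = Cp (prj 0 q) t i" by (simp add: tail_def Cp_simps(3)[OF lim(1)])
  qed
qed

lemma Hc_total: "\<exists>t. hhal N q (Hc q t)"
proof (rule ccontr)
  assume no: "\<not> ?thesis"
  obtain t where t: "Cp (prj 0 q) t 0 \<noteq> 0" using Cp_total by blast
  have "tail (Hc q t) = Cp (prj 0 q) t" by (rule tail_Hc) (use no in blast)
  then have "Hc q t 1 \<noteq> 0" using t by (metis One_nat_def tail_def)
  then show False using no by (auto simp: hhal_def)
qed

definition exact :: "nat \<Rightarrow> om1 \<Rightarrow> bool" where
  "exact q t \<longleftrightarrow> hhal N q (Hc q t) \<and> (\<forall>u<t. \<not> hhal N q (Hc q u))"

lemma status_Hc: "(\<And>u. u < t \<Longrightarrow> \<not> hhal N q (Hc q u)) \<Longrightarrow> Hc q t 1 = Cp (prj 0 q) t 0"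
  using tail_Hc[of t q] by (metis One_nat_def tail_def)

lemma code_Cp_eq: "encv (sdim N) (Cp p t) = encv (sdim N) (Cp p u) \<Longrightarrow> Cp p t = Cp p u"
proof
  fix i assume "encv (sdim N) (Cp p t) = encv (sdim N) (Cp p u)"
  then show "Cp p t i = Cp p u i"
    using prj_encv[of i "sdim N" "Cp p t"] prj_encv[of i "sdim N" "Cp p u"] Cp_beyond[of i p]
    by (cases "i < sdim N") auto
qed

text \<open>Up to \<open>s\<close> the longer list acts like the shorter one. At \<open>s\<close>
  the last of the old states is met, and from then on the counter waits for the state at
  \<open>t\<close>, which by assumption does not occur in between.\<close>

lemma exact_extend:
  assumes ex: "exact (mkq p ts) s" and s: "Cp p s 0 = 0" "s < t"
    and t: "\<And>u. u < t \<Longrightarrow> Cp p u 0 = 0" "\<And>u. s < u \<Longrightarrow> u < t \<Longrightarrow> Cp p u \<noteq> Cp p t"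
  shows "exact (mkq p (ts @ [encv (sdim N) (Cp p t)])) t"
proof -
  define q1 where "q1 = mkq p ts"
  define q2 where "q2 = mkq p (ts @ [encv (sdim N) (Cp p t)])"
  define n where "n = length ts"
  have p1: "prj 0 q1 = p" "prj 1 q1 = n" "\<And>k. k < n \<Longrightarrow> prj (k + 2) q1 = ts ! k"
    unfolding q1_def n_def by (rule prj_mkq)+
  have p2: "prj 0 q2 = p" "prj 1 q2 = Suc n" "\<And>k. k < n \<Longrightarrow> prj (k + 2) q2 = ts ! k"
    "prj (n + 2) q2 = encv (sdim N) (Cp p t)"
    unfolding q2_def n_def using prj_mkq[of p "ts @ [encv (sdim N) (Cp p t)]"] prj_mkq(3)[of _ "ts @ [encv (sdim N) (Cp p t)]" p]
    by (simp_all add: nth_append)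
  have e1: "hhal N q1 (Hc q1 s)" "\<And>u. u < s \<Longrightarrow> \<not> hhal N q1 (Hc q1 u)" using ex by (auto simp: exact_def q1_def)
  have st1: "Hc q1 s 1 = 0" using status_Hc[of s q1] e1(2) s(1) p1(1) by simp
  have ms: "tmatch N q1 (Hc q1 s)" "Suc (Hc q1 s 0) = n" using e1(1) st1 p1(2) by (auto simp: hhal_def)
  have npos: "0 < n" using ms(2) by simp
  \<comment> \<open>The counter stays below \<open>n\<close>, because a match at the value
    \<open>n - 1\<close> makes the system halt.\<close>
  have K: "Hc q1 u 0 < n" if "u \<le> s" for u
    using that
  proof (induction u rule: om1_induct)
    case zero
    then show ?case using npos by (simp add: Hc_def)
  next
    case (suc u)
    have us: "u < s" using suc.prems by (simp add: osuc_le_iff)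
    have "\<not> hhal N q1 (Hc q1 u)" using e1(2)[OF us] .
    then have "Hc q1 (osuc u) 0 = (if tmatch N q1 (Hc q1 u) then Suc (Hc q1 u 0) else Hc q1 u 0)"
      by (simp add: Hc_def hstep_def)
    then show ?case using suc.IH us \<open>\<not> hhal N q1 (Hc q1 u)\<close> p1(2) by (auto simp: hhal_def Suc_lessI split: if_splits)
  next
    case (lim u)
    have "Hc q1 u 0 = lm u (\<lambda>w. Hc q1 w 0)" by (simp add: Hc_def run_olim[OF lim(1)])
    moreover have "lm u (\<lambda>w. Hc q1 w 0) < n"
    proof (cases rule: lm_cases[OF lim(1), of "\<lambda>w. Hc q1 w 0", case_names fin inf])
      case (fin w x)
      then obtain y where y: "y < u" "Hc q1 y 0 = w" by blast
      have "Hc q1 y 0 < n" by (rule lim.IH[OF y(1)]) (use y(1) lim.prems in simp)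
      then show ?thesis using fin(2) y(2) by simp
    qed (use npos in simp)
    ultimately show ?case by simp
  qed
  have m12: "tmatch N q1 x \<longleftrightarrow> tmatch N q2 x" if "x 0 < n" for x
    unfolding tmatch_def p1(2) p2(2) p1(3)[OF that] p2(3)[OF that] using that by simp
  have h2: "\<not> hhal N q2 x" if "x 1 = 0" "x 0 < n" for x using that p2(2) by (simp add: hhal_def)
  have eq: "Hc q1 u = Hc q2 u" if "u \<le> s" for u
    using that
  proof (induction u rule: om1_induct)
    case zero
    then show ?case by (simp add: Hc_def)
  next
    case (suc u)
    have us: "u < s" using suc.prems by (simp add: osuc_le_iff)
    have IH: "Hc q1 u = Hc q2 u" using suc.IH us by simp
    have n1: "\<not> hhal N q1 (Hc q1 u)" using e1(2)[OF us] .
    have k: "Hc q1 u 0 < n" using K us by simp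
    have "Hc q1 u 1 = 0" using n1 by (simp add: hhal_def)
    then have n2: "\<not> hhal N q2 (Hc q1 u)" using h2 k by blast
    have "hstep N q1 A (Hc q1 u) = hstep N q2 A (Hc q1 u)"
      using n1 n2 m12[of "Hc q1 u", OF k] p1(1) p2(1) by (simp add: hstep_def cong: if_cong)
    then show ?case using IH by (simp add: Hc_def)
  next
    case (lim u)
    show ?case
    proof
      fix i
      have "lm u (\<lambda>w. Hc q1 w i) = lm u (\<lambda>w. Hc q2 w i)"
      proof (rule lm_cong)
        fix w assume "w < u"
        then have "Hc q1 w = Hc q2 w" using lim.IH[of w] lim.prems by simp
        then show "Hc q1 w i = Hc q2 w i" by simp
      qed
      then show "Hc q1 u i = Hc q2 u i" by (simp add: Hc_def run_olim[OF lim(1)])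
    qed
  qed
  have le_s: "\<not> hhal N q2 (Hc q2 u)" if "u \<le> s" for u
  proof -
    have "Hc q1 u 1 = 0" using e1(2) st1 that by (metis hhal_def order_le_less)
    then show ?thesis using h2[of "Hc q1 u"] K[OF that] eq[OF that] by simp
  qed
  have at_s: "Hc q2 (osuc s) 0 = n"
  proof -
    have "tmatch N q2 (Hc q2 s)" using m12[of "Hc q1 s", OF K[OF order_refl]] ms(1) eq[OF order_refl] by simp
    moreover have "Suc (Hc q2 s 0) = n" using ms(2) eq[OF order_refl] by simp
    ultimately show ?thesis using le_s[OF order_refl] by (simp add: Hc_def hstep_def)
  qed
  have nomatch: "\<not> hhal N q2 (Hc q2 u)" "\<not> tmatch N q2 (Hc q2 u)"
    if u: "s < u" "u < t" "Hc q2 u 0 = n" "tail (Hc q2 u) = Cp p u" for u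
  proof -
    have "encv (sdim N) (Cp p u) \<noteq> encv (sdim N) (Cp p t)" using code_Cp_eq t(2)[OF u(1,2)] by blast
    then show m: "\<not> tmatch N q2 (Hc q2 u)" unfolding tmatch_def u(3,4) p2(4) by simp
    have "Hc q2 u 1 = Cp p u 0" using u(4) by (metis One_nat_def tail_def)
    then show "\<not> hhal N q2 (Hc q2 u)" using m t(1)[OF u(2)] by (simp add: hhal_def)
  qed
  have main: "s < u \<longrightarrow> u \<le> t \<longrightarrow> Hc q2 u 0 = n \<and> (\<forall>w<u. \<not> hhal N q2 (Hc q2 w))" for u
  proof (induction u rule: om1_induct)
    case (suc u)
    show ?case
    proof (intro impI)
      assume su: "s < osuc u" "osuc u \<le> t"
      then have ut: "u < t" by (simp add: osuc_le_iff)
      show "Hc q2 (osuc u) 0 = n \<and> (\<forall>w<osuc u. \<not> hhal N q2 (Hc q2 w))"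
      proof (cases "u = s")
        case True
        then show ?thesis using at_s le_s by (simp add: less_osuc_iff)
      next
        case False
        then have su': "s < u" using su(1) by (simp add: less_osuc_iff)
        have IH: "Hc q2 u 0 = n" "\<forall>w<u. \<not> hhal N q2 (Hc q2 w)" using suc.IH su' ut by auto
        have tl: "tail (Hc q2 u) = Cp p u" using tail_Hc[of u q2] IH(2) p2(1) by simp
        have "Hc q2 (osuc u) 0 = n" using nomatch[OF su' ut IH(1) tl] IH(1) by (simp add: Hc_def hstep_def)
        moreover have "\<forall>w<osuc u. \<not> hhal N q2 (Hc q2 w)"
          using IH(2) nomatch(1)[OF su' ut IH(1) tl] by (metis less_osuc_iff order_le_less)
        ultimately show ?thesis by blast
      qed
    qed
  next
    case (lim u)
    show ?case
    proof (intro impI)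
      assume su: "s < u" "u \<le> t"
      have IH: "Hc q2 w 0 = n" if "s < w" "w < u" for w
        using lim.IH[OF that(2)] that su(2) by simp
      have "lm u (\<lambda>w. Hc q2 w 0) = n"
        by (rule lm_const[OF lim(1) olim_osuc[OF lim(1) su(1)]]) (use IH in \<open>simp add: osuc_le_iff\<close>)
      then have 0: "Hc q2 u 0 = n" by (simp add: Hc_def run_olim[OF lim(1)])
      have "\<not> hhal N q2 (Hc q2 w)" if w: "w < u" for w
      proof (cases "w \<le> s")
        case False
        then have "s < osuc w" by (simp add: less_osuc_iff)
        moreover have "osuc w < u" by (rule olim_osuc[OF lim(1) w])
        ultimately show ?thesis using lim.IH[of "osuc w"] su(2) by simp
      qed (use le_s in simp)
      then show "Hc q2 u 0 = n \<and> (\<forall>w<u. \<not> hhal N q2 (Hc q2 w))" using 0 by blast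
    qed
  qed simp
  have fin: "Hc q2 t 0 = n" "\<forall>w<t. \<not> hhal N q2 (Hc q2 w)" using main[of t] s(2) by auto
  have "tail (Hc q2 t) = Cp p t" using tail_Hc[of t q2] fin(2) p2(1) by simp
  then have "hhal N q2 (Hc q2 t)" using fin(1) p2(2,4) by (simp add: hhal_def tmatch_def)
  then show ?thesis using fin(2) unfolding exact_def q2_def by blast
qed

text \<open>If the limit showed \<open>c\<close>, no component would drop below \<open>c\<close>
  from some time on, and two later occurrences of \<open>c\<close> would form a strong loop. The run
  would never stop, contrary to totality.\<close>

lemma no_recurrence:
  assumes "olim m" "\<And>u. u < m \<Longrightarrow> Cp p u 0 = 0" "\<And>y. y < m \<Longrightarrow> \<exists>x. y \<le> x \<and> x < m \<and> Cp p x = c"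
  shows "Cp p m \<noteq> c"
proof
  assume eq: "Cp p m = c"
  have "\<exists>s<m. \<forall>u. s \<le> u \<longrightarrow> u < m \<longrightarrow> c i \<le> Cp p u i" for i
    using le_lm[OF assms(1), of "c i" "\<lambda>u. Cp p u i"] eq Cp_simps(3)[OF assms(1), of p i] by simp
  then obtain s where s: "\<And>i. s i < m" "\<And>i u. s i \<le> u \<Longrightarrow> u < m \<Longrightarrow> c i \<le> Cp p u i" by metis
  define S where "S = Max (insert ozero (s ` {..<sdim N}))"
  have Sm: "S < m" using s(1) olim_pos[OF assms(1)] by (auto simp: S_def)
  have ge: "c i \<le> Cp p u i" if u: "S \<le> u" "u < m" for u i
  proof (cases "i < sdim N")
    case True
    then have "s i \<le> S" by (simp add: S_def)
    then show ?thesis using s(2)[of i u] u by simp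
  next
    case False
    then show ?thesis using Cp_beyond[of i p m] eq by simp
  qed
  obtain x where x: "S \<le> x" "x < m" "Cp p x = c" using assms(3)[OF Sm] by blast
  obtain x' where x': "osuc x \<le> x'" "x' < m" "Cp p x' = c" using assms(3)[OF olim_osuc[OF assms(1) x(2)]] by blast
  obtain t where t: "Cp p t 0 \<noteq> 0" using Cp_total by blast
  have R: "Cp p = run (lsys N p A) (\<lambda>_. 0)" unfolding Cp_def loop_system.C_def ..
  have "\<exists>l'\<ge>t. Cp p l' = Cp p x"
    unfolding R
  proof (rule strong_loop[of x x'])
    show "x < x'" using x'(1) by (simp add: osuc_le_iff)
    show "run (lsys N p A) (\<lambda>_. 0) x = run (lsys N p A) (\<lambda>_. 0) x'" using x(3) x'(3) by (simp add: R)
    fix u i assume "x \<le> u" "u \<le> x'"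
    then have "S \<le> u" "u < m" using x(1) x'(2) by auto
    then show "run (lsys N p A) (\<lambda>_. 0) x i \<le> run (lsys N p A) (\<lambda>_. 0) u i" using ge x(3) by (simp add: R)
  qed
  then obtain l where l: "l \<ge> t" "Cp p l = c" using x(3) by auto
  have "Cp p l = Cp p t" by (rule Cp_frozen[OF t l(1)])
  then show False using t l(2) x assms(2)[OF x(2)] by simp
qed

text \<open>The list is extended from a time after which the state at \<open>t\<close> does not
  occur before \<open>t\<close>: the last earlier occurrence of this state, or the supremum of its
  occurrences if there is no last one, or time 0 if there are none. By \<open>no_recurrence\<close>
  the supremum lies before \<open>t\<close>.\<close>

lemma ex_exact:
  assumes "\<And>u. u < t \<Longrightarrow> Cp p u 0 = 0" shows "\<exists>ts. exact (mkq p ts) t"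
  using assms
proof (induction t rule: less_induct)
  case (less t)
  define code where "code = encv (sdim N) (Cp p t)"
  define S where "S = {u. u < t \<and> Cp p u = Cp p t}"
  show ?case
  proof (cases "Cp p t 0 = 0")
    case False
    \<comment> \<open>The empty list never matches, so this system stops with the status of the
      simulated run.\<close>
    have no: "hhal N (mkq p []) x \<longleftrightarrow> x 1 \<noteq> 0" for x
      by (simp add: hhal_def tmatch_def prj_mkq[of p "[]", simplified])
    have "\<forall>u<w. \<not> hhal N (mkq p []) (Hc (mkq p []) u)" if "w \<le> t" for w
      using that
    proof (induction w rule: om1_induct)
      case (suc w)
      then have IH: "\<forall>u<w. \<not> hhal N (mkq p []) (Hc (mkq p []) u)" "w < t"
        by (auto simp: osuc_le_iff)
      have "Hc (mkq p []) w 1 = 0" using status_Hc[of w "mkq p []"] IH less.prems[of w] by (simp add: prj_mkq)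
      then show ?case using IH(1) no by (metis less_osuc_iff order_le_less)
    next
      case (lim w)
      then show ?case using olim_osuc[OF lim(1)] by (metis less_osuc less_imp_le order_trans)
    qed simp
    then have b: "\<forall>u<t. \<not> hhal N (mkq p []) (Hc (mkq p []) u)" by blast
    then have "Hc (mkq p []) t 1 \<noteq> 0" using status_Hc[of t "mkq p []"] False by (simp add: prj_mkq)
    then have "exact (mkq p []) t" using b no by (simp add: exact_def)
    then show ?thesis by blast
  next
    case True
    have step: ?thesis if s: "s < t" "\<And>u. s < u \<Longrightarrow> u < t \<Longrightarrow> Cp p u \<noteq> Cp p t" for s
    proof -
      obtain ts where "exact (mkq p ts) s" using less.IH[OF s(1)] less.prems s(1) by force
      from exact_extend[OF this less.prems[OF s(1)] s(1) less.prems s(2)] show ?thesis by blast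
    qed
    consider "S = {}" | m where "m \<in> S" "\<forall>x\<in>S. x \<le> m" | "S \<noteq> {}" "\<forall>m\<in>S. \<exists>x\<in>S. m < x" by (meson not_le)
    then show ?thesis
    proof cases
      case 1
      show ?thesis
      proof (cases "t = ozero")
        case True
        let ?q = "mkq p [code]"
        have "Hc ?q t = (\<lambda>_. 0)" using True by (simp add: Hc_def)
        moreover have "tail (\<lambda>_. 0) = (\<lambda>_. 0)" by (simp add: tail_def)
        moreover have "code = encv (sdim N) (\<lambda>_. 0)" using True by (simp add: code_def Cp_simps)
        moreover have "prj (0 + 2) ?q = code" using prj_mkq(3)[of 0 "[code]" p] by simp
        ultimately have "hhal N ?q (Hc ?q t)" using prj_mkq(2)[of p "[code]"] by (simp add: hhal_def tmatch_def)
        then show ?thesis using True by (auto simp: exact_def)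
      next
        case False
        then have z: "ozero < t" by (simp add: order_less_le)
        then show ?thesis using step[OF z] 1 by (auto simp: S_def)
      qed
    next
      case (2 m)
      then show ?thesis using step[of m] unfolding S_def by (metis (mono_tags, lifting) mem_Collect_eq not_le)
    next
      case 3
      define m where "m = (LEAST m. \<forall>x\<in>S. x \<le> m)"
      have ub: "\<forall>x\<in>S. x \<le> t" by (auto simp: S_def)
      have m: "\<forall>x\<in>S. x \<le> m" unfolding m_def by (rule LeastI[of "\<lambda>m. \<forall>x\<in>S. x \<le> m", OF ub])
      have mt: "m \<le> t" unfolding m_def by (rule Least_le) (rule ub)
      have lt: "x < m" if x: "x \<in> S" for x using 3(2) m x by (meson order_less_le_trans)
      have cof: "\<exists>x\<in>S. y < x" if y: "y < m" for y
      proof -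
        have "\<not> (\<forall>x\<in>S. x \<le> y)" using not_less_Least[of y "\<lambda>m. \<forall>x\<in>S. x \<le> m"] y unfolding m_def by blast
        then show ?thesis by (simp add: not_le)
      qed
      have "olim m"
      proof (cases m rule: om1_cases)
        case 1
        then show ?thesis using 3(1) lt by auto
      next
        case (2 s)
        then obtain x where "x \<in> S" "s < x" using cof[of s] by auto
        then show ?thesis using lt[of x] 2 by (simp add: less_osuc_iff)
      qed
      have ne: "Cp p m \<noteq> Cp p t"
      proof (rule no_recurrence[OF \<open>olim m\<close>])
        show "Cp p u 0 = 0" if "u < m" for u using less.prems that mt by simp
        fix y assume "y < m"
        then obtain x where "x \<in> S" "y < x" using cof by blast
        then show "\<exists>x. y \<le> x \<and> x < m \<and> Cp p x = Cp p t" using lt[of x] by (auto simp: S_def intro: less_imp_le)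
      qed
      then have "m < t" using mt by (auto simp: order_less_le)
      then show ?thesis
      proof (rule step)
        fix u assume u: "m < u" "u < t"
        show "Cp p u \<noteq> Cp p t"
        proof
          assume "Cp p u = Cp p t"
          then have "u \<le> m" using m u(2) by (auto simp: S_def)
          then show False using u(1) by simp
        qed
      qed
    qed
  qed
qed

end

text \<open>The extra dimension is the counter of matched states. Totality comes from loop
  detection, \<open>naming\<close> from the lists of states.\<close>

interpretation fam: family "hstep N" "hhal N" "hqry N" "Suc (sdim N)" for N
proof
  fix q v A A'
  assume "(hqry N q v \<in> A) = (hqry N q v \<in> A')"
  then have "lsys N (prj 0 q) A (tail v) = lsys N (prj 0 q) A' (tail v)" by (intro lsys_use) (simp add: hqry_def)
  then show "hstep N q A v = hstep N q A' v" by (simp add: hstep_def cong: if_cong)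
next
  fix q v A show "hhal N q v \<Longrightarrow> hstep N q A v = v" by (simp add: hstep_def)
next
  fix q A show "\<exists>t. hhal N q (run (hstep N q A) (\<lambda>_. 0) t)" using Hc_total[of N q A] by (simp add: Hc_def)
next
  fix t q A
  assume *: "\<And>u. u < t \<Longrightarrow> \<not> hhal N q (run (hstep N q A) (\<lambda>_. 0) u)"
  then have *: "\<And>u. u < t \<Longrightarrow> \<not> hhal N q (Hc N A q u)" by (simp add: Hc_def)
  have "Cp N A (prj 0 q) u 0 = 0" if "u < t" for u
  proof -
    have "Hc N A q u 1 = Cp N A (prj 0 q) u 0" by (rule status_Hc) (use * that in force)
    then show ?thesis using *[OF that] by (simp add: hhal_def)
  qed
  from ex_exact[OF this] obtain ts where "exact N A (mkq (prj 0 q) ts) t" by blast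
  then show "\<exists>q'. hhal N q' (run (hstep N q' A) (\<lambda>_. 0) t) \<and> (\<forall>u<t. \<not> hhal N q' (run (hstep N q' A) (\<lambda>_. 0) u))"
    unfolding exact_def Hc_def by blast
next
  fix i q A t show "Suc (sdim N) \<le> i \<Longrightarrow> run (hstep N q A) (\<lambda>_. 0) t i = 0" using Hc_beyond[of N i A q t] by (simp add: Hc_def)
qed

subsection \<open>Simulating a machine\<close>

fun opc :: "instr \<Rightarrow> nat" where
  "opc (Zero i) = 1" | "opc (Incr i) = 2" | "opc (Copy i j) = 3" | "opc (Jump i j q) = 4" | "opc (Oracle i) = 5"
fun arg1 :: "instr \<Rightarrow> nat" where
  "arg1 (Zero i) = i" | "arg1 (Incr i) = i" | "arg1 (Copy i j) = i" | "arg1 (Jump i j q) = i" | "arg1 (Oracle i) = i"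
fun arg2 :: "instr \<Rightarrow> nat" where
  "arg2 (Copy i j) = j" | "arg2 (Jump i j q) = j" | "arg2 I = arg1 I"
fun arg3 :: "instr \<Rightarrow> nat" where
  "arg3 (Jump i j q) = q" | "arg3 I = 0"

text \<open>Register 0 carries the output and may be absent from the program, hence the additional
  slot. Padding with fresh registers gives an enumeration of length exactly \<open>Suc n\<close>, in
  which 0, being least, comes first.\<close>

lemma ex_register_map:
  assumes "num_regs P \<le> n"
  shows "\<exists>reg. inj_on reg {..<Suc n} \<and> reg 0 = 0 \<and> (\<Union>I\<in>set P. instr_regs I) \<subseteq> reg ` {..<Suc n}"
proof -
  define R where "R = insert 0 (\<Union>I\<in>set P. instr_regs I)"
  have fr: "finite (instr_regs I)" for I by (cases I) auto
  then have fin: "finite R" by (simp add: R_def)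
  have "card R \<le> Suc n"
    using assms card_insert_le_m1[of "Suc n" "\<Union>I\<in>set P. instr_regs I" 0] by (simp add: R_def num_regs_def)
  moreover have "infinite (UNIV - R)" using fin by simp
  ultimately obtain B where B: "finite B" "card B = Suc n - card R" "B \<subseteq> UNIV - R"
    using infinite_arbitrarily_large by metis
  have dj: "R \<inter> B = {}" using B(3) by blast
  define R' where "R' = R \<union> B"
  have R': "R \<subseteq> R'" "finite R'" "card R' = Suc n"
    using fin B(1,2) \<open>card R \<le> Suc n\<close> card_Un_disjoint[OF fin B(1)] dj by (auto simp: R'_def)
  define reg where "reg i = sorted_list_of_set R' ! i" for i
  have len: "length (sorted_list_of_set R') = Suc n" using R' by simp
  have "inj_on reg {..<Suc n}"
    unfolding reg_def by (rule inj_onI) (use len nth_eq_iff_index_eq[OF distinct_sorted_list_of_set[of R']] in simp)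
  moreover have im: "reg ` {..<Suc n} = R'"
  proof -
    have "set (sorted_list_of_set R') = reg ` {..<Suc n}" unfolding reg_def set_conv_nth len by auto
    then show ?thesis using R'(2) by simp
  qed
  moreover have "reg 0 = 0"
  proof -
    have "0 \<in> R'" using R'(1) by (auto simp: R_def)
    then have "sorted_list_of_set R' = Min R' # sorted_list_of_set (R' - {Min R'})"
      using R'(2) by (intro sorted_list_of_set_nonempty) auto
    moreover have "Min R' = 0" using \<open>0 \<in> R'\<close> R'(2) by (intro Min_eqI) auto
    ultimately show ?thesis unfolding reg_def by (metis nth_Cons_0)
  qed
  ultimately show ?thesis using R'(1) by (intro exI[of _ reg]) (auto simp: R_def)
qed

text \<open>Component 4 is the slot of the output register: before it come the list counter, the
  status, the phase and the program line.\<close>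

lemma universal_simulation:
  assumes "num_regs P \<le> n"
  shows "\<exists>q. \<forall>A k. halts_with P A 0 k \<longrightarrow> fam.C (Suc n) q A (fam.eta (Suc n) q A) 4 = k"
proof -
  obtain reg where reg: "inj_on reg {..<Suc n}" "reg 0 = 0" "(\<Union>I\<in>set P. instr_regs I) \<subseteq> reg ` {..<Suc n}"
    using ex_register_map[OF assms] by blast
  define N where "N = Suc n"
  define sl where "sl r = (SOME i. i < N \<and> reg i = r)" for r
  have sl: "sl r < N \<and> reg (sl r) = r" if "I \<in> set P" "r \<in> instr_regs I" for r I
  proof -
    have "\<exists>i. i < N \<and> reg i = r" using reg(3) that by (force simp: N_def)
    then show ?thesis unfolding sl_def by (rule someI_ex)
  qed
  have sl_iff: "reg a = r \<longleftrightarrow> a = sl r" if "I \<in> set P" "r \<in> instr_regs I" "a < N" for a r I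
    using sl[OF that(1,2)] reg(1) that(3) by (auto simp: inj_on_def N_def)
  define p where "p = encv (4 * length P) (\<lambda>m. let I = P ! (m div 4) in if m mod 4 = 0 then opc I
      else if m mod 4 = 1 then sl (arg1 I) else if m mod 4 = 2 then sl (arg2 I) else arg3 I)"
  have pr: "prj (4 * l) p = opc (P ! l)" "prj (4 * l + 1) p = sl (arg1 (P ! l))"
    "prj (4 * l + 2) p = sl (arg2 (P ! l))" "prj (4 * l + 3) p = arg3 (P ! l)" if "l < length P" for l
  proof -
    have "4 * l < 4 * length P" "4 * l + 1 < 4 * length P" "4 * l + 2 < 4 * length P" "4 * l + 3 < 4 * length P"
      using that by simp_all
    moreover have "(4 * l) mod 4 = 0" "(4 * l + 1) mod 4 = 1" "(4 * l + 2) mod 4 = 2" "(4 * l + 3) mod 4 = 3"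
      "(4 * l) div 4 = l" "(4 * l + 1) div 4 = l" "(4 * l + 2) div 4 = l" "(4 * l + 3) div 4 = l"
      by presburger+
    ultimately show "prj (4 * l) p = opc (P ! l)" "prj (4 * l + 1) p = sl (arg1 (P ! l))"
      "prj (4 * l + 2) p = sl (arg2 (P ! l))" "prj (4 * l + 3) p = arg3 (P ! l)"
      unfolding p_def prj_encv Let_def by simp_all
  qed
  have pr0: "prj (4 * l) p = 0" if "\<not> l < length P" for l
    unfolding p_def prj_encv using that by simp
  define ren where "ren v = (\<lambda>i. if i = 0 then v 0 else if i \<le> N then v (Suc (reg (i - 1))) else 0)" for v :: vec
  \<comment> \<open>A machine state as it appears in \<open>bstep\<close> while running in phase
    0.\<close>
  define E where "E v = (\<lambda>i. if i < 2 then 0 else ren v (i - 2))" for v :: vec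
  have cfgE: "cfg (Suc N) (E v) = ren v" for v by (auto simp: cfg_def E_def ren_def fun_eq_iff)
  have rgE: "rg N (ren v) (sl r) = v (Suc r)" if "I \<in> set P" "r \<in> instr_regs I" for v r I
    using sl[OF that] by (simp add: rg_def ren_def)
  have us: "ustep N p A (ren v) i = ren (mstep P A v) i" if v: "mok P v" and i: "i < Suc N" for A v i
  proof -
    define l where "l = v 0"
    have l: "l < length P" using v by (simp add: mok_def l_def)
    define I where "I = P ! l"
    have I: "I \<in> set P" using l by (simp add: I_def)
    have l0: "ren v 0 = l" by (simp add: ren_def l_def)
    note pl = pr[OF l, folded I_def]
    have ms: "mstep P A v = case_prod mk (step A I (l, \<lambda>i. v (Suc i)))" by (simp add: mstep_def I_def l_def)
    have mem: "arg1 I \<in> instr_regs I" "arg2 I \<in> instr_regs I" by (cases I; simp)+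
    note rgs = rgE[OF I mem(1)] rgE[OF I mem(2)]
    show ?thesis
    proof (cases i)
      case 0
      have R: "ren w 0 = w 0" for w by (simp add: ren_def)
      have u: "ustep N p A (ren v) 0 = (if opc I = 4 \<and> v (Suc (arg1 I)) = v (Suc (arg2 I)) then arg3 I else Suc l)"
        unfolding ustep_def Let_def l0 pl rgs by simp
      show ?thesis unfolding 0 u R ms by (cases I; simp)
    next
      case (Suc a)
      then have a: "a < N" using i by simp
      have R: "ren w i = w (Suc (reg a))" for w using a Suc by (simp add: ren_def)
      have eqs: "a = sl (arg1 I) \<longleftrightarrow> reg a = arg1 I" "a = sl (arg2 I) \<longleftrightarrow> reg a = arg2 I"
        using sl_iff[OF I mem(1) a] sl_iff[OF I mem(2) a] by simp_all
      have i0: "(i = 0) = False" "(i = Suc b) = (a = b)" for b using Suc by auto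
      show ?thesis unfolding ustep_def Let_def l0 pl rgs R ms i0 eqs by (cases I; simp)
    qed
  qed
  \<comment> \<open>One machine step corresponds to two steps of \<open>bstep\<close>. The
    intermediate state differs only in its phase, which is larger, so the infimum is that of the
    machine step.\<close>
  have sim: "seg (bstep (Suc N) (ustep N p A) (uhal p)) (\<lambda>s. s 0 = 0) (E v) (E m) (E v')"
    if "seg (mstep P A) (mok P) v m v'" for A v m v'
    using that
  proof (induction rule: seg.induct)
    case (seg_step v)
    let ?F = "bstep (Suc N) (ustep N p A) (uhal p)"
    define s1 where "s1 = (E v)(1 := 1)"
    have "opc I \<noteq> 0" for I by (cases I) auto
    then have nh: "\<not> uhal p (ren v)" using pr(1)[of "v 0"] seg_step by (simp add: uhal_def ren_def mok_def)
    have F1: "?F (E v) = s1"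
      unfolding bstep_def cfgE using nh by (auto simp: s1_def E_def fun_eq_iff)
    have "cfg (Suc N) s1 = cfg (Suc N) (E v)" by (auto simp: cfg_def s1_def fun_eq_iff)
    then have cs: "cfg (Suc N) s1 = ren v" by (simp add: cfgE)
    have F2: "?F s1 = E (mstep P A v)"
    proof
      fix i
      show "?F s1 i = E (mstep P A v) i"
        using us[OF seg_step, of "i - 2" A] by (auto simp: bstep_def cs) (auto simp: s1_def E_def ren_def)
    qed
    have "seg ?F (\<lambda>s. s 0 = 0) (E v) (E v) s1" using seg.seg_step[of "\<lambda>s. s 0 = 0" "E v" ?F] F1 by (simp add: E_def)
    moreover have "seg ?F (\<lambda>s. s 0 = 0) s1 s1 (E (mstep P A v))"
      using seg.seg_step[of "\<lambda>s. s 0 = 0" s1 ?F] F2 by (simp add: E_def s1_def)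
    ultimately have "seg ?F (\<lambda>s. s 0 = 0) (E v) (\<lambda>i. min (E v i) (s1 i)) (E (mstep P A v))" by (rule seg.seg_trans)
    moreover have "(\<lambda>i. min (E v i) (s1 i)) = E v" by (auto simp: s1_def E_def fun_eq_iff)
    ultimately show ?case by simp
  next
    case (seg_trans u m v m' w)
    have "E (\<lambda>i. min (m i) (m' i)) = (\<lambda>i. min (E m i) (E m' i))" by (auto simp: E_def ren_def fun_eq_iff)
    then show ?case using seg.seg_trans[OF seg_trans.IH] by simp
  next
    case (seg_lim c m)
    have Ei: "E (\<lambda>i. INF k. m k i) = (\<lambda>i. INF k. E (m k) i)" by (auto simp: E_def ren_def fun_eq_iff)
    have r0: "reset_if_infinite 0 = 0" using reset_if_infinite.simps(1)[of 0] by (simp only: zero_enat_def)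
    have El: "E (\<lambda>i. reset_if_infinite (SUP k. INF j\<in>{k..}. enat (m j i))) =
      (\<lambda>i. reset_if_infinite (SUP k. INF j\<in>{k..}. enat (E (m j) i)))"
      using r0 by (auto simp: E_def ren_def fun_eq_iff)
    show ?case using Ei El seg.seg_lim[of "bstep (Suc N) (ustep N p A) (uhal p)" "\<lambda>s. s 0 = 0" "\<lambda>k. E (c k)" "\<lambda>k. E (m k)"]
      seg_lim.IH by simp
  qed
  define q where "q = mkq p []"
  have "fam.C N q A (fam.eta N q A) 4 = k" if h: "halts_with P A 0 k" for A k
  proof -
    define B where "B = loop_system.B (Suc N) (ustep N p A) (uhal p)"
    have Bs: "B (osuc t) = bstep (Suc N) (ustep N p A) (uhal p) (B t)" "B ozero = (\<lambda>_. 0)" for t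
      by (simp_all add: B_def loop_system.B_def)
    have ini: "case_prod mk (initial 0) = (\<lambda>_. 0)"
      by (rule ext) (simp add: initial_def mk_def split: nat.split)
    have E0: "E (\<lambda>_. 0) = (\<lambda>_. 0)" by (auto simp: E_def ren_def)
    obtain c where c: "c = (\<lambda>_. 0) \<or> (\<exists>m. seg (mstep P A) (mok P) (\<lambda>_. 0) m c)" "\<not> mok P c" "c (Suc 0) = k"
      using halts_with_seg[OF h] unfolding ini by blast
    have "\<exists>t. B t = E c"
      using c(1)
    proof
      assume "c = (\<lambda>_. 0)"
      then show ?thesis using E0 Bs(2) by metis
    next
      assume "\<exists>m. seg (mstep P A) (mok P) (\<lambda>_. 0) m c"
      then obtain m where "seg (mstep P A) (mok P) (\<lambda>_. 0) m c" by blast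
      from seg_run[OF sim[OF this], of "\<lambda>_. 0" ozero] show ?thesis unfolding E0 B_def loop_system.B_def by auto
    qed
    then obtain t where t: "B t = E c" by blast
    have hal: "uhal p (ren c)" using c(2) pr0 by (simp add: uhal_def ren_def mok_def)
    have "E c 0 = 0" "E c 1 = 0" by (simp_all add: E_def)
    then have "B (osuc t) = (E c)(0 := 1, 1 := 1)" unfolding Bs t bstep_def cfgE using hal by simp
    moreover have "E c 3 = k" using c(3) reg(2) by (simp add: E_def ren_def N_def)
    ultimately have B1: "B (osuc t) 0 \<noteq> 0" "B (osuc t) 3 = k" by simp_all
    define e where "e = fam.eta N q A"
    have Hce: "fam.C N q A u = Hc N A q u" for u by (simp add: fam.C_def Hc_def)
    have he: "hhal N q (Hc N A q e)" "\<And>u. u < e \<Longrightarrow> \<not> hhal N q (Hc N A q u)"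
      using fam.hl_eta[of N q A] fam.not_hl[of _ N q A] by (simp_all add: Hce e_def)
    have pq: "prj 0 q = p" "prj 1 q = 0" using prj_mkq(1,2)[of p "[]"] by (simp_all add: q_def)
    have tl: "tail (Hc N A q e) = Cp N A p e" using tail_Hc[of e N q A] he(2) pq by simp
    have st: "Hc N A q e (Suc i) = Cp N A p e i" for i using tl by (metis tail_def)
    have "Hc N A q e 1 \<noteq> 0" using he(1) pq(2) by (simp add: hhal_def tmatch_def)
    then have "Cp N A p e 0 \<noteq> 0" using st[of 0] by simp
    then have "Cp N A p e 3 = B (osuc t) 3"
      unfolding Cp_def B_def by (intro loop_system.halting_agree) (use B1(1) in \<open>simp_all add: B_def N_def\<close>)
    then show ?thesis using st[of 3] B1(2) unfolding Hce e_def by simp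
  qed
  then show ?thesis unfolding N_def by blast
qed

section \<open>Computing with a generic oracle\<close>

lemma rp_comp: "rp A p \<Longrightarrow> (\<And>i. rc A (g i)) \<Longrightarrow> rp A (\<lambda>e. p (\<lambda>i. g i e))"
  unfolding rp_def by (rule rc_comp)

lemma rc_case_nat: "rc A f \<Longrightarrow> (\<And>i. rc A (g i)) \<Longrightarrow> rc A (case_nat f g i)"
  by (cases i) auto

text \<open>Registers cannot be addressed indirectly, so a computed index is resolved by a case
  distinction of fixed length.\<close>

lemma rc_select:
  assumes "\<And>i. rc A (g i)" "rc A a" shows "rc A (\<lambda>e. if a e < n then g (a e) e else 0)"
proof (induction n)
  case (Suc n)
  have "rc A (\<lambda>e. if a e = n then g n e else if a e < n then g (a e) e else 0)"
    by (intro rc_if rp_eq assms rc_const Suc.IH)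
  moreover have "(\<lambda>e. if a e = n then g n e else if a e < n then g (a e) e else 0) =
    (\<lambda>e. if a e < Suc n then g (a e) e else 0)" by (auto simp: less_Suc_eq)
  ultimately show ?case by simp
qed (simp add: rc_const)

lemma rc_flt: assumes "rc A W" "\<And>i. rc A (g i)" shows "rc A (\<lambda>e. flt D (W e) (\<lambda>i. g i e))"
proof -
  have "rc A (\<lambda>e. flt D (e 0) (\<lambda>i. e (Suc i)))"
  proof (rule rc_graph)
    show "rp A (\<lambda>e. (\<lambda>j e. \<forall>c. c \<in> set_decode j \<longleftrightarrow> c \<in> set_decode (e 0) \<and> (\<forall>i<D. prj i c \<le> e (Suc i))) (e 0) (\<lambda>i. e (Suc i)))"
      by (intro rp_all rp_iff rp_conj rp_set_decode rp_ball rp_le rc_prj rc_const rc_var)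
  qed (auto simp: eq_set_decode_iff[of _ "flt _ _ _"] set_decode_flt)
  from rc_comp[OF this, of "case_nat W g"] rc_case_nat[of A W g, OF assms] show ?thesis by simp
qed

lemma rc_ins: assumes "rc A f" "rc A g" shows "rc A (\<lambda>e. ins (f e) (g e))"
proof (rule rc_comp2[OF _ assms], rule rc_graph)
  show "rp A (\<lambda>e. (\<lambda>j e. \<forall>c. c \<in> set_decode j \<longleftrightarrow> c = e 1 \<or> c \<in> set_decode (e 0)) (e 0) (\<lambda>i. e (Suc i)))"
    by (intro rc_intros)
qed (auto simp: eq_set_decode_iff[of _ "ins _ _"] set_decode_ins)

lemma rp_md:
  assumes "rc y f" "rc y s" "rc y l" shows "rp y (\<lambda>e. f e \<in> md y (s e, l e))"
proof -
  have "rp y (\<lambda>e. (f e < l e \<longrightarrow> f e \<in> set_decode (s e)) \<and> (\<not> f e < l e \<longrightarrow> f e \<in> y))"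
    by (intro rp_conj rp_imp rp_less rp_not rp_set_decode rp_oracle assms)
  moreover have "(f e \<in> md y (s e, l e)) \<longleftrightarrow> (f e < l e \<longrightarrow> f e \<in> set_decode (s e)) \<and> (\<not> f e < l e \<longrightarrow> f e \<in> y)" for e
    by (simp add: md_def)
  ultimately show ?thesis by simp
qed

context
  fixes y :: "nat set" and N :: nat and q s l :: "vec \<Rightarrow> nat" and g :: "nat \<Rightarrow> vec \<Rightarrow> nat"
  assumes q: "rc y q" and s: "rc y s" and l: "rc y l" and g: "\<And>i. rc y (g i)"
begin

abbreviation (input) gv :: "vec \<Rightarrow> vec" where "gv e \<equiv> (\<lambda>i. g i e)"

lemma rc_rg: assumes "rc y a" shows "rc y (\<lambda>e. rg N (gv e) (a e))"
  unfolding rg_def by (rule rc_select[OF _ assms]) (rule g)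

lemma rc_ustep: "rc y (\<lambda>e. ustep N (q e) (md y (s e, l e)) (gv e) i)"
proof -
  have eq: "i = Suc a \<longleftrightarrow> Suc a = i" for a by auto
  show ?thesis unfolding ustep_def Let_def eq
    by (intro rc_if rp_eq rp_conj rc_rg rc_prj rc_add rc_mult rc_const rc_Suc rp_md g q s l)
qed

lemma rp_uhal: "rp y (\<lambda>e. uhal (q e) (gv e))"
  unfolding uhal_def by (intro rp_eq rc_prj rc_mult rc_const q g)

end

lemma rc_cfg: "(\<And>i. rc y (g i)) \<Longrightarrow> rc y (\<lambda>e. cfg D (\<lambda>i. g i e) i)"
  unfolding cfg_def by (cases "i < D") (simp_all add: rc_const)

lemma rc_lsys:
  assumes q: "rc y q" and s: "rc y s" and l: "rc y l" and g: "\<And>i. rc y (g i)"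
  shows "rc y (\<lambda>e. lsys N (q e) (md y (s e, l e)) (\<lambda>i. g i e) i)"
proof -
  let ?c = "\<lambda>e. cfg (Suc N) (\<lambda>i. g i e)"
  have c: "rc y (\<lambda>e. ?c e j)" for j by (rule rc_cfg[OF g])
  have en: "rc y (\<lambda>e. encv (Suc N) (?c e))" by (rule rc_encv) (rule c)
  have z: "rc y (\<lambda>e. zc (Suc N) (?c e))" by (rule rc_zc) (rule c)
  have w: "rc y (\<lambda>e. wreg (Suc N) (zc (Suc N) (?c e)))" unfolding wreg_def by (intro rc_Suc rc_add rc_const z)
  have gz: "rc y (\<lambda>e. g (wreg (Suc N) (zc (Suc N) (?c e))) e)"
  proof -
    have "rc y (\<lambda>e. if wreg (Suc N) (zc (Suc N) (?c e)) < sdim N then g (wreg (Suc N) (zc (Suc N) (?c e))) e else 0)"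
      by (rule rc_select[OF g w])
    moreover have "wreg (Suc N) (zc (Suc N) v) < sdim N" for v using zc_le[of "Suc N" v] by (simp add: sdim_def wreg_def)
    ultimately show ?thesis by simp
  qed
  have u: "rc y (\<lambda>e. ustep N (q e) (md y (s e, l e)) (?c e) j)" for j by (rule rc_ustep[OF q s l c])
  have h: "rp y (\<lambda>e. uhal (q e) (?c e))" by (rule rp_uhal[OF q s l c])
  have f: "rc y (\<lambda>e. flt (Suc N) (g i e) (?c e))" by (rule rc_flt[OF g c])
  have "rc y (\<lambda>e. if g 0 e \<noteq> 0 then g i e else if g 1 e = 0 then
      (if i = 0 then if encv (Suc N) (?c e) \<in> set_decode (g (wreg (Suc N) (zc (Suc N) (?c e))) e) then 2
          else if uhal (q e) (?c e) then 1 else 0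
       else if i = 1 then 1 else if i < Suc (Suc (Suc N)) then g i e
       else if i \<le> wreg (Suc N) (Suc N) then flt (Suc N) (g i e) (?c e) else g i e)
     else if i = 1 then 0 else if 2 \<le> i \<and> i < Suc (Suc (Suc N)) then ustep N (q e) (md y (s e, l e)) (?c e) (i - 2)
       else if wreg (Suc N) (zc (Suc N) (?c e)) = i then ins (g i e) (encv (Suc N) (?c e)) else g i e)"
    by (intro rc_if rp_not rp_eq rp_conj rp_const rc_const rp_set_decode rc_ins en w gz u h f g)
  then show ?thesis unfolding lstep_def by (simp add: if_distribR eq_commute[of i "wreg _ _"] cong: if_cong)
qed

lemma rp_tmatch:
  assumes q: "rc y q" and g: "\<And>i. rc y (g i)" shows "rp y (\<lambda>e. tmatch N (q e) (\<lambda>i. g i e))"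
proof -
  have en: "rc y (\<lambda>e. encv (sdim N) (\<lambda>i. g (Suc i) e))" by (rule rc_encv) (rule g)
  show ?thesis unfolding tmatch_def tail_def
    by (intro rp_conj rp_less rp_eq rc_prj rc_const rc_add q g en)
qed

lemma rp_hhal:
  assumes q: "rc y q" and g: "\<And>i. rc y (g i)" shows "rp y (\<lambda>e. hhal N (q e) (\<lambda>i. g i e))"
  unfolding hhal_def
  by (intro rp_disj rp_conj rp_not rp_eq rc_Suc rc_prj rc_const q g rp_tmatch)

lemma rc_hstep:
  assumes q: "rc y q" and s: "rc y s" and l: "rc y l" and g: "\<And>i. rc y (g i)"
  shows "rc y (\<lambda>e. hstep N (q e) (md y (s e, l e)) (\<lambda>i. g i e) i)"
proof -
  have q0: "rc y (\<lambda>e. prj 0 (q e))" by (intro rc_prj rc_const q)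
  have t: "rc y (\<lambda>e. lsys N (prj 0 (q e)) (md y (s e, l e)) (\<lambda>i. g (Suc i) e) (i - 1))"
    by (rule rc_lsys[OF q0 s l g])
  have "rc y (\<lambda>e. if hhal N (q e) (\<lambda>i. g i e) then g i e else if i = 0
      then if tmatch N (q e) (\<lambda>i. g i e) then Suc (g 0 e) else g 0 e
      else lsys N (prj 0 (q e)) (md y (s e, l e)) (\<lambda>i. g (Suc i) e) (i - 1))"
    by (intro rc_if rp_const rc_Suc g t rp_hhal rp_tmatch q)
  then show ?thesis unfolding hstep_def tail_def by (simp add: if_distribR cong: if_cong)
qed

subsection \<open>Comparing two runs\<close>

text \<open>Two systems run side by side, each on its own finite modification of \<open>y\<close>,
  and the second is read when the first halts. All information about ordinals and forcing is
  obtained from such probes.\<close>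

lemma rc_probe_vars:
  "rc y (\<lambda>e. fam.C N (e 3) (md y (e 4, e 5)) (fam.eta N (e 0) (md y (e 1, e 2))) (e 6))"
proof -
  define M where "M = Suc (sdim N)"
  define st where "st k v = (\<lambda>j. if j < M then v (k + j) else 0)" for k and v :: vec
  \<comment> \<open>Components: 0 flag, 1 output, 2 to 8 the seven arguments, then two blocks of
    \<open>M\<close> components with the states of the two systems.\<close>
  define G where "G v i = (if i = 0 then (if hhal N (v 2) (st 9 v) then 1 else 0)
     else if i = 1 then (if v 8 < M then v (9 + M + v 8) else 0)
     else if i < 9 then v i
     else if i < 9 + M then hstep N (v 2) (md y (v 3, v 4)) (st 9 v) (i - 9)
     else hstep N (v 5) (md y (v 6, v 7)) (st (9 + M) v) (i - (9 + M)))" for v :: vec and i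
  define init where "init e i = (if 2 \<le> i \<and> i < 9 then e (i - 2) else 0)" for e :: vec and i
  have rst: "rc y (\<lambda>v. st k v j)" for k j unfolding st_def by (cases "j < M") (simp_all add: rc_var rc_const)
  show ?thesis
  proof (rule rc_iterate[where d = "9 + M + M" and G = G and init = init])
    fix i assume i: "i < 9 + M + M"
    have sel: "rc y (\<lambda>v. if v 8 < M then v (9 + M + v 8) else 0)"
      by (rule rc_select[where g = "\<lambda>i v. v (9 + M + i)"]) (rule rc_var)+
    have h1: "rp y (\<lambda>v. hhal N (v 2) (st 9 v))" by (rule rp_hhal[OF rc_var rst])
    have h2: "rc y (\<lambda>v. hstep N (v 2) (md y (v 3, v 4)) (st 9 v) (i - 9))" by (rule rc_hstep[OF rc_var rc_var rc_var rst])
    have h3: "rc y (\<lambda>v. hstep N (v 5) (md y (v 6, v 7)) (st (9 + M) v) (i - (9 + M)))"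
      by (rule rc_hstep[OF rc_var rc_var rc_var rst])
    show "rc y (\<lambda>v. G v i)" unfolding G_def by (intro rc_if rp_const rc_const rc_var sel h1 h2 h3)
    show "dep (9 + M + M) (\<lambda>v. G v i)" unfolding dep_def
    proof (intro allI impI)
      fix v w :: vec assume vw: "\<forall>i<9 + M + M. v i = w i"
      have "st 9 v = st 9 w" "st (9 + M) v = st (9 + M) w" using vw by (auto simp: st_def fun_eq_iff)
      moreover have "v k = w k" if "k < 9" for k using vw that by simp
      moreover have "v (9 + M + k) = w (9 + M + k)" if "k < M" for k using vw that by simp
      ultimately show "G v i = G w i" unfolding G_def by (simp cong: if_cong)
    qed
    show "rc y (\<lambda>e. init e i)" unfolding init_def by (intro rc_if rp_const rc_var rc_const)
  next
    fix e :: vec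
    define C1 where "C1 = fam.C N (e 0) (md y (e 1, e 2))"
    define C2 where "C2 = fam.C N (e 3) (md y (e 4, e 5))"
    define R where "R = run G (init e)"
    define eta where "eta = fam.eta N (e 0) (md y (e 1, e 2))"
    have Cs: "C1 (osuc t) = hstep N (e 0) (md y (e 1, e 2)) (C1 t)" "C2 (osuc t) = hstep N (e 3) (md y (e 4, e 5)) (C2 t)" for t
      by (simp_all add: C1_def C2_def fam.C_def)
    have C0: "C1 ozero = (\<lambda>_. 0)" "C2 ozero = (\<lambda>_. 0)" by (simp_all add: C1_def C2_def fam.C_def)
    have Cl: "C1 t i = lm t (\<lambda>u. C1 u i)" "C2 t i = lm t (\<lambda>u. C2 u i)" if "olim t" for t i
      by (simp_all add: C1_def C2_def fam.C_def run_olim[OF that])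
    have C_beyond: "C1 t i = 0" "C2 t i = 0" if "M \<le> i" for t i
      using fam.bounded[of N i] that by (simp_all add: C1_def C2_def fam.C_def M_def)
    have Rs: "R (osuc t) = G (R t)" for t by (simp add: R_def)
    have Rl: "R t i = lm t (\<lambda>u. R u i)" if "olim t" for t i by (simp add: R_def run_olim[OF that])
    have main: "(\<forall>i. 2 \<le> i \<longrightarrow> i < 9 \<longrightarrow> R t i = e (i - 2)) \<and> (\<forall>j<M. R t (9 + j) = C1 t j \<and> R t (9 + M + j) = C2 t j)" for t
    proof (induction t rule: om1_induct)
      case zero
      show ?case by (simp add: R_def init_def C0)
    next
      case (suc t)
      have par: "R t 2 = e 0" "R t 3 = e 1" "R t 4 = e 2" "R t 5 = e 3" "R t 6 = e 4" "R t 7 = e 5" "R t 8 = e 6"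
        using suc.IH by simp_all
      have st1: "st 9 (R t) = C1 t" "st (9 + M) (R t) = C2 t"
        using suc.IH C_beyond by (auto simp: st_def fun_eq_iff)
      show ?case using suc.IH unfolding Rs G_def par st1 Cs by simp
    next
      case (lim t)
      show ?case
      proof (intro conjI allI impI)
        fix i :: nat assume i: "2 \<le> i" "i < 9"
        show "R t i = e (i - 2)" unfolding Rl[OF lim(1)]
          by (rule lm_const[OF lim(1) olim_pos[OF lim(1)]]) (use lim.IH i in simp)
      next
        fix j assume j: "j < M"
        show "R t (9 + j) = C1 t j" unfolding Rl[OF lim(1)] Cl[OF lim(1)]
          by (rule lm_cong) (use lim.IH j in simp)
        show "R t (9 + M + j) = C2 t j" unfolding Rl[OF lim(1)] Cl[OF lim(1)]
          by (rule lm_cong) (use lim.IH j in simp)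
      qed
    qed
    have par: "R t 2 = e 0" "R t 8 = e 6" for t using main[of t] by simp_all
    have st1: "st 9 (R t) = C1 t" for t using main[of t] C_beyond by (auto simp: st_def fun_eq_iff)
    \<comment> \<open>Flag and output report on the previous time, so the combined system stops one
      step after the halting time.\<close>
    have flag: "R (osuc t) 0 = (if eta \<le> t then 1 else 0)" for t
      unfolding Rs G_def par st1 by (simp add: C1_def fam.hl_iff eta_def)
    have out: "R (osuc t) 1 = C2 t (e 6)" for t
      unfolding Rs G_def par using main[of t] C_beyond[of "e 6" t] by simp
    have low: "R u 0 = 0" if "u < osuc eta" for u
      using that
    proof (induction u rule: om1_induct)
      case zero
      show ?case by (simp add: R_def init_def)
    next
      case (suc u)
      then have "u < eta" using less_osuc_iff[of "osuc u" eta] osuc_le_iff[of u eta] by simp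
      then show ?case unfolding flag by simp
    next
      case (lim u)
      show ?case unfolding Rl[OF lim(1)]
        by (rule lm_const[OF lim(1) olim_pos[OF lim(1)]]) (use lim in simp)
    qed
    have "init e 0 = 0" by (simp add: init_def)
    moreover have "\<forall>u<osuc eta. R u 0 = 0" using low by blast
    moreover have "R (osuc eta) 0 \<noteq> 0" unfolding flag by simp
    ultimately show "\<exists>t. init e 0 = 0 \<and> (\<forall>u<t. run G (init e) u 0 = 0) \<and> run G (init e) t 0 \<noteq> 0 \<and>
      fam.C N (e 3) (md y (e 4, e 5)) (fam.eta N (e 0) (md y (e 1, e 2))) (e 6) = run G (init e) t 1"
      using out[of eta] unfolding R_def C2_def eta_def by metis
  qed simp
qed

lemma rc_probe:
  assumes "rc y a" "rc y b" "rc y c" "rc y d" "rc y f" "rc y g" "rc y h"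
  shows "rc y (\<lambda>e. fam.C N (d e) (md y (f e, g e)) (fam.eta N (a e) (md y (b e, c e))) (h e))"
proof -
  let ?g = "case_nat a (case_nat b (case_nat c (case_nat d (case_nat f (case_nat g (\<lambda>_. h))))))"
  have "rc y (?g i)" for i by (intro rc_case_nat assms)
  from rc_comp[OF rc_probe_vars[of y N], of ?g, OF this] show ?thesis by (simp add: numeral_eq_Suc)
qed

text \<open>Halting persists, so it is enough to see whether the first system has halted at the
  halting time of the second.\<close>

lemma rp_eta_le:
  assumes "rc y a" "rc y b" "rc y c" "rc y d" "rc y f" "rc y g"
  shows "rp y (\<lambda>e. fam.eta N (a e) (md y (b e, c e)) \<le> fam.eta N (d e) (md y (f e, g e)))"
proof -
  have "rp y (\<lambda>e. hhal N (a e) (\<lambda>i. fam.C N (a e) (md y (b e, c e)) (fam.eta N (d e) (md y (f e, g e))) i))"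
    by (intro rp_hhal rc_probe assms rc_const)
  then show ?thesis by (simp add: fam.hl_iff)
qed

lemma rp_extends:
  assumes "rc y a" "rc y b" "rc y c" "rc y d" shows "rp y (\<lambda>e. ext (a e, b e) (c e, d e))"
proof -
  let ?g = "case_nat a (case_nat b (case_nat c (\<lambda>_. d)))"
  have "rp y (\<lambda>e. e 3 \<le> e 1 \<and> (\<forall>i. i < e 3 \<longrightarrow> (i \<in> set_decode (e 0) \<longleftrightarrow> i \<in> set_decode (e 2))))"
    by (intro rc_intros)
  moreover have "rc y (?g i)" for i by (intro rc_case_nat assms)
  ultimately have "rp y (\<lambda>e. (\<lambda>e. e 3 \<le> e 1 \<and> (\<forall>i. i < e 3 \<longrightarrow> (i \<in> set_decode (e 0) \<longleftrightarrow> i \<in> set_decode (e 2)))) (\<lambda>i. ?g i e))"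
    by (rule rp_comp)
  then show ?thesis by (simp add: ext_def numeral_eq_Suc)
qed

text \<open>\<open>vald\<close> and \<open>frc\<close> are what \<open>valid_read\<close> and
  \<open>Fo_read\<close> make of \<open>valid\<close> and \<open>Fo\<close>: conditions on the runs
  along finite modifications of one real.\<close>

definition vald :: "nat \<Rightarrow> nat set \<Rightarrow> name \<Rightarrow> bool" where
  "vald N y \<nu> \<longleftrightarrow> (\<forall>c'. ext c' (fst \<nu>) \<longrightarrow> fam.eta N (snd \<nu>) (md y c') = fam.eta N (snd \<nu>) (md y (fst \<nu>)))"

definition frc :: "nat \<Rightarrow> nat set \<Rightarrow> cond \<Rightarrow> nat \<Rightarrow> name \<Rightarrow> nat \<Rightarrow> nat set \<Rightarrow> bool" where
  "frc N y c q \<nu> i S \<longleftrightarrow> (\<forall>c'. ext c' c \<longrightarrow> fam.C N q (md y c') (fam.eta N (snd \<nu>) (md y (fst \<nu>))) i \<in> S)"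

lemma rp_vald:
  assumes "rc y a" "rc y b" "rc y q" shows "rp y (\<lambda>e. vald N y ((a e, b e), q e))"
proof -
  let ?g = "case_nat a (case_nat b (\<lambda>_. q))"
  have "rp y (\<lambda>e. \<forall>s l. ext (s, l) (e 0, e 1) \<longrightarrow>
      fam.eta N (e 2) (md y (s, l)) \<le> fam.eta N (e 2) (md y (e 0, e 1)) \<and>
      fam.eta N (e 2) (md y (e 0, e 1)) \<le> fam.eta N (e 2) (md y (s, l)))"
    by (intro rp_all rp_imp rp_conj rp_extends rp_eta_le rc_var)
  moreover have "rc y (?g i)" for i by (intro rc_case_nat assms)
  ultimately have "rp y (\<lambda>e. (\<lambda>e. \<forall>s l. ext (s, l) (e 0, e 1) \<longrightarrow>
      fam.eta N (e 2) (md y (s, l)) \<le> fam.eta N (e 2) (md y (e 0, e 1)) \<and>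
      fam.eta N (e 2) (md y (e 0, e 1)) \<le> fam.eta N (e 2) (md y (s, l))) (\<lambda>i. ?g i e))"
    by (rule rp_comp)
  then show ?thesis by (simp add: vald_def split_paired_All numeral_2_eq_2 eq_iff)
qed

lemma rp_frc:
  assumes S: "\<And>f g. rc y f \<Longrightarrow> rc y g \<Longrightarrow> rp y (\<lambda>e. g e \<in> S (f e))"
    and "rc y a" "rc y b" "rc y q" "rc y c" "rc y d" "rc y f" "rc y i" "rc y w"
  shows "rp y (\<lambda>e. frc N y (a e, b e) (q e) ((c e, d e), f e) (i e) (S (w e)))"
proof -
  let ?g = "case_nat a (case_nat b (case_nat q (case_nat c (case_nat d (case_nat f (case_nat i (\<lambda>_. w)))))))"
  define p where "p = (\<lambda>e::vec. \<forall>s l. ext (s, l) (e 0, e 1) \<longrightarrow>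
    fam.C N (e 2) (md y (s, l)) (fam.eta N (e 5) (md y (e 3, e 4))) (e 6) \<in> S (e 7))"
  have "rp y p" unfolding p_def
    by (intro rp_all rp_imp rp_extends S rc_probe rc_var)
  moreover have "rc y (?g i)" for i by (intro rc_case_nat assms)
  ultimately have "rp y (\<lambda>e. p (\<lambda>i. ?g i e))" by (rule rp_comp)
  then show ?thesis by (simp add: frc_def p_def split_paired_All numeral_eq_Suc)
qed

lemmas rp_frc_sets =
  rp_frc[where S = "\<lambda>v. {v}"] rp_frc[where S = "\<lambda>v. {v..}"] rp_frc[where S = "\<lambda>v. {..<v}"]

text \<open>With validity and forcing read off from \<open>y\<close>, a requirement becomes a
  statement with number quantifiers over probes.\<close>

lemma rp_Req_vars:
  assumes gen: "\<And>c. fam.Gen N (md y c)" shows "rp y (\<lambda>e. fam.Req N (e 0) (e 1, e 2))"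
proof -
  let ?LE = "\<lambda>\<mu> \<kappa>. fam.eta N (snd \<mu>) (md y (fst \<mu>)) \<le> fam.eta N (snd \<kappa>) (md y (fst \<kappa>))"
  have lam: "fam.lam N \<mu> = fam.eta N (snd \<mu>) (md y (fst \<mu>))" if "fam.valid N \<mu>" for \<mu>
    using fam.valid_read(2)[of N y "fst \<mu>" "snd \<mu>", OF gen] that by simp
  have V: "fam.valid N = vald N y"
    using fam.valid_read(1)[of N y, OF gen] by (auto simp: vald_def fun_eq_iff)
  have R: "fam.Req N = req (vald N y) ?LE (frc N y)"
    unfolding fam.Req_def V[symmetric]
  proof (rule req_cong)
    fix c q \<mu> i S assume "fam.valid N \<mu>"
    then show "fam.Fo N c q \<mu> i S = frc N y c q \<mu> i S"
      using fam.Fo_read[of N y \<mu>, OF gen] lam by (simp add: frc_def)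
  qed (simp add: lam)
  have s: "rp y (\<lambda>e. g e \<in> {f e})" "rp y (\<lambda>e. g e \<in> {f e..})" "rp y (\<lambda>e. g e \<in> {..<f e})"
    if "rc y f" "rc y g" for f g :: "vec \<Rightarrow> nat"
    using that by (auto intro: rc_intros)
  show ?thesis
    unfolding R req_def Let_def decD_def
    by (simp only: split_paired_All split_paired_Ex fst_conv snd_conv)
      (intro rp_vald rp_frc_sets s rp_eta_le rp_extends rc_prj rc_intros; assumption)
qed

section \<open>Coding a real into a generic pair\<close>

text \<open>The injections 0, 1, 2, 3 read off from the join of two reals the join itself, the
  reversed join and the two reals.\<close>

definition psi :: "nat \<Rightarrow> nat \<Rightarrow> nat" where
  "psi k i = (if k = 0 then i else if k = 1 then (if i mod 2 = 0 then Suc (2 * (i div 2)) else 2 * (i div 2))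
     else if k = 2 then 2 * i else Suc (2 * i))"

text \<open>The number of bits of the real read by \<open>psi k\<close> that the first
  \<open>l\<close> bits of both reals determine.\<close>

definition len :: "nat \<Rightarrow> nat \<Rightarrow> nat" where "len k l = (if k < 2 then 2 * l else l)"

lemma psi_inj: "psi k i = psi k j \<longleftrightarrow> i = j"
  unfolding psi_def by (auto split: if_splits) presburger+

lemma psi_bounds: "i \<le> Suc (psi k i)" "psi k i \<le> Suc (2 * i)"
  unfolding psi_def by (auto split: if_splits)

lemma psi_less: "i < len k l \<Longrightarrow> psi k i < 2 * l"
  unfolding psi_def len_def by (auto split: if_splits)

lemma le_len: "l \<le> len k l" by (simp add: len_def)

text \<open>However the first \<open>l\<close> bits of the two reals are chosen, filling the positions from \<open>l\<close> to \<open>l'\<close>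
  as in \<open>a\<close> meets the requirements up to \<open>l\<close>.\<close>

definition good :: "nat \<Rightarrow> nat \<Rightarrow> nat \<Rightarrow> nat \<Rightarrow> bool" where
  "good N l l' a \<longleftrightarrow> l \<le> l' \<and> (\<forall>k s j f. k < 4 \<longrightarrow> j \<le> l \<longrightarrow>
     (\<forall>i. 2 * l \<le> i \<longrightarrow> i < 2 * l' \<longrightarrow> (i \<in> set_decode s \<longleftrightarrow> i \<in> set_decode a)) \<longrightarrow>
     (\<forall>i. i < len k l' \<longrightarrow> (i \<in> set_decode f \<longleftrightarrow> psi k i \<in> set_decode s)) \<longrightarrow> fam.Req N j (f, len k l'))"

text \<open>There are finitely many triples of an injection, a requirement and a choice of the first
  bits. A common block is lengthened for one triple after the other, as density permits, and
  lengthening preserves what has been met.\<close>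

lemma ex_good: "\<exists>l' a. good N l l' a"
proof -
  define mix where "mix u W = {p. if p < 2 * l then p \<in> u else p \<in> W}" for u W :: "nat set"
  define P where "P W m k j u \<longleftrightarrow> (\<exists>c. fam.Req N j c \<and> snd c \<le> m \<and>
    (\<forall>W'. (\<forall>p<m. p \<in> W' \<longleftrightarrow> p \<in> W) \<longrightarrow> {i. psi k i \<in> mix u W'} \<in> cyl c))" for W :: "nat set" and m k j u
  define T where "T = {..<4::nat} \<times> {..l} \<times> Pow {..<2 * l}"
  have "finite T" by (simp add: T_def)
  then have "\<exists>W m. \<forall>(k, j, u)\<in>T. P W m k j u"
  proof (induction T rule: finite_induct)
    case (insert \<tau> F)
    obtain k j u where \<tau>: "\<tau> = (k, j, u)" by (cases \<tau>)
    obtain W m where W: "\<forall>(k, j, u)\<in>F. P W m k j u" using insert.IH by blast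
    define m0 where "m0 = max m (2 * l)"
    \<comment> \<open>Length \<open>Suc m0\<close> covers every bit that is read from a position
      below \<open>m0\<close>, since an injection lowers an index by at most one.\<close>
    obtain c' where c': "fam.Req N j c'" "ext c' (restr {i. psi k i \<in> mix u W} (Suc m0))"
      using fam.Req_dense[of N j] unfolding dense_def by blast
    \<comment> \<open>From \<open>m0\<close> on the block copies \<open>c'\<close> through the
      injection; the bound \<open>m2\<close> lies above all positions from which bits of
      \<open>c'\<close> are read.\<close>
    define W2 where "W2 = {p. if p < m0 then p \<in> W else \<exists>i. psi k i = p \<and> i \<in> set_decode (fst c')}"
    define m2 where "m2 = max m0 (2 * snd c' + 2)"
    have "P W2 m2 k' j' u'" if old: "P W m k' j' u'" for k' j' u'
    proof -
      obtain c where c: "fam.Req N j' c" "snd c \<le> m"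
        "\<And>W'. (\<forall>p<m. p \<in> W' \<longleftrightarrow> p \<in> W) \<Longrightarrow> {i. psi k' i \<in> mix u' W'} \<in> cyl c" using old unfolding P_def by blast
      have "{i. psi k' i \<in> mix u' W'} \<in> cyl c" if "\<forall>p<m2. p \<in> W' \<longleftrightarrow> p \<in> W2" for W'
        by (rule c(3)) (use that in \<open>auto simp: m2_def m0_def W2_def less_max_iff_disj\<close>)
      then show ?thesis using c(1,2) unfolding P_def by (intro exI[of _ c]) (simp add: m2_def m0_def)
    qed
    moreover have "P W2 m2 k j u"
    proof -
      have "{i. psi k i \<in> mix u W'} \<in> cyl c'" if W': "\<forall>p<m2. p \<in> W' \<longleftrightarrow> p \<in> W2" for W'
        unfolding cyl_def mem_Collect_eq
      proof (intro allI impI)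
        fix i assume i: "i < snd c'"
        have b: "psi k i < m2" using psi_bounds(2)[of k i] i by (simp add: m2_def)
        show "psi k i \<in> mix u W' \<longleftrightarrow> i \<in> set_decode (fst c')"
        proof (cases "psi k i < m0")
          case True
          have "i < Suc m0" using psi_bounds(1)[of i k] True by simp
          then have "i \<in> set_decode (fst c') \<longleftrightarrow> psi k i \<in> mix u W"
            using c'(2) by (simp add: ext_def mem_restr)
          then show ?thesis using True W' b by (simp add: mix_def W2_def)
        next
          case False
          then have "\<not> psi k i < 2 * l" by (simp add: m0_def)
          then show ?thesis using False W' b by (simp add: mix_def W2_def psi_inj)
        qed
      qed
      then show ?thesis using c'(1) unfolding P_def by (intro exI[of _ c']) (simp add: m2_def)
    qed
    ultimately show ?case using W unfolding \<tau> by (intro exI[of _ W2] exI[of _ m2]) auto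
  qed simp
  then obtain W m where W: "\<forall>(k, j, u)\<in>T. P W m k j u" by blast
  define l' where "l' = max l m"
  define a where "a = set_encode (W \<inter> {..<2 * l'})"
  have a: "p \<in> set_decode a \<longleftrightarrow> p \<in> W" if "p < 2 * l'" for p using that by (simp add: a_def)
  have "good N l l' a" unfolding good_def
  proof (intro conjI allI impI)
    fix k s j f
    assume k: "k < 4" and j: "j \<le> l" and s: "\<forall>i. 2 * l \<le> i \<longrightarrow> i < 2 * l' \<longrightarrow> (i \<in> set_decode s \<longleftrightarrow> i \<in> set_decode a)"
      and f: "\<forall>i. i < len k l' \<longrightarrow> (i \<in> set_decode f \<longleftrightarrow> psi k i \<in> set_decode s)"
    define u where "u = set_decode s \<inter> {..<2 * l}"
    have "P W m k j u" using W k j by (auto simp: T_def u_def)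
    then obtain c where c: "fam.Req N j c" "snd c \<le> m"
      "\<And>W'. (\<forall>p<m. p \<in> W' \<longleftrightarrow> p \<in> W) \<Longrightarrow> {i. psi k i \<in> mix u W'} \<in> cyl c" unfolding P_def by blast
    define W' where "W' = {p. if p < 2 * l then p \<in> W else p \<in> set_decode s}"
    have "\<forall>p<m. p \<in> W' \<longleftrightarrow> p \<in> W" using s a by (auto simp: W'_def l'_def)
    then have "{i. psi k i \<in> mix u W'} \<in> cyl c" by (rule c(3))
    moreover have "mix u W' = set_decode s" by (auto simp: mix_def W'_def u_def)
    ultimately have X: "{i. psi k i \<in> set_decode s} \<in> cyl c" by simp
    have le: "snd c \<le> len k l'" using c(2) le_len[of l' k] by (simp add: l'_def)
    have "ext (f, len k l') c" using X f le by (simp add: ext_def cyl_def)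
    then show "fam.Req N j (f, len k l')" by (rule fam.Req_ext[OF c(1)])
  qed (simp add: l'_def)
  then show ?thesis by blast
qed

section \<open>The coding positions and the coded pair\<close>

definition nxt :: "nat \<Rightarrow> nat \<Rightarrow> nat" where "nxt N l = (LEAST l'. \<exists>a. good N l l' a)"

text \<open>Here an arbitrary choice is allowed: what has to be recomputed from the reals is the
  positions, not the blocks.\<close>

definition blk :: "nat \<Rightarrow> nat \<Rightarrow> nat" where "blk N l = (SOME a. good N l (nxt N l) a)"

lemma good_blk: "good N l (nxt N l) (blk N l)"
proof -
  have "\<exists>a. good N l (nxt N l) a" unfolding nxt_def by (rule LeastI_ex) (rule ex_good)
  then show ?thesis unfolding blk_def by (rule someI_ex)
qed

text \<open>Position \<open>gap N k\<close> itself holds bit \<open>k\<close> of the coded real, so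
  the following block starts one later.\<close>

primrec gap :: "nat \<Rightarrow> nat \<Rightarrow> nat" where
  "gap N 0 = 0"
| "gap N (Suc k) = nxt N (Suc (gap N k))"

lemma gap_less: "gap N k < gap N (Suc k)"
  using good_blk[of N "Suc (gap N k)"] by (simp add: good_def)

lemma gap_strict_mono: "strict_mono (gap N)"
  by (rule strict_mono_Suc_iff[THEN iffD2]) (simp add: gap_less del: gap.simps)

text \<open>Written as the join of the two reals: \<open>2 * p\<close> and \<open>2 * p + 1\<close>
  stand for position \<open>p\<close> of the first and of the second real, which thus carry the same
  coding bits.\<close>

definition coded :: "nat \<Rightarrow> nat set \<Rightarrow> nat set" where
  "coded N x = {i. \<exists>k. (i div 2 = gap N k \<and> k \<in> x) \<or>
     (gap N k < i div 2 \<and> i div 2 < gap N (Suc k) \<and> i \<in> set_decode (blk N (Suc (gap N k))))}"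

lemma gap_unique: "gap N k \<le> a \<Longrightarrow> a < gap N (Suc k) \<Longrightarrow> gap N k' \<le> a \<Longrightarrow> a < gap N (Suc k') \<Longrightarrow> k = k'"
  using strict_mono_less[OF gap_strict_mono, of N k "Suc k'"] strict_mono_less[OF gap_strict_mono, of N k' "Suc k"]
  by (simp del: gap.simps)

lemma coded_at_gap: "i div 2 = gap N k \<Longrightarrow> i \<in> coded N x \<longleftrightarrow> k \<in> x"
proof -
  assume i: "i div 2 = gap N k"
  have "k' = k" if "gap N k' \<le> i div 2" "i div 2 < gap N (Suc k')" for k'
    using gap_unique[of N k "i div 2" k'] gap_less[of N k] i that by (simp del: gap.simps)
  then show ?thesis using i gap_less[of N] unfolding coded_def mem_Collect_eq by (metis less_irrefl order_less_imp_le order_refl)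
qed

lemma coded_in_block:
  assumes "gap N k < i div 2" "i div 2 < gap N (Suc k)"
  shows "i \<in> coded N x \<longleftrightarrow> i \<in> set_decode (blk N (Suc (gap N k)))"
proof -
  have "k' = k" if "gap N k' \<le> i div 2" "i div 2 < gap N (Suc k')" for k'
    using gap_unique[of N k "i div 2" k'] assms that by (simp del: gap.simps)
  then show ?thesis using assms gap_less[of N] unfolding coded_def mem_Collect_eq
    by (metis less_irrefl order_less_imp_le order_refl)
qed

text \<open>Requirement \<open>j\<close> is met by every sufficiently late block, for all possible
  earlier bits. A change below \<open>b\<close> is therefore repaired by a block beyond
  \<open>b\<close>.\<close>

lemma Gen_coded:
  assumes W: "\<And>p. b \<le> p \<Longrightarrow> p \<in> W \<longleftrightarrow> p \<in> coded N x" and k: "k < 4"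
  shows "fam.Gen N {i. psi k i \<in> W}"
  unfolding fam.Gen_def
proof
  fix j
  define K where "K = max j b"
  define l where "l = Suc (gap N K)"
  define l' where "l' = gap N (Suc K)"
  have "K \<le> gap N K" by (rule strict_mono_imp_increasing[OF gap_strict_mono])
  then have l: "j \<le> l" "b \<le> 2 * l" by (auto simp: l_def K_def)
  define s where "s = set_encode (W \<inter> {..<2 * l'})"
  define f where "f = set_encode ({i. psi k i \<in> W} \<inter> {..<len k l'})"
  have "i \<in> set_decode s \<longleftrightarrow> i \<in> set_decode (blk N l)" if i: "2 * l \<le> i" "i < 2 * l'" for i
  proof -
    have "gap N K < i div 2" "i div 2 < gap N (Suc K)" using i by (auto simp: l_def l'_def simp del: gap.simps)
    then show ?thesis using coded_in_block[of N K i x] W[of i] l i by (simp add: s_def l_def)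
  qed
  moreover have "i \<in> set_decode f \<longleftrightarrow> psi k i \<in> set_decode s" if "i < len k l'" for i
    using that psi_less[OF that] by (simp add: f_def s_def)
  ultimately have "fam.Req N j (f, len k l')"
    using good_blk[of N l, unfolded good_def, THEN conjunct2, rule_format, OF k l(1), of s f]
    by (simp add: l'_def l_def[symmetric])
  moreover have "{i. psi k i \<in> W} \<in> cyl (f, len k l')" by (simp add: cyl_def f_def)
  ultimately show "\<exists>c. fam.Req N j c \<and> {i. psi k i \<in> W} \<in> cyl c" by blast
qed

lemma mem_join: "p \<in> join a b \<longleftrightarrow> (if even p then p div 2 \<in> a else p div 2 \<in> b)"
  unfolding join_def by (auto elim!: evenE oddE) presburger+

text \<open>A finite modification of one of the reals is a finite modification of the coded join,
  and the four injections turn its genericity into that of the two reals and of both joins.\<close>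

lemma ex_generic_pair:
  "\<exists>y z. (\<forall>c. fam.Gen N (md y c)) \<and> (\<forall>c. fam.Gen N (md z c)) \<and>
     (\<forall>c. fam.Gen N (join (md y c) z)) \<and> (\<forall>c. fam.Gen N (join (md z c) y)) \<and>
     (\<forall>k. k \<in> x \<longleftrightarrow> gap N k \<in> y) \<and> (\<forall>k. k \<in> x \<longleftrightarrow> gap N k \<in> z)"
proof -
  define y where "y = {i. 2 * i \<in> coded N x}"
  define z where "z = {i. Suc (2 * i) \<in> coded N x}"
  have jn: "p \<in> join y z \<longleftrightarrow> p \<in> coded N x" for p by (auto simp: mem_join y_def z_def)
  have Y: "fam.Gen N {i. psi k i \<in> join (md y c) z}" if "k < 4" for k c
    by (rule Gen_coded[where x = x and b = "2 * snd c"]) (use that in \<open>auto simp: jn[symmetric] mem_join md_def\<close>)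
  have Z: "fam.Gen N {i. psi k i \<in> join y (md z c)}" if "k < 4" for k c
    by (rule Gen_coded[where x = x and b = "2 * snd c"]) (use that in \<open>auto simp: jn[symmetric] mem_join md_def\<close>)
  have p: "psi 0 i = i" "psi 1 i = (if even i then Suc (2 * (i div 2)) else 2 * (i div 2))"
    "psi 2 i = 2 * i" "psi 3 i = Suc (2 * i)" for i by (simp_all add: psi_def even_iff_mod_2_eq_zero)
  have "{i. psi 0 i \<in> join a b} = join a b" "{i. psi 1 i \<in> join a b} = join b a"
    "{i. psi 2 i \<in> join a b} = a" "{i. psi 3 i \<in> join a b} = b" for a b
    unfolding p by (auto simp: mem_join elim!: oddE)
  then have "\<forall>c. fam.Gen N (md y c)" "\<forall>c. fam.Gen N (md z c)"
    "\<forall>c. fam.Gen N (join (md y c) z)" "\<forall>c. fam.Gen N (join (md z c) y)"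
    using Y[of 0] Y[of 2] Z[of 1] Z[of 3] by simp_all
  moreover have "\<forall>k. k \<in> x \<longleftrightarrow> gap N k \<in> y" "\<forall>k. k \<in> x \<longleftrightarrow> gap N k \<in> z"
    using coded_at_gap[of _ N _ x] by (simp_all add: y_def z_def)
  ultimately show ?thesis by blast
qed

lemma rc_psi: "rc A f \<Longrightarrow> rc A g \<Longrightarrow> rc A (\<lambda>e. psi (f e) (g e))"
  unfolding psi_def by (intro rc_intros)

lemma rc_len: "rc A f \<Longrightarrow> rc A g \<Longrightarrow> rc A (\<lambda>e. len (f e) (g e))"
  unfolding len_def by (intro rc_intros)

text \<open>Each position is found by a least search for a good block. Goodness refers only to
  requirements, which \<open>y\<close> decides, and the coded bit is then looked up in
  \<open>y\<close>.\<close>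

lemma computable_from_generic:
  assumes gen: "\<And>c. fam.Gen N (md y c)" and x: "\<And>k. k \<in> x \<longleftrightarrow> gap N k \<in> y"
  shows "ITRM_computable_from x y"
proof (rule computable_if_rc)
  have Req: "rp y (\<lambda>e. fam.Req N (a e) (b e, c e))" if "rc y a" "rc y b" "rc y c" for a b c
  proof -
    have "rc y (case_nat a (case_nat b (\<lambda>_. c)) i)" for i by (intro rc_case_nat that)
    from rp_comp[OF rp_Req_vars[of N y, OF gen], of "case_nat a (case_nat b (\<lambda>_. c))", OF this] show ?thesis
      by (simp add: numeral_2_eq_2)
  qed
  have "rp y (\<lambda>e. good N (e 1) (e 0) (e 2))" unfolding good_def
    by (intro rp_conj rp_le rp_all rp_imp rp_iff rp_less rp_set_decode Req rc_psi rc_len rc_mult rc_const rc_var)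
  then have g: "rp y (\<lambda>e. good N (a e) (b e) (c e))" if "rc y a" "rc y b" "rc y c" for a b c
    using rp_comp[of y "\<lambda>e. good N (e 1) (e 0) (e 2)" "case_nat b (case_nat a (\<lambda>_. c))"] rc_case_nat[OF that(2) rc_case_nat[OF that(1), of "\<lambda>_. c", OF that(3)]] by (simp add: numeral_2_eq_2)
  have n: "rc y (\<lambda>e. nxt N (e 0))" unfolding nxt_def
    by (rule rc_Least) (intro rp_ex g rc_var, rule ex_good)
  have "rc y (\<lambda>e. rec_nat 0 (\<lambda>k s. nxt N (Suc s)) (e 0))"
    by (rule rc_rec) (intro rc_const rc_var rc_comp1[OF n] rc_Suc)+
  moreover have "rec_nat 0 (\<lambda>k s. nxt N (Suc s)) k = gap N k" for k by (induction k) simp_all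
  ultimately have "rc y (\<lambda>e. gap N (e 0))" by simp
  from rp_oracle[OF this] show "rc y (\<lambda>e. if e 0 \<in> x then 1 else 0)" by (simp add: rp_def x)
qed

section \<open>Mutual randomness\<close>

lemma mgr_if_meager_reals:
  assumes "meager_reals X" shows "mgr X"
proof -
  define ch where "ch = ((\<lambda>u i. i \<in> u) :: nat set \<Rightarrow> nat \<Rightarrow> bool)"
  obtain M :: "nat \<Rightarrow> (nat \<Rightarrow> bool) set" where M: "\<And>k. interior (closure (M k)) = {}" "ch ` X \<subseteq> (\<Union>k. M k)"
    using assms unfolding meager_reals_def meager_def nowhere_dense_def ch_def by blast
  define E where "E k = {c. \<forall>u\<in>cyl c. ch u \<notin> M k}" for k
  have "dense (E k)" for k unfolding dense_def
  proof
    fix c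
    define U where "U = (\<Inter>i\<in>{..<snd c}. {f :: nat \<Rightarrow> bool. f i = (i \<in> set_decode (fst c))})"
    have "open {f :: nat \<Rightarrow> bool. f i = b}" for i b
    proof -
      have "open ((\<lambda>f :: nat \<Rightarrow> bool. f i) -` {b})"
        by (rule open_vimage) (simp_all add: open_discrete)
      then show ?thesis by (simp add: vimage_def)
    qed
    then have "open U" unfolding U_def by (intro open_INT) auto
    moreover have "ch (set_decode (fst c)) \<in> U" by (simp add: U_def ch_def)
    ultimately have "\<not> U \<subseteq> closure (M k)" using interior_maximal[of U "closure (M k)"] M(1)[of k] by blast
    then obtain f where f: "f \<in> U" "f \<in> - closure (M k)" by blast
    have "openin (product_topology (\<lambda>_. euclidean) UNIV) (- closure (M k))"
      using open_Compl[OF closed_closure[of "M k"]] unfolding open_fun_def .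
    from product_topology_open_contains_basis[OF this f(2)]
    obtain Y where Y: "f \<in> (\<Pi>\<^sub>E i\<in>UNIV. Y i)" "finite {i. Y i \<noteq> UNIV}" "(\<Pi>\<^sub>E i\<in>UNIV. Y i) \<subseteq> - closure (M k)" by auto
    \<comment> \<open>A basic open set restricts only finitely many coordinates, so a long enough
      initial part of \<open>f\<close> keeps a real inside it.\<close>
    define m where "m = Max (insert (snd c) (Suc ` {i. Y i \<noteq> UNIV}))"
    have m: "snd c \<le> m" "\<And>i. Y i \<noteq> UNIV \<Longrightarrow> i < m" using Y(2) by (auto simp: m_def Suc_le_eq[symmetric])
    define d where "d = restr {i. f i} m"
    have "ch u \<notin> M k" if u: "u \<in> cyl d" for u
    proof -
      have "ch u i \<in> Y i" for i
      proof (cases "Y i = UNIV")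
        case False
        then have "ch u i = f i" using m(2) u by (simp add: d_def cyl_restr ch_def)
        then show ?thesis using Y(1) by auto
      qed simp
      then have "ch u \<in> - closure (M k)" using Y(3) by auto
      then show ?thesis using closure_subset by auto
    qed
    moreover have "ext d c" using f(1) m(1) by (auto simp: ext_def d_def mem_restr U_def)
    ultimately show "\<exists>c'\<in>E k. ext c' c" by (auto simp: E_def)
  qed
  moreover have "\<exists>k. \<forall>c\<in>E k. A \<notin> cyl c" if "A \<in> X" for A
    using M(2) that unfolding E_def by blast
  ultimately show ?thesis unfolding mgr_def by blast
qed

text \<open>For fixed \<open>z\<close>, each condition \<open>c\<close> on \<open>u\<close> has an
  extension that already settles requirement \<open>j\<close>: a long enough part of
  \<open>md y c\<close>, whose join with \<open>z\<close> is generic.\<close>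

lemma mgr_not_Gen_join:
  assumes "\<And>c. fam.Gen N (join (md y c) z)" shows "mgr {u. \<not> fam.Gen N (join u z)}"
proof -
  define E where "E j = {d. \<forall>u\<in>cyl d. \<exists>c. fam.Req N j c \<and> join u z \<in> cyl c}" for j
  have "dense (E j)" for j unfolding dense_def
  proof
    fix c
    obtain c' where c': "fam.Req N j c'" "join (md y c) z \<in> cyl c'" using assms[of c] unfolding fam.Gen_def by blast
    define d where "d = restr (md y c) (max (snd c) (snd c'))"
    have "join u z \<in> cyl c'" if u: "u \<in> cyl d" for u
      using c'(2) u by (auto simp: cyl_def[of c'] d_def cyl_restr mem_join)
    then have "d \<in> E j" using c'(1) by (auto simp: E_def)
    moreover have "ext d c" unfolding d_def by (rule ext_restr[OF md_cyl]) simp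
    ultimately show "\<exists>c'\<in>E j. ext c' c" by blast
  qed
  then show ?thesis unfolding mgr_def E_def by (intro exI[of _ E]) (auto simp: E_def fam.Gen_def)
qed

lemma random_if_generic:
  assumes gen: "\<And>c. fam.Gen (Suc n) (join (md y c) z)" shows "ITRMn_random n y z"
  unfolding ITRMn_random_def
proof
  assume "\<exists>X P. meager_reals X \<and> y \<in> X \<and> num_regs P \<le> n \<and> decides_in P z X"
  then obtain X P where X: "meager_reals X" "y \<in> X" and P: "num_regs P \<le> n" "decides_in P z X" by blast
  obtain q where q: "\<And>A k. halts_with P A 0 k \<Longrightarrow> fam.C (Suc n) q A (fam.eta (Suc n) q A) 4 = k"
    using universal_simulation[OF P(1)] by blast
  have out: "fam.C (Suc n) q (join u z) (fam.eta (Suc n) q (join u z)) 4 = (if u \<in> X then 1 else 0)" for u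
    using q P(2) by (simp add: decides_in_def)
  have "md y (0, 0) = y" by (simp add: md_def)
  then have gy: "fam.Gen (Suc n) (join y z)" using gen[of "(0, 0)"] by simp
  define t where "t = fam.eta (Suc n) q (join y z)"
  have t: "t \<in> fam.L (Suc n)" unfolding t_def by (rule fam.eta_L[OF gy])
  obtain c where c: "join y z \<in> cyl c" "fam.valid (Suc n) (c, q)" using fam.Gen_valid[OF gy] by blast
  have tl: "fam.lam (Suc n) (c, q) = t" unfolding t_def by (rule fam.truth_eta[OF c(2) gy c(1), symmetric])
  obtain c' where c': "join y z \<in> cyl c'" "fo c' {A. fam.C (Suc n) q A t = fam.C (Suc n) q (join y z) t}"
    using fam.truth_state[OF t gy, of q] by blast
  define d where "d = restr y (max (snd c) (snd c'))"
  have "\<not> mgr (cyl d)" by (rule not_mgr_cyl)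
  moreover have "mgr (X \<union> {u. \<not> fam.Gen (Suc n) (join u z)})"
    by (intro mgr_Un mgr_if_meager_reals[OF X(1)] mgr_not_Gen_join[OF gen])
  \<comment> \<open>\<open>u\<close> lies outside \<open>X\<close>, but shares with \<open>y\<close>
    the bits that force halting time and final state; so the machine accepts it as well.\<close>
  ultimately obtain u where u: "u \<in> cyl d" "u \<notin> X" "fam.Gen (Suc n) (join u z)"
    using mgr_mono by blast
  have "join u z \<in> cyl c" "join u z \<in> cyl c'"
    using u(1) c(1) c'(1) by (auto simp: cyl_def[of c] cyl_def[of c'] d_def cyl_restr mem_join)
  then have "fam.eta (Suc n) q (join u z) = t"
    "fam.C (Suc n) q (join u z) t \<in> {fam.C (Suc n) q (join y z) t}"
    using fam.truth_eta[OF c(2) u(3)] tl fam.truth_agree[OF t u(3), of c' q "{fam.C (Suc n) q (join y z) t}"] c'(2)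
    by simp_all
  then show False using out[of u] out[of y] u(2) X(2) by (simp add: t_def)
qed

section \<open>A real that is not computable\<close>

instance instr :: countable by countable_datatype

lemma halts_with_unique:
  assumes "halts_with P A i k" "halts_with P A i k'" shows "k = k'"
proof -
  define R where "R = run (mstep P A) (case_prod mk (initial i))"
  have "\<exists>t. (\<forall>u<t. mok P (R u)) \<and> \<not> mok P (R t) \<and> R t (Suc 0) = k" if h: "halts_with P A i k" for k
  proof -
    obtain c where c: "c = case_prod mk (initial i) \<or>
      (\<exists>m. seg (mstep P A) (mok P) (case_prod mk (initial i)) m c)" "\<not> mok P c" "c (Suc 0) = k"
      using halts_with_seg[OF h] by blast
    from c(1) have "\<exists>t. R t = c \<and> (\<forall>u<t. mok P (R u))"
    proof
      assume "c = case_prod mk (initial i)"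
      then have "R ozero = c \<and> (\<forall>u<ozero. mok P (R u))" by (simp add: R_def)
      then show ?thesis by blast
    next
      assume "\<exists>m. seg (mstep P A) (mok P) (case_prod mk (initial i)) m c"
      then obtain m where "seg (mstep P A) (mok P) (case_prod mk (initial i)) m c" by blast
      from seg_run[OF this run_ozero] show ?thesis unfolding R_def by auto
    qed
    then show ?thesis using c by metis
  qed
  from this[OF assms(1)] this[OF assms(2)] show ?thesis by (metis linorder_neqE)
qed

text \<open>Outputs are unique, so distinct reals have distinct programs, of which there are only
  countably many.\<close>

lemma ex_not_computable: "\<exists>x. \<not> ITRM_computable x"
proof (rule ccontr)
  assume "\<not> ?thesis"
  then obtain p where p: "\<And>x. computes_from (p x) x {}"
    unfolding ITRM_computable_def ITRM_computable_from_def by metis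
  have "inj p"
  proof (rule injI, rule set_eqI)
    fix x x' i assume "p x = p x'"
    then have "halts_with (p x) {} i (if i \<in> x then 1 else 0)" "halts_with (p x) {} i (if i \<in> x' then 1 else 0)"
      using p[of x] p[of x'] by (simp_all add: computes_from_def)
    from halts_with_unique[OF this] show "i \<in> x \<longleftrightarrow> i \<in> x'" by (simp split: if_splits)
  qed
  then have "inj (to_nat \<circ> p)" by (simp add: inj_compose)
  then have "inv (to_nat \<circ> p) ` UNIV = Pow (UNIV :: nat set)" by (simp add: inj_imp_surj_inv)
  then show False using Cantors_theorem by blast
qed

lemma ex_mutually_random_computing:
  "\<exists>y z m. mutually_ITRMn_random n y z \<and> ITRMn_computable_from m x y \<and> ITRMn_computable_from m x z"
proof -
  obtain y z where g: "\<And>c. fam.Gen (Suc n) (md y c)" "\<And>c. fam.Gen (Suc n) (md z c)"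
     "\<And>c. fam.Gen (Suc n) (join (md y c) z)" "\<And>c. fam.Gen (Suc n) (join (md z c) y)"
     "\<And>k. k \<in> x \<longleftrightarrow> gap (Suc n) k \<in> y" "\<And>k. k \<in> x \<longleftrightarrow> gap (Suc n) k \<in> z"
    using ex_generic_pair[of "Suc n" x] by blast
  obtain P Q where PQ: "computes_from P x y" "computes_from Q x z"
    using computable_from_generic[OF g(1,5)] computable_from_generic[OF g(2,6)]
    unfolding ITRM_computable_from_def by blast
  have "ITRMn_computable_from (max (num_regs P) (num_regs Q)) x y"
    "ITRMn_computable_from (max (num_regs P) (num_regs Q)) x z"
    using PQ unfolding ITRMn_computable_from_def by (meson max.cobounded1 max.cobounded2)+
  moreover have "mutually_ITRMn_random n y z"
    using random_if_generic[OF g(3)] random_if_generic[OF g(4)] by (simp add: mutually_ITRMn_random_def)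
  ultimately show ?thesis by blast
qed

theorem theorem13:
  shows "(\<forall>n. \<exists>x y z. mutually_ITRMn_random n y z \<and> \<not> ITRM_computable x \<and>
             ITRM_computable_from x y \<and> ITRM_computable_from x z) \<and>
         (\<forall>x. constructible TYPE('i) x \<longrightarrow>
             (\<forall>n. \<exists>y z m. mutually_ITRMn_random n y z \<and>
                ITRMn_computable_from m x y \<and> ITRMn_computable_from m x z))"
proof (intro conjI allI impI)
  fix n
  obtain x where "\<not> ITRM_computable x" using ex_not_computable by blast
  then show "\<exists>x y z. mutually_ITRMn_random n y z \<and> \<not> ITRM_computable x \<and>
             ITRM_computable_from x y \<and> ITRM_computable_from x z"
    using ex_mutually_random_computing[of n x] unfolding ITRM_computable_from_def ITRMn_computable_from_def by blast
qed (rule ex_mutually_random_computing)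

end
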